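(* Let $d\ge 1$ and let $\sigma:\mathbb{R}\to\mathbb{R}$ be an activation function. Suppose that the coefficients $A,c$, the source $f$ and $\sigma$ satisfy Assumptions (Coeff), (Act), (Barron-Coeff), (Mult) and (Deriv) stated in the context, and let $u^*\in H^1(\mathbb{R}^d)$ be the unique weak solution of $-\nabla\cdot(A\nabla u)+cu=f$ on $\mathbb{R}^d$. Given any $\epsilon\in(0,1/2)$ and any open bounded subset $\Omega\subset\mathbb{R}^d$, there exists a two-layer neural network $u_k(x)=\frac1k\sum_{i=1}^k a_i\sigma(w_i^\top x+b_i)$, with $(a_i,w_i,b_i)\in\mathbb{R}\times\mathbb{R}^d\times\mathbb{R}$ and $$k\le\gamma\, m(\Omega)\left(\frac d\epsilon\right)^{\beta|\ln\epsilon|},$$ such that $\|u_k-u^*\|_{H^1(\Omega)}\le\epsilon$, where $m(\Omega)$ is the Lebesgue measure of $\Omega$ and $\gamma,\beta$ depend only on $\|f\|_{H^{-1}(\mathbb{R}^d)}$ and on the constants in Assumptions (Coeff), (Act), (Barron-Coeff), (Mult), (Deriv), i.e. on $a_{\min},a_{\max},c_{\min},c_{\max}$, $C_0,C_1,\sup|\sigma''|$, $R_A,R_c,R_f,\ell_A,\ell_c,\ell_f$, $R_m,\ell_m$, $R_{d,1},R_{d,2},\ell_{d,1},\ell_{d,2}$. Furthermore, if $\sigma=\cos$, then $\|u_k-u^*\|_{H^1(\Omega)}\le\epsilon$ can be achieved with $k\le\gamma' m(\Omega)d^{\beta'|\ln\epsilon|}$, where $\gamma',\beta'$ depend only on $\|f\|_{H^{-1}(\mathbb{R}^d)}$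 and on the constants in Assumptions (Coeff), (Act) and (Barron-Coeff).
   Context: Notation: $\|v\|$ is the Euclidean norm of a vector, $\|M\|$ the operator norm of a matrix, $\overline{B}^d_R=\{x\in\mathbb{R}^d:\|x\|\le R\}$ (with $\overline{B}^d_{+\infty}=\mathbb{R}^d$). $H^{-1}(\mathbb{R}^d)$ is the dual of $H^1(\mathbb{R}^d)$ with the dual norm. Barron norm and space (relative to a fixed activation $\sigma$): for $\Omega\subset\mathbb{R}^n$, $R\in[0,+\infty]$, $p\in[1,+\infty]$ and $g:\Omega\to\mathbb{R}$, $$\|g\|_{\mathcal{B}^p_R(\Omega)}=\inf_\rho\left(\int|a|^p\,\rho(da,dw,db)\right)^{1/p},$$ the infimum being over probability measures $\rho$ on $\mathbb{R}\times\mathbb{R}^n\times\mathbb{R}$ supported on $\mathbb{R}\times\overline{B}^n_R\times\mathbb{R}$ with $g(x)=\int a\,\sigma(w^\top x+b)\,\rho(da,dw,db)$ for all $x\in\Omega$ (for $p=\infty$ the quantity is the $\rho$-essential supremum of $|a|$; the infimum of the empty set is $+\infty$). $\mathcal{B}^p_R(\Omega)=\{g:\|g\|_{\mathcal{B}^p_R(\Omega)}<\infty\}$. Assumption (Coeff): $A(x)=(A_{ij}(x))_{1\le i,j\le d}$ is symmetric with $\|A(x)\|\le a_{\max}<\infty$ and, for some $a_{\min}>0$, $\xi^\top A(x)\xi\ge a_{\min}\|\xi\|^2$ for all $x,\xi\in\mathbb{R}^d$; $0<c_{\min}\le c(x)\le c_{\max}<\infty$; and $f\in L^2(\mathbb{R}^d)$.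 Under this assumption there is a unique weak solution $u^*\in H^1(\mathbb{R}^d)$, i.e. $\int A\nabla u^*\cdot\nabla v\,dx+\int cu^*v\,dx=\int fv\,dx$ for all $v\in H^1(\mathbb{R}^d)$. Assumption (Act): $\sigma$ is smooth with $C_0:=\sup|\sigma|<\infty$, $C_1:=\sup|\sigma'|<\infty$ and $\sup|\sigma''|<\infty$. Assumption (Barron-Coeff): for some $R_A,R_c,R_f\in(0,+\infty)$, $\ell_A:=\max_{1\le i,j\le d}\|A_{ij}\|_{\mathcal{B}^1_{R_A}(\mathbb{R}^d)}<\infty$, $\ell_c:=\|c\|_{\mathcal{B}^1_{R_c}(\mathbb{R}^d)}<\infty$, $\ell_f:=\|f\|_{\mathcal{B}^1_{R_f}(\mathbb{R}^d)}<\infty$. Assumption (Mult): the function $h:\mathbb{R}^2\to\mathbb{R}$, $h(y_1,y_2)=\sigma(y_1)\sigma(y_2)$, satisfies $\ell_m:=\|h\|_{\mathcal{B}^1_{R_m}(\mathbb{R}^2)}<\infty$ for some $R_m\in(0,+\infty)$. Assumption (Deriv): $\ell_{d,1}:=\|\sigma'\|_{\mathcal{B}^1_{R_{d,1}}(\mathbb{R})}<\infty$ and $\ell_{d,2}:=\|\sigma''\|_{\mathcal{B}^1_{R_{d,2}}(\mathbb{R})}<\infty$ for some $R_{d,1},R_{d,2}\in(0,+\infty)$ (the subscript $d$ here is a label, not the dimension).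
   Formalization: For σ = cos the bound is proved with max(2,d) in place of d, since for d = 1 the stated bound would not depend on ε and is false; k = 0 (the zero network) is allowed, since for small or empty Ω the bound on k can be below 1. *)

theory Defs
  imports "HOL-Probability.Probability"
begin

text \<open>
  The constants of the theorem must not depend on the dimension, so the dimension is a natural
  number \<open>d\<close> rather than a type: a point of \<open>\<real>\<^sup>d\<close> is a function in \<open>{..<d} \<rightarrow>\<^sub>E UNIV\<close>, its topology is
  the product topology, its Euclidean norm is \<open>L2_set x {..<d}\<close>, and Lebesgue measure is the
  product measure. Functions on \<open>\<real>\<^sup>d\<close> are only ever evaluated at such points.
\<close>

type_synonym vec = "nat \<Rightarrow> real"

abbreviation Rd :: "nat \<Rightarrow> vec set" where
  "Rd d \<equiv> {..<d} \<rightarrow>\<^sub>E UNIV"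

abbreviation Rd_top :: "nat \<Rightarrow> vec topology" where
  "Rd_top d \<equiv> powertop_real {..<d}"

abbreviation Rd_leb :: "nat \<Rightarrow> vec measure" where
  "Rd_leb d \<equiv> \<Pi>\<^sub>M i\<in>{..<d}. lborel"

definition dot :: "nat \<Rightarrow> vec \<Rightarrow> vec \<Rightarrow> real" where
  "dot d w x = (\<Sum>i<d. w i * x i)"

definition mat_vec :: "nat \<Rightarrow> (nat \<Rightarrow> nat \<Rightarrow> real) \<Rightarrow> vec \<Rightarrow> vec" where
  "mat_vec d M x = (\<lambda>i\<in>{..<d}. \<Sum>j<d. M i j * x j)"

definition op_norm :: "nat \<Rightarrow> (nat \<Rightarrow> nat \<Rightarrow> real) \<Rightarrow> real" where
  "op_norm d M = (SUP x\<in>{x \<in> Rd d. L2_set x {..<d} \<le> 1}. L2_set (mat_vec d M x) {..<d})"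

definition bounded_Rd :: "nat \<Rightarrow> vec set \<Rightarrow> bool" where
  "bounded_Rd d S \<longleftrightarrow> (\<exists>r. \<forall>x\<in>S. L2_set x {..<d} \<le> r)"


definition partial_deriv :: "nat \<Rightarrow> (vec \<Rightarrow> real) \<Rightarrow> vec \<Rightarrow> real" where
  "partial_deriv i \<phi> x = deriv (\<lambda>t. \<phi> (x(i := t))) (x i)"

primrec C_k :: "nat \<Rightarrow> nat \<Rightarrow> (vec \<Rightarrow> real) \<Rightarrow> bool" where
  "C_k d 0 \<phi> \<longleftrightarrow> continuous_map (Rd_top d) euclideanreal \<phi>"
| "C_k d (Suc k) \<phi> \<longleftrightarrow> continuous_map (Rd_top d) euclideanreal \<phi> \<and>
     (\<forall>i<d. (\<forall>x\<in>Rd d. (\<lambda>t. \<phi> (x(i := t))) differentiable (at (x i))) \<and>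
            C_k d k (partial_deriv i \<phi>))"

definition test_functions :: "nat \<Rightarrow> vec set \<Rightarrow> (vec \<Rightarrow> real) set" where
  "test_functions d U = {\<phi>. (\<forall>k. C_k d k \<phi>) \<and>
     (\<exists>K. compactin (Rd_top d) K \<and> K \<subseteq> U \<and> (\<forall>x\<in>Rd d - K. \<phi> x = 0))}"

text \<open>Elements of \<open>L\<^sup>2\<close> and \<open>H\<^sup>1\<close> are represented by Borel measurable functions.\<close>

definition L2 :: "nat \<Rightarrow> vec set \<Rightarrow> (vec \<Rightarrow> real) set" where
  "L2 d U = {u. set_borel_measurable (Rd_leb d) U u \<and> set_integrable (Rd_leb d) U (\<lambda>x. (u x)\<^sup>2)}"

definition is_weak_grad :: "nat \<Rightarrow> vec set \<Rightarrow> (vec \<Rightarrow> real) \<Rightarrow> (nat \<Rightarrow> vec \<Rightarrow> real) \<Rightarrow> bool" where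
  "is_weak_grad d U u g \<longleftrightarrow>
     (\<forall>i<d. g i \<in> L2 d U \<and>
        (\<forall>\<phi>\<in>test_functions d U.
           (LINT x:U|Rd_leb d. u x * partial_deriv i \<phi> x) = - (LINT x:U|Rd_leb d. g i x * \<phi> x)))"

definition H1 :: "nat \<Rightarrow> vec set \<Rightarrow> (vec \<Rightarrow> real) set" where
  "H1 d U = {u. u \<in> L2 d U \<and> (\<exists>g. is_weak_grad d U u g)}"

text \<open>For open \<open>U\<close> and \<open>u \<in> H1 d U\<close> the weak gradient is unique up to null sets, so the choice below
  affects none of the integrals it occurs in.\<close>

definition weak_grad :: "nat \<Rightarrow> vec set \<Rightarrow> (vec \<Rightarrow> real) \<Rightarrow> nat \<Rightarrow> vec \<Rightarrow> real" where
  "weak_grad d U u = (SOME g. is_weak_grad d U u g)"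

definition H1_norm :: "nat \<Rightarrow> vec set \<Rightarrow> (vec \<Rightarrow> real) \<Rightarrow> real" where
  "H1_norm d U u = sqrt ((LINT x:U|Rd_leb d. (u x)\<^sup>2) +
                         (\<Sum>i<d. LINT x:U|Rd_leb d. (weak_grad d U u i x)\<^sup>2))"

text \<open>The dual norm of the functional \<open>v \<mapsto> \<integral>fv\<close> on \<open>H\<^sup>1(\<real>\<^sup>d)\<close>, for \<open>f \<in> L\<^sup>2(\<real>\<^sup>d)\<close>.\<close>

definition Hm1_norm :: "nat \<Rightarrow> (vec \<Rightarrow> real) \<Rightarrow> real" where
  "Hm1_norm d f = (SUP v\<in>{v \<in> H1 d (Rd d). H1_norm d (Rd d) v \<le> 1}. \<bar>LINT x|Rd_leb d. f x * v x\<bar>)"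

definition weak_solution ::
  "nat \<Rightarrow> (vec \<Rightarrow> nat \<Rightarrow> nat \<Rightarrow> real) \<Rightarrow> (vec \<Rightarrow> real) \<Rightarrow> (vec \<Rightarrow> real) \<Rightarrow> (vec \<Rightarrow> real) \<Rightarrow> bool" where
  "weak_solution d A c f u \<longleftrightarrow> u \<in> H1 d (Rd d) \<and>
     (\<forall>v\<in>H1 d (Rd d).
        (LINT x|Rd_leb d. dot d (mat_vec d (A x) (\<lambda>j. weak_grad d (Rd d) u j x))
                                (\<lambda>i. weak_grad d (Rd d) v i x))
        + (LINT x|Rd_leb d. c x * u x * v x)
        = (LINT x|Rd_leb d. f x * v x))"


text \<open>The Barron norm for \<open>p = 1\<close>. The closed-support condition on \<open>\<rho>\<close> is the almost-everywhere one;
  integrability is required explicitly because the Bochner integral of a non-integrable function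
  is \<open>0\<close>.\<close>

definition barron_rep ::
  "(real \<Rightarrow> real) \<Rightarrow> real \<Rightarrow> nat \<Rightarrow> vec set \<Rightarrow> (vec \<Rightarrow> real) \<Rightarrow> (real \<times> vec \<times> real) measure \<Rightarrow> bool" where
  "barron_rep \<sigma> R n \<Omega> g \<rho> \<longleftrightarrow>
     prob_space \<rho> \<and> sets \<rho> = sets (borel \<Otimes>\<^sub>M ((\<Pi>\<^sub>M i\<in>{..<n}. borel) \<Otimes>\<^sub>M borel)) \<and>
     (AE (a, w, b) in \<rho>. L2_set w {..<n} \<le> R) \<and>
     (\<forall>x\<in>\<Omega>. integrable \<rho> (\<lambda>(a, w, b). a * \<sigma> (dot n w x + b)) \<and>
             g x = (LINT (a, w, b)|\<rho>. a * \<sigma> (dot n w x + b)))"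

definition barron1_norm :: "(real \<Rightarrow> real) \<Rightarrow> real \<Rightarrow> nat \<Rightarrow> vec set \<Rightarrow> (vec \<Rightarrow> real) \<Rightarrow> ennreal" where
  "barron1_norm \<sigma> R n \<Omega> g =
     (INF \<rho>\<in>{\<rho>. barron_rep \<sigma> R n \<Omega> g \<rho>}. \<integral>\<^sup>+ (a, w, b). ennreal \<bar>a\<bar> \<partial>\<rho>)"


definition coeff_assm ::
  "nat \<Rightarrow> (vec \<Rightarrow> nat \<Rightarrow> nat \<Rightarrow> real) \<Rightarrow> (vec \<Rightarrow> real) \<Rightarrow> (vec \<Rightarrow> real) \<Rightarrow>
   real \<Rightarrow> real \<Rightarrow> real \<Rightarrow> real \<Rightarrow> bool" where
  "coeff_assm d A c f a_min a_max c_min c_max \<longleftrightarrow>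
     0 < a_min \<and> 0 < c_min \<and>
     (\<forall>x\<in>Rd d.
        (\<forall>i<d. \<forall>j<d. A x i j = A x j i) \<and>
        op_norm d (A x) \<le> a_max \<and>
        (\<forall>\<xi>\<in>Rd d. dot d \<xi> (mat_vec d (A x) \<xi>) \<ge> a_min * (L2_set \<xi> {..<d})\<^sup>2) \<and>
        c_min \<le> c x \<and> c x \<le> c_max) \<and>
     f \<in> L2 d (Rd d)"

definition act_assm :: "(real \<Rightarrow> real) \<Rightarrow> real \<Rightarrow> real \<Rightarrow> real \<Rightarrow> bool" where
  "act_assm \<sigma> C0 C1 C2 \<longleftrightarrow>
     (\<forall>n. (deriv ^^ n) \<sigma> differentiable_on UNIV) \<and>
     bdd_above (range (\<lambda>x. \<bar>\<sigma> x\<bar>)) \<and> C0 = (SUP x. \<bar>\<sigma> x\<bar>) \<and>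
     bdd_above (range (\<lambda>x. \<bar>deriv \<sigma> x\<bar>)) \<and> C1 = (SUP x. \<bar>deriv \<sigma> x\<bar>) \<and>
     bdd_above (range (\<lambda>x. \<bar>deriv (deriv \<sigma>) x\<bar>)) \<and> C2 = (SUP x. \<bar>deriv (deriv \<sigma>) x\<bar>)"

definition has_barron1_norm ::
  "(real \<Rightarrow> real) \<Rightarrow> real \<Rightarrow> nat \<Rightarrow> (vec \<Rightarrow> real) \<Rightarrow> real \<Rightarrow> bool" where
  "has_barron1_norm \<sigma> R n g l \<longleftrightarrow>
     barron1_norm \<sigma> R n (Rd n) g < \<top> \<and> l = enn2real (barron1_norm \<sigma> R n (Rd n) g)"

definition barron_coeff_assm ::
  "nat \<Rightarrow> (real \<Rightarrow> real) \<Rightarrow> (vec \<Rightarrow> nat \<Rightarrow> nat \<Rightarrow> real) \<Rightarrow> (vec \<Rightarrow> real) \<Rightarrow> (vec \<Rightarrow> real) \<Rightarrow>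
   real \<Rightarrow> real \<Rightarrow> real \<Rightarrow> real \<Rightarrow> real \<Rightarrow> real \<Rightarrow> bool" where
  "barron_coeff_assm d \<sigma> A c f R_A R_c R_f l_A l_c l_f \<longleftrightarrow>
     0 < R_A \<and> 0 < R_c \<and> 0 < R_f \<and>
     (let N = (MAX (i, j)\<in>{..<d} \<times> {..<d}. barron1_norm \<sigma> R_A d (Rd d) (\<lambda>x. A x i j))
      in N < \<top> \<and> l_A = enn2real N) \<and>
     has_barron1_norm \<sigma> R_c d c l_c \<and>
     has_barron1_norm \<sigma> R_f d f l_f"

definition mult_assm :: "(real \<Rightarrow> real) \<Rightarrow> real \<Rightarrow> real \<Rightarrow> bool" where
  "mult_assm \<sigma> R_m l_m \<longleftrightarrow> 0 < R_m \<and> has_barron1_norm \<sigma> R_m 2 (\<lambda>y. \<sigma> (y 0) * \<sigma> (y 1)) l_m"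

definition deriv_assm :: "(real \<Rightarrow> real) \<Rightarrow> real \<Rightarrow> real \<Rightarrow> real \<Rightarrow> real \<Rightarrow> bool" where
  "deriv_assm \<sigma> R_d1 R_d2 l_d1 l_d2 \<longleftrightarrow> 0 < R_d1 \<and> 0 < R_d2 \<and>
     has_barron1_norm \<sigma> R_d1 1 (\<lambda>y. deriv \<sigma> (y 0)) l_d1 \<and>
     has_barron1_norm \<sigma> R_d2 1 (\<lambda>y. deriv (deriv \<sigma>) (y 0)) l_d2"


text \<open>For \<open>k = 0\<close> this is the zero function.\<close>

definition two_layer_net ::
  "nat \<Rightarrow> (real \<Rightarrow> real) \<Rightarrow> nat \<Rightarrow> (nat \<Rightarrow> real) \<Rightarrow> (nat \<Rightarrow> vec) \<Rightarrow> (nat \<Rightarrow> real) \<Rightarrow> vec \<Rightarrow> real" where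
  "two_layer_net d \<sigma> k a w b x = 1 / real k * (\<Sum>i<k. a i * \<sigma> (dot d (w i) x + b i))"

text \<open>The number of neurons is a natural number, possibly \<open>0\<close>: when the bound on it is at least \<open>1\<close>,
  a network with \<open>k = 0\<close> can be replaced by one with \<open>k = 1\<close> and \<open>a 0 = 0\<close>, and when the bound is
  below \<open>1\<close> (small or empty \<open>\<Omega>\<close>) no positive \<open>k\<close> satisfies it.\<close>

definition approximable ::
  "nat \<Rightarrow> (real \<Rightarrow> real) \<Rightarrow> (vec \<Rightarrow> real) \<Rightarrow> vec set \<Rightarrow> real \<Rightarrow> real \<Rightarrow> bool" where
  "approximable d \<sigma> u \<Omega> \<epsilon> bound \<longleftrightarrow>
     (\<exists>k a w b. (\<forall>i<k. w i \<in> Rd d) \<and> real k \<le> bound \<and>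
        (\<lambda>x. two_layer_net d \<sigma> k a w b x - u x) \<in> H1 d \<Omega> \<and>
        H1_norm d \<Omega> (\<lambda>x. two_layer_net d \<sigma> k a w b x - u x) \<le> \<epsilon>)"

end

theory Submission
  imports Defs
begin

text \<open>
  The iteration \<open>u\<^sub>0 = 0\<close>, \<open>u\<^sub>t\<^sub>+\<^sub>1 = u\<^sub>t - \<alpha> (1 - \<Delta>)\<^sup>-\<^sup>1 (-\<nabla>\<cdot>(A\<nabla>u\<^sub>t) + c u\<^sub>t - f)\<close> contracts in \<open>H\<^sup>1(\<real>\<^sup>d)\<close>
  for \<open>\<alpha> = \<lambda>/\<Lambda>\<^sup>2\<close>, where \<open>\<lambda>\<close> and \<open>\<Lambda>\<close> are the coercivity and continuity constants of the bilinear form, so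
  \<open>O(|ln \<epsilon>|)\<close> steps suffice. Every iterate is an average \<open>\<integral> a \<sigma>(w\<cdot>x + b)\<close> with \<open>|a| \<le> N\<close> and \<open>|w| \<le> R\<close>, and
  one step multiplies \<open>R\<close> by a constant and \<open>N\<close> by a constant times \<open>d\<^sup>2 R\<^sup>2\<close>: products and derivatives
  are handled by the assumptions on \<open>\<sigma>\<close>, while \<open>(1 - \<Delta>)\<^sup>-\<^sup>1\<close> acts on a function of \<open>w\<cdot>x\<close> as a
  one-dimensional operator, namely the convolution with a two-sided exponential density, and so
  preserves \<open>R\<close> and \<open>N\<close>. For the cosine the factor \<open>R\<^sup>2\<close> disappears, because the symbol
  \<open>1/(1 + |\<xi>|\<^sup>2)\<close> absorbs the two derivatives. Finally the last iterate is replaced by \<open>k\<close> samples of its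
  integral representation, with squared \<open>H\<^sup>1(\<Omega>)\<close> error at most \<open>m(\<Omega>) N\<^sup>2 (C\<^sub>0\<^sup>2 + R\<^sup>2 C\<^sub>1\<^sup>2) / k\<close>.
\<close>

section \<open>Smooth functions on Euclidean space\<close>

text \<open>Two growth rates decide the theorem. After \<open>t\<close> steps the weights are
  bounded by \<open>R = K^t\<close>, so the factors \<open>R^2\<close> accumulate to
  \<open>K^(O(T^2))\<close>, while the factors \<open>d^2\<close> give \<open>d^(2T)\<close>. With
  \<open>T\<close> of order |ln \<epsilon>|, the first is a power of 1/\<epsilon> whose exponent is
  of order |ln \<epsilon>|: this is the origin of
  \<open>(d/\<epsilon>)^(\<beta> |ln \<epsilon>|)\<close>. Without the factors \<open>R^2\<close>
  only \<open>K^(O(T))\<close> remains, which is a fixed power of 1/\<epsilon>. The main obstacle is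
  that an average of ridge functions is bounded and smooth, but nothing in its form makes it square
  integrable, whereas the contraction takes place in \<open>H^1\<close>. The resolvent is therefore
  constructed pointwise, as a bounded classical solution, and its membership in \<open>H^1\<close>
  is deduced from the equation by a weighted energy estimate. A second gap is that only \<sigma>,
  \<sigma>' and \<sigma>'' are assumed bounded: the bounds on all higher derivatives come from the
  representation of \<sigma>' by \<sigma>.\<close>

lemma space_Rd_leb [simp]: "space (Rd_leb d) = Rd d"
  by (simp add: space_PiM)

lemma topspace_Rd_top [simp]: "topspace (Rd_top d) = Rd d"
  by simp

lemma fun_upd_Rd: "x \<in> Rd d \<Longrightarrow> i < d \<Longrightarrow> x(i := t) \<in> Rd d"
  by (auto simp: PiE_def extensional_def)

text \<open>Precomposition with restriction moves a function on \<open>Rd d\<close> to the whole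
  function type, where open sets generate the Borel sets. Together with the extension by 0 below, it
  turns continuity in \<open>Rd_top d\<close> into measurability for
  \<open>Rd_leb d\<close>.\<close>

lemma continuous_map_Rd_extend:
  assumes "continuous_map (Rd_top d) Y \<phi>"
  shows "continuous_map euclidean Y (\<lambda>x. \<phi> (restrict x {..<d}))"
proof -
  have "continuous_map (product_topology (\<lambda>i::nat. euclideanreal) UNIV) (Rd_top d) (\<lambda>x. restrict x {..<d})"
    by (subst continuous_map_componentwise) (auto intro!: continuous_map_product_projection)
  then show ?thesis
    using continuous_map_compose[OF _ assms] by (simp add: euclidean_product_topology o_def)
qed

lemma measurable_Rd_extend: "(\<lambda>x i. if i < d then x i else 0) \<in> Rd_leb d \<rightarrow>\<^sub>M (borel :: vec measure)"
proof -
  have "(\<lambda>x i. if i < d then x i else 0) \<in> Rd_leb d \<rightarrow>\<^sub>M (\<Pi>\<^sub>M i\<in>UNIV. (borel::real measure))"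
  proof (rule measurable_PiM_single')
    fix i :: nat
    show "(\<lambda>x. if i < d then x i else 0) \<in> borel_measurable (Rd_leb d)"
      by (cases "i < d") simp_all
  qed auto
  then show ?thesis
    by (simp only: sets_PiM_equal_borel cong: measurable_cong_sets)
qed

lemma borel_measurable_continuous_map_Rd:
  assumes "continuous_map (Rd_top d) euclideanreal \<phi>"
  shows "\<phi> \<in> borel_measurable (Rd_leb d)"
proof -
  have "continuous_on UNIV (\<lambda>x. \<phi> (restrict x {..<d}))"
    using continuous_map_Rd_extend[OF assms] by (simp add: continuous_map_iff_continuous2)
  then have "(\<lambda>x. \<phi> (restrict x {..<d})) \<in> borel_measurable borel"
    by (rule borel_measurable_continuous_onI)
  from measurable_compose[OF measurable_Rd_extend this]
  have "(\<lambda>x. \<phi> (restrict (\<lambda>i. if i < d then x i else 0) {..<d})) \<in> borel_measurable (Rd_leb d)" .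
  \<comment> \<open>Extending by 0 and restricting again is the identity on \<open>Rd d\<close>,
    whose points are \<open>undefined\<close> outside \<open>{..<d}\<close>.\<close>
  also have "?this \<longleftrightarrow> ?thesis"
    by (rule measurable_cong) (auto intro!: arg_cong[where f=\<phi>] simp: PiE_def extensional_def fun_eq_iff restrict_def)
  finally show ?thesis .
qed

lemma openin_Rd_sets:
  assumes "openin (Rd_top d) U" shows "U \<in> sets (Rd_leb d)"
proof -
  have UR: "U \<subseteq> Rd d" using openin_subset[OF assms] by simp
  have cm: "continuous_map euclidean (Rd_top d) (\<lambda>x. restrict x {..<d})"
    using continuous_map_Rd_extend[OF continuous_map_id] by (simp add: id_def)
  have "open ((\<lambda>x. restrict x {..<d}) -` U)"
    using openin_continuous_map_preimage[OF cm assms] by (simp add: vimage_def)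
  then have "(\<lambda>x. restrict x {..<d}) -` U \<in> sets borel" by simp
  from measurable_sets[OF measurable_Rd_extend this]
  have "(\<lambda>x i. if i < d then x i else 0) -` ((\<lambda>x. restrict x {..<d}) -` U) \<inter> Rd d \<in> sets (Rd_leb d)" 
    by (simp only: space_Rd_leb)
  also have "(\<lambda>x i. if i < d then x i else 0) -` ((\<lambda>x. restrict x {..<d}) -` U) \<inter> Rd d = U"
  proof -
    have "restrict (\<lambda>i. if i < d then x i else 0) {..<d} = x" if "x \<in> Rd d" for x :: vec
      using that by (auto simp: PiE_def extensional_def fun_eq_iff restrict_def)
    then show ?thesis using UR by auto
  qed
  finally show ?thesis .
qed

lemma continuous_map_Rd_lipschitz:
  assumes "\<And>x y. x \<in> Rd d \<Longrightarrow> y \<in> Rd d \<Longrightarrow> \<bar>\<phi> x - \<phi> y\<bar> \<le> L * (\<Sum>i<d. \<bar>x i - y i\<bar>)"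
  shows "continuous_map (Rd_top d) euclideanreal \<phi>"
proof -
  have "continuous_map (Rd_top d) (Met_TC.mtopology) \<phi>"
    unfolding Met_TC.continuous_map_to_metric
  proof (intro ballI allI impI)
    fix x and e :: real assume x: "x \<in> topspace (Rd_top d)" and e: "0 < e"
    \<comment> \<open>Division by \<open>\<bar>L\<bar> + 1\<close> instead of \<open>L\<close> keeps
      the radius positive for every real \<open>L\<close>.\<close>
    let ?U = "{y \<in> topspace (Rd_top d). (\<Sum>i<d. \<bar>x i - y i\<bar>) \<in> {..< e / (\<bar>L\<bar> + 1)}}"
    have "openin (Rd_top d) ?U"
      by (rule openin_continuous_map_preimage[where Y=euclideanreal])
        (auto intro!: continuous_map_sum continuous_map_real_abs continuous_map_diff continuous_map_product_projection)
    moreover have "x \<in> ?U" using x e by auto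
    moreover have "\<phi> y \<in> Met_TC.mball (\<phi> x) e" if y: "y \<in> ?U" for y
    proof -
      have "\<bar>\<phi> x - \<phi> y\<bar> \<le> L * (\<Sum>i<d. \<bar>x i - y i\<bar>)" using assms x y by simp
      also have "\<dots> \<le> (\<bar>L\<bar> + 1) * (\<Sum>i<d. \<bar>x i - y i\<bar>)" by (intro mult_right_mono sum_nonneg) auto
      also have "\<dots> < e" using y by (simp add: field_simps)
      finally show ?thesis by (simp add: dist_real_def)
    qed
    ultimately show "\<exists>U. openin (Rd_top d) U \<and> x \<in> U \<and> (\<forall>y\<in>U. \<phi> y \<in> Met_TC.mball (\<phi> x) e)" by blast
  qed
  then show ?thesis by simp
qed

text \<open>\<open>deriv\<close> has a value even where no derivative exists. The relation carries
  existence and value together, so that the rules of differentiation compose.\<close>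

definition has_partial :: "nat \<Rightarrow> nat \<Rightarrow> (vec \<Rightarrow> real) \<Rightarrow> (vec \<Rightarrow> real) \<Rightarrow> bool" where
  "has_partial d i \<phi> \<psi> \<longleftrightarrow> (\<forall>x\<in>Rd d. ((\<lambda>t. \<phi> (x(i := t))) has_field_derivative \<psi> x) (at (x i)))"

lemma has_partial_pd: "has_partial d i \<phi> \<psi> \<Longrightarrow> x \<in> Rd d \<Longrightarrow> partial_deriv i \<phi> x = \<psi> x"
  by (auto simp: has_partial_def partial_deriv_def intro!: DERIV_imp_deriv)

lemma has_partial_at:
  assumes "has_partial d i \<phi> \<psi>" "x \<in> Rd d" "i < d"
  shows "((\<lambda>t. \<phi> (x(i := t))) has_field_derivative \<psi> (x(i := t))) (at t)"
  using assms(1)[unfolded has_partial_def, rule_format, OF fun_upd_Rd[OF assms(2,3), of t]] by simp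

lemma partial_deriv_cong:
  assumes "\<And>x. x \<in> Rd d \<Longrightarrow> \<phi> x = \<psi> x" "i < d" "x \<in> Rd d"
  shows "partial_deriv i \<phi> x = partial_deriv i \<psi> x"
proof -
  have "(\<lambda>t. \<phi> (x(i := t))) = (\<lambda>t. \<psi> (x(i := t)))"
    using assms fun_upd_Rd by (intro ext assms(1)) auto
  then show ?thesis by (simp add: partial_deriv_def)
qed

lemma has_partial_cong:
  assumes "has_partial d i \<phi> \<psi>" "\<And>x. x \<in> Rd d \<Longrightarrow> \<phi> x = \<phi>' x" "\<And>x. x \<in> Rd d \<Longrightarrow> \<psi> x = \<psi>' x" "i < d"
  shows "has_partial d i \<phi>' \<psi>'"
  unfolding has_partial_def
proof
  fix x assume x: "x \<in> Rd d"
  have "(\<lambda>t. \<phi>' (x(i := t))) = (\<lambda>t. \<phi> (x(i := t)))"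
    using assms x fun_upd_Rd by (intro ext assms(2)[symmetric]) auto
  then show "((\<lambda>t. \<phi>' (x(i := t))) has_field_derivative \<psi>' x) (at (x i))"
    using assms x by (auto simp: has_partial_def)
qed

lemma has_partial_add:
  "has_partial d i \<phi> \<phi>' \<Longrightarrow> has_partial d i \<psi> \<psi>' \<Longrightarrow> has_partial d i (\<lambda>x. \<phi> x + \<psi> x) (\<lambda>x. \<phi>' x + \<psi>' x)"
  unfolding has_partial_def by (auto intro!: derivative_eq_intros)

lemma has_partial_mult:
  "has_partial d i \<phi> \<phi>' \<Longrightarrow> has_partial d i \<psi> \<psi>' \<Longrightarrow>
   has_partial d i (\<lambda>x. \<phi> x * \<psi> x) (\<lambda>x. \<phi>' x * \<psi> x + \<phi> x * \<psi>' x)"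
  unfolding has_partial_def by (auto intro!: derivative_eq_intros)

lemma has_partial_const: "has_partial d i (\<lambda>x. c) (\<lambda>x. 0)"
  unfolding has_partial_def by auto

lemma has_partial_sum:
  "finite I \<Longrightarrow> (\<And>j. j \<in> I \<Longrightarrow> has_partial d i (\<phi> j) (\<phi>' j)) \<Longrightarrow>
   has_partial d i (\<lambda>x. \<Sum>j\<in>I. \<phi> j x) (\<lambda>x. \<Sum>j\<in>I. \<phi>' j x)"
  unfolding has_partial_def by (auto intro!: derivative_eq_intros)

definition smooth :: "nat \<Rightarrow> (vec \<Rightarrow> real) \<Rightarrow> bool" where
  "smooth d \<phi> \<longleftrightarrow> (\<forall>k. C_k d k \<phi>)"

lemma continuous_map_Rd_cong:
  assumes "continuous_map (Rd_top d) euclideanreal \<phi>" "\<And>x. x \<in> Rd d \<Longrightarrow> \<phi> x = \<psi> x"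
  shows "continuous_map (Rd_top d) euclideanreal \<psi>"
  using continuous_map_eq[OF assms(1)] assms(2) by simp

text \<open>Closure of a class under partial derivatives replaces formulas for derivatives of order
  \<open>k\<close>. \<open>C_k\<close> recurses through \<open>partial_deriv\<close>, which known
  formulas determine only on \<open>Rd d\<close>, so the induction covers every function that agrees
  there with a member of the class.\<close>

lemma smooth_coinduct [case_names member continuous partial]:
  assumes "X \<phi>"
    and cont: "\<And>\<phi>. X \<phi> \<Longrightarrow> continuous_map (Rd_top d) euclideanreal \<phi>"
    and part: "\<And>\<phi> i. X \<phi> \<Longrightarrow> i < d \<Longrightarrow> \<exists>\<psi>. X \<psi> \<and> has_partial d i \<phi> \<psi>"
  shows "smooth d \<phi>"
proof -
  have "C_k d k \<psi>" if "X \<theta>" "\<And>x. x \<in> Rd d \<Longrightarrow> \<theta> x = \<psi> x" for k \<theta> \<psi>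
    using that
  proof (induction k arbitrary: \<theta> \<psi>)
    case 0
    then show ?case using continuous_map_Rd_cong[OF cont[OF 0(1)]] by auto
  next
    case (Suc k)
    have "continuous_map (Rd_top d) euclideanreal \<psi>"
      using continuous_map_Rd_cong[OF cont[OF Suc.prems(1)]] Suc.prems(2) by auto
    moreover have "(\<lambda>t. \<psi> (x(i := t))) differentiable (at (x i))" and "C_k d k (partial_deriv i \<psi>)"
      if i: "i < d" and x: "x \<in> Rd d" for i x
    proof -
      from part[OF Suc.prems(1) i] obtain \<theta>' where X': "X \<theta>'" "has_partial d i \<theta> \<theta>'" by blast
      have hp: "has_partial d i \<psi> \<theta>'"
        using has_partial_cong[OF X'(2) Suc.prems(2) refl i] .
      then show "(\<lambda>t. \<psi> (x(i := t))) differentiable (at (x i))"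
        using x by (auto simp: has_partial_def real_differentiable_def)
      show "C_k d k (partial_deriv i \<psi>)"
        by (rule Suc.IH[OF X'(1)]) (simp add: has_partial_pd[OF hp])
    qed
    \<comment> \<open>The second fact above was shown under the assumption of a point of
      \<open>Rd d\<close>, although it does not mention it, so a point must be exhibited.\<close>
    moreover have "(\<lambda>_\<in>{..<d}. 0) \<in> Rd d" by auto
    ultimately show ?case unfolding C_k.simps by blast
  qed
  from this[OF assms(1)] show ?thesis by (simp add: smooth_def)
qed

lemma smooth_continuous: "smooth d \<phi> \<Longrightarrow> continuous_map (Rd_top d) euclideanreal \<phi>"
  using C_k.simps(1) unfolding smooth_def by blast

lemma smooth_measurable: "smooth d \<phi> \<Longrightarrow> \<phi> \<in> borel_measurable (Rd_leb d)"
  by (intro borel_measurable_continuous_map_Rd smooth_continuous)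

lemma smooth_pd: "smooth d \<phi> \<Longrightarrow> i < d \<Longrightarrow> smooth d (partial_deriv i \<phi>)"
  using C_k.simps(2) unfolding smooth_def by blast

lemma smooth_has_partial: "smooth d \<phi> \<Longrightarrow> i < d \<Longrightarrow> has_partial d i \<phi> (partial_deriv i \<phi>)"
proof -
  assume "smooth d \<phi>" "i < d"
  then have "C_k d (Suc 0) \<phi>" "i < d" by (simp_all only: smooth_def)
  then show ?thesis
    unfolding has_partial_def partial_deriv_def
    by (auto simp: DERIV_deriv_iff_real_differentiable)
qed

lemma smooth_cong:
  assumes "smooth d \<phi>" "\<And>x. x \<in> Rd d \<Longrightarrow> \<phi> x = \<psi> x"
  shows "smooth d \<psi>"
proof (rule smooth_coinduct[where X="\<lambda>\<psi>. \<exists>\<phi>. smooth d \<phi> \<and> (\<forall>x\<in>Rd d. \<phi> x = \<psi> x)"])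
  show "\<exists>\<phi>. smooth d \<phi> \<and> (\<forall>x\<in>Rd d. \<phi> x = \<psi> x)" using assms by blast
next
  fix \<psi> assume "\<exists>\<phi>. smooth d \<phi> \<and> (\<forall>x\<in>Rd d. \<phi> x = \<psi> x)"
  then show "continuous_map (Rd_top d) euclideanreal \<psi>"
    using continuous_map_Rd_cong smooth_continuous by blast
next
  fix \<psi> i assume "\<exists>\<phi>. smooth d \<phi> \<and> (\<forall>x\<in>Rd d. \<phi> x = \<psi> x)" "i < d"
  then obtain \<phi> where \<phi>: "smooth d \<phi>" "\<forall>x\<in>Rd d. \<phi> x = \<psi> x" by blast
  have "has_partial d i \<psi> (partial_deriv i \<phi>)"
    using has_partial_cong[OF smooth_has_partial[OF \<phi>(1) \<open>i < d\<close>] _ refl \<open>i < d\<close>] \<phi>(2) by blast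
  then show "\<exists>\<theta>. (\<exists>\<phi>. smooth d \<phi> \<and> (\<forall>x\<in>Rd d. \<phi> x = \<theta> x)) \<and> has_partial d i \<psi> \<theta>"
    using smooth_pd[OF \<phi>(1) \<open>i < d\<close>] by blast
qed

lemma smooth_const: "smooth d (\<lambda>x. c)"
proof (rule smooth_coinduct[where X="\<lambda>\<phi>. \<exists>c. \<phi> = (\<lambda>x. c)"])
  show "\<exists>\<psi>. (\<exists>c. \<psi> = (\<lambda>x. c)) \<and> has_partial d i \<phi> \<psi>" if "\<exists>c. \<phi> = (\<lambda>x. c)" for \<phi> i
    using that has_partial_const by (intro exI[of _ "\<lambda>x. 0"]) auto
qed auto

text \<open>The product rule turns a product into a sum of products, so products alone are not
  closed under derivatives; coinduction is applied to the algebra that smooth functions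
  generate.\<close>

inductive smooth_algebra :: "nat \<Rightarrow> (vec \<Rightarrow> real) \<Rightarrow> bool" for d where
  base: "smooth d \<phi> \<Longrightarrow> smooth_algebra d \<phi>"
| add: "smooth_algebra d \<phi> \<Longrightarrow> smooth_algebra d \<psi> \<Longrightarrow> smooth_algebra d (\<lambda>x. \<phi> x + \<psi> x)"
| mult: "smooth_algebra d \<phi> \<Longrightarrow> smooth_algebra d \<psi> \<Longrightarrow> smooth_algebra d (\<lambda>x. \<phi> x * \<psi> x)"

lemma smooth_algebra_smooth: "smooth_algebra d \<phi> \<Longrightarrow> smooth d \<phi>"
proof (rule smooth_coinduct[where X="smooth_algebra d"])
  show "continuous_map (Rd_top d) euclideanreal \<phi>" if "smooth_algebra d \<phi>" for \<phi>
    using that by induction (auto intro: smooth_continuous continuous_map_add continuous_map_real_mult)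
  show "\<exists>\<psi>. smooth_algebra d \<psi> \<and> has_partial d i \<phi> \<psi>" if "smooth_algebra d \<phi>" "i < d" for \<phi> i
    using that(1)
  proof induction
    case (base \<phi>)
    then show ?case using smooth_has_partial smooth_pd \<open>i < d\<close> smooth_algebra.base by blast
  next
    case (add \<phi> \<psi>)
    then show ?case using has_partial_add smooth_algebra.add by blast
  next
    case (mult \<phi> \<psi>)
    then obtain \<phi>' \<psi>' where "smooth_algebra d \<phi>'" "has_partial d i \<phi> \<phi>'" "smooth_algebra d \<psi>'" "has_partial d i \<psi> \<psi>'"
      by blast
    then show ?case
      using mult.hyps
      by (intro exI[of _ "\<lambda>x. \<phi>' x * \<psi> x + \<phi> x * \<psi>' x"]) (auto intro: smooth_algebra.intros has_partial_mult)
  qed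
qed

lemma smooth_add: "smooth d \<phi> \<Longrightarrow> smooth d \<psi> \<Longrightarrow> smooth d (\<lambda>x. \<phi> x + \<psi> x)"
  and smooth_mult: "smooth d \<phi> \<Longrightarrow> smooth d \<psi> \<Longrightarrow> smooth d (\<lambda>x. \<phi> x * \<psi> x)"
  by (auto intro!: smooth_algebra_smooth intro: smooth_algebra.intros)

lemma smooth_cmult: "smooth d \<phi> \<Longrightarrow> smooth d (\<lambda>x. c * \<phi> x)"
  by (intro smooth_mult smooth_const)

lemma smooth_diff: "smooth d \<phi> \<Longrightarrow> smooth d \<psi> \<Longrightarrow> smooth d (\<lambda>x. \<phi> x - \<psi> x)"
  using smooth_add[OF _ smooth_cmult[of d \<psi> "-1"], of \<phi>] by simp

lemma smooth_sum: "finite I \<Longrightarrow> (\<And>i. i \<in> I \<Longrightarrow> smooth d (\<phi> i)) \<Longrightarrow> smooth d (\<lambda>x. \<Sum>i\<in>I. \<phi> i x)"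
  by (induction I rule: finite_induct) (auto intro: smooth_const smooth_add)

lemma smooth_prod: "finite I \<Longrightarrow> (\<And>i. i \<in> I \<Longrightarrow> smooth d (\<phi> i)) \<Longrightarrow> smooth d (\<lambda>x. \<Prod>i\<in>I. \<phi> i x)"
  by (induction I rule: finite_induct) (auto intro: smooth_const smooth_mult)

lemma pd_mult:
  assumes "smooth d \<phi>" "smooth d \<psi>" "i < d" "x \<in> Rd d"
  shows "partial_deriv i (\<lambda>x. \<phi> x * \<psi> x) x = partial_deriv i \<phi> x * \<psi> x + \<phi> x * partial_deriv i \<psi> x"
  by (rule has_partial_pd[OF has_partial_mult]) (use assms smooth_has_partial in auto)

lemma pd_add:
  assumes "smooth d \<phi>" "smooth d \<psi>" "i < d" "x \<in> Rd d"
  shows "partial_deriv i (\<lambda>x. \<phi> x + \<psi> x) x = partial_deriv i \<phi> x + partial_deriv i \<psi> x"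
  by (rule has_partial_pd[OF has_partial_add]) (use assms smooth_has_partial in auto)

lemma pd_cmult:
  assumes "smooth d \<phi>" "i < d" "x \<in> Rd d"
  shows "partial_deriv i (\<lambda>x. c * \<phi> x) x = c * partial_deriv i \<phi> x"
  using pd_mult[OF smooth_const assms(1,2,3), of c] has_partial_pd[OF has_partial_const assms(3), of i c] by simp

lemma pd_diff:
  assumes "smooth d \<phi>" "smooth d \<psi>" "i < d" "x \<in> Rd d"
  shows "partial_deriv i (\<lambda>x. \<phi> x - \<psi> x) x = partial_deriv i \<phi> x - partial_deriv i \<psi> x"
  using pd_add[OF assms(1) smooth_cmult[OF assms(2), of "-1"] assms(3,4)]
    pd_cmult[OF assms(2,3,4), of "-1"] by simp

lemma pd_sum:
  assumes "finite I" "\<And>j. j \<in> I \<Longrightarrow> smooth d (\<phi> j)" "i < d" "x \<in> Rd d"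
  shows "partial_deriv i (\<lambda>x. \<Sum>j\<in>I. \<phi> j x) x = (\<Sum>j\<in>I. partial_deriv i (\<phi> j) x)"
  by (rule has_partial_pd[OF has_partial_sum]) (use assms smooth_has_partial in auto)

text \<open>\<open>S\<close> plays the role of the set of all derivatives.\<close>

definition smooth1 :: "(real \<Rightarrow> real) \<Rightarrow> bool" where
  "smooth1 \<eta> \<longleftrightarrow> (\<exists>S. \<eta> \<in> S \<and> (\<forall>f\<in>S. \<exists>f'\<in>S. \<forall>x. (f has_real_derivative f' x) (at x)))"

lemma smooth1_deriv: "smooth1 \<eta> \<Longrightarrow> \<exists>\<eta>'. smooth1 \<eta>' \<and> (\<forall>x. (\<eta> has_real_derivative \<eta>' x) (at x))"
  unfolding smooth1_def by metis

lemma smooth1_continuous: "smooth1 \<eta> \<Longrightarrow> continuous_on UNIV \<eta>"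
  using smooth1_deriv by (meson DERIV_isCont continuous_at_imp_continuous_on)

lemma smooth_coordinate:
  assumes "smooth1 \<eta>" "i < d"
  shows "smooth d (\<lambda>x. \<eta> (x i))"
proof (rule smooth_coinduct[where X="\<lambda>\<phi>. \<exists>\<eta>. smooth1 \<eta> \<and> \<phi> = (\<lambda>x. \<eta> (x i))"])
  show "\<exists>\<zeta>. smooth1 \<zeta> \<and> (\<lambda>x. \<eta> (x i)) = (\<lambda>x. \<zeta> (x i))" using assms by blast
  show "continuous_map (Rd_top d) euclideanreal \<phi>" if "\<exists>\<eta>. smooth1 \<eta> \<and> \<phi> = (\<lambda>x. \<eta> (x i))" for \<phi>
  proof -
    from that obtain \<eta> where "smooth1 \<eta>" "\<phi> = (\<lambda>x. \<eta> (x i))" by auto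
    moreover have "continuous_map (Rd_top d) euclideanreal (\<lambda>x. x i)"
      using assms(2) by (auto intro: continuous_map_product_projection)
    ultimately show ?thesis
      using continuous_map_compose[of "Rd_top d" euclideanreal "\<lambda>x. x i" euclideanreal \<eta>]
        smooth1_continuous[of \<eta>] by (simp add: o_def)
  qed
  show "\<exists>\<psi>. (\<exists>\<eta>. smooth1 \<eta> \<and> \<psi> = (\<lambda>x. \<eta> (x i))) \<and> has_partial d j \<phi> \<psi>"
    if "\<exists>\<eta>. smooth1 \<eta> \<and> \<phi> = (\<lambda>x. \<eta> (x i))" "j < d" for \<phi> j
  proof -
    from that obtain \<eta> where \<eta>: "smooth1 \<eta>" "\<phi> = (\<lambda>x. \<eta> (x i))" by auto
    show ?thesis
    proof (cases "j = i")
      case True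
      obtain \<eta>' where \<eta>': "smooth1 \<eta>'" "\<forall>x. (\<eta> has_real_derivative \<eta>' x) (at x)"
        using smooth1_deriv[OF \<eta>(1)] by blast
      then show ?thesis
        using True \<eta>(2) by (intro exI[of _ "\<lambda>x. \<eta>' (x i)"]) (auto simp: has_partial_def)
    next
      case False
      \<comment> \<open>Differentiating in another direction gives 0, which must again be a smooth
        function of \<open>x i\<close>.\<close>
      have "smooth1 (\<lambda>x. 0)" unfolding smooth1_def by (intro exI[of _ "{\<lambda>x. 0}"]) auto
      then show ?thesis
        using False \<eta>(2) by (intro exI[of _ "\<lambda>x. 0"]) (auto simp: has_partial_def)
    qed
  qed
qed

section \<open>Integration by parts\<close>

interpretation Rd: product_sigma_finite "\<lambda>_::nat. lborel :: real measure"
  by unfold_locales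

lemma sigma_finite_Rd_leb: "sigma_finite_measure (Rd_leb d)"
  by (intro Rd.sigma_finite) auto

section \<open>Bounded support and integration along coordinate lines\<close>

definition vanishes_outside :: "nat \<Rightarrow> real \<Rightarrow> (vec \<Rightarrow> real) \<Rightarrow> bool" where
  "vanishes_outside d r \<phi> \<longleftrightarrow> (\<forall>x\<in>Rd d. (\<exists>i<d. r < \<bar>x i\<bar>) \<longrightarrow> \<phi> x = 0)"

lemma vanishes_outside_mult:
  "vanishes_outside d r \<phi> \<Longrightarrow> vanishes_outside d r (\<lambda>x. \<psi> x * \<phi> x)"
  "vanishes_outside d r \<phi> \<Longrightarrow> vanishes_outside d r (\<lambda>x. \<phi> x * \<psi> x)"
  by (auto simp: vanishes_outside_def)

lemma compactin_Rd_bounded: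
  assumes "compactin (Rd_top d) K"
  shows "\<exists>r. \<forall>x\<in>K. \<forall>i<d. \<bar>x i\<bar> \<le> r"
proof -
  have "\<exists>r. \<forall>x\<in>K. \<bar>x i\<bar> \<le> r" if "i < d" for i
  proof -
    have "compactin euclideanreal ((\<lambda>x. x i) ` K)"
      by (rule image_compactin[OF assms]) (use that in \<open>auto intro: continuous_map_product_projection\<close>)
    then have "bounded ((\<lambda>x. x i) ` K)" by (simp add: compact_imp_bounded)
    then show ?thesis by (auto simp: bounded_iff)
  qed
  then obtain r where r: "\<And>i x. i < d \<Longrightarrow> x \<in> K \<Longrightarrow> \<bar>x i\<bar> \<le> r i" by metis
  have "\<bar>x i\<bar> \<le> (\<Sum>i<d. \<bar>r i\<bar>)" if "x \<in> K" "i < d" for x i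
  proof -
    have "\<bar>x i\<bar> \<le> \<bar>r i\<bar>" using r that by fastforce
    also have "\<dots> \<le> (\<Sum>i<d. \<bar>r i\<bar>)" using that by (intro member_le_sum) auto
    finally show ?thesis .
  qed
  then show ?thesis by blast
qed

lemma not_in_Rd_box:
  assumes "x \<in> Rd d" "x \<notin> (\<Pi>\<^sub>E i\<in>{..<d}. {-r..r})"
  shows "\<exists>i<d. r < \<bar>x i\<bar>"
proof -
  from assms have "\<exists>i<d. x i \<notin> {-r..r}" by (auto simp: PiE_iff)
  then show ?thesis by (auto simp: not_le abs_if)
qed

lemma compactin_Rd_box: "compactin (Rd_top d) (\<Pi>\<^sub>E i\<in>{..<d}. {a i..b i})"
  by (auto simp: compactin_PiE)

lemma emeasure_Rd_box: "emeasure (Rd_leb d) (\<Pi>\<^sub>E i\<in>{..<d}. {a i..b i}) < \<infinity>"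
proof -
  have "emeasure (Rd_leb d) (\<Pi>\<^sub>E i\<in>{..<d}. {a i..b i}) = (\<Prod>i<d. emeasure lborel {a i..b i})"
    by (rule Rd.emeasure_PiM) simp_all
  also have "\<dots> \<noteq> \<top>"
    unfolding ennreal_prod_eq_top by (simp add: emeasure_lborel_Icc_eq)
  finally show ?thesis by (simp add: less_top)
qed

lemma sets_Rd_box [measurable]: "(\<Pi>\<^sub>E i\<in>{..<d}. {a i..b i}) \<in> sets (Rd_leb d)"
  by (intro sets_PiM_I_finite) auto

lemma continuous_bounded_on_compact:
  assumes "continuous_map (Rd_top d) euclideanreal \<phi>" "compactin (Rd_top d) K"
  shows "\<exists>C. \<forall>x\<in>K. \<bar>\<phi> x\<bar> \<le> C"
proof -
  have "bounded (\<phi> ` K)"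
    using image_compactin[OF assms(2,1)] by (simp add: compact_imp_bounded)
  then show ?thesis by (auto simp: bounded_iff)
qed

lemma integrable_vanishes_outside:
  assumes c: "continuous_map (Rd_top d) euclideanreal \<phi>" and v: "vanishes_outside d r \<phi>"
  shows "integrable (Rd_leb d) \<phi>"
proof -
  let ?B = "\<Pi>\<^sub>E i\<in>{..<d}. {-r..r}"
  obtain C where C: "\<forall>x\<in>?B. \<bar>\<phi> x\<bar> \<le> C"
    using continuous_bounded_on_compact[OF c compactin_Rd_box[of d "\<lambda>_. -r" "\<lambda>_. r"]] by metis
  show ?thesis
  proof (rule integrableI_bounded_set[where A="?B" and B=C])
    show "AE x in Rd_leb d. x \<notin> ?B \<longrightarrow> \<phi> x = 0"
    proof (rule AE_I2, rule impI)
      fix x assume x: "x \<in> space (Rd_leb d)" "x \<notin> ?B"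
      then show "\<phi> x = 0" using not_in_Rd_box[of x d r] v by (auto simp: vanishes_outside_def)
    qed
  qed (use C emeasure_Rd_box borel_measurable_continuous_map_Rd[OF c] in auto)
qed

text \<open>A point with \<open>r < \<bar>x j\<bar>\<close> has a neighbourhood of such points on
  its line in direction \<open>i\<close>: for \<open>j = i\<close> because the condition is open,
  for other \<open>j\<close> because \<open>x j\<close> does not change. So \<phi> is locally 0 on
  that line.\<close>

lemma has_partial_vanishes_outside:
  assumes "has_partial d i \<phi> \<psi>" "vanishes_outside d r \<phi>" "i < d"
  shows "vanishes_outside d r \<psi>"
  unfolding vanishes_outside_def
proof (intro ballI impI)
  fix x assume x: "x \<in> Rd d" and "\<exists>j<d. r < \<bar>x j\<bar>"
  then obtain j where j: "j < d" "r < \<bar>x j\<bar>" by blast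
  have "eventually (\<lambda>t. \<phi> (x(i := t)) = 0) (nhds (x i))"
  proof (cases "j = i")
    case True
    have "open {t. r < \<bar>t\<bar>}" by (intro open_Collect_less continuous_intros)
    then have "eventually (\<lambda>t. t \<in> {t. r < \<bar>t\<bar>}) (nhds (x i))"
      using j True by (intro eventually_nhds_in_open) auto
    then show ?thesis
      by eventually_elim (use assms(2) fun_upd_Rd[OF x assms(3)] in \<open>force simp: vanishes_outside_def intro: assms(3)\<close>)
  next
    case False
    show ?thesis
      by (rule always_eventually)
        (use assms(2) fun_upd_Rd[OF x assms(3)] j False in \<open>force simp: vanishes_outside_def\<close>)
  qed
  then have "((\<lambda>t. \<phi> (x(i := t))) has_field_derivative 0) (at (x i))"
    by (subst DERIV_cong_ev[OF refl _ refl, of _ "\<lambda>_. 0"]) auto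
  moreover have "((\<lambda>t. \<phi> (x(i := t))) has_field_derivative \<psi> x) (at (x i))"
    using assms(1) x by (auto simp: has_partial_def)
  ultimately show "\<psi> x = 0" by (metis DERIV_unique)
qed

text \<open>Fubini with coordinate \<open>i\<close> innermost: on every line parallel to that axis
  the inner integral is a difference of two boundary values outside the support.\<close>

lemma integral_partial_zero:
  assumes hp: "has_partial d i \<phi> \<psi>" and c: "continuous_map (Rd_top d) euclideanreal \<psi>"
    and v: "vanishes_outside d r \<phi>" and i: "i < d"
  shows "(\<integral>x. \<psi> x \<partial>Rd_leb d) = 0"
proof -
  let ?J = "{..<d} - {i}"
  have ins: "insert i ?J = {..<d}" using i by auto
  have v': "vanishes_outside d r \<psi>" by (rule has_partial_vanishes_outside[OF hp v i])
  have int: "integrable (Pi\<^sub>M (insert i ?J) (\<lambda>_. lborel)) \<psi>"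
    unfolding ins by (rule integrable_vanishes_outside[OF c v'])
  have "(\<integral>x. \<psi> x \<partial>Rd_leb d) = (\<integral>x. (\<integral>t. \<psi> (x(i := t)) \<partial>lborel) \<partial>Pi\<^sub>M ?J (\<lambda>_. lborel))"
    using Rd.product_integral_insert[OF _ _ int] unfolding ins by simp
  also have "\<dots> = (\<integral>x. 0 \<partial>Pi\<^sub>M ?J (\<lambda>_. lborel :: real measure))"
  proof (rule Bochner_Integration.integral_cong[OF refl])
    fix x assume x: "x \<in> space (Pi\<^sub>M ?J (\<lambda>_. lborel :: real measure))"
    have xR: "x(i := t) \<in> Rd d" for t
      using x i by (auto simp: space_PiM PiE_def extensional_def)
    \<comment> \<open>\<open>r\<close> may be negative; \<open>q\<close> is positive and lies
      strictly outside, so both boundary values vanish.\<close>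
    define q where "q = \<bar>r\<bar> + 1"
    have out: "\<phi> (x(i := t)) = 0" "\<psi> (x(i := t)) = 0" if "\<bar>t\<bar> > \<bar>r\<bar>" for t
      using v v' xR[of t] i that by (auto simp: vanishes_outside_def intro!: exI[of _ i])
    have D: "((\<lambda>t. \<phi> (x(i := t))) has_real_derivative \<psi> (x(i := t))) (at t)" for t
      using has_partial_at[OF hp xR[of 0] i, of t] by simp
    have cpsi: "continuous_on UNIV (\<lambda>t. \<psi> (x(i := t)))"
    proof -
      have "continuous_map euclideanreal (Rd_top d) (\<lambda>t. x(i := t))"
        using xR by (subst continuous_map_componentwise) (auto simp: PiE_def)
      from continuous_map_compose[OF this c] show ?thesis by (simp add: o_def)
    qed
    have "(\<integral>t. \<psi> (x(i := t)) \<partial>lborel) = (\<integral>t. \<psi> (x(i := t)) * indicator {-q..q} t \<partial>lborel)"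
      by (rule Bochner_Integration.integral_cong)
        (auto simp: q_def indicator_def abs_le_iff intro!: out)
    also have "\<dots> = \<phi> (x(i := q)) - \<phi> (x(i := - q))"
    proof (rule integral_FTC_Icc_real)
      show "isCont (\<lambda>t. \<psi> (x(i := t))) t" for t
        using cpsi by (simp add: continuous_on_eq_continuous_at)
    qed (simp_all add: q_def D del: fun_upd_apply)
    also have "\<dots> = 0" using out[of q] out[of "-q"] by (simp add: q_def)
    finally show "(\<integral>t. \<psi> (x(i := t)) \<partial>lborel) = 0" .
  qed
  finally show ?thesis by simp
qed

lemma test_functions_smooth: "\<phi> \<in> test_functions d U \<Longrightarrow> smooth d \<phi>"
  by (simp add: test_functions_def smooth_def)

lemma test_functions_vanish:
  assumes "\<phi> \<in> test_functions d U" shows "\<exists>r. vanishes_outside d r \<phi>"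
proof -
  obtain K where K: "compactin (Rd_top d) K" "\<forall>x\<in>Rd d - K. \<phi> x = 0"
    using assms by (auto simp: test_functions_def)
  obtain r where r: "\<forall>x\<in>K. \<forall>i<d. \<bar>x i\<bar> \<le> r" using compactin_Rd_bounded[OF K(1)] by blast
  have "vanishes_outside d r \<phi>"
    unfolding vanishes_outside_def
  proof (intro ballI impI)
    fix x assume "x \<in> Rd d" "\<exists>i<d. r < \<bar>x i\<bar>"
    then show "\<phi> x = 0" using r K(2) by (meson DiffI not_le)
  qed
  then show ?thesis by blast
qed

lemma smooth_vanish_test:
  assumes "smooth d \<phi>" "vanishes_outside d r \<phi>"
  shows "\<phi> \<in> test_functions d (Rd d)"
proof -
  have "\<phi> x = 0" if "x \<in> Rd d - (\<Pi>\<^sub>E i\<in>{..<d}. {-r..r})" for x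
    using not_in_Rd_box[of x d r] assms(2) that by (auto simp: vanishes_outside_def)
  moreover have "(\<Pi>\<^sub>E i\<in>{..<d}. {-r..r}) \<subseteq> Rd d" by auto
  ultimately show ?thesis
    using assms(1) compactin_Rd_box[of d "\<lambda>_. -r" "\<lambda>_. r"]
    unfolding test_functions_def smooth_def by blast
qed

text \<open>The identity of \<open>is_weak_grad\<close> without square integrability of the
  gradient, so that it is available for bounded smooth functions before they are known to be in
  \<open>L2\<close>.\<close>

definition test_pair :: "nat \<Rightarrow> (vec \<Rightarrow> real) \<Rightarrow> (nat \<Rightarrow> vec \<Rightarrow> real) \<Rightarrow> bool" where
  "test_pair d v g \<longleftrightarrow> (\<forall>i<d. \<forall>\<phi>\<in>test_functions d (Rd d).
     (\<integral>x. v x * partial_deriv i \<phi> x \<partial>Rd_leb d) = - (\<integral>x. g i x * \<phi> x \<partial>Rd_leb d))"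

lemma smooth_test_pair:
  assumes w: "smooth d w" shows "test_pair d w (\<lambda>i. partial_deriv i w)"
  unfolding test_pair_def
proof (intro allI impI ballI)
  fix i \<phi> assume i: "i < d" and \<phi>: "\<phi> \<in> test_functions d (Rd d)"
  have s: "smooth d \<phi>" by (rule test_functions_smooth[OF \<phi>])
  obtain r where r: "vanishes_outside d r \<phi>" using test_functions_vanish[OF \<phi>] by blast
  have r': "vanishes_outside d r (partial_deriv i \<phi>)"
    by (rule has_partial_vanishes_outside[OF smooth_has_partial[OF s i] r i])
  have i1: "integrable (Rd_leb d) (\<lambda>x. w x * partial_deriv i \<phi> x)"
    by (intro integrable_vanishes_outside[OF smooth_continuous, where r=r] smooth_mult w smooth_pd[OF s i] vanishes_outside_mult(1)[OF r'])
  have i2: "integrable (Rd_leb d) (\<lambda>x. partial_deriv i w x * \<phi> x)"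
    by (intro integrable_vanishes_outside[OF smooth_continuous, where r=r] smooth_mult s smooth_pd[OF w i] vanishes_outside_mult(1)[OF r])
  have "(\<integral>x. partial_deriv i w x * \<phi> x + w x * partial_deriv i \<phi> x \<partial>Rd_leb d) = 0"
    by (rule integral_partial_zero[OF has_partial_mult[OF smooth_has_partial[OF w i] smooth_has_partial[OF s i]] _ _ i, where r=r])
      (intro smooth_continuous smooth_add smooth_mult smooth_pd w s i vanishes_outside_mult(1)[OF r])+
  then show "(\<integral>x. w x * partial_deriv i \<phi> x \<partial>Rd_leb d) = - (\<integral>x. partial_deriv i w x * \<phi> x \<partial>Rd_leb d)"
    using i1 i2 by simp
qed

section \<open>A smooth function that vanishes on the negative half-line\<close>

definition exp_poly :: "real poly \<Rightarrow> real \<Rightarrow> real" where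
  "exp_poly p t = (if 0 < t then poly p (1 / t) * exp (- (1 / t)) else 0)"

lemma tendsto_poly_exp_0: "((\<lambda>u::real. u ^ k * poly q u * exp (- u)) \<longlongrightarrow> 0) at_top"
proof (induction q arbitrary: k)
  case (pCons a q)
  have "((\<lambda>u::real. a * (u ^ k / exp u) + u ^ Suc k * poly q u * exp (- u)) \<longlongrightarrow> a * 0 + 0) at_top"
    by (intro tendsto_intros tendsto_power_div_exp_0 pCons.IH)
  then show ?case by (simp add: algebra_simps exp_minus divide_inverse)
qed simp

text \<open>With \<open>u = 1/t\<close> one has \<open>u' = - u^2\<close>, so the derivative of
  \<open>p(u) exp (- u)\<close> is \<open>u^2 (p(u) - p'(u)) exp (- u)\<close>: these functions are
  closed under derivatives, which makes \<open>bump\<close> smooth. At 0 the difference quotient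
  from the right is \<open>u p(u) exp (- u)\<close>, which tends to 0.\<close>

lemma exp_poly_deriv:
  "(exp_poly p has_real_derivative exp_poly ([:0, 0, 1:] * (p - pderiv p)) t) (at t)"
proof -
  consider "t > 0" | "t < 0" | "t = 0" by linarith
  then show ?thesis
  proof cases
    case 1
    have "((\<lambda>t. poly p (1 / t) * exp (- (1 / t))) has_real_derivative
        poly ([:0, 0, 1:] * (p - pderiv p)) (1 / t) * exp (- (1 / t))) (at t)"
      using 1 by (auto intro!: derivative_eq_intros DERIV_chain'[of _ _ _ _ "poly p"] poly_DERIV
          simp: field_simps power2_eq_square)
    then have "((\<lambda>t. poly p (1 / t) * exp (- (1 / t))) has_real_derivative
        exp_poly ([:0, 0, 1:] * (p - pderiv p)) t) (at t)" using 1 by (simp add: exp_poly_def)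
    then show ?thesis
      by (rule has_field_derivative_transform_within_open[where S="{0<..}"]) (use 1 in \<open>auto simp: exp_poly_def\<close>)
  next
    case 2
    have "((\<lambda>t. 0) has_real_derivative exp_poly ([:0, 0, 1:] * (p - pderiv p)) t) (at t)"
      using 2 by (simp add: exp_poly_def)
    then show ?thesis
      by (rule has_field_derivative_transform_within_open[where S="{..<0}"]) (use 2 in \<open>auto simp: exp_poly_def\<close>)
  next
    case 3
    have "((\<lambda>h. exp_poly p h / h) \<longlongrightarrow> 0) (at_right 0)"
    proof -
      have "((\<lambda>h. inverse h ^ 1 * poly p (inverse h) * exp (- inverse h)) \<longlongrightarrow> 0) (at_right (0::real))"
        using filterlim_compose[OF tendsto_poly_exp_0 filterlim_inverse_at_top_right] .
      then show ?thesis
        by (rule Lim_transform_eventually)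
          (auto simp: eventually_at_filter exp_poly_def field_simps)
    qed
    moreover have "((\<lambda>h. exp_poly p h / h) \<longlongrightarrow> 0) (at_left 0)"
      by (rule Lim_transform_eventually[OF tendsto_const]) (auto simp: eventually_at_filter exp_poly_def)
    ultimately have "((\<lambda>h. exp_poly p h / h) \<longlongrightarrow> 0) (at 0)"
      by (simp add: filterlim_split_at_real)
    then show ?thesis using 3 by (simp add: DERIV_def exp_poly_def)
  qed
qed

definition bump :: "real \<Rightarrow> real" where "bump t = (if 0 < t then exp (- (1 / t)) else 0)"
definition bump' :: "real \<Rightarrow> real" where "bump' t = (if 0 < t then (1 / t)\<^sup>2 * exp (- (1 / t)) else 0)"

lemma bump_exp_poly: "bump = exp_poly 1"
  by (auto simp: bump_def exp_poly_def)

lemma bump_deriv: "(bump has_real_derivative bump' t) (at t)"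
proof -
  have "exp_poly ([:0, 0, 1:] * (1 - pderiv 1)) t = bump' t"
    by (auto simp: bump'_def exp_poly_def power2_eq_square)
  then show ?thesis using exp_poly_deriv[of 1 t] by (simp add: bump_exp_poly)
qed

lemma bump_bounds: "0 \<le> bump t" "bump t \<le> 1" "\<bar>bump' t\<bar> \<le> 2"
proof -
  show "0 \<le> bump t" "bump t \<le> 1" by (auto simp: bump_def)
  \<comment> \<open>From \<open>u^2 / 2 \<le> exp u\<close>.\<close>
  have "u\<^sup>2 * exp (- u) \<le> 2" if "0 < u" for u :: real
    using exp_lower_Taylor_quadratic[of u] that by (simp add: exp_minus field_simps)
  then show "\<bar>bump' t\<bar> \<le> 2" by (auto simp: bump'_def)
qed

lemma smooth1_bump_affine: "smooth1 (\<lambda>s. bump (\<alpha> * s + \<beta>))"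
  unfolding smooth1_def
proof (intro exI[of _ "{\<lambda>s. c * exp_poly p (\<alpha> * s + \<beta>) | c p. True}"] conjI ballI)
  show "(\<lambda>s. bump (\<alpha> * s + \<beta>)) \<in> {\<lambda>s. c * exp_poly p (\<alpha> * s + \<beta>) | c p. True}"
    by (auto simp: bump_exp_poly intro!: exI[of _ 1])
  fix f assume "f \<in> {\<lambda>s. c * exp_poly p (\<alpha> * s + \<beta>) | c p. True}"
  then obtain c p where f: "f = (\<lambda>s. c * exp_poly p (\<alpha> * s + \<beta>))" by blast
  show "\<exists>f'\<in>{\<lambda>s. c * exp_poly p (\<alpha> * s + \<beta>) | c p. True}. \<forall>x. (f has_real_derivative f' x) (at x)"
    unfolding f
  proof (intro bexI allI)
    fix x show "((\<lambda>s. c * exp_poly p (\<alpha> * s + \<beta>)) has_real_derivative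
       (c * \<alpha>) * exp_poly ([:0, 0, 1:] * (p - pderiv p)) (\<alpha> * x + \<beta>)) (at x)"
      by (rule derivative_eq_intros DERIV_chain'[OF _ exp_poly_deriv] refl | simp)+
  qed blast
qed

lemma bump_tendsto: "filterlim f at_top F \<Longrightarrow> ((\<lambda>n. bump (f n)) \<longlongrightarrow> 1) F"
  "filterlim f at_top F \<Longrightarrow> ((\<lambda>n. bump' (f n)) \<longlongrightarrow> 0) F"
proof -
  assume f: "filterlim f at_top F"
  then have ev: "eventually (\<lambda>n. f n > 0) F" by (auto simp: filterlim_at_top_dense)
  have inv: "((\<lambda>n. 1 / f n) \<longlongrightarrow> 0) F"
    using tendsto_inverse_0_at_top[OF f] by (simp add: divide_inverse)
  have "((\<lambda>n. exp (- (1 / f n))) \<longlongrightarrow> exp (- 0)) F"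
    by (intro tendsto_intros inv)
  moreover have "eventually (\<lambda>n. exp (- (1 / f n)) = bump (f n)) F"
    using ev by eventually_elim (simp add: bump_def)
  ultimately show "((\<lambda>n. bump (f n)) \<longlongrightarrow> 1) F"
    using Lim_transform_eventually by force
  have "((\<lambda>n. (1 / f n)\<^sup>2 * exp (- (1 / f n))) \<longlongrightarrow> 0\<^sup>2 * exp (- 0)) F"
    by (intro tendsto_intros inv)
  moreover have "eventually (\<lambda>n. (1 / f n)\<^sup>2 * exp (- (1 / f n)) = bump' (f n)) F"
    using ev by eventually_elim (simp add: bump'_def)
  ultimately show "((\<lambda>n. bump' (f n)) \<longlongrightarrow> 0) F"
    using Lim_transform_eventually by force
qed

text \<open>No plateau is built: the factors stay below 1 but tend to 1. Pointwise
  \<open>cutoff d n\<close> tends to 1 and \<open>cutoff'\<close> to 0, with bounds independent of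
  \<open>n\<close>; these are the ingredients of dominated convergence in
  \<open>divergence\<close>.\<close>

definition cutoff :: "nat \<Rightarrow> nat \<Rightarrow> vec \<Rightarrow> real" where
  "cutoff d n x = (\<Prod>i<d. bump (real n + x i) * bump (real n - x i))"

definition cutoff' :: "nat \<Rightarrow> nat \<Rightarrow> nat \<Rightarrow> vec \<Rightarrow> real" where
  "cutoff' d n i x = (bump' (real n + x i) * bump (real n - x i) - bump (real n + x i) * bump' (real n - x i))
     * (\<Prod>j\<in>{..<d} - {i}. bump (real n + x j) * bump (real n - x j))"

lemma smooth_cutoff: "smooth d (cutoff d n)"
proof -
  have "smooth d (\<lambda>x. \<Prod>i<d. bump (1 * x i + real n) * bump (-1 * x i + real n))"
    by (intro smooth_prod smooth_mult smooth_coordinate[OF smooth1_bump_affine]) auto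
  then show ?thesis by (simp add: cutoff_def[abs_def] add.commute)
qed

lemma cutoff_vanishes: "vanishes_outside d (real n) (cutoff d n)"
  unfolding vanishes_outside_def cutoff_def
proof (intro ballI impI)
  fix x assume "\<exists>i<d. real n < \<bar>x i\<bar>"
  then obtain i where "i < d" "bump (real n + x i) * bump (real n - x i) = 0"
    by (force simp: bump_def abs_if split: if_splits)
  then show "(\<Prod>i<d. bump (real n + x i) * bump (real n - x i)) = 0" by (auto intro!: prod_zero)
qed

lemma cutoff_bounds: "0 \<le> cutoff d n x" "cutoff d n x \<le> 1"
  unfolding cutoff_def by (auto intro!: prod_nonneg prod_le_1 mult_le_one bump_bounds mult_nonneg_nonneg)

lemma cutoff_has_partial:
  assumes "i < d" shows "has_partial d i (cutoff d n) (cutoff' d n i)"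
  unfolding has_partial_def
proof
  fix x :: vec assume "x \<in> Rd d"
  let ?P = "\<Prod>j\<in>{..<d} - {i}. bump (real n + x j) * bump (real n - x j)"
  have "cutoff d n (x(i := t)) = bump (real n + t) * bump (real n - t) * ?P" for t
    unfolding cutoff_def using assms
    by (subst prod.remove[of _ i]) (auto intro!: prod.cong)
  moreover have "((\<lambda>t. bump (real n + t) * bump (real n - t) * ?P) has_field_derivative cutoff' d n i x) (at (x i))"
    unfolding cutoff'_def
    by (rule derivative_eq_intros DERIV_chain'[OF _ bump_deriv] refl | simp)+
  ultimately show "((\<lambda>t. cutoff d n (x(i := t))) has_field_derivative cutoff' d n i x) (at (x i))" by simp
qed

lemma cutoff'_bound: "\<bar>cutoff' d n i x\<bar> \<le> 4"
proof -
  have "\<bar>bump' s * bump t\<bar> \<le> 2" for s t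
    using mult_mono[OF bump_bounds(3)[of s] bump_bounds(2)[of t]] bump_bounds[of t] by (simp add: abs_mult)
  from this[of "real n + x i" "real n - x i"] this[of "real n - x i" "real n + x i"]
  have "\<bar>bump' (real n + x i) * bump (real n - x i) - bump (real n + x i) * bump' (real n - x i)\<bar> \<le> 4"
    by (simp add: mult.commute)
  moreover have "\<bar>\<Prod>j\<in>{..<d} - {i}. bump (real n + x j) * bump (real n - x j)\<bar> \<le> 1"
    unfolding abs_prod by (intro prod_le_1) (auto simp: abs_mult intro!: mult_le_one bump_bounds simp: bump_bounds abs_of_nonneg)
  ultimately have "\<bar>bump' (real n + x i) * bump (real n - x i) - bump (real n + x i) * bump' (real n - x i)\<bar> *
      \<bar>\<Prod>j\<in>{..<d} - {i}. bump (real n + x j) * bump (real n - x j)\<bar> \<le> 4 * 1"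
    by (intro mult_mono) auto
  then show ?thesis by (simp add: cutoff'_def abs_mult)
qed

lemma cutoff_tendsto: "(\<lambda>n. cutoff d n x) \<longlonglongrightarrow> 1" and cutoff'_tendsto: "(\<lambda>n. cutoff' d n i x) \<longlonglongrightarrow> 0"
proof -
  have f: "filterlim (\<lambda>n. real n + x j) at_top sequentially" "filterlim (\<lambda>n. real n - x j) at_top sequentially" for j
    using filterlim_tendsto_add_at_top[OF tendsto_const filterlim_real_sequentially, of "x j"]
      filterlim_tendsto_add_at_top[OF tendsto_const filterlim_real_sequentially, of "- x j"]
    by (simp_all add: add.commute)
  have "(\<lambda>n. cutoff d n x) \<longlonglongrightarrow> (\<Prod>i<d. 1 * 1)"
    unfolding cutoff_def by (intro tendsto_intros bump_tendsto f)
  then show "(\<lambda>n. cutoff d n x) \<longlonglongrightarrow> 1" by simp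
  have "(\<lambda>n. cutoff' d n i x) \<longlonglongrightarrow> (0 * 1 - 1 * 0) * (\<Prod>j\<in>{..<d} - {i}. 1 * 1)"
    unfolding cutoff'_def by (intro tendsto_intros bump_tendsto f)
  then show "(\<lambda>n. cutoff' d n i x) \<longlonglongrightarrow> 0" by simp
qed

lemma cutoff_measurable [measurable]: "cutoff d n \<in> borel_measurable (Rd_leb d)"
  by (intro smooth_measurable smooth_cutoff)

lemma cutoff'_measurable: "i < d \<Longrightarrow> cutoff' d n i \<in> borel_measurable (Rd_leb d)"
  by (subst measurable_cong[OF has_partial_pd[OF cutoff_has_partial, symmetric]])
    (auto intro: smooth_measurable smooth_pd smooth_cutoff)

text \<open>The common property of smooth functions and of \<open>L2\<close> functions that makes
  their products with test functions integrable; \<open>divergence\<close> is applied to both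
  kinds.\<close>

definition locally_integrable :: "nat \<Rightarrow> (vec \<Rightarrow> real) \<Rightarrow> bool" where
  "locally_integrable d v \<longleftrightarrow> v \<in> borel_measurable (Rd_leb d) \<and>
     (\<forall>\<phi> r. continuous_map (Rd_top d) euclideanreal \<phi> \<longrightarrow> vanishes_outside d r \<phi> \<longrightarrow>
        integrable (Rd_leb d) (\<lambda>x. v x * \<phi> x))"

lemma locally_integrable_smooth: "smooth d v \<Longrightarrow> locally_integrable d v"
  unfolding locally_integrable_def
  by (auto intro: smooth_measurable integrable_vanishes_outside continuous_map_real_mult smooth_continuous vanishes_outside_mult)

lemma locally_integrable_L2:
  assumes [measurable]: "v \<in> borel_measurable (Rd_leb d)" and v: "integrable (Rd_leb d) (\<lambda>x. (v x)\<^sup>2)"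
  shows "locally_integrable d v"
  unfolding locally_integrable_def
proof (intro conjI allI impI)
  fix \<phi> r assume c: "continuous_map (Rd_top d) euclideanreal \<phi>" and z: "vanishes_outside d r \<phi>"
  have [measurable]: "\<phi> \<in> borel_measurable (Rd_leb d)" by (rule borel_measurable_continuous_map_Rd[OF c])
  have "integrable (Rd_leb d) (\<lambda>x. \<phi> x * \<phi> x)"
    by (intro integrable_vanishes_outside[where r=r] continuous_map_real_mult c vanishes_outside_mult z)
  with v have "integrable (Rd_leb d) (\<lambda>x. (v x)\<^sup>2 + \<phi> x * \<phi> x)" by simp
  then show "integrable (Rd_leb d) (\<lambda>x. v x * \<phi> x)"
  proof (rule Bochner_Integration.integrable_bound)
    have "\<bar>a * b\<bar> \<le> a\<^sup>2 + b * b" for a b :: real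
      using sum_squares_bound[of "\<bar>a\<bar>" "\<bar>b\<bar>"] abs_ge_zero[of "a * b"]
      unfolding abs_mult power2_eq_square abs_mult_self_eq by linarith
    then show "AE x in Rd_leb d. norm (v x * \<phi> x) \<le> norm ((v x)\<^sup>2 + \<phi> x * \<phi> x)"
      by (intro AE_I2) (simp add: abs_of_nonneg)
  qed measurable
qed fact

text \<open>The identity against test functions is extended to fields \<Phi> of unbounded support by
  testing with \<open>cutoff\<close> times \<Phi> and letting the cutoff tend to 1. Integrability is
  required of \<open>v\<close> times the whole divergence, not of its summands: in the applications
  the equation controls only the whole divergence.\<close>

theorem divergence:
  assumes tp: "test_pair d v g"
    and v: "locally_integrable d v" and g: "\<And>i. i < d \<Longrightarrow> g i \<in> borel_measurable (Rd_leb d)"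
    and \<Phi>: "\<And>i. i < d \<Longrightarrow> smooth d (\<Phi> i)"
    and int1: "\<And>i. i < d \<Longrightarrow> integrable (Rd_leb d) (\<lambda>x. v x * \<Phi> i x)"
    and int2: "\<And>i. i < d \<Longrightarrow> integrable (Rd_leb d) (\<lambda>x. g i x * \<Phi> i x)"
    and int3: "integrable (Rd_leb d) (\<lambda>x. v x * (\<Sum>i<d. partial_deriv i (\<Phi> i) x))"
  shows "(\<integral>x. v x * (\<Sum>i<d. partial_deriv i (\<Phi> i) x) \<partial>Rd_leb d) = - (\<Sum>i<d. \<integral>x. g i x * \<Phi> i x \<partial>Rd_leb d)"
proof -
  let ?M = "Rd_leb d"
  have [measurable]: "v \<in> borel_measurable ?M" using v by (simp add: locally_integrable_def)
  note [measurable] = g cutoff'_measurable smooth_measurable[OF \<Phi>] smooth_measurable[OF smooth_pd[OF \<Phi>]]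
  define L where "L n x = v x * (\<Sum>i<d. cutoff' d n i x * \<Phi> i x + cutoff d n x * partial_deriv i (\<Phi> i) x)" for n x
  have eq: "(\<integral>x. L n x \<partial>?M) = - (\<Sum>i<d. \<integral>x. g i x * (cutoff d n x * \<Phi> i x) \<partial>?M)" for n
  proof -
    have pd: "partial_deriv i (\<lambda>x. cutoff d n x * \<Phi> i x) x = cutoff' d n i x * \<Phi> i x + cutoff d n x * partial_deriv i (\<Phi> i) x"
      if "i < d" "x \<in> Rd d" for i x
      using has_partial_pd[OF has_partial_mult[OF cutoff_has_partial smooth_has_partial[OF \<Phi>]]] that by blast
    have s: "smooth d (\<lambda>x. cutoff d n x * \<Phi> i x)" if "i < d" for i
      using that by (intro smooth_mult smooth_cutoff \<Phi>)
    have z: "vanishes_outside d (real n) (\<lambda>x. cutoff d n x * \<Phi> i x)" for i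
      by (rule vanishes_outside_mult(2)[OF cutoff_vanishes])
    have int: "integrable ?M (\<lambda>x. v x * partial_deriv i (\<lambda>x. cutoff d n x * \<Phi> i x) x)" if "i < d" for i
      using v smooth_continuous[OF smooth_pd[OF s[OF that] that]]
        has_partial_vanishes_outside[OF smooth_has_partial[OF s[OF that] that] z that]
      unfolding locally_integrable_def by blast
    have "(\<integral>x. L n x \<partial>?M) = (\<integral>x. (\<Sum>i<d. v x * partial_deriv i (\<lambda>x. cutoff d n x * \<Phi> i x) x) \<partial>?M)"
      unfolding L_def by (intro Bochner_Integration.integral_cong refl) (simp add: pd sum_distrib_left)
    also have "\<dots> = (\<Sum>i<d. \<integral>x. v x * partial_deriv i (\<lambda>x. cutoff d n x * \<Phi> i x) x \<partial>?M)"
      by (intro Bochner_Integration.integral_sum) (auto intro: int)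
    also have "\<dots> = (\<Sum>i<d. - (\<integral>x. g i x * (cutoff d n x * \<Phi> i x) \<partial>?M))"
      using tp smooth_vanish_test[OF s z] unfolding test_pair_def by (intro sum.cong refl) simp
    finally show ?thesis by (simp add: sum_negf)
  qed
  have "(\<lambda>n. \<integral>x. L n x \<partial>?M) \<longlonglongrightarrow> (\<integral>x. v x * (\<Sum>i<d. partial_deriv i (\<Phi> i) x) \<partial>?M)"
  proof (rule integral_dominated_convergence)
    let ?w = "\<lambda>x. (\<Sum>i<d. 4 * \<bar>v x * \<Phi> i x\<bar>) + \<bar>v x * (\<Sum>i<d. partial_deriv i (\<Phi> i) x)\<bar>"
    show "integrable ?M ?w"
      by (intro Bochner_Integration.integrable_add Bochner_Integration.integrable_sum integrable_mult_right integrable_abs int1 int3) auto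
    show "AE x in ?M. (\<lambda>n. L n x) \<longlonglongrightarrow> v x * (\<Sum>i<d. partial_deriv i (\<Phi> i) x)"
    proof (rule AE_I2)
      fix x
      have "(\<lambda>n. L n x) \<longlonglongrightarrow> v x * (\<Sum>i<d. 0 * \<Phi> i x + 1 * partial_deriv i (\<Phi> i) x)"
        unfolding L_def by (intro tendsto_intros cutoff_tendsto cutoff'_tendsto)
      then show "(\<lambda>n. L n x) \<longlonglongrightarrow> v x * (\<Sum>i<d. partial_deriv i (\<Phi> i) x)" by simp
    qed
    show "AE x in ?M. norm (L n x) \<le> ?w x" for n
    proof (rule AE_I2)
      fix x
      \<comment> \<open>The terms with derivatives of \<Phi> are kept together, so that
        \<open>int3\<close> dominates them.\<close>
      have "L n x = (\<Sum>i<d. cutoff' d n i x * (v x * \<Phi> i x)) + cutoff d n x * (v x * (\<Sum>i<d. partial_deriv i (\<Phi> i) x))"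
        unfolding L_def by (simp add: sum.distrib sum_distrib_left algebra_simps)
      then have "\<bar>L n x\<bar> \<le> \<bar>\<Sum>i<d. cutoff' d n i x * (v x * \<Phi> i x)\<bar> + \<bar>cutoff d n x * (v x * (\<Sum>i<d. partial_deriv i (\<Phi> i) x))\<bar>"
        using abs_triangle_ineq by metis
      also have "\<dots> \<le> (\<Sum>i<d. \<bar>cutoff' d n i x * (v x * \<Phi> i x)\<bar>) + \<bar>cutoff d n x * (v x * (\<Sum>i<d. partial_deriv i (\<Phi> i) x))\<bar>"
        by (intro add_right_mono sum_abs)
      also have "\<dots> \<le> ?w x"
        unfolding abs_mult[of "cutoff' d n _ x"] abs_mult[of "cutoff d n x"]
        using cutoff_bounds[of d n x]
        by (intro add_mono sum_mono mult_right_mono cutoff'_bound mult_left_le_one_le) auto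
      finally show "norm (L n x) \<le> ?w x" by simp
    qed
    show "L n \<in> borel_measurable ?M" for n unfolding L_def by measurable
  qed measurable
  moreover have "(\<lambda>n. - (\<Sum>i<d. \<integral>x. g i x * (cutoff d n x * \<Phi> i x) \<partial>?M)) \<longlonglongrightarrow> - (\<Sum>i<d. \<integral>x. g i x * \<Phi> i x \<partial>?M)"
  proof (intro tendsto_minus tendsto_sum)
    fix i assume "i \<in> {..<d}"
    then have i: "i < d" by simp
    show "(\<lambda>n. \<integral>x. g i x * (cutoff d n x * \<Phi> i x) \<partial>?M) \<longlonglongrightarrow> (\<integral>x. g i x * \<Phi> i x \<partial>?M)"
    proof (rule integral_dominated_convergence)
      show "integrable ?M (\<lambda>x. \<bar>g i x * \<Phi> i x\<bar>)" using int2[OF i] by (rule integrable_abs)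
      show "AE x in ?M. (\<lambda>n. g i x * (cutoff d n x * \<Phi> i x)) \<longlonglongrightarrow> g i x * \<Phi> i x"
      proof (rule AE_I2)
        fix x
        have "(\<lambda>n. g i x * (cutoff d n x * \<Phi> i x)) \<longlonglongrightarrow> g i x * (1 * \<Phi> i x)"
          by (intro tendsto_intros cutoff_tendsto)
        then show "(\<lambda>n. g i x * (cutoff d n x * \<Phi> i x)) \<longlonglongrightarrow> g i x * \<Phi> i x" by simp
      qed
      show "AE x in ?M. norm (g i x * (cutoff d n x * \<Phi> i x)) \<le> \<bar>g i x * \<Phi> i x\<bar>" for n
      proof (rule AE_I2)
        fix x
        have "\<bar>g i x * (cutoff d n x * \<Phi> i x)\<bar> = cutoff d n x * \<bar>g i x * \<Phi> i x\<bar>"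
          using cutoff_bounds[of d n x] by (simp add: abs_mult)
        also have "\<dots> \<le> \<bar>g i x * \<Phi> i x\<bar>"
          using cutoff_bounds[of d n x] by (intro mult_left_le_one_le) auto
        finally show "norm (g i x * (cutoff d n x * \<Phi> i x)) \<le> \<bar>g i x * \<Phi> i x\<bar>" by simp
      qed
    qed (use i in measurable)
  qed
  ultimately show ?thesis unfolding eq using LIMSEQ_unique by blast
qed

section \<open>Sobolev functions and uniqueness of weak gradients\<close>

abbreviation obox :: "nat \<Rightarrow> vec \<Rightarrow> vec \<Rightarrow> vec set" where
  "obox d p q \<equiv> \<Pi>\<^sub>E i\<in>{..<d}. {p i<..<q i}"

abbreviation cbox' :: "nat \<Rightarrow> vec \<Rightarrow> vec \<Rightarrow> vec set" where
  "cbox' d p q \<equiv> \<Pi>\<^sub>E i\<in>{..<d}. {p i..q i}"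

lemma sets_obox [measurable]: "obox d p q \<in> sets (Rd_leb d)"
  by (intro sets_PiM_I_finite) auto

lemma obox_UN: "(\<Union>n. obox d (\<lambda>_. - real n) (\<lambda>_. real n)) = Rd d"
proof
  show "Rd d \<subseteq> (\<Union>n. obox d (\<lambda>_. - real n) (\<lambda>_. real n))"
  proof
    fix x assume x: "x \<in> Rd d"
    obtain n :: nat where n: "(\<Sum>i<d. \<bar>x i\<bar>) < real n" using reals_Archimedean2 by blast
    have "- real n < x i \<and> x i < real n" if "i < d" for i
      using member_le_sum[of i "{..<d}" "\<lambda>i. \<bar>x i\<bar>"] that n by auto
    then have "x \<in> obox d (\<lambda>_. - real n) (\<lambda>_. real n)"
      using x by (auto simp: PiE_iff)
    then show "x \<in> (\<Union>n. obox d (\<lambda>_. - real n) (\<lambda>_. real n))" by blast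
  qed
qed (auto simp: PiE_iff)

text \<open>A half-space is the countable union of boxes whose other sides grow to infinity.\<close>

lemma sets_Rd_leb_obox: "sets (Rd_leb d) = sigma_sets (Rd d) (range (\<lambda>(p, q). obox d p q))"
proof
  let ?E = "range (\<lambda>(p, q). obox d p q)"
  show "sigma_sets (Rd d) ?E \<subseteq> sets (Rd_leb d)"
  proof -
    have "?E \<subseteq> sets (Rd_leb d)" by (rule image_subsetI) (simp add: case_prod_beta sets_obox)
    from sets.sigma_sets_subset[OF this] show ?thesis by simp
  qed
  have E: "?E \<subseteq> Pow (Rd d)" by (auto simp: PiE_iff)
  let ?N = "sigma (Rd d) ?E"
  have sp: "space ?N = Rd d" using E by (rule space_measure_of)
  have st: "sets ?N = sigma_sets (Rd d) ?E" using E by (rule sets_measure_of)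
  have "(\<lambda>x i. x i) \<in> ?N \<rightarrow>\<^sub>M Rd_leb d"
  proof (rule measurable_PiM_single')
    fix i assume "i \<in> {..<d}"
    then have i: "i < d" by simp
    have "(\<lambda>x. x i) \<in> borel_measurable ?N"
      unfolding borel_measurable_iff_less sp
    proof
      fix a
      have "{x \<in> Rd d. x i < a} = (\<Union>n. obox d (\<lambda>_. - real n) (\<lambda>j. if j = i then a else real n))"
      proof (intro equalityI subsetI)
        fix x assume x: "x \<in> {x \<in> Rd d. x i < a}"
        then have "x \<in> (\<Union>n. obox d (\<lambda>_. - real n) (\<lambda>_. real n))" unfolding obox_UN by simp
        then obtain n where "x \<in> obox d (\<lambda>_. - real n) (\<lambda>_. real n)" by blast
        then have "x \<in> obox d (\<lambda>_. - real n) (\<lambda>j. if j = i then a else real n)"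
          using x by (auto simp: PiE_iff)
        then show "x \<in> (\<Union>n. obox d (\<lambda>_. - real n) (\<lambda>j. if j = i then a else real n))" by blast
      qed (use i in \<open>auto simp: PiE_iff dest!: bspec[of _ _ i]\<close>)
      also have "\<dots> \<in> sets ?N"
      proof (intro sets.countable_UN image_subsetI)
        fix n :: nat
        have "obox d (\<lambda>_. - real n) (\<lambda>j. if j = i then a else real n) \<in> ?E" by force
        then show "obox d (\<lambda>_. - real n) (\<lambda>j. if j = i then a else real n) \<in> sets ?N"
          unfolding st by (rule sigma_sets.Basic)
      qed
      finally show "{x \<in> Rd d. x i < a} \<in> sets ?N" .
    qed
    then show "(\<lambda>x. x i) \<in> ?N \<rightarrow>\<^sub>M lborel" by simp
  qed (auto simp: sp)
  show "sets (Rd_leb d) \<subseteq> sigma_sets (Rd d) ?E"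
  proof
    fix A assume A: "A \<in> sets (Rd_leb d)"
    from measurable_sets[OF \<open>(\<lambda>x i. x i) \<in> ?N \<rightarrow>\<^sub>M Rd_leb d\<close> A]
    have "(\<lambda>x i. x i) -` A \<inter> Rd d \<in> sigma_sets (Rd d) ?E" unfolding sp st .
    moreover have "(\<lambda>x i. x i) -` A \<inter> Rd d = A"
      using sets.sets_into_space[OF A] by auto
    ultimately show "A \<in> sigma_sets (Rd d) ?E" by simp
  qed
qed

lemma obox_Int: "obox d p q \<inter> obox d a b = obox d (\<lambda>i. max (p i) (a i)) (\<lambda>i. min (q i) (b i))"
  unfolding PiE_Int by (rule PiE_cong) auto

text \<open>The positive and the negative part of \<open>h\<close> are densities of two measures
  that agree on open boxes, an intersection-stable generator, and hence everywhere.\<close>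

lemma obox_integrals_zero_AE:
  fixes h :: "vec \<Rightarrow> real"
  assumes h: "integrable (Rd_leb d) h"
    and z: "\<And>p q. (\<integral>x. h x * indicator (obox d p q) x \<partial>Rd_leb d) = 0"
  shows "AE x in Rd_leb d. h x = 0"
proof -
  let ?M = "Rd_leb d"
  have [measurable]: "h \<in> borel_measurable ?M" using h by auto
  interpret M: sigma_finite_measure ?M by (rule sigma_finite_Rd_leb)
  have fin: "(\<integral>\<^sup>+x. ennreal (s * h x) * indicator A x \<partial>?M) \<noteq> \<infinity>" if "\<bar>s\<bar> = 1" for s A
  proof -
    have "(\<integral>\<^sup>+x. ennreal (s * h x) * indicator A x \<partial>?M) \<le> (\<integral>\<^sup>+x. ennreal (norm (h x)) \<partial>?M)"
    proof (intro nn_integral_mono)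
      fix x
      have "s * h x \<le> \<bar>h x\<bar>" using that by (metis abs_ge_self abs_mult mult_1)
      then have "ennreal (s * h x) \<le> ennreal (norm (h x))" by (intro ennreal_leI) simp
      then show "ennreal (s * h x) * indicator A x \<le> ennreal (norm (h x))"
        by (auto simp: indicator_def)
    qed
    also have "\<dots> < \<infinity>" using h by (simp add: integrable_iff_bounded)
    finally show ?thesis by simp
  qed
  have "density ?M (\<lambda>x. ennreal (h x)) = density ?M (\<lambda>x. ennreal (- h x))"
  proof (rule measure_eqI_generator_eq[where E="range (\<lambda>(p, q). obox d p q)" and \<Omega>="Rd d"
        and A="\<lambda>n. obox d (\<lambda>_. - real n) (\<lambda>_. real n)"])
    show "Int_stable (range (\<lambda>(p, q). obox d p q))"
      unfolding Int_stable_def by (clarsimp simp: obox_Int) force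
    fix X assume "X \<in> range (\<lambda>(p, q). obox d p q)"
    then obtain p q where X: "X = obox d p q" by auto
    have "integrable ?M (\<lambda>x. h x * indicator X x)"
      using h unfolding X by (intro integrable_real_mult_indicator) auto
    from real_lebesgue_integral_def[OF this] z[of p q]
    have "enn2real (\<integral>\<^sup>+x. ennreal (h x * indicator X x) \<partial>?M) = enn2real (\<integral>\<^sup>+x. ennreal (- (h x * indicator X x)) \<partial>?M)"
      unfolding X by simp
    also have "(\<lambda>x. ennreal (h x * indicator X x)) = (\<lambda>x. ennreal (h x) * indicator X x)"
      by (auto simp: indicator_def)
    also have "(\<lambda>x. ennreal (- (h x * indicator X x))) = (\<lambda>x. ennreal (- h x) * indicator X x)"
      by (auto simp: indicator_def)
    finally have e: "enn2real (\<integral>\<^sup>+x. ennreal (h x) * indicator X x \<partial>?M) = enn2real (\<integral>\<^sup>+x. ennreal (- h x) * indicator X x \<partial>?M)" .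
    have "(\<integral>\<^sup>+x. ennreal (h x) * indicator X x \<partial>?M) < \<top>" "(\<integral>\<^sup>+x. ennreal (- h x) * indicator X x \<partial>?M) < \<top>"
      using fin[of 1 X] fin[of "-1" X] by (simp_all add: top.not_eq_extremum)
    with e have "(\<integral>\<^sup>+x. ennreal (h x) * indicator X x \<partial>?M) = (\<integral>\<^sup>+x. ennreal (- h x) * indicator X x \<partial>?M)"
      by (metis ennreal_enn2real)
    then show "emeasure (density ?M (\<lambda>x. ennreal (h x))) X = emeasure (density ?M (\<lambda>x. ennreal (- h x))) X"
      unfolding X by (subst (1 2) emeasure_density) auto
  next
    fix n
    show "emeasure (density ?M (\<lambda>x. ennreal (h x))) (obox d (\<lambda>_. - real n) (\<lambda>_. real n)) \<noteq> \<infinity>"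
      using fin[of 1 "obox d (\<lambda>_. - real n) (\<lambda>_. real n)"] by (subst emeasure_density) auto
  qed (auto simp: sets_Rd_leb_obox PiE_iff obox_UN)
  \<comment> \<open>\<open>ennreal\<close> sends negative numbers to 0, so this equates the positive
    with the negative part, one of which vanishes at each point.\<close>
  then have "AE x in ?M. ennreal (h x) = ennreal (- h x)"
    by (intro M.density_unique) auto
  then show ?thesis
  proof eventually_elim
    case (elim x)
    then show ?case by (metis ennreal_neg ennreal_eq_zero_iff linorder_linear neg_0_le_iff_le neg_le_0_iff_le antisym)
  qed
qed

lemma abs_mult_le_squares: "\<bar>a * b\<bar> \<le> a\<^sup>2 + (b::real)\<^sup>2"
  using sum_squares_bound[of "\<bar>a\<bar>" "\<bar>b\<bar>"] abs_ge_zero[of "a * b"]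
  unfolding abs_mult power2_abs by linarith

text \<open>The fundamental lemma of the calculus of variations. On a closed box inside
  \<open>U\<close>, products of bumps converge boundedly to indicators of open sub-boxes, which
  reduces the claim to \<open>obox_integrals_zero_AE\<close>; countably many boxes with rational
  corners cover \<open>U\<close>.\<close>

lemma test_zero_AE:
  fixes f :: "vec \<Rightarrow> real"
  assumes U: "openin (Rd_top d) U"
    and f: "\<And>a b. cbox' d a b \<subseteq> U \<Longrightarrow> integrable (Rd_leb d) (\<lambda>x. indicator (cbox' d a b) x * f x)"
    and z: "\<And>\<phi>. \<phi> \<in> test_functions d U \<Longrightarrow> (\<integral>x. indicator U x * (f x * \<phi> x) \<partial>Rd_leb d) = 0"
  shows "AE x in Rd_leb d. x \<in> U \<longrightarrow> f x = 0"
proof -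
  let ?M = "Rd_leb d"
  have box: "AE x in ?M. x \<in> obox d a b \<longrightarrow> f x = 0" if ab: "cbox' d a b \<subseteq> U" for a b
  proof -
    \<comment> \<open>\<open>f\<close> is integrable only on boxes inside \<open>U\<close>; cutting
      it off makes it integrable on the whole space.\<close>
    define G where "G x = indicator (cbox' d a b) x * f x" for x
    have G: "integrable ?M G" unfolding G_def by (rule f[OF ab])
    then have [measurable]: "G \<in> borel_measurable ?M" by auto
    have "AE x in ?M. G x * indicator (obox d a b) x = 0"
    proof (rule obox_integrals_zero_AE)
      show "integrable ?M (\<lambda>x. G x * indicator (obox d a b) x)"
        using G by (intro integrable_real_mult_indicator) auto
    next
      fix p q
      \<comment> \<open>The corners of the intersection of the box from \<open>p\<close> to
        \<open>q\<close> with the box from \<open>a\<close> to \<open>b\<close>: the support of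
        \<phi> has to stay inside \<open>U\<close>.\<close>
      define P where "P i = max (p i) (a i)" for i
      define Q where "Q i = min (q i) (b i)" for i
      \<comment> \<open>The factor \<open>n\<close> steepens the bumps, so that each tends to 1
        strictly inside the box while the value outside stays 0.\<close>
      define \<phi> where "\<phi> n x = (\<Prod>i<d. bump (real n * (x i - P i)) * bump (real n * (Q i - x i)))" for n x
      have s: "smooth d (\<phi> n)" for n
      proof -
        have "smooth d (\<lambda>x. \<Prod>i<d. bump (real n * x i + (- (real n * P i))) * bump (- real n * x i + real n * Q i))"
          by (intro smooth_prod smooth_mult smooth_coordinate[OF smooth1_bump_affine]) auto
        then show ?thesis by (simp add: \<phi>_def[abs_def] algebra_simps)
      qed
      have PQ: "cbox' d P Q \<subseteq> cbox' d a b" by (intro PiE_mono) (auto simp: P_def Q_def)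
      have bounds: "0 \<le> \<phi> n x" "\<phi> n x \<le> 1" for n x
        unfolding \<phi>_def by (auto intro!: prod_nonneg prod_le_1 mult_le_one bump_bounds mult_nonneg_nonneg)
      have zero: "\<phi> n x = 0" if "i < d" "x i \<le> P i \<or> Q i \<le> x i" for n x i
      proof -
        have "real n * (x i - P i) \<le> 0 \<or> real n * (Q i - x i) \<le> 0"
          using that by (auto intro!: mult_nonneg_nonpos)
        then have "bump (real n * (x i - P i)) * bump (real n * (Q i - x i)) = 0"
          by (auto simp: bump_def)
        then show ?thesis unfolding \<phi>_def using that(1) by (intro prod_zero) auto
      qed
      have out: "\<phi> n x = 0" if x: "x \<in> Rd d" "x \<notin> cbox' d P Q" for n x
      proof -
        obtain i where "i < d" "x i \<notin> {P i..Q i}" using x by (auto simp: PiE_iff)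
        then show ?thesis by (intro zero[of i]) auto
      qed
      have test: "\<phi> n \<in> test_functions d U" for n
      proof -
        have "cbox' d P Q \<subseteq> U" using PQ ab by (rule order_trans)
        then show ?thesis
          using s[of n] out compactin_Rd_box[of d P Q] unfolding test_functions_def smooth_def by blast
      qed
      have [measurable]: "\<phi> n \<in> borel_measurable ?M" for n by (rule smooth_measurable[OF s])
      have "(\<integral>x. G x * \<phi> n x \<partial>?M) = 0" for n
      proof -
        have "(\<integral>x. G x * \<phi> n x \<partial>?M) = (\<integral>x. indicator U x * (f x * \<phi> n x) \<partial>?M)"
        proof (rule Bochner_Integration.integral_cong[OF refl])
          fix x assume "x \<in> space ?M"
          then have x: "x \<in> Rd d" by simp
          show "G x * \<phi> n x = indicator U x * (f x * \<phi> n x)"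
          proof (cases "x \<in> cbox' d P Q")
            case True
            have "x \<in> cbox' d a b" by (rule subsetD[OF PQ True])
            then have "indicator (cbox' d a b) x = (1::real)" "indicator U x = (1::real)"
              using subsetD[OF ab] by (simp_all only: indicator_simps)
            then show ?thesis unfolding G_def by simp
          next
            case False
            then show ?thesis using out[OF x] by simp
          qed
        qed
        then show ?thesis using z[OF test] by simp
      qed
      moreover have "(\<lambda>n. \<integral>x. G x * \<phi> n x \<partial>?M) \<longlonglongrightarrow> (\<integral>x. G x * indicator (obox d P Q) x \<partial>?M)"
      proof (rule integral_dominated_convergence)
        show "integrable ?M (\<lambda>x. \<bar>G x\<bar>)" using G by (rule integrable_abs)
        show "AE x in ?M. norm (G x * \<phi> n x) \<le> \<bar>G x\<bar>" for n
          using bounds[of n] by (intro AE_I2) (auto simp: abs_mult intro!: mult_left_le)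
        show "AE x in ?M. (\<lambda>n. G x * \<phi> n x) \<longlonglongrightarrow> G x * indicator (obox d P Q) x"
        proof (rule AE_I2, intro tendsto_mult tendsto_const)
          fix x assume "x \<in> space ?M"
          then have x: "x \<in> Rd d" by simp
          show "(\<lambda>n. \<phi> n x) \<longlonglongrightarrow> indicator (obox d P Q) x"
          proof (cases "x \<in> obox d P Q")
            case True
            have f: "filterlim (\<lambda>n. real n * c) at_top sequentially" if "0 < c" for c
              using filterlim_at_top_mult_tendsto_pos[OF tendsto_const that filterlim_real_sequentially]
              by simp
            have pos: "0 < x i - P i" "0 < Q i - x i" if "i < d" for i
              using True that by (auto simp: PiE_iff)
            have "(\<lambda>n. \<phi> n x) \<longlonglongrightarrow> (\<Prod>i<d. 1 * 1)"
              unfolding \<phi>_def by (intro tendsto_intros bump_tendsto f pos) auto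
            then show ?thesis using True by simp
          next
            case False
            then obtain i where "i < d" "x i \<le> P i \<or> Q i \<le> x i"
              using x by (auto simp: PiE_iff not_less)
            then have "\<phi> n x = 0" for n by (rule zero)
            then show ?thesis using False by simp
          qed
        qed
      qed measurable
      ultimately have "(\<integral>x. G x * indicator (obox d P Q) x \<partial>?M) = 0"
        by (simp add: LIMSEQ_const_iff)
      moreover have "obox d P Q = obox d a b \<inter> obox d p q"
        unfolding P_def Q_def using obox_Int[of d p q a b] by (simp add: Int_commute)
      ultimately show "(\<integral>x. G x * indicator (obox d a b) x * indicator (obox d p q) x \<partial>?M) = 0"
        by (simp add: indicator_inter_arith mult.assoc)
    qed
    moreover have "obox d a b \<subseteq> cbox' d a b" by (intro PiE_mono) auto
    ultimately show ?thesis
      by (elim eventually_mono) (auto simp: G_def indicator_def split: if_splits)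
  qed
  let ?Q = "\<Pi>\<^sub>E i\<in>{..<d}. \<rat>"
  let ?C = "{(a, b) \<in> ?Q \<times> ?Q. cbox' d a b \<subseteq> U}"
  have "countable ?C"
    by (rule countable_subset[of _ "?Q \<times> ?Q"]) (auto intro!: countable_SIGMA countable_PiE countable_rat)
  then have ae: "AE x in ?M. \<forall>y\<in>?C. x \<in> obox d (fst y) (snd y) \<longrightarrow> f x = 0"
    by (subst AE_ball_countable) (use box in auto)
  have ex: "\<exists>y\<in>?C. x \<in> obox d (fst y) (snd y)" if x: "x \<in> U" for x
  proof -
    obtain V where V: "\<And>i. i < d \<Longrightarrow> open (V i)" "x \<in> Pi\<^sub>E {..<d} V" "Pi\<^sub>E {..<d} V \<subseteq> U"
    proof -
      have "\<exists>V. finite {i \<in> {..<d}. V i \<noteq> topspace euclideanreal} \<and> (\<forall>i\<in>{..<d}. openin euclideanreal (V i)) \<and>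
          x \<in> Pi\<^sub>E {..<d} V \<and> Pi\<^sub>E {..<d} V \<subseteq> U"
        using U x unfolding openin_product_topology_alt by (rule bspec)
      then show thesis using that by (metis lessThan_iff open_openin)
    qed
    have "\<exists>a b. a \<in> \<rat> \<and> b \<in> \<rat> \<and> a < x i \<and> x i < b \<and> {a..b} \<subseteq> V i" if i: "i < d" for i
    proof -
      have "x i \<in> V i" using V(2) i by auto
      then obtain e where e: "0 < e" "cball (x i) e \<subseteq> V i"
        using V(1)[OF i] open_contains_cball by blast
      obtain a where a: "a \<in> \<rat>" "x i - e < a" "a < x i" using Rats_dense_in_real[of "x i - e" "x i"] e by auto
      obtain b where b: "b \<in> \<rat>" "x i < b" "b < x i + e" using Rats_dense_in_real[of "x i" "x i + e"] e by auto
      have "{a..b} \<subseteq> cball (x i) e" using a b by (auto simp: dist_real_def)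
      then show ?thesis using a b e by blast
    qed
    then obtain a b where ab: "\<And>i. i < d \<Longrightarrow> a i \<in> \<rat> \<and> b i \<in> \<rat> \<and> a i < x i \<and> x i < b i \<and> {a i..b i} \<subseteq> V i"
      by metis
    have "x \<in> Rd d" using V(2) by (auto simp: PiE_iff)
    \<comment> \<open>Restricted corners belong to the countable set \<open>?Q\<close>, in which
      functions are fixed outside \<open>{..<d}\<close>.\<close>
    have "cbox' d (restrict a {..<d}) (restrict b {..<d}) \<subseteq> Pi\<^sub>E {..<d} V"
      by (intro PiE_mono) (use ab in auto)
    then have "(restrict a {..<d}, restrict b {..<d}) \<in> ?C" using V(3) ab by auto
    moreover have "x \<in> obox d (restrict a {..<d}) (restrict b {..<d})"
      using ab \<open>x \<in> Rd d\<close> by (auto simp: PiE_iff)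
    ultimately show ?thesis by (intro bexI[of _ "(restrict a {..<d}, restrict b {..<d})"]) simp_all
  qed
  show ?thesis
    using ae
  proof (rule eventually_mono, intro impI)
    fix x assume all: "\<forall>y\<in>?C. x \<in> obox d (fst y) (snd y) \<longrightarrow> f x = 0" and "x \<in> U"
    obtain y where y: "y \<in> ?C" "x \<in> obox d (fst y) (snd y)" using ex[OF \<open>x \<in> U\<close>] by (rule bexE)
    show "f x = 0" by (rule bspec[OF all y(1), THEN mp, OF y(2)])
  qed
qed

section \<open>Square integrable functions on subsets\<close>

lemma LINT_Rd: "(LINT x:Rd d|Rd_leb d. f x) = (\<integral>x. f x \<partial>Rd_leb d)" for f :: "vec \<Rightarrow> real"
  unfolding set_lebesgue_integral_def by (rule Bochner_Integration.integral_cong) auto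

lemma set_borel_measurable_Rd: "set_borel_measurable (Rd_leb d) (Rd d) f \<longleftrightarrow> f \<in> borel_measurable (Rd_leb d)"
  for f :: "vec \<Rightarrow> real"
  unfolding set_borel_measurable_def by (rule measurable_cong) auto

lemma L2_Rd: "u \<in> L2 d (Rd d) \<longleftrightarrow> u \<in> borel_measurable (Rd_leb d) \<and> integrable (Rd_leb d) (\<lambda>x. (u x)\<^sup>2)"
proof -
  have "integrable (Rd_leb d) (\<lambda>x. indicator (Rd d) x *\<^sub>R (u x)\<^sup>2) \<longleftrightarrow> integrable (Rd_leb d) (\<lambda>x. (u x)\<^sup>2)"
    by (rule Bochner_Integration.integrable_cong) auto
  then show ?thesis by (simp add: L2_def set_borel_measurable_Rd set_integrable_def)
qed

lemma L2_iff:
  assumes "U \<in> sets (Rd_leb d)"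
  shows "u \<in> L2 d U \<longleftrightarrow> (\<lambda>x. indicator U x * u x) \<in> L2 d (Rd d)"
proof -
  have "(\<lambda>x. (indicator U x * u x)\<^sup>2) = (\<lambda>x. indicator U x * (u x)\<^sup>2)" by (auto simp: indicator_def)
  then show ?thesis unfolding L2_Rd by (simp add: L2_def set_borel_measurable_def set_integrable_def)
qed

lemma L2_mult_integrable:
  assumes "u \<in> L2 d (Rd d)" "v \<in> L2 d (Rd d)"
  shows "integrable (Rd_leb d) (\<lambda>x. u x * v x)"
proof -
  have [measurable]: "u \<in> borel_measurable (Rd_leb d)" "v \<in> borel_measurable (Rd_leb d)" using assms by (auto simp: L2_Rd)
  have "integrable (Rd_leb d) (\<lambda>x. (u x)\<^sup>2 + (v x)\<^sup>2)" using assms by (auto simp: L2_Rd)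
  then show ?thesis
    by (rule Bochner_Integration.integrable_bound) (auto intro!: AE_I2 simp: abs_mult_le_squares)
qed

lemma L2_lincomb_Rd:
  assumes "u \<in> L2 d (Rd d)" "v \<in> L2 d (Rd d)"
  shows "(\<lambda>x. a * u x + b * v x) \<in> L2 d (Rd d)"
proof -
  have "integrable (Rd_leb d) (\<lambda>x. a\<^sup>2 * (u x)\<^sup>2 + 2 * a * b * (u x * v x) + b\<^sup>2 * (v x)\<^sup>2)"
    using assms L2_mult_integrable[OF assms] by (auto simp: L2_Rd)
  moreover have "a\<^sup>2 * (u x)\<^sup>2 + 2 * a * b * (u x * v x) + b\<^sup>2 * (v x)\<^sup>2 = (a * u x + b * v x)\<^sup>2" for x
    by (simp add: power2_eq_square algebra_simps)
  ultimately show ?thesis using assms by (auto simp: L2_Rd)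
qed

lemma L2_lincomb:
  assumes "U \<in> sets (Rd_leb d)" "u \<in> L2 d U" "v \<in> L2 d U"
  shows "(\<lambda>x. a * u x + b * v x) \<in> L2 d U"
  using L2_lincomb_Rd[of "\<lambda>x. indicator U x * u x" d "\<lambda>x. indicator U x * v x" a b] assms
  by (simp add: L2_iff[OF assms(1)] algebra_simps)

lemma L2_mono:
  assumes "U \<in> sets (Rd_leb d)" "u \<in> L2 d (Rd d)"
  shows "u \<in> L2 d U"
proof -
  have "integrable (Rd_leb d) (\<lambda>x. (u x)\<^sup>2 * indicator U x)"
    using assms by (intro integrable_real_mult_indicator) (auto simp: L2_Rd)
  moreover have "(u x)\<^sup>2 * indicator U x = (indicator U x * u x)\<^sup>2" for x by (simp add: indicator_def)
  moreover have "(\<lambda>x. indicator U x * u x) \<in> borel_measurable (Rd_leb d)"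
    using assms by (intro borel_measurable_times borel_measurable_indicator) (simp_all add: L2_Rd)
  ultimately show ?thesis unfolding L2_iff[OF assms(1), of u] L2_Rd by simp
qed

lemma L2_bounded:
  assumes U: "U \<in> sets (Rd_leb d)" "emeasure (Rd_leb d) U < \<infinity>"
    and u: "u \<in> borel_measurable (Rd_leb d)" "\<And>x. x \<in> Rd d \<Longrightarrow> \<bar>u x\<bar> \<le> C"
  shows "u \<in> L2 d U"
proof -
  have "integrable (Rd_leb d) (\<lambda>x. (indicator U x * u x)\<^sup>2)"
  proof (rule integrableI_bounded_set[where A=U and B="C\<^sup>2"])
    show "AE x in Rd_leb d. x \<in> U \<longrightarrow> norm ((indicator U x * u x)\<^sup>2) \<le> C\<^sup>2"
    proof (intro AE_I2 impI)
      fix x assume "x \<in> space (Rd_leb d)" "x \<in> U"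
      then have "\<bar>u x\<bar>\<^sup>2 \<le> C\<^sup>2" using u(2)[of x] by (intro power_mono) auto
      then show "norm ((indicator U x * u x)\<^sup>2) \<le> C\<^sup>2" using \<open>x \<in> U\<close> by simp
    qed
  qed (use U u in auto)
  moreover have "(\<lambda>x. indicator U x * u x) \<in> borel_measurable (Rd_leb d)"
    using U u by (intro borel_measurable_times borel_measurable_indicator) simp_all
  ultimately show ?thesis unfolding L2_iff[OF U(1), of u] L2_Rd by simp
qed

lemma L2_indicator:
  assumes "B \<in> sets (Rd_leb d)" "emeasure (Rd_leb d) B < \<infinity>"
  shows "(\<lambda>x. indicator B x) \<in> L2 d (Rd d)"
proof -
  have "(\<lambda>x. (indicator B x)\<^sup>2) = (indicator B :: vec \<Rightarrow> real)" by (auto simp: indicator_def)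
  then show ?thesis using assms by (simp add: L2_Rd)
qed

lemma L2_test_integrable:
  assumes "v \<in> L2 d (Rd d)" "smooth d \<phi>" "vanishes_outside d r \<phi>"
  shows "integrable (Rd_leb d) (\<lambda>x. v x * \<phi> x)"
proof -
  have "locally_integrable d v" using assms(1) locally_integrable_L2 by (simp add: L2_Rd)
  then show ?thesis using assms smooth_continuous[OF assms(2)] unfolding locally_integrable_def by blast
qed

section \<open>Weak gradients: restriction, uniqueness, linearity\<close>

lemma test_functions_mono: "U \<subseteq> V \<Longrightarrow> test_functions d U \<subseteq> test_functions d V"
  unfolding test_functions_def by blast

text \<open>The set \<open>K\<close>, compact in a Hausdorff space, is closed. So around a point
  outside \<open>U\<close>, even a boundary point, the function vanishes identically and its
  derivative with it.\<close>

lemma test_function_outside: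
  assumes \<phi>: "\<phi> \<in> test_functions d U" and x: "x \<in> Rd d - U" and i: "i < d"
  shows "\<phi> x = 0" "partial_deriv i \<phi> x = 0"
proof -
  obtain K where K: "compactin (Rd_top d) K" "K \<subseteq> U" "\<forall>x\<in>Rd d - K. \<phi> x = 0"
    using \<phi> by (auto simp: test_functions_def)
  show "\<phi> x = 0" using K x by auto
  have "Hausdorff_space (Rd_top d)" by (simp add: Hausdorff_space_product_topology)
  then have "closedin (Rd_top d) K" using K(1) compactin_imp_closedin by blast
  then have op: "openin (Rd_top d) (Rd d - K)" by (simp add: closedin_def)
  have "continuous_map euclideanreal (Rd_top d) (\<lambda>t. x(i := t))"
    using x i fun_upd_Rd[of x d i] by (subst continuous_map_componentwise) (auto simp: PiE_def)
  from openin_continuous_map_preimage[OF this op]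
  have "open {t. x(i := t) \<in> Rd d - K}" by simp
  moreover have "x i \<in> {t. x(i := t) \<in> Rd d - K}" using x K(2) by auto
  ultimately have "eventually (\<lambda>t. x(i := t) \<in> Rd d - K) (nhds (x i))"
    using eventually_nhds by blast
  then have "eventually (\<lambda>t. \<phi> (x(i := t)) = 0) (nhds (x i))"
    by eventually_elim (use K(3) in blast)
  then have "((\<lambda>t. \<phi> (x(i := t))) has_field_derivative 0) (at (x i))"
    by (subst DERIV_cong_ev[OF refl _ refl, of _ "\<lambda>_. 0"]) auto
  then show "partial_deriv i \<phi> x = 0" unfolding partial_deriv_def by (rule DERIV_imp_deriv)
qed

lemma test_pair_restrict:
  assumes tp: "test_pair d v g" and U: "U \<subseteq> Rd d" and i: "i < d" and \<phi>: "\<phi> \<in> test_functions d U"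
  shows "(LINT x:U|Rd_leb d. v x * partial_deriv i \<phi> x) = - (LINT x:U|Rd_leb d. g i x * \<phi> x)"
proof -
  have "(LINT x:U|Rd_leb d. v x * partial_deriv i \<phi> x) = (\<integral>x. v x * partial_deriv i \<phi> x \<partial>Rd_leb d)"
    unfolding set_lebesgue_integral_def
    by (rule Bochner_Integration.integral_cong) (use test_function_outside[OF \<phi> _ i] in \<open>auto simp: indicator_def\<close>)
  also have "\<dots> = - (\<integral>x. g i x * \<phi> x \<partial>Rd_leb d)"
    using tp i \<phi> test_functions_mono[OF U] unfolding test_pair_def by blast
  also have "(\<integral>x. g i x * \<phi> x \<partial>Rd_leb d) = (LINT x:U|Rd_leb d. g i x * \<phi> x)"
    unfolding set_lebesgue_integral_def
    by (rule Bochner_Integration.integral_cong) (use test_function_outside[OF \<phi> _ i] in \<open>auto simp: indicator_def\<close>)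
  finally show ?thesis .
qed

lemma is_weak_grad_Rd: "is_weak_grad d (Rd d) u g \<longleftrightarrow> (\<forall>i<d. g i \<in> L2 d (Rd d)) \<and> test_pair d u g"
  unfolding is_weak_grad_def test_pair_def LINT_Rd imp_conjR all_conj_distrib ..

lemma is_weak_gradD:
  assumes "is_weak_grad d U u g" "i < d"
  shows "g i \<in> L2 d U"
    and "\<phi> \<in> test_functions d U \<Longrightarrow>
      (LINT x:U|Rd_leb d. u x * partial_deriv i \<phi> x) = - (LINT x:U|Rd_leb d. g i x * \<phi> x)"
  using assms by (simp_all add: is_weak_grad_def)

lemma is_weak_grad_unique:
  assumes U: "openin (Rd_top d) U" and g: "is_weak_grad d U u g" and g': "is_weak_grad d U u g'" and i: "i < d"
  shows "AE x in Rd_leb d. x \<in> U \<longrightarrow> g i x = g' i x"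
proof -
  let ?M = "Rd_leb d"
  have Um [measurable]: "U \<in> sets ?M" by (rule openin_Rd_sets[OF U])
  have L2: "(\<lambda>x. indicator U x * g i x) \<in> L2 d (Rd d)" "(\<lambda>x. indicator U x * g' i x) \<in> L2 d (Rd d)"
    using is_weak_gradD(1)[OF g i] is_weak_gradD(1)[OF g' i]
    unfolding L2_iff[OF Um, of "g i"] L2_iff[OF Um, of "g' i"] .
  have test: "integrable ?M (\<lambda>x. indicator U x * g i x * \<phi> x)" "integrable ?M (\<lambda>x. indicator U x * g' i x * \<phi> x)"
    if \<phi>: "\<phi> \<in> test_functions d U" for \<phi>
  proof -
    obtain r where r: "vanishes_outside d r \<phi>" using test_functions_vanish[OF \<phi>] by blast
    show "integrable ?M (\<lambda>x. indicator U x * g i x * \<phi> x)" "integrable ?M (\<lambda>x. indicator U x * g' i x * \<phi> x)"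
      by (rule L2_test_integrable[OF _ test_functions_smooth[OF \<phi>] r], rule L2)+
  qed
  have "AE x in ?M. x \<in> U \<longrightarrow> g i x - g' i x = 0"
  proof (rule test_zero_AE[OF U])
    fix a b assume ab: "cbox' d a b \<subseteq> U"
    define B where "B = cbox' d a b"
    have B: "B \<subseteq> U" "B \<in> sets ?M" "emeasure ?M B < \<infinity>"
      unfolding B_def by (rule ab sets_Rd_box emeasure_Rd_box)+
    from L2_mult_integrable[OF L2_indicator[OF B(2,3)] L2_lincomb_Rd[OF L2, of 1 "-1"]]
    have "integrable ?M (\<lambda>x. indicator B x * (1 * (indicator U x * g i x) + - 1 * (indicator U x * g' i x)))" .
    also have "(\<lambda>x. indicator B x * (1 * (indicator U x * g i x) + - 1 * (indicator U x * g' i x)))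
       = (\<lambda>x. indicator B x * (g i x - g' i x))"
      using B(1) by (intro ext) (auto simp: indicator_def)
    finally show "integrable ?M (\<lambda>x. indicator (cbox' d a b) x * (g i x - g' i x))" unfolding B_def .
  next
    fix \<phi> assume \<phi>: "\<phi> \<in> test_functions d U"
    have "(LINT x:U|?M. g i x * \<phi> x) = (LINT x:U|?M. g' i x * \<phi> x)"
      using is_weak_gradD(2)[OF g i \<phi>] is_weak_gradD(2)[OF g' i \<phi>] by simp
    then have "(\<integral>x. indicator U x * g i x * \<phi> x \<partial>?M) = (\<integral>x. indicator U x * g' i x * \<phi> x \<partial>?M)"
      by (simp add: set_lebesgue_integral_def mult.assoc)
    then show "(\<integral>x. indicator U x * ((g i x - g' i x) * \<phi> x) \<partial>?M) = 0"
      using test[OF \<phi>] by (simp add: algebra_simps)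
  qed
  then show ?thesis by simp
qed

lemma weak_grad_is:
  assumes "u \<in> H1 d U" shows "is_weak_grad d U u (weak_grad d U u)"
proof -
  have "\<exists>g. is_weak_grad d U u g" using assms unfolding H1_def mem_Collect_eq by (rule conjunct2)
  then show ?thesis unfolding weak_grad_def by (rule someI_ex)
qed

lemma H1_I: "u \<in> L2 d U \<Longrightarrow> is_weak_grad d U u g \<Longrightarrow> u \<in> H1 d U"
  unfolding H1_def mem_Collect_eq by (intro conjI exI)

lemma H1_L2: "u \<in> H1 d U \<Longrightarrow> u \<in> L2 d U"
  unfolding H1_def mem_Collect_eq by (rule conjunct1)

text \<open>Frees the norm from the choice made in \<open>weak_grad\<close>: it may be computed with
  any known weak gradient.\<close>

lemma H1_norm_eq:
  assumes U: "openin (Rd_top d) U" and u: "u \<in> L2 d U" and g: "is_weak_grad d U u g"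
  shows "H1_norm d U u = sqrt ((LINT x:U|Rd_leb d. (u x)\<^sup>2) + (\<Sum>i<d. LINT x:U|Rd_leb d. (g i x)\<^sup>2))"
proof -
  have Um [measurable]: "U \<in> sets (Rd_leb d)" by (rule openin_Rd_sets[OF U])
  have H: "u \<in> H1 d U" by (rule H1_I[OF u g])
  have "(LINT x:U|Rd_leb d. (weak_grad d U u i x)\<^sup>2) = (LINT x:U|Rd_leb d. (g i x)\<^sup>2)" if i: "i < d" for i
    unfolding set_lebesgue_integral_def
  proof (rule integral_cong_AE)
    have "(\<lambda>x. indicator U x * h i x) \<in> L2 d (Rd d)" if "is_weak_grad d U u h" for h
      using is_weak_gradD(1)[OF that i] unfolding L2_iff[OF Um, of "h i"] .
    then have "(\<lambda>x. (indicator U x * h i x)\<^sup>2) \<in> borel_measurable (Rd_leb d)" if "is_weak_grad d U u h" for h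
      using that by (auto simp: L2_Rd)
    moreover have "(\<lambda>x. (indicator U x * h i x)\<^sup>2) = (\<lambda>x. indicator U x *\<^sub>R (h i x)\<^sup>2)" for h :: "nat \<Rightarrow> vec \<Rightarrow> real"
      by (auto simp: indicator_def)
    ultimately show "(\<lambda>x. indicator U x *\<^sub>R (weak_grad d U u i x)\<^sup>2) \<in> borel_measurable (Rd_leb d)"
      "(\<lambda>x. indicator U x *\<^sub>R (g i x)\<^sup>2) \<in> borel_measurable (Rd_leb d)"
      using g weak_grad_is[OF H] by metis+
    show "AE x in Rd_leb d. indicator U x *\<^sub>R (weak_grad d U u i x)\<^sup>2 = indicator U x *\<^sub>R (g i x)\<^sup>2"
      using is_weak_grad_unique[OF U weak_grad_is[OF H] g i] by eventually_elim (auto simp: indicator_def)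
  qed
  then have "(\<Sum>i<d. LINT x:U|Rd_leb d. (weak_grad d U u i x)\<^sup>2) = (\<Sum>i<d. LINT x:U|Rd_leb d. (g i x)\<^sup>2)"
    by (intro sum.cong refl) simp
  then show ?thesis unfolding H1_norm_def by (rule arg_cong)
qed

lemma is_weak_grad_lincomb:
  assumes U: "openin (Rd_top d) U" and "u \<in> L2 d U" "u' \<in> L2 d U"
    and g: "is_weak_grad d U u g" and g': "is_weak_grad d U u' g'"
  shows "is_weak_grad d U (\<lambda>x. a * u x + b * u' x) (\<lambda>i x. a * g i x + b * g' i x)"
  unfolding is_weak_grad_def
proof (intro allI impI conjI ballI)
  fix i assume i: "i < d"
  have Um: "U \<in> sets (Rd_leb d)" by (rule openin_Rd_sets[OF U])
  show "(\<lambda>x. a * g i x + b * g' i x) \<in> L2 d U"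
    by (intro L2_lincomb Um is_weak_gradD(1)[OF g i] is_weak_gradD(1)[OF g' i])
  fix \<phi> assume \<phi>: "\<phi> \<in> test_functions d U"
  have s: "smooth d \<phi>" by (rule test_functions_smooth[OF \<phi>])
  obtain r where r: "vanishes_outside d r \<phi>" using test_functions_vanish[OF \<phi>] by blast
  have r': "vanishes_outside d r (partial_deriv i \<phi>)"
    by (rule has_partial_vanishes_outside[OF smooth_has_partial[OF s i] r i])
  have int: "integrable (Rd_leb d) (\<lambda>x. indicator U x * v x * \<psi> x)"
    if "v \<in> L2 d U" "smooth d \<psi>" "vanishes_outside d r \<psi>" for v \<psi>
    using that(1) by (intro L2_test_integrable[OF _ that(2,3)]) (simp add: L2_iff[OF Um, of v])
  note gL = is_weak_gradD(1)[OF g i] is_weak_gradD(1)[OF g' i]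
  have lin: "(LINT x:U|Rd_leb d. (a * v x + b * w x) * \<psi> x) = a * (LINT x:U|Rd_leb d. v x * \<psi> x) + b * (LINT x:U|Rd_leb d. w x * \<psi> x)"
    if "v \<in> L2 d U" "w \<in> L2 d U" "smooth d \<psi>" "vanishes_outside d r \<psi>" for v w \<psi>
  proof -
    have "(LINT x:U|Rd_leb d. (a * v x + b * w x) * \<psi> x) =
       (\<integral>x. a * (indicator U x * v x * \<psi> x) + b * (indicator U x * w x * \<psi> x) \<partial>Rd_leb d)"
      unfolding set_lebesgue_integral_def by (rule Bochner_Integration.integral_cong) (auto simp: algebra_simps)
    also have "\<dots> = a * (\<integral>x. indicator U x * v x * \<psi> x \<partial>Rd_leb d) + b * (\<integral>x. indicator U x * w x * \<psi> x \<partial>Rd_leb d)"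
      using int[OF that(1,3,4)] int[OF that(2,3,4)] by simp
    finally show ?thesis by (simp add: set_lebesgue_integral_def mult.assoc)
  qed
  note e = is_weak_gradD(2)[OF g i \<phi>] is_weak_gradD(2)[OF g' i \<phi>]
  show "(LINT x:U|Rd_leb d. (a * u x + b * u' x) * partial_deriv i \<phi> x) = - (LINT x:U|Rd_leb d. (a * g i x + b * g' i x) * \<phi> x)"
    unfolding lin[OF assms(2,3) smooth_pd[OF s i] r'] lin[OF gL s r] e by simp
qed

lemma is_weak_grad_restrict:
  assumes U: "openin (Rd_top d) U" and g: "is_weak_grad d (Rd d) u g"
  shows "is_weak_grad d U u g"
proof -
  have Um: "U \<in> sets (Rd_leb d)" by (rule openin_Rd_sets[OF U])
  have "U \<subseteq> Rd d" using openin_subset[OF U] by simp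
  then show ?thesis
    using g test_pair_restrict[of d u g U] L2_mono[OF Um]
    unfolding is_weak_grad_Rd unfolding is_weak_grad_def by blast
qed

lemma is_weak_grad_smooth:
  assumes U: "openin (Rd_top d) U" "emeasure (Rd_leb d) U < \<infinity>" and w: "smooth d w"
    and b: "\<And>i x. i < d \<Longrightarrow> x \<in> Rd d \<Longrightarrow> \<bar>partial_deriv i w x\<bar> \<le> C"
  shows "is_weak_grad d U w (\<lambda>i. partial_deriv i w)"
proof -
  have Um: "U \<in> sets (Rd_leb d)" by (rule openin_Rd_sets[OF U(1)])
  have "U \<subseteq> Rd d" using openin_subset[OF U(1)] by simp
  moreover have "partial_deriv i w \<in> L2 d U" if "i < d" for i
    using b that by (intro L2_bounded[OF Um U(2), of _ C] smooth_measurable smooth_pd w) auto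
  ultimately show ?thesis
    using test_pair_restrict[OF smooth_test_pair[OF w], of U] unfolding is_weak_grad_def by blast
qed

section \<open>Averages of ridge functions\<close>

text \<open>Again \<open>S\<close> stands for the set of all derivatives. Their boundedness is what
  allows repeated differentiation under the integral over the parameters.\<close>

definition bounded_smooth :: "(real \<Rightarrow> real) \<Rightarrow> bool" where
  "bounded_smooth s \<longleftrightarrow> (\<exists>S. s \<in> S \<and>
     (\<forall>f\<in>S. bounded (range f) \<and> (\<exists>f'\<in>S. \<forall>x. (f has_real_derivative f' x) (at x))))"

lemma bounded_smooth_has_deriv:
  assumes "bounded_smooth s"
  shows "(s has_real_derivative deriv s x) (at x)" "bounded_smooth (deriv s)" "\<exists>C>0. \<forall>x. \<bar>s x\<bar> \<le> C"
proof -
  obtain S where S: "s \<in> S" "\<forall>f\<in>S. bounded (range f) \<and> (\<exists>f'\<in>S. \<forall>x. (f has_real_derivative f' x) (at x))"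
    using assms unfolding bounded_smooth_def by blast
  obtain f' where f': "f' \<in> S" "\<And>x. (s has_real_derivative f' x) (at x)" using S by blast
  have "f' = deriv s" using f'(2) by (intro ext DERIV_imp_deriv[symmetric])
  then show "(s has_real_derivative deriv s x) (at x)" "bounded_smooth (deriv s)"
    using f' S unfolding bounded_smooth_def by blast+
  show "\<exists>C>0. \<forall>x. \<bar>s x\<bar> \<le> C" using S by (auto simp: bounded_pos)
qed

lemma bounded_smooth_borel: "bounded_smooth s \<Longrightarrow> s \<in> borel_measurable borel"
  by (intro borel_measurable_continuous_onI continuous_at_imp_continuous_on ballI DERIV_isCont)
    (rule bounded_smooth_has_deriv(1))

lemma lipschitz_of_deriv_bound:
  fixes f :: "real \<Rightarrow> real"
  assumes "\<And>x. (f has_real_derivative f' x) (at x)" "\<And>x. \<bar>f' x\<bar> \<le> C"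
  shows "\<bar>f y - f x\<bar> \<le> C * \<bar>y - x\<bar>"
  using field_differentiable_bound[of UNIV f f' C y x] assms by auto

text \<open>The mean value inequality for \<open>y \<mapsto> f y - y * f' z\<close>, whose
  derivative is at most \<open>C * \<bar>k\<bar>\<close> on the ball. The factor 1/2 of the Taylor
  formula is given away.\<close>

lemma taylor_deriv_bound:
  fixes f :: "real \<Rightarrow> real"
  assumes f: "\<And>x. (f has_real_derivative f' x) (at x)" and f': "\<And>x. (f' has_real_derivative f'' x) (at x)"
    and C: "\<And>x. \<bar>f'' x\<bar> \<le> C"
  shows "\<bar>f (z + k) - f z - k * f' z\<bar> \<le> C * k\<^sup>2"
proof -
  have C0: "0 \<le> C" using C[of 0] by simp
  have "norm ((f (z + k) - (z + k) * f' z) - (f z - z * f' z)) \<le> (C * \<bar>k\<bar>) * norm (z + k - z)"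
  proof (rule field_differentiable_bound[where S="cball z \<bar>k\<bar>" and f="\<lambda>y. f y - y * f' z" and f'="\<lambda>y. f' y - f' z"])
    fix y assume y: "y \<in> cball z \<bar>k\<bar>"
    show "((\<lambda>y. f y - y * f' z) has_real_derivative f' y - f' z) (at y within cball z \<bar>k\<bar>)"
      using DERIV_subset[OF f] by (auto intro!: derivative_eq_intros)
    have "\<bar>f' y - f' z\<bar> \<le> C * \<bar>y - z\<bar>" by (rule lipschitz_of_deriv_bound[OF f' C])
    also have "\<dots> \<le> C * \<bar>k\<bar>" using y C0 by (intro mult_left_mono) (auto simp: dist_real_def abs_minus_commute)
    finally show "norm (f' y - f' z) \<le> C * \<bar>k\<bar>" by simp
  qed (auto simp: dist_real_def)
  then show ?thesis by (simp add: algebra_simps power2_eq_square abs_mult_self_eq)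
qed

text \<open>A quadratic bound on the remainder that is uniform in the parameter survives averaging.
  Differentiation under the integral therefore becomes a single estimate, without a limit inside the
  integral.\<close>

lemma DERIV_of_quadratic_bound:
  fixes F :: "real \<Rightarrow> real"
  assumes "\<And>t. \<bar>F t - F a - (t - a) * D\<bar> \<le> K * (t - a)\<^sup>2"
  shows "(F has_real_derivative D) (at a)"
proof -
  have "((\<lambda>t. (F t - F a) / (t - a) - D) \<longlongrightarrow> 0) (at a)"
  proof (rule Lim_null_comparison)
    show "\<forall>\<^sub>F t in at a. norm ((F t - F a) / (t - a) - D) \<le> K * \<bar>t - a\<bar>"
    proof (rule eventually_at_topological[THEN iffD2], intro exI[of _ UNIV] conjI ballI impI)
      fix t assume "t \<noteq> a"
      then have "norm ((F t - F a) / (t - a) - D) = \<bar>F t - F a - (t - a) * D\<bar> / \<bar>t - a\<bar>"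
        by (simp add: field_simps flip: abs_divide)
      also have "\<dots> \<le> K * (t - a)\<^sup>2 / \<bar>t - a\<bar>" using assms by (intro divide_right_mono) auto
      also have "\<dots> = K * \<bar>t - a\<bar>" using \<open>t \<noteq> a\<close> by (simp add: power2_eq_square field_simps)
      finally show "norm ((F t - F a) / (t - a) - D) \<le> K * \<bar>t - a\<bar>" .
    qed auto
    have "((\<lambda>t. K * \<bar>t - a\<bar>) \<longlongrightarrow> K * \<bar>a - a\<bar>) (at a)" by (intro tendsto_intros)
    then show "((\<lambda>t. K * \<bar>t - a\<bar>) \<longlongrightarrow> 0) (at a)" by simp
  qed
  then have "((\<lambda>t. (F t - F a) / (t - a)) \<longlongrightarrow> D) (at a)" by (simp add: LIM_zero_iff)
  then show ?thesis by (simp add: has_field_derivative_iff)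
qed

lemma L2_set_cmult: "L2_set (\<lambda>i. c * f i) A = \<bar>c\<bar> * L2_set f A"
  by (simp add: L2_set_def power_mult_distrib sum_distrib_left[symmetric] real_sqrt_mult)

lemma dot_add: "dot d (\<lambda>i. v i + w i) x = dot d v x + dot d w x"
  by (simp add: dot_def sum.distrib algebra_simps)

lemma dot_cmult: "dot d (\<lambda>i. c * w i) x = c * dot d w x"
  by (simp add: dot_def sum_distrib_left mult.assoc)

lemma dot_upd: "i < d \<Longrightarrow> dot d w (x(i := t)) = dot d w x + w i * (t - x i)"
  by (simp add: dot_def sum.remove[of "{..<d}" i] algebra_simps)

lemma dot_cong: "(\<And>i. i < d \<Longrightarrow> v i = w i) \<Longrightarrow> dot d v x = dot d w x"
  by (simp add: dot_def)

text \<open>Coefficient and profile are separate arguments because a partial derivative multiplies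
  \<alpha> by \<open>w \<theta> i\<close> and replaces \<open>s\<close> by its derivative, leaving
  the rest unchanged.\<close>

definition rint :: "'m measure \<Rightarrow> nat \<Rightarrow> ('m \<Rightarrow> vec) \<Rightarrow> ('m \<Rightarrow> real) \<Rightarrow> ('m \<Rightarrow> real) \<Rightarrow> (real \<Rightarrow> real) \<Rightarrow> vec \<Rightarrow> real" where
  "rint P d w b \<alpha> s x = (\<integral>\<theta>. \<alpha> \<theta> * s (dot d (w \<theta>) x + b \<theta>) \<partial>P)"

text \<open>The bound on the weights holds for every \<theta> and not just almost every one, so that
  estimates are pointwise; null sets are corrected once, when the measure is constructed.\<close>

locale ridge = prob_space P for P :: "'m measure" +
  fixes d :: nat and w :: "'m \<Rightarrow> vec" and b :: "'m \<Rightarrow> real" and R :: real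
  assumes w_measurable: "\<And>i. i < d \<Longrightarrow> (\<lambda>\<theta>. w \<theta> i) \<in> borel_measurable P"
    and b_measurable [measurable]: "b \<in> borel_measurable P"
    and w_bound: "\<And>\<theta>. L2_set (w \<theta>) {..<d} \<le> R"
begin

lemma R_nonneg: "0 \<le> R"
  using w_bound L2_set_nonneg order_trans by blast

lemma w_component_bound: "i < d \<Longrightarrow> \<bar>w \<theta> i\<bar> \<le> R"
proof -
  assume "i < d"
  then have "\<bar>w \<theta> i\<bar> \<le> L2_set (\<lambda>i. \<bar>w \<theta> i\<bar>) {..<d}" by (intro member_le_L2_set) auto
  also have "\<dots> = L2_set (w \<theta>) {..<d}" by (simp add: L2_set_def)
  finally show ?thesis using w_bound[of \<theta>] by simp
qed

lemma dot_measurable [measurable]: "(\<lambda>\<theta>. dot d (w \<theta>) x) \<in> borel_measurable P"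
  unfolding dot_def using w_measurable by (intro borel_measurable_sum borel_measurable_times) auto

lemma rint_integrable:
  assumes "\<alpha> \<in> borel_measurable P" "\<And>\<theta>. \<bar>\<alpha> \<theta>\<bar> \<le> N" "bounded_smooth s"
  shows "integrable P (\<lambda>\<theta>. \<alpha> \<theta> * s (dot d (w \<theta>) x + b \<theta>))"
proof -
  note [measurable] = assms(1) bounded_smooth_borel[OF assms(3)]
  obtain C where C: "0 < C" "\<And>x. \<bar>s x\<bar> \<le> C" using bounded_smooth_has_deriv(3)[OF assms(3)] by blast
  show ?thesis
  proof (rule integrable_const_bound[where B="N * C"])
    show "AE \<theta> in P. norm (\<alpha> \<theta> * s (dot d (w \<theta>) x + b \<theta>)) \<le> N * C"
      using assms(2) C by (intro AE_I2) (auto simp: abs_mult intro!: mult_mono order_trans[OF abs_ge_zero])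
  qed measurable
qed

lemma abs_integral_le_const:
  assumes "f \<in> borel_measurable P" "\<And>\<theta>. \<bar>f \<theta>\<bar> \<le> B"
  shows "\<bar>\<integral>\<theta>. f \<theta> \<partial>P\<bar> \<le> (B::real)"
proof -
  have i: "integrable P f" using assms by (intro integrable_const_bound[where B=B]) auto
  have "\<bar>\<integral>\<theta>. f \<theta> \<partial>P\<bar> \<le> (\<integral>\<theta>. \<bar>f \<theta>\<bar> \<partial>P)" by (rule integral_abs_bound)
  also have "\<dots> \<le> (\<integral>\<theta>. B \<partial>P)" using i assms by (intro integral_mono) auto
  finally show ?thesis by (simp add: prob_space)
qed

lemma rint_bound:
  assumes "\<alpha> \<in> borel_measurable P" "\<And>\<theta>. \<bar>\<alpha> \<theta>\<bar> \<le> N" "bounded_smooth s" "\<And>x. \<bar>s x\<bar> \<le> C"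
  shows "\<bar>rint P d w b \<alpha> s x\<bar> \<le> N * C"
proof -
  note [measurable] = assms(1) bounded_smooth_borel[OF assms(3)]
  show ?thesis unfolding rint_def
    using assms(2,4) by (intro abs_integral_le_const) (auto simp: abs_mult intro!: mult_mono order_trans[OF abs_ge_zero])
qed

lemma rint_continuous:
  assumes \<alpha>: "\<alpha> \<in> borel_measurable P" "\<And>\<theta>. \<bar>\<alpha> \<theta>\<bar> \<le> N" and s: "bounded_smooth s"
  shows "continuous_map (Rd_top d) euclideanreal (rint P d w b \<alpha> s)"
proof -
  note [measurable] = \<alpha>(1) bounded_smooth_borel[OF s]
  obtain C where C: "0 < C" "\<And>x. \<bar>deriv s x\<bar> \<le> C"
    using bounded_smooth_has_deriv(3)[OF bounded_smooth_has_deriv(2)[OF s]] by blast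
  have N: "0 \<le> N" using \<alpha>(2) abs_ge_zero order_trans by blast
  show ?thesis
  proof (rule continuous_map_Rd_lipschitz[where L="N * (C * R)"])
    fix x y :: vec
    let ?z = "\<lambda>x \<theta>. dot d (w \<theta>) x + b \<theta>"
    have "\<bar>s (?z x \<theta>) - s (?z y \<theta>)\<bar> \<le> C * (R * (\<Sum>i<d. \<bar>x i - y i\<bar>))" for \<theta>
    proof -
      have "\<bar>s (?z x \<theta>) - s (?z y \<theta>)\<bar> \<le> C * \<bar>?z x \<theta> - ?z y \<theta>\<bar>"
        by (rule lipschitz_of_deriv_bound[OF bounded_smooth_has_deriv(1)[OF s] C(2)])
      also have "\<bar>?z x \<theta> - ?z y \<theta>\<bar> = \<bar>\<Sum>i<d. w \<theta> i * (x i - y i)\<bar>"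
        by (simp add: dot_def sum_subtractf algebra_simps)
      also have "\<dots> \<le> (\<Sum>i<d. R * \<bar>x i - y i\<bar>)"
        by (rule order_trans[OF sum_abs]) (auto simp: abs_mult intro!: sum_mono mult_right_mono w_component_bound)
      also have "\<dots> = R * (\<Sum>i<d. \<bar>x i - y i\<bar>)" by (simp add: sum_distrib_left)
      finally show ?thesis using C(1) by simp
    qed
    then have *: "\<bar>\<alpha> \<theta> * (s (?z x \<theta>) - s (?z y \<theta>))\<bar> \<le> N * (C * (R * (\<Sum>i<d. \<bar>x i - y i\<bar>)))" for \<theta>
      unfolding abs_mult using \<alpha>(2) N by (intro mult_mono) auto
    have "rint P d w b \<alpha> s x - rint P d w b \<alpha> s y = (\<integral>\<theta>. \<alpha> \<theta> * (s (?z x \<theta>) - s (?z y \<theta>)) \<partial>P)"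
      unfolding rint_def using rint_integrable[OF \<alpha> s] by (simp add: right_diff_distrib)
    also have "\<bar>\<dots>\<bar> \<le> N * (C * (R * (\<Sum>i<d. \<bar>x i - y i\<bar>)))"
      by (rule abs_integral_le_const[OF _ *]) measurable
    finally show "\<bar>rint P d w b \<alpha> s x - rint P d w b \<alpha> s y\<bar> \<le> N * (C * R) * (\<Sum>i<d. \<bar>x i - y i\<bar>)"
      by (simp add: mult.assoc)
  qed
qed

lemma rint_has_partial:
  assumes \<alpha>: "\<alpha> \<in> borel_measurable P" "\<And>\<theta>. \<bar>\<alpha> \<theta>\<bar> \<le> N" and s: "bounded_smooth s" and i: "i < d"
  shows "has_partial d i (rint P d w b \<alpha> s) (rint P d w b (\<lambda>\<theta>. \<alpha> \<theta> * w \<theta> i) (deriv s))"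
  unfolding has_partial_def
proof
  fix x :: vec assume "x \<in> Rd d"
  note s' = bounded_smooth_has_deriv(2)[OF s]
  note [measurable] = \<alpha>(1) bounded_smooth_borel[OF s] bounded_smooth_borel[OF s'] w_measurable[OF i]
  obtain C where C: "0 < C" "\<And>x. \<bar>deriv (deriv s) x\<bar> \<le> C"
    using bounded_smooth_has_deriv(3)[OF bounded_smooth_has_deriv(2)[OF s']] by blast
  have N: "0 \<le> N" using \<alpha>(2) abs_ge_zero order_trans by blast
  have \<alpha>': "(\<lambda>\<theta>. \<alpha> \<theta> * w \<theta> i) \<in> borel_measurable P" "\<bar>\<alpha> \<theta> * w \<theta> i\<bar> \<le> N * R" for \<theta>
    using \<alpha>(2) N w_component_bound[OF i] by (auto simp: abs_mult intro!: mult_mono)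
  let ?z = "\<lambda>\<theta>. dot d (w \<theta>) x + b \<theta>"
  let ?F = "\<lambda>t. rint P d w b \<alpha> s (x(i := t))"
  let ?D = "rint P d w b (\<lambda>\<theta>. \<alpha> \<theta> * w \<theta> i) (deriv s) x"
  show "(?F has_field_derivative ?D) (at (x i))"
  proof (rule DERIV_of_quadratic_bound[where K="N * (C * R\<^sup>2)"])
    fix t
    let ?e = "\<lambda>\<theta>. s (?z \<theta> + w \<theta> i * (t - x i)) - s (?z \<theta>) - (w \<theta> i * (t - x i)) * deriv s (?z \<theta>)"
    have "\<bar>?e \<theta>\<bar> \<le> C * (R\<^sup>2 * (t - x i)\<^sup>2)" for \<theta>
    proof -
      have "\<bar>?e \<theta>\<bar> \<le> C * (w \<theta> i * (t - x i))\<^sup>2"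
        by (rule taylor_deriv_bound[OF bounded_smooth_has_deriv(1)[OF s] bounded_smooth_has_deriv(1)[OF s'] C(2)])
      also have "\<dots> \<le> C * (R\<^sup>2 * (t - x i)\<^sup>2)"
        unfolding power_mult_distrib using C(1) power_mono[OF w_component_bound[OF i, of \<theta>] abs_ge_zero, of 2]
        by (intro mult_left_mono mult_right_mono) auto
      finally show ?thesis .
    qed
    then have *: "\<bar>\<alpha> \<theta> * ?e \<theta>\<bar> \<le> N * (C * (R\<^sup>2 * (t - x i)\<^sup>2))" for \<theta>
      unfolding abs_mult using \<alpha>(2) N by (intro mult_mono) auto
    have i1: "integrable P (\<lambda>\<theta>. \<alpha> \<theta> * s (?z \<theta> + w \<theta> i * (t - x i)))"
      using rint_integrable[OF \<alpha> s, of "x(i := t)"] by (simp add: dot_upd[OF i] ac_simps)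
    have "?F t - ?F (x i) - (t - x i) * ?D =
       (\<integral>\<theta>. \<alpha> \<theta> * s (?z \<theta> + w \<theta> i * (t - x i)) - \<alpha> \<theta> * s (?z \<theta>) - (t - x i) * (\<alpha> \<theta> * w \<theta> i * deriv s (?z \<theta>)) \<partial>P)"
    proof -
      have Ft: "?F t = (\<integral>\<theta>. \<alpha> \<theta> * s (?z \<theta> + w \<theta> i * (t - x i)) \<partial>P)"
        unfolding rint_def dot_upd[OF i] by (intro Bochner_Integration.integral_cong refl) (simp add: ac_simps)
      have Fx: "?F (x i) = (\<integral>\<theta>. \<alpha> \<theta> * s (?z \<theta>) \<partial>P)" by (simp add: rint_def)
      show ?thesis
        unfolding Ft Fx unfolding rint_def
        using i1 rint_integrable[OF \<alpha> s, of x] rint_integrable[OF \<alpha>' s', of x]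
        by simp
    qed
    also have "\<dots> = (\<integral>\<theta>. \<alpha> \<theta> * ?e \<theta> \<partial>P)" by (intro Bochner_Integration.integral_cong refl) (simp add: algebra_simps)
    also have "\<bar>\<dots>\<bar> \<le> N * (C * (R\<^sup>2 * (t - x i)\<^sup>2))"
      by (rule abs_integral_le_const[OF _ *]) measurable
    finally show "\<bar>?F t - ?F (x i) - (t - x i) * ?D\<bar> \<le> N * (C * R\<^sup>2) * (t - x i)\<^sup>2"
      by (simp add: mult.assoc)
  qed
qed

lemma rint_coeff_bound:
  assumes "\<alpha> \<in> borel_measurable P" "\<And>\<theta>. \<bar>\<alpha> \<theta>\<bar> \<le> N" "i < d"
  shows "(\<lambda>\<theta>. \<alpha> \<theta> * w \<theta> i) \<in> borel_measurable P" "\<bar>\<alpha> \<theta> * w \<theta> i\<bar> \<le> N * R"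
proof -
  have "0 \<le> N" using assms(2) abs_ge_zero order_trans by blast
  then show "\<bar>\<alpha> \<theta> * w \<theta> i\<bar> \<le> N * R"
    using assms w_component_bound[OF assms(3)] by (auto simp: abs_mult intro!: mult_mono)
  show "(\<lambda>\<theta>. \<alpha> \<theta> * w \<theta> i) \<in> borel_measurable P" using assms w_measurable by simp
qed

lemma rint_smooth:
  assumes "\<alpha> \<in> borel_measurable P" "\<And>\<theta>. \<bar>\<alpha> \<theta>\<bar> \<le> N" "bounded_smooth s"
  shows "smooth d (rint P d w b \<alpha> s)"
proof (rule smooth_coinduct[where X="\<lambda>\<phi>. \<exists>\<alpha> N s. \<alpha> \<in> borel_measurable P \<and> (\<forall>\<theta>. \<bar>\<alpha> \<theta>\<bar> \<le> N) \<and> bounded_smooth s \<and> \<phi> = rint P d w b \<alpha> s"])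
  show "\<exists>\<alpha>' N s'. \<alpha>' \<in> borel_measurable P \<and> (\<forall>\<theta>. \<bar>\<alpha>' \<theta>\<bar> \<le> N) \<and> bounded_smooth s' \<and> rint P d w b \<alpha> s = rint P d w b \<alpha>' s'"
    using assms by blast
next
  fix \<phi> assume "\<exists>\<alpha> N s. \<alpha> \<in> borel_measurable P \<and> (\<forall>\<theta>. \<bar>\<alpha> \<theta>\<bar> \<le> N) \<and> bounded_smooth s \<and> \<phi> = rint P d w b \<alpha> s"
  then show "continuous_map (Rd_top d) euclideanreal \<phi>" using rint_continuous by auto
next
  fix \<phi> i assume "\<exists>\<alpha> N s. \<alpha> \<in> borel_measurable P \<and> (\<forall>\<theta>. \<bar>\<alpha> \<theta>\<bar> \<le> N) \<and> bounded_smooth s \<and> \<phi> = rint P d w b \<alpha> s" and i: "i < d"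
  then obtain \<alpha> N s where \<alpha>: "\<alpha> \<in> borel_measurable P" "\<And>\<theta>. \<bar>\<alpha> \<theta>\<bar> \<le> N" "bounded_smooth s" and \<phi>: "\<phi> = rint P d w b \<alpha> s"
    by auto
  show "\<exists>\<psi>. (\<exists>\<alpha> N s. \<alpha> \<in> borel_measurable P \<and> (\<forall>\<theta>. \<bar>\<alpha> \<theta>\<bar> \<le> N) \<and> bounded_smooth s \<and> \<psi> = rint P d w b \<alpha> s) \<and> has_partial d i \<phi> \<psi>"
    unfolding \<phi>
    by (intro exI[of _ "rint P d w b (\<lambda>\<theta>. \<alpha> \<theta> * w \<theta> i) (deriv s)"] conjI rint_has_partial[OF \<alpha> i]
        exI[of _ "\<lambda>\<theta>. \<alpha> \<theta> * w \<theta> i"] exI[of _ "N * R"] exI[of _ "deriv s"] allI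
        rint_coeff_bound[OF \<alpha>(1,2) i] bounded_smooth_has_deriv(2)[OF \<alpha>(3)] refl)
qed

lemma rint_pd:
  assumes "\<alpha> \<in> borel_measurable P" "\<And>\<theta>. \<bar>\<alpha> \<theta>\<bar> \<le> N" "bounded_smooth s" "i < d" "x \<in> Rd d"
  shows "partial_deriv i (rint P d w b \<alpha> s) x = rint P d w b (\<lambda>\<theta>. \<alpha> \<theta> * w \<theta> i) (deriv s) x"
  by (rule has_partial_pd[OF rint_has_partial[OF assms(1-4)] assms(5)])

text \<open>On a function of \<open>dot d w x\<close> the Laplacian is \<open>|w|^2\<close> times
  the second derivative of the profile. This is what reduces \<open>1 - \<Delta>\<close> to one
  dimension.\<close>

lemma rint_laplace:
  assumes \<alpha>: "\<alpha> \<in> borel_measurable P" "\<And>\<theta>. \<bar>\<alpha> \<theta>\<bar> \<le> N" and s: "bounded_smooth s" and x: "x \<in> Rd d"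
  shows "(\<Sum>i<d. partial_deriv i (partial_deriv i (rint P d w b \<alpha> s)) x) =
    rint P d w b (\<lambda>\<theta>. \<alpha> \<theta> * (L2_set (w \<theta>) {..<d})\<^sup>2) (deriv (deriv s)) x"
proof -
  note s' = bounded_smooth_has_deriv(2)[OF s]
  note s'' = bounded_smooth_has_deriv(2)[OF s']
  have "partial_deriv i (partial_deriv i (rint P d w b \<alpha> s)) x = rint P d w b (\<lambda>\<theta>. \<alpha> \<theta> * w \<theta> i * w \<theta> i) (deriv (deriv s)) x"
    if i: "i < d" for i
  proof -
    have "partial_deriv i (partial_deriv i (rint P d w b \<alpha> s)) x = partial_deriv i (rint P d w b (\<lambda>\<theta>. \<alpha> \<theta> * w \<theta> i) (deriv s)) x"
      by (rule partial_deriv_cong[OF rint_pd[OF \<alpha> s i] i x])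
    also have "\<dots> = rint P d w b (\<lambda>\<theta>. \<alpha> \<theta> * w \<theta> i * w \<theta> i) (deriv (deriv s)) x"
      by (rule rint_pd[OF rint_coeff_bound[OF \<alpha> i] s' i x])
    finally show ?thesis .
  qed
  then have "(\<Sum>i<d. partial_deriv i (partial_deriv i (rint P d w b \<alpha> s)) x) =
     (\<Sum>i<d. rint P d w b (\<lambda>\<theta>. \<alpha> \<theta> * w \<theta> i * w \<theta> i) (deriv (deriv s)) x)" by simp
  also have "\<dots> = (\<integral>\<theta>. (\<Sum>i<d. \<alpha> \<theta> * w \<theta> i * w \<theta> i * deriv (deriv s) (dot d (w \<theta>) x + b \<theta>)) \<partial>P)"
    unfolding rint_def
    by (rule Bochner_Integration.integral_sum[symmetric])
      (intro rint_integrable[OF rint_coeff_bound[OF rint_coeff_bound[OF \<alpha>]] s''], auto)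
  also have "\<dots> = rint P d w b (\<lambda>\<theta>. \<alpha> \<theta> * (L2_set (w \<theta>) {..<d})\<^sup>2) (deriv (deriv s)) x"
    unfolding rint_def L2_set_def
    by (intro Bochner_Integration.integral_cong refl)
      (simp add: sum_nonneg sum_distrib_left sum_distrib_right power2_eq_square mult.assoc)
  finally show ?thesis .
qed

end

text \<open>An existential quantifier does not range over types, so the parameter space is fixed to
  be that of the Barron measures. The functions \<open>w\<close>, \<open>b\<close>, \<open>a\<close>
  on it remain free, and \<open>ridge_repI\<close> transports measures from other parameter
  spaces.\<close>

definition ridge_rep :: "(real \<Rightarrow> real) \<Rightarrow> nat \<Rightarrow> real \<Rightarrow> real \<Rightarrow> (vec \<Rightarrow> real) \<Rightarrow> bool" where
  "ridge_rep \<sigma> d R N g \<longleftrightarrow> (\<exists>(P :: (real \<times> vec \<times> real) measure) w b a.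
     ridge P d w b R \<and> a \<in> borel_measurable P \<and> (\<forall>\<theta>. \<bar>a \<theta>\<bar> \<le> N) \<and>
     (\<forall>x\<in>Rd d. g x = rint P d w b a \<sigma> x))"

lemma ridge_repE:
  assumes "ridge_rep \<sigma> d R N g"
  obtains P :: "(real \<times> vec \<times> real) measure" and w b a where
    "ridge P d w b R" "a \<in> borel_measurable P" "\<And>\<theta>. \<bar>a \<theta>\<bar> \<le> N" "\<And>x. x \<in> Rd d \<Longrightarrow> g x = rint P d w b a \<sigma> x"
  using assms unfolding ridge_rep_def by blast

lemma ridge_rep_nonneg:
  assumes "ridge_rep \<sigma> d R N g" shows "0 \<le> R" "0 \<le> N"
proof -
  obtain P :: "(real \<times> vec \<times> real) measure" and w b and a :: "real \<times> vec \<times> real \<Rightarrow> real"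
    where *: "ridge P d w b R" "\<And>\<theta>. \<bar>a \<theta>\<bar> \<le> N"
    by (rule ridge_repE[OF assms]) auto
  show "0 \<le> R" by (rule ridge.R_nonneg[OF *(1)])
  show "0 \<le> N" by (rule order_trans[OF abs_ge_zero *(2)])
qed

lemma ridge_repI:
  fixes P :: "'m measure"
  assumes "ridge P d w b R" and a: "a \<in> borel_measurable P" "\<And>\<theta>. \<bar>a \<theta>\<bar> \<le> N"
    and \<sigma> [measurable]: "\<sigma> \<in> borel_measurable borel"
    and g: "\<And>x. x \<in> Rd d \<Longrightarrow> g x = rint P d w b a \<sigma> x"
  shows "ridge_rep \<sigma> d R N g"
proof -
  interpret ridge P d w b R by fact
  note [measurable] = a(1) w_measurable
  define S :: "(real \<times> vec \<times> real) measure" where "S = borel \<Otimes>\<^sub>M ((\<Pi>\<^sub>M i\<in>{..<d}. borel) \<Otimes>\<^sub>M borel)"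
  define T where "T \<theta> = (a \<theta>, restrict (w \<theta>) {..<d}, b \<theta>)" for \<theta>
  have T [measurable]: "T \<in> P \<rightarrow>\<^sub>M S"
    unfolding T_def[abs_def] S_def by (intro measurable_Pair measurable_restrict) auto
  \<comment> \<open>Outside the image of \<open>T\<close> the coordinates are arbitrary, so they are
    truncated to satisfy the bounds everywhere; on the image the truncation changes nothing.\<close>
  define a' where "a' p = max (- N) (min N (fst p))" for p :: "real \<times> vec \<times> real"
  define w' where "w' p = (if L2_set (fst (snd p)) {..<d} \<le> R then fst (snd p) else (\<lambda>_. 0))" for p :: "real \<times> vec \<times> real"
  define b' where "b' p = snd (snd p)" for p :: "real \<times> vec \<times> real"
  have comp [measurable]: "(\<lambda>p. fst (snd p) i) \<in> borel_measurable S" if "i < d" for i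
  proof -
    have "i \<in> {..<d}" using that by simp
    then show ?thesis unfolding S_def
      using measurable_compose[of "\<lambda>p. fst (snd p)" "borel \<Otimes>\<^sub>M ((\<Pi>\<^sub>M i\<in>{..<d}. borel) \<Otimes>\<^sub>M borel)"
          "\<Pi>\<^sub>M i\<in>{..<d}. borel", OF _ measurable_component_singleton[OF \<open>i \<in> {..<d}\<close>]] by simp
  qed
  have [measurable]: "(\<lambda>p. L2_set (fst (snd p)) {..<d}) \<in> borel_measurable S"
  proof -
    have "(\<lambda>p. \<Sum>i<d. (fst (snd p) i)\<^sup>2) \<in> borel_measurable S"
      by (intro borel_measurable_sum borel_measurable_power comp) auto
    then show ?thesis unfolding L2_set_def by measurable
  qed
  have [measurable]: "a' \<in> borel_measurable S" "b' \<in> borel_measurable S"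
    unfolding a'_def[abs_def] b'_def[abs_def] S_def by measurable
  have [measurable]: "(\<lambda>p. w' p i) \<in> borel_measurable S" if "i < d" for i
  proof -
    have "(\<lambda>p. w' p i) = (\<lambda>p. if L2_set (fst (snd p)) {..<d} \<le> R then fst (snd p) i else 0)"
      by (auto simp: w'_def)
    then show ?thesis using that by simp
  qed
  have N: "0 \<le> N" by (rule order_trans[OF abs_ge_zero a(2)])
  have rd: "ridge (distr P S T) d w' b' R"
  proof (intro ridge.intro ridge_axioms.intro)
    show "prob_space (distr P S T)" by (rule prob_space_distr) simp
    show "L2_set (w' \<theta>) {..<d} \<le> R" for \<theta> using R_nonneg by (auto simp: w'_def L2_set_def)
  qed simp_all
  moreover have "\<bar>a' p\<bar> \<le> N" for p using N by (auto simp: a'_def)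
  moreover have "g x = rint (distr P S T) d w' b' a' \<sigma> x" if x: "x \<in> Rd d" for x
  proof -
    have [measurable]: "(\<lambda>p. dot d (w' p) x) \<in> borel_measurable S"
      unfolding dot_def by (intro borel_measurable_sum borel_measurable_times) auto
    have "rint (distr P S T) d w' b' a' \<sigma> x = (\<integral>\<theta>. a' (T \<theta>) * \<sigma> (dot d (w' (T \<theta>)) x + b' (T \<theta>)) \<partial>P)"
      unfolding rint_def by (rule integral_distr) measurable
    also have "\<dots> = rint P d w b a \<sigma> x"
      unfolding rint_def
    proof (rule Bochner_Integration.integral_cong[OF refl])
      fix \<theta>
      have "L2_set (restrict (w \<theta>) {..<d}) {..<d} = L2_set (w \<theta>) {..<d}" by (simp add: L2_set_def)
      then have "w' (T \<theta>) = restrict (w \<theta>) {..<d}" using w_bound[of \<theta>] by (simp add: w'_def T_def)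
      moreover have "dot d (restrict (w \<theta>) {..<d}) x = dot d (w \<theta>) x" by (rule dot_cong) simp
      moreover have "a' (T \<theta>) = a \<theta>" using a(2)[of \<theta>] by (simp add: a'_def T_def abs_le_iff)
      ultimately show "a' (T \<theta>) * \<sigma> (dot d (w' (T \<theta>)) x + b' (T \<theta>)) = a \<theta> * \<sigma> (dot d (w \<theta>) x + b \<theta>)"
        by (simp add: b'_def T_def)
    qed
    finally show ?thesis using g[OF x] by simp
  qed
  ultimately show ?thesis unfolding ridge_rep_def
    by (intro exI[of _ "distr P S T"] exI[of _ w'] exI[of _ b'] exI[of _ a']) simp
qed

lemma ridge_rep_mono:
  assumes "ridge_rep \<sigma> d R N g" "R \<le> R'" "N \<le> N'"
  shows "ridge_rep \<sigma> d R' N' g"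
proof -
  obtain P :: "(real \<times> vec \<times> real) measure" and w b a where
    *: "ridge P d w b R" "a \<in> borel_measurable P" "\<And>\<theta>. \<bar>a \<theta>\<bar> \<le> N" "\<And>x. x \<in> Rd d \<Longrightarrow> g x = rint P d w b a \<sigma> x"
    by (rule ridge_repE[OF assms(1)]) auto
  interpret ridge P d w b R by fact
  have "ridge P d w b R'"
    by (intro ridge.intro ridge_axioms.intro prob_space_axioms w_measurable b_measurable order_trans[OF w_bound assms(2)])
  then show ?thesis unfolding ridge_rep_def
    by (intro exI[of _ P] exI[of _ w] exI[of _ b] exI[of _ a]) (simp add: * order_trans[OF *(3) assms(3)])
qed

lemma ridge_rep_cong:
  assumes "ridge_rep \<sigma> d R N g" "\<And>x. x \<in> Rd d \<Longrightarrow> g x = h x"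
  shows "ridge_rep \<sigma> d R N h"
proof -
  obtain P :: "(real \<times> vec \<times> real) measure" and w b a where
    *: "ridge P d w b R" "a \<in> borel_measurable P" "\<And>\<theta>. \<bar>a \<theta>\<bar> \<le> N" "\<And>x. x \<in> Rd d \<Longrightarrow> g x = rint P d w b a \<sigma> x"
    by (rule ridge_repE[OF assms(1)]) auto
  show ?thesis unfolding ridge_rep_def
    by (intro exI[of _ P] exI[of _ w] exI[of _ b] exI[of _ a]) (simp add: * assms(2)[symmetric])
qed

lemma ridge_rep_cmult:
  assumes "ridge_rep \<sigma> d R N g"
  shows "ridge_rep \<sigma> d R (\<bar>c\<bar> * N) (\<lambda>x. c * g x)"
proof -
  obtain P :: "(real \<times> vec \<times> real) measure" and w b a where
    *: "ridge P d w b R" "a \<in> borel_measurable P" "\<And>\<theta>. \<bar>a \<theta>\<bar> \<le> N" "\<And>x. x \<in> Rd d \<Longrightarrow> g x = rint P d w b a \<sigma> x"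
    by (rule ridge_repE[OF assms(1)]) auto
  have "c * g x = rint P d w b (\<lambda>\<theta>. c * a \<theta>) \<sigma> x" if "x \<in> Rd d" for x
    using *(4)[OF that] by (simp add: rint_def mult.assoc)
  moreover have "(\<lambda>\<theta>. c * a \<theta>) \<in> borel_measurable P" using *(2) by simp
  moreover have "\<bar>c * a \<theta>\<bar> \<le> \<bar>c\<bar> * N" for \<theta>
    unfolding abs_mult by (intro mult_left_mono *(3)) simp
  ultimately show ?thesis unfolding ridge_rep_def using *(1)
    by (intro exI[of _ P] exI[of _ w] exI[of _ b] exI[of _ "\<lambda>\<theta>. c * a \<theta>"]) simp
qed

lemma ridge_rep_zero:
  assumes "0 \<le> R" "0 \<le> N" "\<sigma> \<in> borel_measurable borel" shows "ridge_rep \<sigma> d R N (\<lambda>x. 0)"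
proof (rule ridge_repI)
  show "ridge (return borel (0::real)) d (\<lambda>_ _. 0) (\<lambda>_. 0) R"
    using assms by (intro ridge.intro ridge_axioms.intro prob_space_return) (auto simp: L2_set_def)
  show "(\<lambda>_. 0) \<in> borel_measurable (return borel (0::real))" "\<bar>0\<bar> \<le> N" using assms by auto
qed (use assms in \<open>auto simp: rint_def\<close>)

section \<open>Sums, products and derivatives of averages\<close>

lemma integral_pair_prob:
  fixes f :: "'a \<times> 'b \<Rightarrow> real"
  assumes P: "prob_space P" and Q: "prob_space Q"
    and f: "f \<in> borel_measurable (P \<Otimes>\<^sub>M Q)" and B: "\<And>p. \<bar>f p\<bar> \<le> B"
  shows "(\<integral>p. f p \<partial>(P \<Otimes>\<^sub>M Q)) = (\<integral>x. (\<integral>y. f (x, y) \<partial>Q) \<partial>P)"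
proof -
  interpret X: prob_space P by fact
  interpret Y: prob_space Q by fact
  interpret pair_prob_space P Q ..
  have "integrable (P \<Otimes>\<^sub>M Q) f" by (rule integrable_const_bound[where B=B]) (use f B in auto)
  from integral_fst'[OF this] show ?thesis by simp
qed

lemma prob_space_pair: "prob_space P \<Longrightarrow> prob_space Q \<Longrightarrow> prob_space (P \<Otimes>\<^sub>M Q)"
proof -
  assume "prob_space P" "prob_space Q"
  then interpret X: prob_space P + Y: prob_space Q by simp_all
  interpret pair_prob_space P Q ..
  show ?thesis by unfold_locales
qed

lemma abs_bound_mult: "\<bar>x\<bar> \<le> A \<Longrightarrow> \<bar>y\<bar> \<le> B \<Longrightarrow> \<bar>x * y\<bar> \<le> A * (B::real)"
  unfolding abs_mult by (intro mult_mono) auto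

text \<open>An iterated average of ridge functions is one average over the product of the parameter
  spaces. The operations below differ only in their choice of \<open>W\<close>, \<open>B\<close> and
  \<open>A\<close>.\<close>

lemma ridge_rep_superpose:
  fixes P :: "'a measure" and Q :: "'b measure"
  assumes P: "prob_space P" and Q: "prob_space Q" and \<sigma>: "bounded_smooth \<sigma>"
    and W: "\<And>i. i < d \<Longrightarrow> (\<lambda>p. W p i) \<in> borel_measurable (P \<Otimes>\<^sub>M Q)" and B: "B \<in> borel_measurable (P \<Otimes>\<^sub>M Q)"
    and A: "A \<in> borel_measurable (P \<Otimes>\<^sub>M Q)" "\<And>p. \<bar>A p\<bar> \<le> N" and WR: "\<And>p. L2_set (W p) {..<d} \<le> R"
    and g: "\<And>x. x \<in> Rd d \<Longrightarrow> g x = (\<integral>p. (\<integral>q. A (p, q) * \<sigma> (dot d (W (p, q)) x + B (p, q)) \<partial>Q) \<partial>P)"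
  shows "ridge (P \<Otimes>\<^sub>M Q) d W B R" "x \<in> Rd d \<Longrightarrow> g x = rint (P \<Otimes>\<^sub>M Q) d W B A \<sigma> x" "ridge_rep \<sigma> d R N g"
proof -
  note \<sigma>m [measurable] = bounded_smooth_borel[OF \<sigma>]
  show r: "ridge (P \<Otimes>\<^sub>M Q) d W B R"
    using W B WR by (intro ridge.intro ridge_axioms.intro prob_space_pair P Q) auto
  interpret ridge "P \<Otimes>\<^sub>M Q" d W B R by (rule r)
  note [measurable] = A(1)
  obtain C where C: "0 < C" "\<And>x. \<bar>\<sigma> x\<bar> \<le> C" using bounded_smooth_has_deriv(3)[OF \<sigma>] by blast
  have eq: "g x = rint (P \<Otimes>\<^sub>M Q) d W B A \<sigma> x" if x: "x \<in> Rd d" for x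
    unfolding rint_def g[OF x]
    by (subst integral_pair_prob[OF P Q, where B="N * C"]) (auto intro!: abs_bound_mult A C)
  then show "x \<in> Rd d \<Longrightarrow> g x = rint (P \<Otimes>\<^sub>M Q) d W B A \<sigma> x" .
  show "ridge_rep \<sigma> d R N g" by (rule ridge_repI[OF r A \<sigma>m eq])
qed

lemma integral_pair_mult:
  fixes f :: "'a \<Rightarrow> real" and g :: "'b \<Rightarrow> real"
  assumes P: "prob_space P" and Q: "prob_space Q"
    and [measurable]: "f \<in> borel_measurable P" "g \<in> borel_measurable Q" and B: "\<And>p. \<bar>f p\<bar> \<le> B" "\<And>q. \<bar>g q\<bar> \<le> C"
  shows "(\<integral>p. f (fst p) * g (snd p) \<partial>(P \<Otimes>\<^sub>M Q)) = (\<integral>x. f x \<partial>P) * (\<integral>y. g y \<partial>Q)"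
  by (subst integral_pair_prob[OF P Q, where B="B * C"]) (auto intro!: abs_bound_mult B)

text \<open>A coin decides which of the two averages is sampled. Its bias is proportional to
  \<open>N1\<close> and \<open>N2\<close>, which makes both rescaled coefficients bounded by exactly
  \<open>N1 + N2\<close>.\<close>

lemma ridge_rep_add:
  assumes \<sigma>: "bounded_smooth \<sigma>" and g1: "ridge_rep \<sigma> d R N1 g1" and g2: "ridge_rep \<sigma> d R N2 g2"
  shows "ridge_rep \<sigma> d R (N1 + N2) (\<lambda>x. g1 x + g2 x)"
proof -
  obtain P1 :: "(real \<times> vec \<times> real) measure" and w1 b1 a1 where
    1: "ridge P1 d w1 b1 R" "a1 \<in> borel_measurable P1" "\<And>\<theta>. \<bar>a1 \<theta>\<bar> \<le> N1" "\<And>x. x \<in> Rd d \<Longrightarrow> g1 x = rint P1 d w1 b1 a1 \<sigma> x"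
    by (rule ridge_repE[OF g1]) auto
  obtain P2 :: "(real \<times> vec \<times> real) measure" and w2 b2 a2 where
    2: "ridge P2 d w2 b2 R" "a2 \<in> borel_measurable P2" "\<And>\<theta>. \<bar>a2 \<theta>\<bar> \<le> N2" "\<And>x. x \<in> Rd d \<Longrightarrow> g2 x = rint P2 d w2 b2 a2 \<sigma> x"
    by (rule ridge_repE[OF g2]) auto
  interpret P1: ridge P1 d w1 b1 R by fact
  interpret P2: ridge P2 d w2 b2 R by fact
  note [measurable] = 1(2) 2(2) P1.w_measurable P2.w_measurable bounded_smooth_borel[OF \<sigma>]
  have N: "0 \<le> N1" "0 \<le> N2" by (rule ridge_rep_nonneg(2)[OF g1] ridge_rep_nonneg(2)[OF g2])+
  define p where "p = N1 / (N1 + N2)"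
  have p: "p \<in> {0..1}" using N by (auto simp: p_def divide_le_eq)
  let ?B = "measure_pmf (bernoulli_pmf p)" and ?Q = "P1 \<Otimes>\<^sub>M P2"
  have Q: "prob_space ?Q" by (intro prob_space_pair) unfold_locales
  have B: "prob_space ?B" by unfold_locales
  obtain C where C: "0 < C" "\<And>x. \<bar>\<sigma> x\<bar> \<le> C" using bounded_smooth_has_deriv(3)[OF \<sigma>] by blast
  \<comment> \<open>The inverse of the probability \<open>p\<close> of the first branch, and below
    that of the second. If \<open>N1 = 0\<close>, the quotient is 0, but then \<open>a1\<close>
    vanishes as well.\<close>
  define k1 where "k1 = (N1 + N2) / N1"
  define k2 where "k2 = (N1 + N2) / N2"
  have k: "p * (k1 * a1 \<theta>) = a1 \<theta>" "(1 - p) * (k2 * a2 \<theta>) = a2 \<theta>" "\<bar>k1 * a1 \<theta>\<bar> \<le> N1 + N2" "\<bar>k2 * a2 \<theta>\<bar> \<le> N1 + N2" for \<theta>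
  proof -
    have "N1 = 0 \<Longrightarrow> a1 \<theta> = 0" "N2 = 0 \<Longrightarrow> a2 \<theta> = 0" using 1(3)[of \<theta>] 2(3)[of \<theta>] by auto
    moreover have "p * k1 = 1" if "N1 \<noteq> 0"
      using that N by (simp add: p_def k1_def add_nonneg_eq_0_iff)
    moreover have "(1 - p) * k2 = 1" if "N2 \<noteq> 0"
    proof -
      have "1 - p = N2 / (N1 + N2)" using that N by (simp add: p_def add_nonneg_eq_0_iff field_simps)
      then show ?thesis using that N by (simp add: k2_def add_nonneg_eq_0_iff)
    qed
    ultimately show "p * (k1 * a1 \<theta>) = a1 \<theta>" "(1 - p) * (k2 * a2 \<theta>) = a2 \<theta>"
      by (metis mult.assoc mult_1 mult_zero_right)+
    have "\<bar>k1 * a1 \<theta>\<bar> \<le> k1 * N1" "\<bar>k2 * a2 \<theta>\<bar> \<le> k2 * N2"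
    proof -
      have "0 \<le> k1" "0 \<le> k2" using N by (auto simp: k1_def k2_def)
      then show "\<bar>k1 * a1 \<theta>\<bar> \<le> k1 * N1" "\<bar>k2 * a2 \<theta>\<bar> \<le> k2 * N2"
        using 1(3)[of \<theta>] 2(3)[of \<theta>] by (simp_all add: abs_mult mult_left_mono)
    qed
    moreover have "k1 * N1 \<le> N1 + N2" "k2 * N2 \<le> N1 + N2" using N by (auto simp: k1_def k2_def)
    ultimately show "\<bar>k1 * a1 \<theta>\<bar> \<le> N1 + N2" "\<bar>k2 * a2 \<theta>\<bar> \<le> N1 + N2" by linarith+
  qed
  have fst_m: "Measurable.pred (?B \<Otimes>\<^sub>M ?Q) fst"
    by (rule measurable_compose[OF measurable_fst]) simp
  show ?thesis
  proof (rule ridge_rep_superpose(3)[OF B Q \<sigma>])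
    show "(\<lambda>q. (if fst q then w1 (fst (snd q)) else w2 (snd (snd q))) i) \<in> borel_measurable (?B \<Otimes>\<^sub>M ?Q)" if "i < d" for i
    proof -
      have "(\<lambda>q. if fst q then w1 (fst (snd q)) i else w2 (snd (snd q)) i) \<in> borel_measurable (?B \<Otimes>\<^sub>M ?Q)"
      proof (rule measurable_If)
        have "(\<lambda>\<theta>. w1 \<theta> i) \<in> borel_measurable P1" "(\<lambda>\<theta>. w2 \<theta> i) \<in> borel_measurable P2"
          using that P1.w_measurable P2.w_measurable by auto
        then show "(\<lambda>q. w1 (fst (snd q)) i) \<in> borel_measurable (?B \<Otimes>\<^sub>M ?Q)"
          "(\<lambda>q. w2 (snd (snd q)) i) \<in> borel_measurable (?B \<Otimes>\<^sub>M ?Q)"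
          by measurable
      qed (use fst_m in \<open>simp add: pred_def\<close>)
      then show ?thesis by (simp add: if_distrib[of "\<lambda>f. f i"])
    qed
    show "(\<lambda>q. if fst q then b1 (fst (snd q)) else b2 (snd (snd q))) \<in> borel_measurable (?B \<Otimes>\<^sub>M ?Q)"
      by (rule measurable_If) (use fst_m in \<open>simp_all add: pred_def\<close>)
    show "(\<lambda>q. if fst q then k1 * a1 (fst (snd q)) else k2 * a2 (snd (snd q))) \<in> borel_measurable (?B \<Otimes>\<^sub>M ?Q)"
      by (rule measurable_If) (use fst_m in \<open>simp_all add: pred_def\<close>)
    show "\<bar>if fst q then k1 * a1 (fst (snd q)) else k2 * a2 (snd (snd q))\<bar> \<le> N1 + N2" for q
      using k by auto
    show "L2_set (if fst q then w1 (fst (snd q)) else w2 (snd (snd q))) {..<d} \<le> R" for q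
      using P1.w_bound P2.w_bound by auto
    fix x assume x: "x \<in> Rd d"
    have bd1: "\<bar>a1 \<theta> * \<sigma> (dot d (w1 \<theta>) x + b1 \<theta>)\<bar> \<le> N1 * C" for \<theta>
      by (rule abs_bound_mult[OF 1(3) C(2)])
    have bd2: "\<bar>a2 \<theta> * \<sigma> (dot d (w2 \<theta>) x + b2 \<theta>)\<bar> \<le> N2 * C" for \<theta>
      by (rule abs_bound_mult[OF 2(3) C(2)])
    have i1: "(\<integral>q. a1 (fst q) * \<sigma> (dot d (w1 (fst q)) x + b1 (fst q)) \<partial>?Q) = g1 x"
      using integral_pair_mult[where f="\<lambda>\<theta>. a1 \<theta> * \<sigma> (dot d (w1 \<theta>) x + b1 \<theta>)" and B="N1 * C" and g="\<lambda>_. 1" and C=1, OF P1.prob_space_axioms P2.prob_space_axioms _ _ bd1]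
      by (simp add: 1(4)[OF x] rint_def P2.prob_space)
    have i2: "(\<integral>q. a2 (snd q) * \<sigma> (dot d (w2 (snd q)) x + b2 (snd q)) \<partial>?Q) = g2 x"
      using integral_pair_mult[where g="\<lambda>\<theta>. a2 \<theta> * \<sigma> (dot d (w2 \<theta>) x + b2 \<theta>)" and C="N2 * C" and f="\<lambda>_. 1" and B=1, OF P1.prob_space_axioms P2.prob_space_axioms _ _ _ bd2]
      by (simp add: 2(4)[OF x] rint_def P1.prob_space)
    have e1: "(\<integral>q. k1 * a1 (fst q) * \<sigma> (dot d (w1 (fst q)) x + b1 (fst q)) \<partial>?Q) = k1 * g1 x"
      unfolding i1[symmetric] by (simp add: mult.assoc)
    have e2: "(\<integral>q. k2 * a2 (snd q) * \<sigma> (dot d (w2 (snd q)) x + b2 (snd q)) \<partial>?Q) = k2 * g2 x"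
      unfolding i2[symmetric] by (simp add: mult.assoc)
    have "(\<integral>\<theta>. (p * k1) * (a1 \<theta> * \<sigma> (dot d (w1 \<theta>) x + b1 \<theta>)) \<partial>P1) = g1 x"
      unfolding 1(4)[OF x] rint_def
      by (intro Bochner_Integration.integral_cong refl) (metis k(1) mult.assoc)
    then have "(p * k1) * g1 x = g1 x" by (simp add: 1(4)[OF x] rint_def)
    moreover have "(\<integral>\<theta>. ((1 - p) * k2) * (a2 \<theta> * \<sigma> (dot d (w2 \<theta>) x + b2 \<theta>)) \<partial>P2) = g2 x"
      unfolding 2(4)[OF x] rint_def
      by (intro Bochner_Integration.integral_cong refl) (metis k(2) mult.assoc)
    then have "((1 - p) * k2) * g2 x = g2 x" by (simp add: 2(4)[OF x] rint_def)
    ultimately have "p * (k1 * g1 x) + (1 - p) * (k2 * g2 x) = g1 x + g2 x" by (simp only: mult.assoc)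
    then show "g1 x + g2 x = (\<integral>\<beta>. (\<integral>q. (if fst (\<beta>, q) then k1 * a1 (fst (snd (\<beta>, q))) else k2 * a2 (snd (snd (\<beta>, q)))) *
        \<sigma> (dot d (if fst (\<beta>, q) then w1 (fst (snd (\<beta>, q))) else w2 (snd (snd (\<beta>, q)))) x +
           (if fst (\<beta>, q) then b1 (fst (snd (\<beta>, q))) else b2 (snd (snd (\<beta>, q))))) \<partial>?Q) \<partial>?B)"
      using p by (simp add: e1 e2 mult.commute)
  qed
qed

lemma ridge_rep_sum:
  assumes "bounded_smooth \<sigma>" "finite I" "\<And>j. j \<in> I \<Longrightarrow> ridge_rep \<sigma> d R N (g j)" "0 \<le> R" "0 \<le> N"
  shows "ridge_rep \<sigma> d R (real (card I) * N) (\<lambda>x. \<Sum>j\<in>I. g j x)"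
  using assms(2,3)
proof (induction I rule: finite_induct)
  case empty
  then show ?case using ridge_rep_zero[OF assms(4) _ bounded_smooth_borel[OF assms(1)], of 0] by simp
next
  case (insert j I)
  then show ?case using ridge_rep_add[OF assms(1), of d R N "g j" "real (card I) * N" "\<lambda>x. \<Sum>j\<in>I. g j x"]
    by (simp add: algebra_simps)
qed

lemma ridge_rep_smooth:
  assumes \<sigma>: "bounded_smooth \<sigma>" and g: "ridge_rep \<sigma> d R N g"
  shows "smooth d g"
    and "(\<And>y. \<bar>\<sigma> y\<bar> \<le> C) \<Longrightarrow> x \<in> Rd d \<Longrightarrow> \<bar>g x\<bar> \<le> N * C"
    and "(\<And>y. \<bar>deriv \<sigma> y\<bar> \<le> C) \<Longrightarrow> x \<in> Rd d \<Longrightarrow> i < d \<Longrightarrow> \<bar>partial_deriv i g x\<bar> \<le> N * R * C"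
proof -
  obtain P :: "(real \<times> vec \<times> real) measure" and w b a where
    *: "ridge P d w b R" "a \<in> borel_measurable P" "\<And>\<theta>. \<bar>a \<theta>\<bar> \<le> N" "\<And>x. x \<in> Rd d \<Longrightarrow> g x = rint P d w b a \<sigma> x"
    by (rule ridge_repE[OF g]) auto
  interpret ridge P d w b R by fact
  show "smooth d g" by (rule smooth_cong[OF rint_smooth[OF *(2,3) \<sigma>]]) (simp add: *)
  show "(\<And>y. \<bar>\<sigma> y\<bar> \<le> C) \<Longrightarrow> x \<in> Rd d \<Longrightarrow> \<bar>g x\<bar> \<le> N * C"
    unfolding *(4) by (rule rint_bound[OF *(2,3) \<sigma>])
  assume C: "\<And>y. \<bar>deriv \<sigma> y\<bar> \<le> C" and x: "x \<in> Rd d" and i: "i < d"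
  show "\<bar>partial_deriv i g x\<bar> \<le> N * R * C"
  proof -
    have "partial_deriv i g x = rint P d w b (\<lambda>\<theta>. a \<theta> * w \<theta> i) (deriv \<sigma>) x"
      using partial_deriv_cong[of d g "rint P d w b a \<sigma>" i x] *(4) i x rint_pd[OF *(2,3) \<sigma> i x] by simp
    then show ?thesis
      using rint_bound[OF rint_coeff_bound[OF *(2,3) i] bounded_smooth_has_deriv(2)[OF \<sigma>] C] by simp
  qed
qed

text \<open>In the representation of the two-variable product the arguments of \<sigma> are affine,
  so inserting two affine functions of \<open>x\<close> leaves an affine function of
  \<open>x\<close>. Its weight is a combination of the two weights with factors of modulus at most
  \<open>Rm\<close>.\<close>

lemma ridge_rep_mult:
  assumes \<sigma>: "bounded_smooth \<sigma>" and m: "ridge_rep \<sigma> 2 Rm Nm (\<lambda>y. \<sigma> (y 0) * \<sigma> (y 1))"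
    and g1: "ridge_rep \<sigma> d R1 N1 g1" and g2: "ridge_rep \<sigma> d R2 N2 g2"
  shows "ridge_rep \<sigma> d (Rm * (R1 + R2)) (N1 * N2 * Nm) (\<lambda>x. g1 x * g2 x)"
proof -
  obtain P1 :: "(real \<times> vec \<times> real) measure" and w1 b1 a1 where
    1: "ridge P1 d w1 b1 R1" "a1 \<in> borel_measurable P1" "\<And>\<theta>. \<bar>a1 \<theta>\<bar> \<le> N1" "\<And>x. x \<in> Rd d \<Longrightarrow> g1 x = rint P1 d w1 b1 a1 \<sigma> x"
    by (rule ridge_repE[OF g1]) auto
  obtain P2 :: "(real \<times> vec \<times> real) measure" and w2 b2 a2 where
    2: "ridge P2 d w2 b2 R2" "a2 \<in> borel_measurable P2" "\<And>\<theta>. \<bar>a2 \<theta>\<bar> \<le> N2" "\<And>x. x \<in> Rd d \<Longrightarrow> g2 x = rint P2 d w2 b2 a2 \<sigma> x"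
    by (rule ridge_repE[OF g2]) auto
  obtain Q :: "(real \<times> vec \<times> real) measure" and w b a where
    3: "ridge Q 2 w b Rm" "a \<in> borel_measurable Q" "\<And>\<theta>. \<bar>a \<theta>\<bar> \<le> Nm"
      "\<And>y. y \<in> Rd 2 \<Longrightarrow> \<sigma> (y 0) * \<sigma> (y 1) = rint Q 2 w b a \<sigma> y"
    by (rule ridge_repE[OF m]) auto
  interpret P1: ridge P1 d w1 b1 R1 by fact
  interpret P2: ridge P2 d w2 b2 R2 by fact
  interpret Q: ridge Q 2 w b Rm by fact
  note [measurable] = 1(2) 2(2) 3(2) bounded_smooth_borel[OF \<sigma>]
  have wm [measurable]: "(\<lambda>\<theta>. w \<theta> 0) \<in> borel_measurable Q" "(\<lambda>\<theta>. w \<theta> (Suc 0)) \<in> borel_measurable Q"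
    by (intro Q.w_measurable, simp)+
  obtain C where C: "0 < C" "\<And>x. \<bar>\<sigma> x\<bar> \<le> C" using bounded_smooth_has_deriv(3)[OF \<sigma>] by blast
  \<comment> \<open>The representation on \<open>Rd 2\<close>, evaluated at the point with
    coordinates \<open>u\<close> and \<open>v\<close>.\<close>
  have h: "\<sigma> u * \<sigma> v = (\<integral>q. a q * \<sigma> (w q 0 * u + w q (Suc 0) * v + b q) \<partial>Q)" for u v
  proof -
    have "(\<lambda>i\<in>{..<2}. if i = 0 then u else v) \<in> Rd 2" by auto
    from 3(4)[OF this] show ?thesis by (simp add: rint_def dot_def numeral_2_eq_2)
  qed
  have P12: "prob_space (P1 \<Otimes>\<^sub>M P2)" by (intro prob_space_pair P1.prob_space_axioms P2.prob_space_axioms)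
  define W where "W = (\<lambda>pq::((real \<times> vec \<times> real) \<times> (real \<times> vec \<times> real)) \<times> (real \<times> vec \<times> real).
      \<lambda>i. w (snd pq) 0 * w1 (fst (fst pq)) i + w (snd pq) (Suc 0) * w2 (snd (fst pq)) i)"
  define B where "B = (\<lambda>pq::((real \<times> vec \<times> real) \<times> (real \<times> vec \<times> real)) \<times> (real \<times> vec \<times> real).
      w (snd pq) 0 * b1 (fst (fst pq)) + w (snd pq) (Suc 0) * b2 (snd (fst pq)) + b (snd pq))"
  define A where "A = (\<lambda>pq::((real \<times> vec \<times> real) \<times> (real \<times> vec \<times> real)) \<times> (real \<times> vec \<times> real).
      a1 (fst (fst pq)) * a2 (snd (fst pq)) * a (snd pq))"
  show ?thesis
  proof (rule ridge_rep_superpose(3)[OF P12 Q.prob_space_axioms \<sigma>, where W=W and B=B and A=A])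
    show "(\<lambda>p. W p i) \<in> borel_measurable ((P1 \<Otimes>\<^sub>M P2) \<Otimes>\<^sub>M Q)" if "i < d" for i
    proof -
      have [measurable]: "(\<lambda>\<theta>. w1 \<theta> i) \<in> borel_measurable P1" "(\<lambda>\<theta>. w2 \<theta> i) \<in> borel_measurable P2"
        using that P1.w_measurable P2.w_measurable by auto
      show ?thesis unfolding W_def by measurable
    qed
    show "B \<in> borel_measurable ((P1 \<Otimes>\<^sub>M P2) \<Otimes>\<^sub>M Q)" "A \<in> borel_measurable ((P1 \<Otimes>\<^sub>M P2) \<Otimes>\<^sub>M Q)"
      unfolding B_def A_def by measurable
    show "\<bar>A pq\<bar> \<le> N1 * N2 * Nm" for pq
      unfolding A_def by (intro abs_bound_mult 1 2 3)
    show "L2_set (W pq) {..<d} \<le> Rm * (R1 + R2)" for pq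
    proof -
      let ?p = "fst (fst pq)" and ?p' = "snd (fst pq)" and ?q = "snd pq"
      have "L2_set (W pq) {..<d} \<le> L2_set (\<lambda>i. w ?q 0 * w1 ?p i) {..<d} + L2_set (\<lambda>i. w ?q (Suc 0) * w2 ?p' i) {..<d}"
        unfolding W_def by (rule L2_set_triangle_ineq)
      also have "\<dots> = \<bar>w ?q 0\<bar> * L2_set (w1 ?p) {..<d} + \<bar>w ?q (Suc 0)\<bar> * L2_set (w2 ?p') {..<d}"
        by (simp add: L2_set_cmult)
      also have "\<dots> \<le> Rm * R1 + Rm * R2"
        by (intro add_mono mult_mono Q.w_component_bound P1.w_bound P2.w_bound L2_set_nonneg Q.R_nonneg) auto
      finally show ?thesis by (simp add: distrib_left)
    qed
    fix x assume x: "x \<in> Rd d"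
    let ?z1 = "\<lambda>\<theta>. dot d (w1 \<theta>) x + b1 \<theta>" and ?z2 = "\<lambda>\<theta>. dot d (w2 \<theta>) x + b2 \<theta>"
    have arg: "dot d (W (p, q)) x + B (p, q) = w q 0 * ?z1 (fst p) + w q (Suc 0) * ?z2 (snd p) + b q" for p q
      by (simp only: W_def B_def fst_conv snd_conv dot_add dot_cmult) (simp add: algebra_simps)
    have "(\<integral>q. A (p, q) * \<sigma> (dot d (W (p, q)) x + B (p, q)) \<partial>Q) =
        (a1 (fst p) * \<sigma> (?z1 (fst p))) * (a2 (snd p) * \<sigma> (?z2 (snd p)))" for p
    proof -
      have "(\<integral>q. A (p, q) * \<sigma> (dot d (W (p, q)) x + B (p, q)) \<partial>Q) =
          (\<integral>q. (a1 (fst p) * a2 (snd p)) * (a q * \<sigma> (w q 0 * ?z1 (fst p) + w q (Suc 0) * ?z2 (snd p) + b q)) \<partial>Q)"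
        unfolding arg by (intro Bochner_Integration.integral_cong refl) (simp add: A_def mult.assoc)
      also have "\<dots> = (a1 (fst p) * a2 (snd p)) * (\<sigma> (?z1 (fst p)) * \<sigma> (?z2 (snd p)))"
        unfolding h by (rule integral_mult_right_zero)
      finally show ?thesis by (simp only: ac_simps)
    qed
    then have "(\<integral>p. (\<integral>q. A (p, q) * \<sigma> (dot d (W (p, q)) x + B (p, q)) \<partial>Q) \<partial>(P1 \<Otimes>\<^sub>M P2)) =
       (\<integral>p. (a1 (fst p) * \<sigma> (?z1 (fst p))) * (a2 (snd p) * \<sigma> (?z2 (snd p))) \<partial>(P1 \<Otimes>\<^sub>M P2))"
      by simp
    also have "\<dots> = g1 x * g2 x"
      unfolding 1(4)[OF x] 2(4)[OF x] rint_def
      by (rule integral_pair_mult[OF P1.prob_space_axioms P2.prob_space_axioms, where B="N1 * C" and C="N2 * C"])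
        (measurable, (intro abs_bound_mult 1 2 C)+)
    finally show "g1 x * g2 x = (\<integral>p. (\<integral>q. A (p, q) * \<sigma> (dot d (W (p, q)) x + B (p, q)) \<partial>Q) \<partial>(P1 \<Otimes>\<^sub>M P2))" ..
  qed
qed

text \<open>The chain rule produces the component \<open>w \<theta> i\<close>, hence the factor
  \<open>R\<close> in the coefficient bound; the profile \<sigma>' is then expressed through
  \<sigma> again, which scales the weights by at most \<open>R1\<close>.\<close>

lemma ridge_rep_deriv:
  assumes \<sigma>: "bounded_smooth \<sigma>" and h: "ridge_rep \<sigma> 1 R1 N1 (\<lambda>y. deriv \<sigma> (y 0))"
    and g: "ridge_rep \<sigma> d R N g" and i: "i < d"
  shows "ridge_rep \<sigma> d (R1 * R) (N * R * N1) (partial_deriv i g)"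
proof -
  obtain P :: "(real \<times> vec \<times> real) measure" and w b a where
    *: "ridge P d w b R" "a \<in> borel_measurable P" "\<And>\<theta>. \<bar>a \<theta>\<bar> \<le> N" "\<And>x. x \<in> Rd d \<Longrightarrow> g x = rint P d w b a \<sigma> x"
    by (rule ridge_repE[OF g]) auto
  obtain Q :: "(real \<times> vec \<times> real) measure" and w' b' a' where
    3: "ridge Q 1 w' b' R1" "a' \<in> borel_measurable Q" "\<And>\<theta>. \<bar>a' \<theta>\<bar> \<le> N1"
      "\<And>y. y \<in> Rd 1 \<Longrightarrow> deriv \<sigma> (y 0) = rint Q 1 w' b' a' \<sigma> y"
    by (rule ridge_repE[OF h]) auto
  interpret P: ridge P d w b R by fact
  interpret Q: ridge Q 1 w' b' R1 by fact
  note [measurable] = *(2) 3(2) bounded_smooth_borel[OF \<sigma>] P.w_measurable[OF i]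
  have wm [measurable]: "(\<lambda>\<theta>. w' \<theta> 0) \<in> borel_measurable Q"
    by (intro Q.w_measurable) simp
  have \<sigma>': "deriv \<sigma> u = (\<integral>q. a' q * \<sigma> (w' q 0 * u + b' q) \<partial>Q)" for u
  proof -
    have "(\<lambda>i\<in>{..<1}. u) \<in> Rd 1" by auto
    from 3(4)[OF this] show ?thesis by (simp add: rint_def dot_def)
  qed
  define W where "W = (\<lambda>pq::(real \<times> vec \<times> real) \<times> (real \<times> vec \<times> real). \<lambda>j. w' (snd pq) 0 * w (fst pq) j)"
  define B where "B = (\<lambda>pq::(real \<times> vec \<times> real) \<times> (real \<times> vec \<times> real). w' (snd pq) 0 * b (fst pq) + b' (snd pq))"
  define A where "A = (\<lambda>pq::(real \<times> vec \<times> real) \<times> (real \<times> vec \<times> real). a (fst pq) * w (fst pq) i * a' (snd pq))"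
  show ?thesis
  proof (rule ridge_rep_superpose(3)[OF P.prob_space_axioms Q.prob_space_axioms \<sigma>, where W=W and B=B and A=A])
    show "(\<lambda>p. W p j) \<in> borel_measurable (P \<Otimes>\<^sub>M Q)" if "j < d" for j
    proof -
      have [measurable]: "(\<lambda>\<theta>. w \<theta> j) \<in> borel_measurable P" using that P.w_measurable by auto
      show ?thesis unfolding W_def by measurable
    qed
    show "B \<in> borel_measurable (P \<Otimes>\<^sub>M Q)" "A \<in> borel_measurable (P \<Otimes>\<^sub>M Q)"
      unfolding B_def A_def by measurable
    show "\<bar>A pq\<bar> \<le> N * R * N1" for pq
      unfolding A_def by (intro abs_bound_mult * 3 P.w_component_bound i)
    show "L2_set (W pq) {..<d} \<le> R1 * R" for pq
      unfolding W_def L2_set_cmult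
      by (intro mult_mono Q.w_component_bound P.w_bound L2_set_nonneg Q.R_nonneg) auto
    fix x assume x: "x \<in> Rd d"
    let ?z = "\<lambda>\<theta>. dot d (w \<theta>) x + b \<theta>"
    have arg: "dot d (W (p, q)) x + B (p, q) = w' q 0 * ?z p + b' q" for p q
      by (simp only: W_def B_def fst_conv snd_conv dot_cmult) (simp add: algebra_simps)
    have "(\<integral>q. A (p, q) * \<sigma> (dot d (W (p, q)) x + B (p, q)) \<partial>Q) = a p * w p i * deriv \<sigma> (?z p)" for p
    proof -
      have "(\<integral>q. A (p, q) * \<sigma> (dot d (W (p, q)) x + B (p, q)) \<partial>Q) =
          (\<integral>q. (a p * w p i) * (a' q * \<sigma> (w' q 0 * ?z p + b' q)) \<partial>Q)"
        unfolding arg by (intro Bochner_Integration.integral_cong refl) (simp add: A_def mult.assoc)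
      also have "\<dots> = (a p * w p i) * deriv \<sigma> (?z p)"
        unfolding \<sigma>' by (rule integral_mult_right_zero)
      finally show ?thesis .
    qed
    then show "partial_deriv i g x = (\<integral>p. (\<integral>q. A (p, q) * \<sigma> (dot d (W (p, q)) x + B (p, q)) \<partial>Q) \<partial>P)"
      using partial_deriv_cong[of d g "rint P d w b a \<sigma>" i x] *(4) i x P.rint_pd[OF *(2,3) \<sigma> i x]
      by (simp add: rint_def)
  qed
qed

section \<open>The resolvent of the Laplacian on ridge functions\<close>

text \<open>The classical form of \<open>(1 - \<Delta>) w = g\<close>. It makes sense for functions
  that are merely bounded; \<open>helmholtz_weak\<close> recovers the weak form once square
  integrability is known.\<close>

definition helmholtz :: "nat \<Rightarrow> (vec \<Rightarrow> real) \<Rightarrow> (vec \<Rightarrow> real) \<Rightarrow> bool" where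
  "helmholtz d w g \<longleftrightarrow> (\<forall>x\<in>Rd d. w x - (\<Sum>i<d. partial_deriv i (partial_deriv i w) x) = g x)"

lemma helmholtz_lincomb:
  assumes "smooth d w1" "smooth d w2" "helmholtz d w1 g1" "helmholtz d w2 g2"
  shows "helmholtz d (\<lambda>x. a * w1 x + b * w2 x) (\<lambda>x. a * g1 x + b * g2 x)"
  unfolding helmholtz_def
proof
  fix x assume x: "x \<in> Rd d"
  have pd: "partial_deriv i (\<lambda>x. a * v1 x + b * v2 x) y = a * partial_deriv i v1 y + b * partial_deriv i v2 y"
    if "smooth d v1" "smooth d v2" "i < d" "y \<in> Rd d" for v1 v2 i y
    using pd_add[OF smooth_cmult[OF that(1), of a] smooth_cmult[OF that(2), of b] that(3,4)]
      pd_cmult[OF that(1,3,4), of a] pd_cmult[OF that(2,3,4), of b] by simp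
  have "partial_deriv i (partial_deriv i (\<lambda>x. a * w1 x + b * w2 x)) x =
      a * partial_deriv i (partial_deriv i w1) x + b * partial_deriv i (partial_deriv i w2) x" if i: "i < d" for i
    using partial_deriv_cong[OF pd[OF assms(1,2) i] i x] pd[OF smooth_pd[OF assms(1) i] smooth_pd[OF assms(2) i] i x] by simp
  then have "(\<Sum>i<d. partial_deriv i (partial_deriv i (\<lambda>x. a * w1 x + b * w2 x)) x) =
      a * (\<Sum>i<d. partial_deriv i (partial_deriv i w1) x) + b * (\<Sum>i<d. partial_deriv i (partial_deriv i w2) x)"
    by (simp add: sum.distrib sum_distrib_left)
  moreover have "g1 x = w1 x - (\<Sum>i<d. partial_deriv i (partial_deriv i w1) x)"
    "g2 x = w2 x - (\<Sum>i<d. partial_deriv i (partial_deriv i w2) x)"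
    using assms(3,4) x by (auto simp: helmholtz_def)
  ultimately show "a * w1 x + b * w2 x - (\<Sum>i<d. partial_deriv i (partial_deriv i (\<lambda>x. a * w1 x + b * w2 x)) x) = a * g1 x + b * g2 x"
    by (simp only:) (simp add: algebra_simps)
qed

lemma helmholtz_cong: "helmholtz d w g \<Longrightarrow> (\<And>x. x \<in> Rd d \<Longrightarrow> g x = h x) \<Longrightarrow> helmholtz d w h"
  by (simp add: helmholtz_def)

abbreviation exp_dist :: "real measure" where
  "exp_dist \<equiv> density lborel (exponential_density 1)"

lemma prob_space_exp_dist: "prob_space exp_dist"
  by (rule prob_space_exponential_density) simp

text \<open>Applied to \<open>q(t) = s(y + r t)\<close> and to \<open>q(t) = s(y - r t)\<close>: the first-order terms cancel in the sum, so the average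
  over \<open>\<plusminus>t\<close> is inverted by \<open>1 - r\<^sup>2 \<partial>\<^sup>2\<close>.\<close>

lemma exp_dist_resolvent:
  fixes q :: "real \<Rightarrow> real"
  assumes q: "\<And>x. (q has_real_derivative q' x) (at x)" and q': "\<And>x. (q' has_real_derivative q'' x) (at x)"
    and c: "continuous_on UNIV q''" and B: "\<And>x. \<bar>q x\<bar> \<le> B" "\<And>x. \<bar>q' x\<bar> \<le> B" "\<And>x. \<bar>q'' x\<bar> \<le> B"
  shows "(\<integral>t. q t - q'' t \<partial>exp_dist) = q 0 + q' 0"
proof -
  have cq: "continuous_on UNIV q" "continuous_on UNIV q'"
    using q q' by (auto intro!: continuous_at_imp_continuous_on DERIV_isCont)
  have [measurable]: "q \<in> borel_measurable borel" "q'' \<in> borel_measurable borel"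
    using cq c by (auto intro: borel_measurable_continuous_onI)
  let ?f = "\<lambda>t. exp (- t) * (q t - q'' t)"
  have int: "integrable lborel (exponential_density 1)"
  proof -
    interpret prob_space exp_dist by (rule prob_space_exp_dist)
    have "integrable exp_dist (\<lambda>_. 1::real)" by simp
    then show ?thesis by (subst (asm) integrable_real_density) (auto simp: exponential_density_nonneg)
  qed
  have e1: "(\<integral>t. q t - q'' t \<partial>exp_dist) = (\<integral>t. exponential_density 1 t * (q t - q'' t) \<partial>lborel)"
    by (subst integral_real_density) (auto simp: exponential_density_nonneg)
  have l1: "(\<lambda>n. \<integral>t. ?f t * indicator {0..real n} t \<partial>lborel) \<longlonglongrightarrow> (\<integral>t. exponential_density 1 t * (q t - q'' t) \<partial>lborel)"
  proof (rule integral_dominated_convergence)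
    show "integrable lborel (\<lambda>t. exponential_density 1 t * (2 * B))" using int by simp
    show "AE t in lborel. norm (?f t * indicator {0..real n} t) \<le> exponential_density 1 t * (2 * B)" for n
    proof (rule AE_I2)
      fix t :: real
      have "\<bar>q t - q'' t\<bar> \<le> 2 * B" using B(1)[of t] B(3)[of t] by linarith
      moreover have "0 \<le> B" using B(1)[of 0] by linarith
      ultimately show "norm (?f t * indicator {0..real n} t) \<le> exponential_density 1 t * (2 * B)"
        by (auto simp: exponential_density_def indicator_def abs_mult)
    qed
    show "AE t in lborel. (\<lambda>n. ?f t * indicator {0..real n} t) \<longlonglongrightarrow> exponential_density 1 t * (q t - q'' t)"
    proof (rule AE_I2)
      fix t :: real
      obtain m :: nat where m: "t \<le> real m" using real_arch_simple by blast
      have "eventually (\<lambda>n. ?f t * indicator {0..real n} t = exponential_density 1 t * (q t - q'' t)) sequentially"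
        using eventually_ge_at_top[of m]
        by eventually_elim (use m in \<open>auto simp: exponential_density_def indicator_def\<close>)
      then show "(\<lambda>n. ?f t * indicator {0..real n} t) \<longlonglongrightarrow> exponential_density 1 t * (q t - q'' t)"
        by (rule tendsto_eventually)
    qed
  qed auto
  have e2: "(\<integral>t. ?f t * indicator {0..real n} t \<partial>lborel) = q 0 + q' 0 - exp (- real n) * (q n + q' n)" for n
  proof -
    have "(\<integral>t. ?f t * indicator {0..real n} t \<partial>lborel) = (- exp (- real n) * (q n + q' n)) - (- exp (- 0) * (q 0 + q' 0))"
    proof (rule integral_FTC_Icc_real)
      fix t
      \<comment> \<open>The derivative of \<open>- exp (- t) * p\<close> is
        \<open>exp (- t) * (p - p')\<close>, and \<open>p = q + q'\<close> gives
        \<open>p - p' = q - q''\<close>: this is the factorisation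
        \<open>1 - \<partial>^2 = (1 - \<partial>)(1 + \<partial>)\<close>.\<close>
      show "((\<lambda>t. - exp (- t) * (q t + q' t)) has_real_derivative ?f t) (at t)"
        by (auto intro!: derivative_eq_intros q q' simp: algebra_simps)
      show "isCont ?f t"
        using cq c by (intro continuous_intros) (auto simp: continuous_on_eq_continuous_at)
    qed simp
    then show ?thesis by simp
  qed
  have l2: "(\<lambda>n. q 0 + q' 0 - exp (- real n) * (q n + q' n)) \<longlonglongrightarrow> q 0 + q' 0 - 0"
  proof (intro tendsto_intros)
    show "(\<lambda>n. exp (- real n) * (q (real n) + q' (real n))) \<longlonglongrightarrow> 0"
    proof (rule Lim_null_comparison)
      show "\<forall>\<^sub>F n in sequentially. norm (exp (- real n) * (q (real n) + q' (real n))) \<le> exp (- real n) * (2 * B)"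
      proof (intro always_eventually allI)
        fix n
        have "\<bar>q (real n) + q' (real n)\<bar> \<le> 2 * B" using B(1)[of "real n"] B(2)[of "real n"] by linarith
        then show "norm (exp (- real n) * (q (real n) + q' (real n))) \<le> exp (- real n) * (2 * B)"
          by (simp add: abs_mult)
      qed
      have "(\<lambda>n. exp (- real n)) \<longlonglongrightarrow> 0"
        by (intro filterlim_compose[OF exp_at_bot] filterlim_uminus_at_bot_at_top[THEN filterlim_compose] filterlim_real_sequentially)
      then show "(\<lambda>n. exp (- real n) * (2 * B)) \<longlonglongrightarrow> 0" by (rule tendsto_mult_left_zero)
    qed
  qed
  show ?thesis using LIMSEQ_unique[OF l1[unfolded e2] l2] e1 by simp
qed

lemma DERIV_affine:
  fixes f :: "real \<Rightarrow> real"
  assumes "\<And>x. (f has_real_derivative f' x) (at x)"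
  shows "((\<lambda>t. f (y + s * t)) has_real_derivative s * f' (y + s * t)) (at t)"
proof -
  have "((\<lambda>t. y + s * t) has_real_derivative s) (at t)" by (auto intro!: derivative_eq_intros)
  from DERIV_chain2[OF assms this] show ?thesis by (simp add: mult.commute)
qed

text \<open>The convolution is carried out on the bias alone: it is shifted by
  \<open>\<plusminus> |w| t\<close> with exponentially distributed \<open>t\<close>, while weights
  and coefficients stay as they are. The scale \<open>|w|\<close> matches the factor
  \<open>|w|^2\<close> in the Laplacian.\<close>

lemma ridge_rep_resolvent:
  assumes \<sigma>: "bounded_smooth \<sigma>" and g: "ridge_rep \<sigma> d R N g"
  shows "\<exists>v. ridge_rep \<sigma> d R N v \<and> helmholtz d v g"
proof -
  obtain P :: "(real \<times> vec \<times> real) measure" and w b a where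
    *: "ridge P d w b R" "a \<in> borel_measurable P" "\<And>\<theta>. \<bar>a \<theta>\<bar> \<le> N" "\<And>x. x \<in> Rd d \<Longrightarrow> g x = rint P d w b a \<sigma> x"
    by (rule ridge_repE[OF g]) auto
  interpret P: ridge P d w b R by fact
  note \<sigma>1 = bounded_smooth_has_deriv(2)[OF \<sigma>]
  note \<sigma>2 = bounded_smooth_has_deriv(2)[OF \<sigma>1]
  note [measurable] = *(2) bounded_smooth_borel[OF \<sigma>] bounded_smooth_borel[OF \<sigma>1] bounded_smooth_borel[OF \<sigma>2]
  let ?r = "\<lambda>\<theta>. L2_set (w \<theta>) {..<d}"
  have rm [measurable]: "?r \<in> borel_measurable P"
  proof -
    have "(\<lambda>\<theta>. \<Sum>i<d. (w \<theta> i)\<^sup>2) \<in> borel_measurable P"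
      by (intro borel_measurable_sum borel_measurable_power P.w_measurable) auto
    then show ?thesis unfolding L2_set_def by measurable
  qed
  let ?PQ = "P \<Otimes>\<^sub>M exp_dist"
  let ?z = "\<lambda>x \<theta>. dot d (w \<theta>) x + b \<theta>"
  define W where "W = (\<lambda>p::(real \<times> vec \<times> real) \<times> real. w (fst p))"
  define B where "B \<epsilon> = (\<lambda>p::(real \<times> vec \<times> real) \<times> real. b (fst p) + \<epsilon> * ?r (fst p) * snd p)" for \<epsilon> :: real
  define A where "A = (\<lambda>p::(real \<times> vec \<times> real) \<times> real. a (fst p))"
  have rd: "ridge ?PQ d W (B \<epsilon>) R" for \<epsilon>
  proof (intro ridge.intro ridge_axioms.intro)
    show "prob_space ?PQ" by (intro prob_space_pair P.prob_space_axioms prob_space_exp_dist)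
    show "(\<lambda>p. W p i) \<in> borel_measurable ?PQ" if "i < d" for i
      unfolding W_def using measurable_compose[OF measurable_fst P.w_measurable[OF that]] .
    show "B \<epsilon> \<in> borel_measurable ?PQ" unfolding B_def by measurable
    show "L2_set (W p) {..<d} \<le> R" for p unfolding W_def by (rule P.w_bound)
  qed
  have A: "A \<in> borel_measurable ?PQ" "\<bar>A p\<bar> \<le> N" for p
    unfolding A_def using * by measurable
  define v where "v \<epsilon> = rint ?PQ d W (B \<epsilon>) A \<sigma>" for \<epsilon>
  have rep: "ridge_rep \<sigma> d R N (v \<epsilon>)" for \<epsilon>
    by (rule ridge_repI[OF rd A bounded_smooth_borel[OF \<sigma>]]) (simp add: v_def)
  \<comment> \<open>The result of \<open>1 - \<Delta>\<close> for one sign of the shift: the given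
    function plus an error that is odd in \<epsilon>.\<close>
  define h where "h \<epsilon> x = (\<integral>\<theta>. a \<theta> * \<sigma> (?z x \<theta>) + \<epsilon> * (a \<theta> * ?r \<theta> * deriv \<sigma> (?z x \<theta>)) \<partial>P)" for \<epsilon> x
  obtain C0 where C0: "0 < C0" "\<And>x. \<bar>\<sigma> x\<bar> \<le> C0" using bounded_smooth_has_deriv(3)[OF \<sigma>] by blast
  obtain C1 where C1: "0 < C1" "\<And>x. \<bar>deriv \<sigma> x\<bar> \<le> C1" using bounded_smooth_has_deriv(3)[OF \<sigma>1] by blast
  obtain C2 where C2: "0 < C2" "\<And>x. \<bar>deriv (deriv \<sigma>) x\<bar> \<le> C2" using bounded_smooth_has_deriv(3)[OF \<sigma>2] by blast
  have rR: "\<bar>?r \<theta>\<bar> \<le> R" "\<bar>(?r \<theta>)\<^sup>2\<bar> \<le> R * R" for \<theta>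
  proof -
    show "\<bar>?r \<theta>\<bar> \<le> R" using P.w_bound by (simp add: abs_of_nonneg)
    then show "\<bar>(?r \<theta>)\<^sup>2\<bar> \<le> R * R" unfolding power2_eq_square by (intro abs_bound_mult)
  qed
  have helm: "helmholtz d (v \<epsilon>) (h \<epsilon>)" if \<epsilon>: "\<bar>\<epsilon>\<bar> = 1" for \<epsilon>
    unfolding helmholtz_def
  proof
    fix x assume x: "x \<in> Rd d"
    interpret PQ: ridge ?PQ d W "B \<epsilon>" R by (rule rd)
    let ?f = "\<lambda>p. A p * (\<sigma> (?z x (fst p) + \<epsilon> * ?r (fst p) * snd p) - (?r (fst p))\<^sup>2 * deriv (deriv \<sigma>) (?z x (fst p) + \<epsilon> * ?r (fst p) * snd p))"
    have A': "(\<lambda>p. A p * (L2_set (W p) {..<d})\<^sup>2) \<in> borel_measurable ?PQ"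
      "\<bar>A p * (L2_set (W p) {..<d})\<^sup>2\<bar> \<le> N * (R * R)" for p
    proof -
      show "(\<lambda>p. A p * (L2_set (W p) {..<d})\<^sup>2) \<in> borel_measurable ?PQ"
        unfolding A_def W_def by measurable
      show "\<bar>A p * (L2_set (W p) {..<d})\<^sup>2\<bar> \<le> N * (R * R)"
        unfolding W_def by (intro abs_bound_mult A rR)
    qed
    have "v \<epsilon> x - (\<Sum>i<d. partial_deriv i (partial_deriv i (v \<epsilon>)) x) =
        rint ?PQ d W (B \<epsilon>) A \<sigma> x - rint ?PQ d W (B \<epsilon>) (\<lambda>p. A p * (L2_set (W p) {..<d})\<^sup>2) (deriv (deriv \<sigma>)) x"
      unfolding v_def PQ.rint_laplace[OF A \<sigma> x] ..
    also have "\<dots> = (\<integral>p. ?f p \<partial>?PQ)"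
    proof -
      have arg: "dot d (W p) x + B \<epsilon> p = ?z x (fst p) + \<epsilon> * ?r (fst p) * snd p" for p :: "(real \<times> vec \<times> real) \<times> real"
        by (simp add: W_def B_def)
      have "rint ?PQ d W (B \<epsilon>) A \<sigma> x - rint ?PQ d W (B \<epsilon>) (\<lambda>p. A p * (L2_set (W p) {..<d})\<^sup>2) (deriv (deriv \<sigma>)) x =
        (\<integral>p. A p * \<sigma> (dot d (W p) x + B \<epsilon> p) - A p * (L2_set (W p) {..<d})\<^sup>2 * deriv (deriv \<sigma>) (dot d (W p) x + B \<epsilon> p) \<partial>?PQ)"
        unfolding rint_def
        by (intro Bochner_Integration.integral_diff[symmetric] PQ.rint_integrable[OF A \<sigma>] PQ.rint_integrable[OF A' \<sigma>2])
      also have "\<dots> = (\<integral>p. ?f p \<partial>?PQ)"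
        unfolding arg by (intro Bochner_Integration.integral_cong refl) (simp only: W_def right_diff_distrib mult.assoc)
      finally show ?thesis .
    qed
    also have "\<dots> = (\<integral>\<theta>. (\<integral>t. ?f (\<theta>, t) \<partial>exp_dist) \<partial>P)"
    proof (rule integral_pair_prob[OF P.prob_space_axioms prob_space_exp_dist, where B="N * (C0 + R * R * C2)"])
      show "?f \<in> borel_measurable ?PQ" using A(1) by measurable
      fix p :: "(real \<times> vec \<times> real) \<times> real"
      have "\<bar>\<sigma> y - (?r (fst p))\<^sup>2 * deriv (deriv \<sigma>) y\<bar> \<le> C0 + R * R * C2" for y
        using C0(2)[of y] abs_bound_mult[OF rR(2) C2(2), of "fst p" y] by linarith
      then show "\<bar>?f p\<bar> \<le> N * (C0 + R * R * C2)" by (intro abs_bound_mult A)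
    qed
    also have "\<dots> = h \<epsilon> x"
      unfolding h_def
    proof (intro Bochner_Integration.integral_cong refl)
      fix \<theta>
      let ?s = "\<epsilon> * ?r \<theta>" and ?y = "?z x \<theta>"
      \<comment> \<open>Either sign of the shift has the same square, as required by the factor in
        the Laplacian.\<close>
      have sq: "(?r \<theta>)\<^sup>2 = ?s * ?s"
        using \<epsilon> by (metis abs_mult_self_eq mult.left_commute mult.commute mult_1 power2_eq_square)
      have sR: "\<bar>?s\<bar> \<le> R" using \<epsilon> rR(1)[of \<theta>] by (simp add: abs_mult)
      have bounds: "\<bar>\<sigma> y\<bar> \<le> C0 + R * C1 + R * R * C2" "\<bar>?s * deriv \<sigma> y\<bar> \<le> C0 + R * C1 + R * R * C2"
        "\<bar>?s * ?s * deriv (deriv \<sigma>) y\<bar> \<le> C0 + R * C1 + R * R * C2" for y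
        using C0(1) C0(2)[of y] abs_bound_mult[OF sR C1(2), of y] abs_bound_mult[OF abs_bound_mult[OF sR sR] C2(2), of y]
          mult_nonneg_nonneg[OF P.R_nonneg less_imp_le[OF C1(1)]]
          mult_nonneg_nonneg[OF mult_nonneg_nonneg[OF P.R_nonneg P.R_nonneg] less_imp_le[OF C2(1)]]
        by linarith+
      have "(\<integral>t. \<sigma> (?y + ?s * t) - ?s * ?s * deriv (deriv \<sigma>) (?y + ?s * t) \<partial>exp_dist) = \<sigma> (?y + ?s * 0) + ?s * deriv \<sigma> (?y + ?s * 0)"
      proof (rule exp_dist_resolvent)
        fix t
        show "((\<lambda>t. \<sigma> (?y + ?s * t)) has_real_derivative ?s * deriv \<sigma> (?y + ?s * t)) (at t)"
          by (rule DERIV_affine[OF bounded_smooth_has_deriv(1)[OF \<sigma>]])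
        show "((\<lambda>t. ?s * deriv \<sigma> (?y + ?s * t)) has_real_derivative ?s * ?s * deriv (deriv \<sigma>) (?y + ?s * t)) (at t)"
          unfolding mult.assoc[of ?s ?s]
          by (rule DERIV_cmult[OF DERIV_affine[OF bounded_smooth_has_deriv(1)[OF \<sigma>1]]])
      next
        have "isCont (deriv (deriv \<sigma>)) t" for t
          by (rule DERIV_isCont[OF bounded_smooth_has_deriv(1)[OF \<sigma>2]])
        then have "isCont (\<lambda>t. deriv (deriv \<sigma>) (?y + ?s * t)) t" for t
          by (intro isCont_o2[where f="\<lambda>t. ?y + ?s * t" and g="deriv (deriv \<sigma>)"]) simp_all
        then show "continuous_on UNIV (\<lambda>t. ?s * ?s * deriv (deriv \<sigma>) (?y + ?s * t))"
          by (intro continuous_at_imp_continuous_on ballI isCont_mult continuous_const)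
      qed (rule bounds)+
      then have eq: "(\<integral>t. \<sigma> (?y + ?s * t) - (?r \<theta>)\<^sup>2 * deriv (deriv \<sigma>) (?y + ?s * t) \<partial>exp_dist) = \<sigma> ?y + ?s * deriv \<sigma> ?y"
        unfolding sq by simp
      show "(\<integral>t. ?f (\<theta>, t) \<partial>exp_dist) = a \<theta> * \<sigma> ?y + \<epsilon> * (a \<theta> * ?r \<theta> * deriv \<sigma> ?y)"
        unfolding fst_conv snd_conv A_def integral_mult_right_zero eq by (simp add: algebra_simps)
    qed
    finally show "v \<epsilon> x - (\<Sum>i<d. partial_deriv i (partial_deriv i (v \<epsilon>)) x) = h \<epsilon> x" .
  qed
  \<comment> \<open>Averaging the two signs cancels the odd error and keeps the bound at
    \<open>N\<close>.\<close>
  have "ridge_rep \<sigma> d R (\<bar>1/2\<bar> * N + \<bar>1/2\<bar> * N) (\<lambda>x. 1/2 * v 1 x + 1/2 * v (-1) x)"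
    by (intro ridge_rep_add[OF \<sigma>] ridge_rep_cmult rep)
  moreover have "helmholtz d (\<lambda>x. 1/2 * v 1 x + 1/2 * v (-1) x) (\<lambda>x. 1/2 * h 1 x + 1/2 * h (-1) x)"
    by (intro helmholtz_lincomb helm ridge_rep_smooth(1)[OF \<sigma> rep]) auto
  moreover have "1/2 * h 1 x + 1/2 * h (-1) x = g x" if x: "x \<in> Rd d" for x
  proof -
    have ar: "(\<lambda>\<theta>. a \<theta> * ?r \<theta>) \<in> borel_measurable P" "\<bar>a \<theta> * ?r \<theta>\<bar> \<le> N * R" for \<theta>
      by (measurable, intro abs_bound_mult * rR)
    have "h \<epsilon> x = (\<integral>\<theta>. a \<theta> * \<sigma> (?z x \<theta>) \<partial>P) + \<epsilon> * (\<integral>\<theta>. a \<theta> * ?r \<theta> * deriv \<sigma> (?z x \<theta>) \<partial>P)" for \<epsilon>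
      unfolding h_def using P.rint_integrable[OF *(2,3) \<sigma>, of x] P.rint_integrable[OF ar \<sigma>1, of x] by simp
    then show ?thesis using *(4)[OF x] by (simp add: rint_def field_simps)
  qed
  ultimately show ?thesis
    by (intro exI[of _ "\<lambda>x. 1/2 * v 1 x + 1/2 * v (-1) x"]) (auto intro: helmholtz_cong)
qed

section \<open>The cosine activation\<close>

lemma bounded_smooth_trig: "bounded_smooth (\<lambda>x. c * cos x + e * sin x)"
  unfolding bounded_smooth_def
proof (intro exI[of _ "{\<lambda>x. c * cos x + e * sin x | c e. True}"] conjI ballI)
  show "(\<lambda>x. c * cos x + e * sin x) \<in> {\<lambda>x. c * cos x + e * sin x | c e. True}" by blast
  fix f :: "real \<Rightarrow> real" assume "f \<in> {\<lambda>x. c * cos x + e * sin x | c e. True}"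
  then obtain c e where f: "f = (\<lambda>x. c * cos x + e * sin x)" by blast
  have "\<bar>c * cos x + e * sin x\<bar> \<le> \<bar>c\<bar> * 1 + \<bar>e\<bar> * 1" for x
    using abs_bound_mult[of c "\<bar>c\<bar>" "cos x" 1] abs_bound_mult[of e "\<bar>e\<bar>" "sin x" 1]
      abs_triangle_ineq[of "c * cos x" "e * sin x"] by simp
  then show "bounded (range f)" unfolding f bounded_iff by auto
  show "\<exists>f'\<in>{\<lambda>x. c * cos x + e * sin x | c e. True}. \<forall>x. (f has_real_derivative f' x) (at x)"
    unfolding f
  proof (intro bexI allI)
    show "((\<lambda>x. c * cos x + e * sin x) has_real_derivative e * cos x + (- c) * sin x) (at x)" for x
      by (auto intro!: derivative_eq_intros)
  qed blast
qed

lemma bounded_smooth_cos: "bounded_smooth cos" and bounded_smooth_sin: "bounded_smooth sin"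
  and bounded_smooth_minus_cos: "bounded_smooth (\<lambda>x. - cos x)"
  using bounded_smooth_trig[of 1 0] bounded_smooth_trig[of 0 1] bounded_smooth_trig[of "-1" 0]
  by simp_all

lemma deriv_cos: "deriv cos = (\<lambda>x::real. - sin x)" and deriv_sin: "deriv sin = (\<lambda>x::real. cos x)"
  and deriv_minus_sin: "deriv (\<lambda>x::real. - sin x) = (\<lambda>x. - cos x)"
  by (intro ext DERIV_imp_deriv; auto intro!: derivative_eq_intros)+

text \<open>The identity \<open>cos y0 cos y1 = (cos (y0 + y1) + cos (y0 - y1)) / 2\<close> read as
  an average over a fair coin; the weights have norm \<open>sqrt 2\<close>, rounded up to 2.\<close>

lemma ridge_rep_cos_cos: "ridge_rep cos 2 2 1 (\<lambda>y. cos (y 0) * cos (y 1))"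
proof (rule ridge_repI)
  let ?P = "measure_pmf (bernoulli_pmf (1/2))"
  let ?w = "\<lambda>(\<beta>::bool) (i::nat). if i = 0 \<or> \<beta> then 1 else - 1 :: real"
  show "ridge ?P 2 ?w (\<lambda>_. 0) 2"
  proof (intro ridge.intro ridge_axioms.intro)
    show "prob_space ?P" by unfold_locales
    show "L2_set (?w \<beta>) {..<2} \<le> 2" for \<beta>
      unfolding L2_set_def by (rule real_le_lsqrt) (simp_all add: numeral_2_eq_2)
  qed simp_all
  show "cos (y 0) * cos (y 1) = rint ?P 2 ?w (\<lambda>_. 0) (\<lambda>_. 1) cos y" for y
    by (simp add: rint_def dot_def numeral_2_eq_2 cos_times_cos add_divide_distrib)
qed auto

text \<open>For the cosine the factor \<open>1 / (1 + |w|\<^sup>2)\<close> of the resolvent absorbs both derivatives, so the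
  bound on the coefficients does not involve \<open>R\<close>.\<close>

lemma ridge_rep_cos_resolvent:
  assumes f: "ridge_rep cos d R' N' f" and u: "ridge_rep cos d R N u" and i: "i < d" and j: "j < d"
  shows "\<exists>v. ridge_rep cos d (R + R') (N * N' * (1 + R')) v \<and>
    helmholtz d v (partial_deriv i (\<lambda>x. f x * partial_deriv j u x))"
proof -
  obtain P :: "(real \<times> vec \<times> real) measure" and w b a where
    1: "ridge P d w b R" "a \<in> borel_measurable P" "\<And>\<theta>. \<bar>a \<theta>\<bar> \<le> N" "\<And>x. x \<in> Rd d \<Longrightarrow> u x = rint P d w b a cos x"
    by (rule ridge_repE[OF u]) auto
  obtain Q :: "(real \<times> vec \<times> real) measure" and w' b' a' where
    2: "ridge Q d w' b' R'" "a' \<in> borel_measurable Q" "\<And>\<theta>. \<bar>a' \<theta>\<bar> \<le> N'" "\<And>x. x \<in> Rd d \<Longrightarrow> f x = rint Q d w' b' a' cos x"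
    by (rule ridge_repE[OF f]) auto
  interpret P: ridge P d w b R by fact
  interpret Q: ridge Q d w' b' R' by fact
  note [measurable] = 1(2) 2(2) P.w_measurable[OF j]
  note [simp] = deriv_cos deriv_sin deriv_minus_sin
  let ?PQ = "P \<Otimes>\<^sub>M Q"
  define W where "W \<epsilon> = (\<lambda>p::(real \<times> vec \<times> real) \<times> (real \<times> vec \<times> real). \<lambda>k. w (fst p) k + \<epsilon> * w' (snd p) k)" for \<epsilon> :: real
  define B where "B \<epsilon> = (\<lambda>p::(real \<times> vec \<times> real) \<times> (real \<times> vec \<times> real). b (fst p) + \<epsilon> * b' (snd p))" for \<epsilon> :: real
  \<comment> \<open>From \<open>- sin y cos y' = - (sin (y + y') + sin (y - y')) / 2\<close>; the
    two signs are the two values of \<epsilon>.\<close>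
  define K where "K = (\<lambda>p::(real \<times> vec \<times> real) \<times> (real \<times> vec \<times> real). - (1/2) * (a (fst p) * w (fst p) j * a' (snd p)))"
  have Wm: "(\<lambda>p. W \<epsilon> p k) \<in> borel_measurable ?PQ" if "k < d" for \<epsilon> k
  proof -
    have [measurable]: "(\<lambda>\<theta>. w \<theta> k) \<in> borel_measurable P" "(\<lambda>\<theta>. w' \<theta> k) \<in> borel_measurable Q"
      using that P.w_measurable Q.w_measurable by auto
    show ?thesis unfolding W_def by measurable
  qed
  have rd: "ridge ?PQ d (W \<epsilon>) (B \<epsilon>) (R + R')" if \<epsilon>: "\<bar>\<epsilon>\<bar> = 1" for \<epsilon>
  proof (intro ridge.intro ridge_axioms.intro)
    show "prob_space ?PQ" by (intro prob_space_pair P.prob_space_axioms Q.prob_space_axioms)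
    show "B \<epsilon> \<in> borel_measurable ?PQ" unfolding B_def by measurable
    show "L2_set (W \<epsilon> p) {..<d} \<le> R + R'" for p
    proof -
      have "L2_set (W \<epsilon> p) {..<d} \<le> L2_set (w (fst p)) {..<d} + L2_set (\<lambda>k. \<epsilon> * w' (snd p) k) {..<d}"
        unfolding W_def by (rule L2_set_triangle_ineq)
      then show ?thesis using P.w_bound[of "fst p"] Q.w_bound[of "snd p"] \<epsilon> by (simp add: L2_set_cmult)
    qed
  qed (rule Wm)
  have Km: "K \<in> borel_measurable ?PQ" unfolding K_def by measurable
  have Kb: "\<bar>K p\<bar> \<le> 1/2 * (N * R * N')" for p
    unfolding K_def by (intro abs_bound_mult 1 2 P.w_component_bound j) simp
  have prod: "f x * partial_deriv j u x = rint ?PQ d (W 1) (B 1) K sin x + rint ?PQ d (W (-1)) (B (-1)) K sin x"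
    if x: "x \<in> Rd d" for x
  proof -
    let ?z = "\<lambda>\<theta>. dot d (w \<theta>) x + b \<theta>" and ?z' = "\<lambda>\<theta>. dot d (w' \<theta>) x + b' \<theta>"
    interpret Pp: ridge ?PQ d "W 1" "B 1" "R + R'" by (rule rd) simp
    interpret Pm: ridge ?PQ d "W (-1)" "B (-1)" "R + R'" by (rule rd) simp
    have arg: "dot d (W \<epsilon> p) x + B \<epsilon> p = ?z (fst p) + \<epsilon> * ?z' (snd p)" for \<epsilon> p
      by (simp only: W_def B_def dot_add dot_cmult) (simp add: algebra_simps)
    have "partial_deriv j u x = (\<integral>\<theta>. a \<theta> * w \<theta> j * - sin (?z \<theta>) \<partial>P)"
      using partial_deriv_cong[of d u "rint P d w b a cos" j x] 1(4) j x P.rint_pd[OF 1(2,3) bounded_smooth_cos j x]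
      by (simp add: rint_def)
    then have "f x * partial_deriv j u x = (\<integral>\<theta>. a \<theta> * w \<theta> j * - sin (?z \<theta>) \<partial>P) * (\<integral>\<theta>. a' \<theta> * cos (?z' \<theta>) \<partial>Q)"
      using 2(4)[OF x] by (simp add: rint_def)
    also have "\<dots> = (\<integral>p. (a (fst p) * w (fst p) j * - sin (?z (fst p))) * (a' (snd p) * cos (?z' (snd p))) \<partial>?PQ)"
    proof (rule integral_pair_mult[OF P.prob_space_axioms Q.prob_space_axioms, symmetric, where B="N * R * 1" and C="N' * 1"])
      show "\<bar>a p * w p j * - sin (?z p)\<bar> \<le> N * R * 1" for p
        by (intro abs_bound_mult 1 P.w_component_bound j) simp
      show "\<bar>a' p * cos (?z' p)\<bar> \<le> N' * 1" for p
        by (intro abs_bound_mult 2) simp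
    qed measurable
    also have "\<dots> = (\<integral>p. K p * sin (dot d (W 1 p) x + B 1 p) + K p * sin (dot d (W (-1) p) x + B (-1) p) \<partial>?PQ)"
    proof -
      have "(s * - sin y) * (t * cos y') = - (1/2) * (s * t) * sin (y + 1 * y') + - (1/2) * (s * t) * sin (y + (- 1) * y')" for s t y y' :: real
        by (simp add: sin_add sin_diff field_simps)
      then show ?thesis unfolding arg K_def by (intro Bochner_Integration.integral_cong refl)
    qed
    also have "\<dots> = rint ?PQ d (W 1) (B 1) K sin x + rint ?PQ d (W (-1)) (B (-1)) K sin x"
      unfolding rint_def
      by (intro Bochner_Integration.integral_add Pp.rint_integrable[OF Km Kb bounded_smooth_sin] Pm.rint_integrable[OF Km Kb bounded_smooth_sin])
    finally show ?thesis .
  qed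
  \<comment> \<open>The outer derivative turns \<open>sin\<close> into \<open>cos\<close> with the
    factor \<open>W \<epsilon> p i\<close>, and \<open>1 - \<Delta>\<close> multiplies a cosine by
    \<open>1 + |W|^2\<close>, which is divided out here.\<close>
  define \<alpha> where "\<alpha> \<epsilon> p = K p * W \<epsilon> p i / (1 + (L2_set (W \<epsilon> p) {..<d})\<^sup>2)" for \<epsilon> p
  define v where "v \<epsilon> = rint ?PQ d (W \<epsilon>) (B \<epsilon>) (\<alpha> \<epsilon>) cos" for \<epsilon>
  have Lm: "(\<lambda>p. (L2_set (W \<epsilon> p) {..<d})\<^sup>2) \<in> borel_measurable ?PQ" for \<epsilon>
  proof -
    have "(\<lambda>p. \<Sum>k<d. (W \<epsilon> p k)\<^sup>2) \<in> borel_measurable ?PQ"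
      by (intro borel_measurable_sum borel_measurable_power Wm) auto
    then show ?thesis unfolding L2_set_def by measurable
  qed
  have \<alpha>m: "\<alpha> \<epsilon> \<in> borel_measurable ?PQ" for \<epsilon>
    unfolding \<alpha>_def using Km Wm[OF i, of \<epsilon>] Lm[of \<epsilon>] by measurable
  have \<alpha>b: "\<bar>\<alpha> \<epsilon> p\<bar> \<le> 1/2 * (N * N' * (1 + R'))" if \<epsilon>: "\<bar>\<epsilon>\<bar> = 1" for \<epsilon> p
  proof -
    interpret PQ: ridge ?PQ d "W \<epsilon>" "B \<epsilon>" "R + R'" by (rule rd[OF \<epsilon>])
    let ?n = "L2_set (W \<epsilon> p) {..<d}"
    have comp: "\<bar>y k\<bar> \<le> L2_set y {..<d}" if "k < d" for y k
      using member_le_L2_set[of "{..<d}" k "\<lambda>i. \<bar>y i\<bar>"] that by (simp add: L2_set_def)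
    \<comment> \<open>The inner derivative produced a component of \<open>w\<close>, not of
      \<open>W\<close>. As \<open>w\<close> differs from \<open>W\<close> by a vector of norm at
      most \<open>R'\<close>, the product of both components is at most
      \<open>(|W| + R') |W|\<close>, which the denominator controls up to
      \<open>1 + R'\<close>.\<close>
    have "L2_set (\<lambda>k. W \<epsilon> p k + (- \<epsilon>) * w' (snd p) k) {..<d} \<le> ?n + L2_set (\<lambda>k. (- \<epsilon>) * w' (snd p) k) {..<d}"
      by (rule L2_set_triangle_ineq)
    then have "L2_set (w (fst p)) {..<d} \<le> ?n + R'"
      using \<epsilon> Q.w_bound[of "snd p"] unfolding L2_set_cmult by (simp add: W_def)
    then have wj: "\<bar>w (fst p) j\<bar> \<le> ?n + R'" using comp[OF j, of "w (fst p)"] by linarith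
    have Wi: "\<bar>W \<epsilon> p i\<bar> \<le> ?n" by (rule comp[OF i])
    have n0: "0 \<le> ?n" by (rule L2_set_nonneg)
    have "\<bar>w (fst p) j * W \<epsilon> p i\<bar> \<le> (?n + R') * ?n" by (rule abs_bound_mult[OF wj Wi])
    also have "\<dots> \<le> (1 + R') * (1 + ?n\<^sup>2)"
    proof -
      have "2 * ?n \<le> ?n\<^sup>2 + 1" using sum_squares_bound[of ?n 1] by simp
      then have "?n \<le> 1 + ?n\<^sup>2" using n0 by linarith
      then have "R' * ?n \<le> R' * (1 + ?n\<^sup>2)" using Q.R_nonneg by (intro mult_left_mono)
      then show ?thesis by (simp add: algebra_simps power2_eq_square)
    qed
    finally have wW: "\<bar>w (fst p) j * W \<epsilon> p i / (1 + ?n\<^sup>2)\<bar> \<le> 1 + R'"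
      by (simp add: abs_divide pos_divide_le_eq add_pos_nonneg)
    have "\<alpha> \<epsilon> p = - (1/2) * (a (fst p) * a' (snd p) * (w (fst p) j * W \<epsilon> p i / (1 + ?n\<^sup>2)))"
      by (simp add: \<alpha>_def K_def)
    also have "\<bar>\<dots>\<bar> \<le> 1/2 * (N * N' * (1 + R'))"
      by (intro abs_bound_mult 1 2 wW) simp
    finally show ?thesis .
  qed
  have rep: "ridge_rep cos d (R + R') (1/2 * (N * N' * (1 + R'))) (v \<epsilon>)" if \<epsilon>: "\<bar>\<epsilon>\<bar> = 1" for \<epsilon>
    by (rule ridge_repI[OF rd[OF \<epsilon>] \<alpha>m \<alpha>b[OF \<epsilon>]]) (auto simp: v_def)
  define h where "h \<epsilon> = rint ?PQ d (W \<epsilon>) (B \<epsilon>) (\<lambda>p. K p * W \<epsilon> p i) cos" for \<epsilon>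
  have helm: "helmholtz d (v \<epsilon>) (h \<epsilon>)" if \<epsilon>: "\<bar>\<epsilon>\<bar> = 1" for \<epsilon>
    unfolding helmholtz_def
  proof
    fix x assume x: "x \<in> Rd d"
    interpret PQ: ridge ?PQ d "W \<epsilon>" "B \<epsilon>" "R + R'" by (rule rd[OF \<epsilon>])
    let ?n = "\<lambda>p. L2_set (W \<epsilon> p) {..<d}"
    have n2: "\<bar>(?n p)\<^sup>2\<bar> \<le> (R + R') * (R + R')" for p
      unfolding power2_eq_square using PQ.w_bound[of p] by (intro abs_bound_mult) (simp_all add: abs_of_nonneg)
    have m2: "(\<lambda>p. \<alpha> \<epsilon> p * (?n p)\<^sup>2) \<in> borel_measurable ?PQ" using \<alpha>m[of \<epsilon>] Lm[of \<epsilon>] by measurable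
    have b2: "\<bar>\<alpha> \<epsilon> p * (?n p)\<^sup>2\<bar> \<le> 1/2 * (N * N' * (1 + R')) * ((R + R') * (R + R'))" for p
      by (intro abs_bound_mult \<alpha>b[OF \<epsilon>] n2)
    have "v \<epsilon> x - (\<Sum>i<d. partial_deriv i (partial_deriv i (v \<epsilon>)) x) =
        rint ?PQ d (W \<epsilon>) (B \<epsilon>) (\<alpha> \<epsilon>) cos x - rint ?PQ d (W \<epsilon>) (B \<epsilon>) (\<lambda>p. \<alpha> \<epsilon> p * (?n p)\<^sup>2) (\<lambda>x. - cos x) x"
      unfolding v_def PQ.rint_laplace[OF \<alpha>m \<alpha>b[OF \<epsilon>] bounded_smooth_cos x] by simp
    also have "\<dots> = (\<integral>p. \<alpha> \<epsilon> p * cos (dot d (W \<epsilon> p) x + B \<epsilon> p) - \<alpha> \<epsilon> p * (?n p)\<^sup>2 * - cos (dot d (W \<epsilon> p) x + B \<epsilon> p) \<partial>?PQ)"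
      unfolding rint_def
      by (intro Bochner_Integration.integral_diff[symmetric] PQ.rint_integrable[OF \<alpha>m \<alpha>b[OF \<epsilon>] bounded_smooth_cos]
        PQ.rint_integrable[OF m2 b2 bounded_smooth_minus_cos])
    also have "\<dots> = h \<epsilon> x"
      unfolding h_def rint_def
    proof (intro Bochner_Integration.integral_cong refl)
      fix p
      have "1 + (?n p)\<^sup>2 \<noteq> 0" using zero_le_power2[of "?n p"] by linarith
      then have "\<alpha> \<epsilon> p * (1 + (?n p)\<^sup>2) = K p * W \<epsilon> p i" by (simp add: \<alpha>_def)
      then have "K p * W \<epsilon> p i = \<alpha> \<epsilon> p + \<alpha> \<epsilon> p * (?n p)\<^sup>2" by (simp add: algebra_simps)
      then show "\<alpha> \<epsilon> p * cos (dot d (W \<epsilon> p) x + B \<epsilon> p) - \<alpha> \<epsilon> p * (?n p)\<^sup>2 * - cos (dot d (W \<epsilon> p) x + B \<epsilon> p) =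
        K p * W \<epsilon> p i * cos (dot d (W \<epsilon> p) x + B \<epsilon> p)" by (simp only:) (simp add: algebra_simps)
    qed
    finally show "v \<epsilon> x - (\<Sum>i<d. partial_deriv i (partial_deriv i (v \<epsilon>)) x) = h \<epsilon> x" .
  qed
  have "ridge_rep cos d (R + R') (1/2 * (N * N' * (1 + R')) + 1/2 * (N * N' * (1 + R'))) (\<lambda>x. v 1 x + v (-1) x)"
    by (intro ridge_rep_add[OF bounded_smooth_cos] rep) auto
  moreover have "helmholtz d (\<lambda>x. 1 * v 1 x + 1 * v (-1) x) (\<lambda>x. 1 * h 1 x + 1 * h (-1) x)"
    by (intro helmholtz_lincomb helm ridge_rep_smooth(1)[OF bounded_smooth_cos rep]) auto
  moreover have "1 * h 1 x + 1 * h (-1) x = partial_deriv i (\<lambda>x. f x * partial_deriv j u x) x" if x: "x \<in> Rd d" for x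
  proof -
    interpret Pp: ridge ?PQ d "W 1" "B 1" "R + R'" by (rule rd) simp
    interpret Pm: ridge ?PQ d "W (-1)" "B (-1)" "R + R'" by (rule rd) simp
    have "partial_deriv i (\<lambda>x. f x * partial_deriv j u x) x =
      partial_deriv i (\<lambda>x. rint ?PQ d (W 1) (B 1) K sin x + rint ?PQ d (W (-1)) (B (-1)) K sin x) x"
      by (rule partial_deriv_cong[OF prod i x])
    also have "\<dots> = h 1 x + h (-1) x"
      using has_partial_pd[OF has_partial_add[OF Pp.rint_has_partial[OF Km Kb bounded_smooth_sin i] Pm.rint_has_partial[OF Km Kb bounded_smooth_sin i]] x]
      by (simp add: h_def)
    finally show ?thesis by simp
  qed
  ultimately show ?thesis
    by (intro exI[of _ "\<lambda>x. v 1 x + v (-1) x"]) (auto intro: helmholtz_cong simp: mult.assoc)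
qed

section \<open>The energy estimate\<close>

text \<open>For fixed \<open>q\<close> without zeros, the quotients \<open>p / q^k\<close> are
  closed under derivatives, with \<open>k\<close> raised by one each time.\<close>

lemma smooth1_rational: "smooth1 (\<lambda>t. 1 / (1 + (\<delta> * t)\<^sup>2))"
proof -
  define q where "q = [:1, 0, \<delta>\<^sup>2:]"
  have q: "poly q t = 1 + (\<delta> * t)\<^sup>2" for t
    by (simp add: q_def power2_eq_square algebra_simps)
  have q0: "poly q t \<noteq> 0" for t unfolding q using zero_le_power2[of "\<delta> * t"] by linarith
  have "smooth1 (\<lambda>t. poly 1 t / poly q t ^ 1)"
    unfolding smooth1_def
  proof (intro exI[of _ "{\<lambda>t. poly p t / poly q t ^ k | p k. True}"] conjI ballI)
    show "(\<lambda>t. poly 1 t / poly q t ^ 1) \<in> {\<lambda>t. poly p t / poly q t ^ k | p k. True}" by blast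
    fix f assume "f \<in> {\<lambda>t. poly p t / poly q t ^ k | p k. True}"
    then obtain p k where f: "f = (\<lambda>t. poly p t / poly q t ^ k)" by blast
    show "\<exists>f'\<in>{\<lambda>t. poly p t / poly q t ^ k | p k. True}. \<forall>x. (f has_real_derivative f' x) (at x)"
      unfolding f
    proof (intro bexI allI)
      fix t
      have "((\<lambda>t. poly p t / poly q t ^ k) has_real_derivative
          (poly (pderiv p) t * poly q t ^ k - poly p t * (real k * poly q t ^ (k - 1) * poly (pderiv q) t)) / (poly q t ^ k * poly q t ^ k)) (at t)"
        using q0[of t] by (auto intro!: derivative_eq_intros poly_DERIV)
      also have "(poly (pderiv p) t * poly q t ^ k - poly p t * (real k * poly q t ^ (k - 1) * poly (pderiv q) t)) / (poly q t ^ k * poly q t ^ k)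
         = poly (pderiv p * q - of_nat k * p * pderiv q) t / poly q t ^ Suc k"
        using q0[of t] by (cases k) (simp_all add: field_simps)
      finally show "((\<lambda>t. poly p t / poly q t ^ k) has_real_derivative
          poly (pderiv p * q - of_nat k * p * pderiv q) t / poly q t ^ Suc k) (at t)" .
    qed blast
  qed
  then show ?thesis by (simp add: q)
qed

text \<open>An integrable weight whose logarithmic gradient is of size \<open>\<delta>\<close>. It makes the energy estimate
  meaningful for functions that are only known to be bounded, and \<open>\<delta>\<close> tends to \<open>0\<close> afterwards.\<close>

definition weight :: "nat \<Rightarrow> real \<Rightarrow> vec \<Rightarrow> real" where
  "weight d \<delta> x = (\<Prod>i<d. 1 / (1 + (\<delta> * x i)\<^sup>2))"

lemma smooth_weight: "smooth d (weight d \<delta>)"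
  unfolding weight_def[abs_def] by (intro smooth_prod smooth_coordinate smooth1_rational) auto

lemma weight_bounds: "0 < weight d \<delta> x" "weight d \<delta> x \<le> 1"
proof -
  have p: "0 < 1 + (\<delta> * x i)\<^sup>2" for i using zero_le_power2[of "\<delta> * x i"] by linarith
  show "0 < weight d \<delta> x" unfolding weight_def using p by (intro prod_pos) auto
  show "weight d \<delta> x \<le> 1" unfolding weight_def using p by (intro prod_le_1) (auto simp: divide_le_eq less_imp_le)
qed

lemma weight_has_partial:
  assumes "i < d"
  shows "has_partial d i (weight d \<delta>) (\<lambda>x. - (2 * \<delta>\<^sup>2 * x i / (1 + (\<delta> * x i)\<^sup>2)) * weight d \<delta> x)"
  unfolding has_partial_def
proof
  fix x :: vec assume "x \<in> Rd d"
  let ?P = "\<Prod>j\<in>{..<d} - {i}. 1 / (1 + (\<delta> * x j)\<^sup>2)"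
  have p: "1 + (\<delta> * x i)\<^sup>2 \<noteq> 0" using zero_le_power2[of "\<delta> * x i"] by linarith
  have up: "weight d \<delta> (x(i := t)) = 1 / (1 + (\<delta> * t)\<^sup>2) * ?P" for t
    unfolding weight_def using assms by (subst prod.remove[of _ i]) (auto intro!: prod.cong)
  have "((\<lambda>t. 1 / (1 + (\<delta> * t)\<^sup>2) * ?P) has_field_derivative - (2 * \<delta>\<^sup>2 * x i) / ((1 + (\<delta> * x i)\<^sup>2) * (1 + (\<delta> * x i)\<^sup>2)) * ?P) (at (x i))"
    using p by (auto intro!: derivative_eq_intros simp: power2_eq_square)
  moreover have "- (2 * \<delta>\<^sup>2 * x i) / ((1 + (\<delta> * x i)\<^sup>2) * (1 + (\<delta> * x i)\<^sup>2)) * ?P = - (2 * \<delta>\<^sup>2 * x i / (1 + (\<delta> * x i)\<^sup>2)) * weight d \<delta> x"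
    using up[of "x i"] by simp
  ultimately show "((\<lambda>t. weight d \<delta> (x(i := t))) has_field_derivative - (2 * \<delta>\<^sup>2 * x i / (1 + (\<delta> * x i)\<^sup>2)) * weight d \<delta> x) (at (x i))"
    unfolding up by simp
qed

lemma weight_pd_bound:
  assumes "i < d" "x \<in> Rd d" "0 < \<delta>"
  shows "\<bar>partial_deriv i (weight d \<delta>) x\<bar> \<le> \<delta> * weight d \<delta> x"
proof -
  have p: "0 < 1 + (\<delta> * x i)\<^sup>2" using zero_le_power2[of "\<delta> * x i"] by linarith
  \<comment> \<open>With \<open>s = \<delta> * x i\<close> the logarithmic derivative has modulus
    \<open>2 \<delta> |s| / (1 + s^2)\<close>, and \<open>2 |s| \<le> 1 + s^2\<close>.\<close>
  have "2 * \<bar>\<delta> * x i\<bar> \<le> (\<delta> * x i)\<^sup>2 + 1" using sum_squares_bound[of "\<bar>\<delta> * x i\<bar>" 1] by simp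
  then have "\<delta> * (2 * \<bar>\<delta> * x i\<bar>) \<le> \<delta> * (1 + (\<delta> * x i)\<^sup>2)" using assms(3) by (intro mult_left_mono) auto
  moreover have "\<bar>2 * \<delta>\<^sup>2 * x i\<bar> = \<delta> * (2 * \<bar>\<delta> * x i\<bar>)" using assms(3) by (simp add: abs_mult power2_eq_square)
  ultimately have "\<bar>2 * \<delta>\<^sup>2 * x i / (1 + (\<delta> * x i)\<^sup>2)\<bar> \<le> \<delta>"
    using p unfolding abs_divide abs_of_pos[OF p] by (simp only: pos_divide_le_eq)
  then have "\<bar>2 * \<delta>\<^sup>2 * x i / (1 + (\<delta> * x i)\<^sup>2)\<bar> * \<bar>weight d \<delta> x\<bar> \<le> \<delta> * \<bar>weight d \<delta> x\<bar>"
    by (intro mult_right_mono) auto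
  then show ?thesis
    using weight_bounds[of d \<delta> x] unfolding has_partial_pd[OF weight_has_partial[OF assms(1)] assms(2)]
    by (simp add: abs_mult)
qed

lemma weight_integrable:
  assumes "0 < \<delta>" shows "integrable (Rd_leb d) (weight d \<delta>)"
proof -
  have "integrable lborel (\<lambda>x::real. inverse (1 + x\<^sup>2))"
    using integrable_inverse_1_plus_square by (simp add: set_integrable_def einterval_eq_UNIV)
  then have "integrable lborel (\<lambda>x::real. inverse (1 + (0 + \<delta> * x)\<^sup>2))"
    using assms by (intro lborel_integrable_real_affine[where f="\<lambda>x. inverse (1 + x\<^sup>2)"]) auto
  then have "integrable lborel (\<lambda>x::real. 1 / (1 + (\<delta> * x)\<^sup>2))" by (simp add: divide_inverse)
  then show ?thesis
    unfolding weight_def[abs_def] by (intro Rd.product_integrable_prod) auto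
qed

lemma weight_tendsto: "(\<lambda>n. weight d (c / real (Suc n)) x) \<longlonglongrightarrow> 1"
proof -
  have "(\<lambda>n. c * inverse (real (Suc n))) \<longlonglongrightarrow> c * 0"
    by (intro tendsto_intros LIMSEQ_inverse_real_of_nat)
  then have l: "(\<lambda>n. c / real (Suc n)) \<longlonglongrightarrow> 0" by (simp add: divide_inverse)
  have "(\<lambda>n. weight d (c / real (Suc n)) x) \<longlonglongrightarrow> (\<Prod>i<d. 1 / (1 + (0 * x i)\<^sup>2))"
    unfolding weight_def by (intro tendsto_intros l) auto
  then show ?thesis by simp
qed

text \<open>Fatou's lemma turns a bound on the weighted integrals that is uniform in
  \<open>n\<close> into integrability; \<open>E\<close> itself is not yet known to be dominated by
  anything integrable.\<close>

lemma integrable_of_weighted: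
  fixes E :: "'a \<Rightarrow> real"
  assumes [measurable]: "E \<in> borel_measurable M" "\<And>n. \<psi> n \<in> borel_measurable M" and E: "\<And>x. 0 \<le> E x"
    and \<psi>: "\<And>n x. 0 \<le> \<psi> n x" "\<And>x. (\<lambda>n. \<psi> n x) \<longlonglongrightarrow> (1::real)"
    and int: "\<And>n. integrable M (\<lambda>x. \<psi> n x * E x)" and K: "\<And>n. (\<integral>x. \<psi> n x * E x \<partial>M) \<le> K"
  shows "integrable M E"
proof -
  have "(\<integral>\<^sup>+x. ennreal (E x) \<partial>M) = (\<integral>\<^sup>+x. liminf (\<lambda>n. ennreal (\<psi> n x * E x)) \<partial>M)"
  proof (rule nn_integral_cong)
    fix x
    have "(\<lambda>n. \<psi> n x * E x) \<longlonglongrightarrow> 1 * E x" by (intro tendsto_intros \<psi>)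
    then have "(\<lambda>n. ennreal (\<psi> n x * E x)) \<longlonglongrightarrow> ennreal (E x)" by (auto intro: tendsto_ennrealI)
    then show "ennreal (E x) = liminf (\<lambda>n. ennreal (\<psi> n x * E x))"
      by (intro lim_imp_Liminf[symmetric]) auto
  qed
  also have "\<dots> \<le> liminf (\<lambda>n. \<integral>\<^sup>+x. ennreal (\<psi> n x * E x) \<partial>M)"
    by (rule nn_integral_liminf) measurable
  also have "\<dots> \<le> liminf (\<lambda>n. ennreal K)"
  proof (rule Liminf_mono, rule always_eventually, rule allI)
    fix n
    have "(\<integral>\<^sup>+x. ennreal (\<psi> n x * E x) \<partial>M) = ennreal (\<integral>x. \<psi> n x * E x \<partial>M)"
      by (rule nn_integral_eq_integral[OF int]) (auto intro!: AE_I2 mult_nonneg_nonneg \<psi> E)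
    also have "\<dots> \<le> ennreal K" by (rule ennreal_leI[OF K])
    finally show "(\<integral>\<^sup>+x. ennreal (\<psi> n x * E x) \<partial>M) \<le> ennreal K" .
  qed
  also have "\<dots> < \<infinity>" by (simp add: Liminf_const)
  finally show ?thesis using E by (intro integrableI_nonneg) auto
qed

section \<open>From the weighted energy to square integrability\<close>

lemma pd_div_sum:
  assumes "x \<in> Rd d" "\<And>i. i < d \<Longrightarrow> smooth d (G i)" "\<And>i. i < d \<Longrightarrow> smooth d (F i)"
  shows "(\<Sum>i<d. partial_deriv i (\<lambda>x. G i x - F i x) x) = (\<Sum>i<d. partial_deriv i (G i) x) - (\<Sum>i<d. partial_deriv i (F i) x)"
proof -
  have "partial_deriv i (\<lambda>x. G i x - F i x) x = partial_deriv i (G i) x - partial_deriv i (F i) x" if "i < d" for i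
    by (rule pd_diff[OF assms(2,3) that assms(1)]) (use that in auto)
  then show ?thesis by (simp add: sum_subtractf)
qed

text \<open>To be read with \<open>G\<close> the gradient of \<open>w\<close>, \<open>p\<close> that
  of the weight, and \<open>w - h\<close> the divergence of \<open>G - F\<close>. The first two
  summands on the right then form the divergence of \<open>w \<psi> (G - F)\<close> and integrate to
  0, so the last one bounds the weighted energy independently of \<delta>.\<close>

lemma energy_pointwise:
  fixes w h \<psi> \<delta> :: real and G F p :: "nat \<Rightarrow> real"
  assumes \<psi>: "0 \<le> \<psi>" "\<psi> \<le> 1" and \<delta>: "0 < \<delta>" "real d * \<delta> \<le> 1/4" "\<delta> \<le> 1/4"
    and p: "\<And>i. i < d \<Longrightarrow> \<bar>p i\<bar> \<le> \<delta> * \<psi>"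
  shows "1/2 * (\<psi> * (w\<^sup>2 + (\<Sum>i<d. (G i)\<^sup>2))) \<le>
    w * ((\<Sum>i<d. p i * (G i - F i)) + \<psi> * (w - h)) + (\<Sum>i<d. G i * (\<psi> * (G i - F i))) + (h\<^sup>2 + 2 * (\<Sum>i<d. (F i)\<^sup>2))"
proof -
  have a: "- (w * (p i * (G i - F i))) \<le> \<psi> * (\<delta> * w\<^sup>2 + 1/8 * (G i)\<^sup>2 + 1/8 * (F i)\<^sup>2)" if "i < d" for i
  proof -
    have "- (w * (p i * (G i - F i))) \<le> \<bar>p i\<bar> * (\<bar>w\<bar> * \<bar>G i - F i\<bar>)"
      by (metis abs_ge_minus_self abs_mult mult.left_commute)
    also have "\<dots> \<le> (\<delta> * \<psi>) * (\<bar>w\<bar> * (\<bar>G i\<bar> + \<bar>F i\<bar>))"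
      using p[OF that] by (intro mult_mono mult_left_mono) auto
    also have "\<dots> \<le> (\<delta> * \<psi>) * (w\<^sup>2 + 1/2 * (G i)\<^sup>2 + 1/2 * (F i)\<^sup>2)"
    proof (intro mult_left_mono)
      show "\<bar>w\<bar> * (\<bar>G i\<bar> + \<bar>F i\<bar>) \<le> w\<^sup>2 + 1/2 * (G i)\<^sup>2 + 1/2 * (F i)\<^sup>2"
        using sum_squares_bound[of "\<bar>w\<bar>" "\<bar>G i\<bar>"] sum_squares_bound[of "\<bar>w\<bar>" "\<bar>F i\<bar>"]
        unfolding power2_abs distrib_left by linarith
    qed (use \<delta> \<psi> in auto)
    also have "\<dots> = \<psi> * (\<delta> * w\<^sup>2 + \<delta> * (1/2 * (G i)\<^sup>2 + 1/2 * (F i)\<^sup>2))" by (simp add: algebra_simps)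
    also have "\<dots> \<le> \<psi> * (\<delta> * w\<^sup>2 + 1/4 * (1/2 * (G i)\<^sup>2 + 1/2 * (F i)\<^sup>2))"
      using \<psi> \<delta> by (intro mult_left_mono add_left_mono mult_right_mono) auto
    finally show ?thesis by (simp add: algebra_simps)
  qed
  have b: "G i * F i \<le> 1/4 * (G i)\<^sup>2 + (F i)\<^sup>2" for i
    using zero_le_power2[of "1/2 * G i - F i"] by (simp add: power2_eq_square algebra_simps)
  have c: "w * h \<le> 1/4 * w\<^sup>2 + h\<^sup>2"
    using zero_le_power2[of "1/2 * w - h"] by (simp add: power2_eq_square algebra_simps)
  let ?SG = "\<Sum>i<d. (G i)\<^sup>2" and ?SF = "\<Sum>i<d. (F i)\<^sup>2"
  have S: "0 \<le> ?SG" "0 \<le> ?SF" by (auto intro!: sum_nonneg)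
  have "- (w * (\<Sum>i<d. p i * (G i - F i))) \<le> \<psi> * (real d * \<delta> * w\<^sup>2 + 1/8 * ?SG + 1/8 * ?SF)"
  proof -
    have "- (w * (\<Sum>i<d. p i * (G i - F i))) = (\<Sum>i<d. - (w * (p i * (G i - F i))))"
      by (simp add: sum_distrib_left sum_negf)
    also have "\<dots> \<le> (\<Sum>i<d. \<psi> * (\<delta> * w\<^sup>2 + 1/8 * (G i)\<^sup>2 + 1/8 * (F i)\<^sup>2))" by (intro sum_mono a) auto
    also have "\<dots> = \<psi> * (real d * \<delta> * w\<^sup>2 + 1/8 * ?SG + 1/8 * ?SF)"
      by (simp add: sum.distrib sum_distrib_left[symmetric] sum_divide_distrib)
    finally show ?thesis .
  qed
  also have "\<dots> \<le> \<psi> * (1/4 * w\<^sup>2 + 1/8 * ?SG + 1/8 * ?SF)"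
    using \<psi> \<delta> by (intro mult_left_mono add_right_mono mult_right_mono) auto
  finally have 1: "- (w * (\<Sum>i<d. p i * (G i - F i))) \<le> \<psi> * (1/4 * w\<^sup>2 + 1/8 * ?SG + 1/8 * ?SF)" .
  have 2: "(\<Sum>i<d. G i * (\<psi> * (G i - F i))) \<ge> \<psi> * (3/4 * ?SG - ?SF)"
  proof -
    have "\<psi> * (3/4 * ?SG - ?SF) = (\<Sum>i<d. \<psi> * (3/4 * (G i)\<^sup>2 - (F i)\<^sup>2))"
      by (simp only: sum_distrib_left sum_subtractf[symmetric])
    also have "\<dots> \<le> (\<Sum>i<d. \<psi> * (G i * (G i - F i)))"
    proof (intro sum_mono mult_left_mono)
      fix i show "3/4 * (G i)\<^sup>2 - (F i)\<^sup>2 \<le> G i * (G i - F i)"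
        using b[of i] by (simp add: power2_eq_square algebra_simps)
    qed (use \<psi> in auto)
    also have "\<dots> = (\<Sum>i<d. G i * (\<psi> * (G i - F i)))" by (simp add: algebra_simps)
    finally show ?thesis .
  qed
  have 3: "w * (\<psi> * (w - h)) \<ge> \<psi> * (3/4 * w\<^sup>2 - h\<^sup>2)"
  proof -
    have "\<psi> * (3/4 * w\<^sup>2 - h\<^sup>2) \<le> \<psi> * (w * (w - h))"
      using c \<psi> by (intro mult_left_mono) (simp_all add: power2_eq_square algebra_simps)
    then show ?thesis by (simp add: algebra_simps)
  qed
  have 4: "\<psi> * (h\<^sup>2 + 9/8 * ?SF) \<le> h\<^sup>2 + 2 * ?SF"
  proof -
    have "\<psi> * (h\<^sup>2 + 9/8 * ?SF) \<le> 1 * (h\<^sup>2 + 9/8 * ?SF)" using \<psi> S by (intro mult_right_mono) auto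
    then show ?thesis using S by simp
  qed
  \<comment> \<open>The balance of the Young constants: \<open>w^2\<close> comes out exactly
    (\<open>1/4 + 1/2 = 3/4\<close>), the gradient has \<open>1/8\<close> to spare, and
    \<open>1/8 = 9/8 - 1\<close> for \<open>F\<close>.\<close>
  have "\<psi> * (1/4 * w\<^sup>2 + 1/8 * ?SG + 1/8 * ?SF) + 1/2 * (\<psi> * (w\<^sup>2 + ?SG)) \<le>
    \<psi> * (3/4 * ?SG - ?SF) + \<psi> * (3/4 * w\<^sup>2 - h\<^sup>2) + \<psi> * (h\<^sup>2 + 9/8 * ?SF)"
    using mult_nonneg_nonneg[OF \<psi>(1) S(1)] by (simp add: algebra_simps)
  then show ?thesis using 1 2 3 4 unfolding distrib_left[of w] by linarith
qed

lemma integrable_bounded_mult: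
  fixes f \<psi> :: "'a \<Rightarrow> real"
  assumes "integrable M \<psi>" "f \<in> borel_measurable M" "\<And>x. x \<in> space M \<Longrightarrow> \<bar>f x\<bar> \<le> C * \<bar>\<psi> x\<bar>"
  shows "integrable M f"
  by (rule Bochner_Integration.integrable_bound[of M "\<lambda>x. C * \<psi> x"])
    (use assms in \<open>auto intro!: AE_I2 simp: abs_mult intro: order_trans[OF _ mult_right_mono[OF abs_ge_self]]\<close>)

text \<open>A bounded classical solution with square integrable data lies in \<open>H1\<close>: the
  equation is tested with \<open>w\<close> times an integrable weight. The bounds \<open>C\<close>
  make all integrals finite but do not enter the resulting estimate, which survives the limit of the
  weights.\<close>

theorem helmholtz_energy:
  assumes w: "smooth d w" and F: "\<And>i. i < d \<Longrightarrow> smooth d (F i)" and h: "h \<in> borel_measurable (Rd_leb d)"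
    and bw: "\<And>x. x \<in> Rd d \<Longrightarrow> \<bar>w x\<bar> \<le> C" and bG: "\<And>i x. i < d \<Longrightarrow> x \<in> Rd d \<Longrightarrow> \<bar>partial_deriv i w x\<bar> \<le> C"
    and bF: "\<And>i x. i < d \<Longrightarrow> x \<in> Rd d \<Longrightarrow> \<bar>F i x\<bar> \<le> C" and bh: "\<And>x. x \<in> Rd d \<Longrightarrow> \<bar>h x\<bar> \<le> C"
    and LF: "\<And>i. i < d \<Longrightarrow> F i \<in> L2 d (Rd d)" and Lh: "h \<in> L2 d (Rd d)"
    and eq: "helmholtz d w (\<lambda>x. h x - (\<Sum>i<d. partial_deriv i (F i) x))"
  shows "w \<in> L2 d (Rd d)" "\<And>i. i < d \<Longrightarrow> partial_deriv i w \<in> L2 d (Rd d)"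
proof -
  let ?M = "Rd_leb d"
  let ?G = "\<lambda>i. partial_deriv i w"
  let ?E = "\<lambda>x. (w x)\<^sup>2 + (\<Sum>i<d. (?G i x)\<^sup>2)"
  let ?H = "\<lambda>x. (h x)\<^sup>2 + 2 * (\<Sum>i<d. (F i x)\<^sup>2)"
  note [measurable] = smooth_measurable[OF w] smooth_measurable[OF F] smooth_measurable[OF smooth_pd[OF w]] h
  have C0: "0 \<le> C"
  proof -
    have "(\<lambda>_\<in>{..<d}. 0) \<in> Rd d" by auto
    from bw[OF this] show ?thesis by (rule order_trans[OF abs_ge_zero])
  qed
  \<comment> \<open>Chosen so that every \<open>\<delta> n\<close> meets both smallness conditions
    of \<open>energy_pointwise\<close>.\<close>
  define c where "c = 1 / (4 * (real d + 1))"
  have c: "0 < c" "real d * c \<le> 1/4" "c \<le> 1/4" by (auto simp: c_def field_simps)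
  define \<delta> where "\<delta> n = c / real (Suc n)" for n
  have \<delta>: "0 < \<delta> n" "real d * \<delta> n \<le> 1/4" "\<delta> n \<le> 1/4" for n
  proof -
    show "0 < \<delta> n" using c by (simp add: \<delta>_def)
    have "\<delta> n \<le> c" using c by (simp add: \<delta>_def divide_le_eq)
    then show "\<delta> n \<le> 1/4" "real d * \<delta> n \<le> 1/4" using c mult_left_mono[of "\<delta> n" c "real d"] by linarith+
  qed
  have intE: "integrable ?M (\<lambda>x. weight d (\<delta> n) x * ?E x)" for n
  proof (rule integrable_bounded_mult[OF weight_integrable[OF \<delta>(1), of d n], where C="C\<^sup>2 + real d * C\<^sup>2"])
    show "(\<lambda>x. weight d (\<delta> n) x * ?E x) \<in> borel_measurable ?M"
      using smooth_measurable[OF smooth_weight] by measurable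
    fix x assume "x \<in> space ?M"
    then have x: "x \<in> Rd d" by simp
    have "(w x)\<^sup>2 \<le> C\<^sup>2" "i < d \<Longrightarrow> (?G i x)\<^sup>2 \<le> C\<^sup>2" for i
      using bw[OF x] bG[of i x] x C0 by (auto simp: abs_le_square_iff[symmetric])
    then have "?E x \<le> C\<^sup>2 + real d * C\<^sup>2"
      using sum_bounded_above[of "{..<d}" "\<lambda>i. (?G i x)\<^sup>2" "C\<^sup>2"] by (intro add_mono) auto
    moreover have "0 \<le> ?E x" by (intro add_nonneg_nonneg sum_nonneg) auto
    ultimately show "\<bar>weight d (\<delta> n) x * ?E x\<bar> \<le> (C\<^sup>2 + real d * C\<^sup>2) * \<bar>weight d (\<delta> n) x\<bar>"
      unfolding abs_mult mult.commute[of "C\<^sup>2 + real d * C\<^sup>2"] by (intro mult_left_mono) auto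
  qed
  have intH: "integrable ?M ?H"
    using LF Lh by (auto simp: L2_Rd intro!: Bochner_Integration.integrable_add integrable_mult_right)
  have bound: "(\<integral>x. weight d (\<delta> n) x * ?E x \<partial>?M) \<le> 2 * (\<integral>x. ?H x \<partial>?M)" for n
  proof -
    let ?\<psi> = "weight d (\<delta> n)"
    let ?\<Phi> = "\<lambda>i x. ?\<psi> x * (?G i x - F i x)"
    have s: "smooth d (\<lambda>x. ?G i x - F i x)" if "i < d" for i
      using that by (intro smooth_diff smooth_pd w F)
    have sP: "smooth d (?\<Phi> i)" if "i < d" for i
      using that by (intro smooth_mult smooth_weight s)
    have pd: "(\<Sum>i<d. partial_deriv i (?\<Phi> i) x) =
        (\<Sum>i<d. partial_deriv i ?\<psi> x * (?G i x - F i x)) + ?\<psi> x * (w x - h x)" if x: "x \<in> Rd d" for x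
    proof -
      have "(\<Sum>i<d. partial_deriv i (?\<Phi> i) x) =
        (\<Sum>i<d. partial_deriv i ?\<psi> x * (?G i x - F i x) + ?\<psi> x * partial_deriv i (\<lambda>x. ?G i x - F i x) x)"
        by (rule sum.cong[OF refl]) (rule pd_mult[OF smooth_weight s _ x], simp_all)
      also have "\<dots> = (\<Sum>i<d. partial_deriv i ?\<psi> x * (?G i x - F i x)) + ?\<psi> x * (\<Sum>i<d. partial_deriv i (\<lambda>x. ?G i x - F i x) x)"
        by (simp add: sum.distrib sum_distrib_left)
      also have "(\<Sum>i<d. partial_deriv i (\<lambda>x. ?G i x - F i x) x) = w x - h x"
      proof -
    have "w x - (\<Sum>i<d. partial_deriv i (?G i) x) = h x - (\<Sum>i<d. partial_deriv i (F i) x)"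
      using eq x by (simp add: helmholtz_def)
    moreover have "(\<Sum>i<d. partial_deriv i (\<lambda>x. ?G i x - F i x) x) =
        (\<Sum>i<d. partial_deriv i (?G i) x) - (\<Sum>i<d. partial_deriv i (F i) x)"
      by (rule pd_div_sum[OF x smooth_pd[OF w] F])
    ultimately show ?thesis by linarith
  qed
      finally show ?thesis .
    qed
    note \<psi>int = weight_integrable[OF \<delta>(1), of d n]
    note [measurable] = smooth_measurable[OF smooth_weight, of d "\<delta> n"] smooth_measurable[OF smooth_pd[OF smooth_weight], of _ d "\<delta> n"]
      smooth_measurable[OF smooth_pd[OF sP]]
    have \<psi>0: "0 < ?\<psi> x" for x by (rule weight_bounds)
    have GF: "\<bar>?G i x - F i x\<bar> \<le> 2 * C" if "i < d" "x \<in> Rd d" for i x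
      using bG[OF that] bF[OF that] by linarith
    have i1: "integrable ?M (\<lambda>x. w x * ?\<Phi> i x)" if "i < d" for i
    proof (rule integrable_bounded_mult[OF \<psi>int, where C="C * (2 * C)"])
      fix x assume "x \<in> space ?M"
      then have "\<bar>w x * (?G i x - F i x)\<bar> \<le> C * (2 * C)" using that by (intro abs_bound_mult bw GF) auto
      then have "\<bar>w x * (?G i x - F i x)\<bar> * \<bar>?\<psi> x\<bar> \<le> C * (2 * C) * \<bar>?\<psi> x\<bar>" by (intro mult_right_mono) auto
      then show "\<bar>w x * ?\<Phi> i x\<bar> \<le> C * (2 * C) * \<bar>?\<psi> x\<bar>" by (simp only: abs_mult ac_simps)
    qed (use that in measurable)
    have i2: "integrable ?M (\<lambda>x. ?G i x * ?\<Phi> i x)" if "i < d" for i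
    proof (rule integrable_bounded_mult[OF \<psi>int, where C="C * (2 * C)"])
      fix x assume "x \<in> space ?M"
      then have "\<bar>?G i x * (?G i x - F i x)\<bar> \<le> C * (2 * C)" using that by (intro abs_bound_mult bG GF) auto
      then have "\<bar>?G i x * (?G i x - F i x)\<bar> * \<bar>?\<psi> x\<bar> \<le> C * (2 * C) * \<bar>?\<psi> x\<bar>" by (intro mult_right_mono) auto
      then show "\<bar>?G i x * ?\<Phi> i x\<bar> \<le> C * (2 * C) * \<bar>?\<psi> x\<bar>" by (simp only: abs_mult ac_simps)
    qed (use that in measurable)
    have i3: "integrable ?M (\<lambda>x. w x * (\<Sum>i<d. partial_deriv i (?\<Phi> i) x))"
    proof (rule integrable_bounded_mult[OF \<psi>int, where C="C * (real d * (\<delta> n * (2 * C)) + 2 * C)"])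
      fix x assume "x \<in> space ?M"
      then have x: "x \<in> Rd d" by simp
      have "\<bar>\<Sum>i<d. partial_deriv i ?\<psi> x * (?G i x - F i x)\<bar> \<le> (\<Sum>i<d. \<bar>partial_deriv i ?\<psi> x * (?G i x - F i x)\<bar>)"
        by (rule sum_abs)
      also have "\<dots> \<le> (\<Sum>i<d. \<delta> n * ?\<psi> x * (2 * C))"
        using x by (intro sum_mono abs_bound_mult weight_pd_bound \<delta> GF) auto
      finally have "\<bar>\<Sum>i<d. partial_deriv i ?\<psi> x * (?G i x - F i x)\<bar> \<le> real d * (\<delta> n * (2 * C)) * \<bar>?\<psi> x\<bar>"
        using \<psi>0[of x] by (simp add: ac_simps)
      moreover have "\<bar>?\<psi> x * (w x - h x)\<bar> \<le> 2 * C * \<bar>?\<psi> x\<bar>"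
        using bw[OF x] bh[OF x] unfolding abs_mult mult.commute[of "2 * C"] by (intro mult_left_mono) auto
      ultimately have "\<bar>\<Sum>i<d. partial_deriv i (?\<Phi> i) x\<bar> \<le> (real d * (\<delta> n * (2 * C)) + 2 * C) * \<bar>?\<psi> x\<bar>"
        unfolding pd[OF x] distrib_right by (intro order_trans[OF abs_triangle_ineq add_mono])
      then have "\<bar>w x * (\<Sum>i<d. partial_deriv i (?\<Phi> i) x)\<bar> \<le> C * ((real d * (\<delta> n * (2 * C)) + 2 * C) * \<bar>?\<psi> x\<bar>)"
        by (intro abs_bound_mult bw x)
      then show "\<bar>w x * (\<Sum>i<d. partial_deriv i (?\<Phi> i) x)\<bar> \<le> C * (real d * (\<delta> n * (2 * C)) + 2 * C) * \<bar>?\<psi> x\<bar>"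
        by (simp only: mult.assoc)
    qed measurable
    have div: "(\<integral>x. w x * (\<Sum>i<d. partial_deriv i (?\<Phi> i) x) \<partial>?M) = - (\<Sum>i<d. \<integral>x. ?G i x * ?\<Phi> i x \<partial>?M)"
      by (rule divergence[OF smooth_test_pair[OF w] locally_integrable_smooth[OF w] _ sP i1 i2 i3]) measurable
    have iS: "integrable ?M (\<lambda>x. \<Sum>i<d. ?G i x * ?\<Phi> i x)"
      by (intro Bochner_Integration.integrable_sum i2) auto
    \<comment> \<open>The integrand is the divergence of \<open>w\<close> times
      \<open>?\<Phi>\<close>.\<close>
    have zero: "(\<integral>x. w x * (\<Sum>i<d. partial_deriv i (?\<Phi> i) x) + (\<Sum>i<d. ?G i x * ?\<Phi> i x) \<partial>?M) = 0"
    proof -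
      have "(\<integral>x. (\<Sum>i<d. ?G i x * ?\<Phi> i x) \<partial>?M) = (\<Sum>i<d. \<integral>x. ?G i x * ?\<Phi> i x \<partial>?M)"
        by (intro Bochner_Integration.integral_sum i2) auto
      then show ?thesis using Bochner_Integration.integral_add[OF i3 iS] div by simp
    qed
    have "(\<integral>x. 1/2 * (?\<psi> x * ?E x) \<partial>?M) \<le>
      (\<integral>x. (w x * (\<Sum>i<d. partial_deriv i (?\<Phi> i) x) + (\<Sum>i<d. ?G i x * ?\<Phi> i x)) + ?H x \<partial>?M)"
    proof (rule integral_mono)
      show "integrable ?M (\<lambda>x. 1/2 * (?\<psi> x * ?E x))" using intE[of n] by (rule integrable_mult_right)
      show "integrable ?M (\<lambda>x. (w x * (\<Sum>i<d. partial_deriv i (?\<Phi> i) x) + (\<Sum>i<d. ?G i x * ?\<Phi> i x)) + ?H x)"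
        by (intro Bochner_Integration.integrable_add[OF Bochner_Integration.integrable_add[OF i3 iS] intH])
      fix x assume "x \<in> space ?M"
      then have x: "x \<in> Rd d" by simp
      show "1/2 * (?\<psi> x * ?E x) \<le> (w x * (\<Sum>i<d. partial_deriv i (?\<Phi> i) x) + (\<Sum>i<d. ?G i x * ?\<Phi> i x)) + ?H x"
        unfolding pd[OF x]
        by (rule energy_pointwise[OF less_imp_le[OF \<psi>0] weight_bounds(2) \<delta> weight_pd_bound[OF _ x \<delta>(1)]])
    qed
    also have "\<dots> = 0 + (\<integral>x. ?H x \<partial>?M)"
      unfolding zero[symmetric] by (rule Bochner_Integration.integral_add[OF Bochner_Integration.integrable_add[OF i3 iS] intH])
    finally show ?thesis by simp
  qed
  have intE': "integrable ?M ?E"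
  proof (rule integrable_of_weighted[OF _ _ _ _ _ intE bound])
    show "weight d (\<delta> n) \<in> borel_measurable ?M" for n by (rule smooth_measurable[OF smooth_weight])
    show "(\<lambda>n. weight d (\<delta> n) x) \<longlonglongrightarrow> 1" for x unfolding \<delta>_def by (rule weight_tendsto)
    show "0 \<le> weight d (\<delta> n) x" for n x using weight_bounds(1) by (rule less_imp_le)
    show "0 \<le> ?E x" for x by (intro add_nonneg_nonneg sum_nonneg) auto
  qed measurable
  have E0: "0 \<le> (\<Sum>i<d. (?G i x)\<^sup>2)" for x by (intro sum_nonneg) auto
  have "integrable ?M (\<lambda>x. (w x)\<^sup>2)"
    by (rule Bochner_Integration.integrable_bound[OF intE']) (use E0 in \<open>auto intro!: AE_I2\<close>)
  then show "w \<in> L2 d (Rd d)" unfolding L2_Rd using smooth_measurable[OF w] by simp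
  show "partial_deriv i w \<in> L2 d (Rd d)" if i: "i < d" for i
  proof -
    have "integrable ?M (\<lambda>x. (?G i x)\<^sup>2)"
    proof (rule Bochner_Integration.integrable_bound[OF intE'])
      show "AE x in ?M. norm ((?G i x)\<^sup>2) \<le> norm (?E x)"
      proof (rule AE_I2)
        fix x
        have "(?G i x)\<^sup>2 \<le> (\<Sum>i<d. (?G i x)\<^sup>2)" using i by (intro member_le_sum) auto
        then show "norm ((?G i x)\<^sup>2) \<le> norm (?E x)" using E0[of x] by (simp add: add_increasing)
      qed
    qed (use i in measurable)
    then show ?thesis unfolding L2_Rd using smooth_measurable[OF smooth_pd[OF w i]] by simp
  qed
qed

text \<open>The field \<open>\<nabla>w - F\<close> is used as a whole because its divergence equals
  \<open>w - h\<close> and is square integrable, whereas nothing is known of this kind about the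
  divergences of its two parts.\<close>

theorem helmholtz_weak:
  assumes w: "smooth d w" and F: "\<And>i. i < d \<Longrightarrow> smooth d (F i)"
    and Lw: "w \<in> L2 d (Rd d)" and LG: "\<And>i. i < d \<Longrightarrow> partial_deriv i w \<in> L2 d (Rd d)"
    and LF: "\<And>i. i < d \<Longrightarrow> F i \<in> L2 d (Rd d)" and Lh: "h \<in> L2 d (Rd d)"
    and eq: "helmholtz d w (\<lambda>x. h x - (\<Sum>i<d. partial_deriv i (F i) x))"
    and v: "v \<in> L2 d (Rd d)" and g: "is_weak_grad d (Rd d) v g"
  shows "(\<integral>x. w x * v x + (\<Sum>i<d. partial_deriv i w x * g i x) \<partial>Rd_leb d) =
         (\<integral>x. h x * v x + (\<Sum>i<d. F i x * g i x) \<partial>Rd_leb d)"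
proof -
  let ?M = "Rd_leb d"
  let ?G = "\<lambda>i. partial_deriv i w"
  have Lg: "g i \<in> L2 d (Rd d)" if "i < d" for i by (rule is_weak_gradD(1)[OF g that])
  have Lwh: "(\<lambda>x. w x - h x) \<in> L2 d (Rd d)" using L2_lincomb_Rd[OF Lw Lh, of 1 "-1"] by simp
  have LGF: "(\<lambda>x. ?G i x - F i x) \<in> L2 d (Rd d)" if "i < d" for i
    using L2_lincomb_Rd[OF LG[OF that] LF[OF that], of 1 "-1"] by simp
  have div: "(\<Sum>i<d. partial_deriv i (\<lambda>x. ?G i x - F i x) x) = w x - h x" if x: "x \<in> Rd d" for x
  proof -
    have "w x - (\<Sum>i<d. partial_deriv i (?G i) x) = h x - (\<Sum>i<d. partial_deriv i (F i) x)"
      using eq x by (simp add: helmholtz_def)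
    moreover have "(\<Sum>i<d. partial_deriv i (\<lambda>x. ?G i x - F i x) x) =
        (\<Sum>i<d. partial_deriv i (?G i) x) - (\<Sum>i<d. partial_deriv i (F i) x)"
      by (rule pd_div_sum[OF x smooth_pd[OF w] F])
    ultimately show ?thesis by linarith
  qed
  have cong: "(\<integral>x. v x * (\<Sum>i<d. partial_deriv i (\<lambda>x. ?G i x - F i x) x) \<partial>?M) = (\<integral>x. v x * (w x - h x) \<partial>?M)"
    by (rule Bochner_Integration.integral_cong[OF refl]) (simp add: div)
  have "(\<integral>x. v x * (\<Sum>i<d. partial_deriv i (\<lambda>x. ?G i x - F i x) x) \<partial>?M) = - (\<Sum>i<d. \<integral>x. g i x * (?G i x - F i x) \<partial>?M)"
  proof (rule divergence)
    show "test_pair d v g" using g is_weak_grad_Rd by blast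
    show "locally_integrable d v" using v locally_integrable_L2 by (simp add: L2_Rd)
    show "g i \<in> borel_measurable ?M" if "i < d" for i using Lg[OF that] by (simp add: L2_Rd)
    show "smooth d (\<lambda>x. ?G i x - F i x)" if "i < d" for i using that by (intro smooth_diff smooth_pd w F)
    show "integrable ?M (\<lambda>x. v x * (?G i x - F i x))" "integrable ?M (\<lambda>x. g i x * (?G i x - F i x))" if "i < d" for i
      using that by (intro L2_mult_integrable v LGF Lg; simp)+
    have "integrable ?M (\<lambda>x. v x * (w x - h x))" by (rule L2_mult_integrable[OF v Lwh])
    then show "integrable ?M (\<lambda>x. v x * (\<Sum>i<d. partial_deriv i (\<lambda>x. ?G i x - F i x) x))"
      by (rule Bochner_Integration.integrable_cong[OF refl, THEN iffD1, rotated]) (simp add: div)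
  qed
  then have *: "(\<integral>x. v x * (w x - h x) \<partial>?M) = - (\<Sum>i<d. \<integral>x. g i x * (?G i x - F i x) \<partial>?M)" unfolding cong .
  have i1: "integrable ?M (\<lambda>x. v x * (w x - h x))" by (rule L2_mult_integrable[OF v Lwh])
  have i2: "integrable ?M (\<lambda>x. g i x * (?G i x - F i x))" if "i < d" for i
    using that by (intro L2_mult_integrable LGF Lg)
  have iw: "integrable ?M (\<lambda>x. w x * v x + (\<Sum>i<d. ?G i x * g i x))"
    using Lw v LG Lg by (intro Bochner_Integration.integrable_add Bochner_Integration.integrable_sum L2_mult_integrable) auto
  have ih: "integrable ?M (\<lambda>x. h x * v x + (\<Sum>i<d. F i x * g i x))"
    using Lh v LF Lg by (intro Bochner_Integration.integrable_add Bochner_Integration.integrable_sum L2_mult_integrable) auto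
  have "(\<integral>x. w x * v x + (\<Sum>i<d. ?G i x * g i x) \<partial>?M) - (\<integral>x. h x * v x + (\<Sum>i<d. F i x * g i x) \<partial>?M) =
    (\<integral>x. v x * (w x - h x) + (\<Sum>i<d. g i x * (?G i x - F i x)) \<partial>?M)"
    unfolding Bochner_Integration.integral_diff[OF iw ih, symmetric]
    by (intro Bochner_Integration.integral_cong refl) (simp add: algebra_simps sum_subtractf)
  also have "\<dots> = (\<integral>x. v x * (w x - h x) \<partial>?M) + (\<Sum>i<d. \<integral>x. g i x * (?G i x - F i x) \<partial>?M)"
  proof -
    have iS: "integrable ?M (\<lambda>x. \<Sum>i<d. g i x * (?G i x - F i x))"
      by (intro Bochner_Integration.integrable_sum i2) auto
    have "(\<integral>x. (\<Sum>i<d. g i x * (?G i x - F i x)) \<partial>?M) = (\<Sum>i<d. \<integral>x. g i x * (?G i x - F i x) \<partial>?M)"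
      by (intro Bochner_Integration.integral_sum i2) auto
    then show ?thesis using Bochner_Integration.integral_add[OF i1 iS] by simp
  qed
  also have "\<dots> = 0" unfolding * by simp
  finally show ?thesis by simp
qed

section \<open>The contraction\<close>

lemma openin_Rd: "openin (Rd_top d) (Rd d)"
  using openin_topspace[of "Rd_top d"] unfolding topspace_Rd_top .

lemma L2_bounded_times:
  assumes a: "a \<in> borel_measurable (Rd_leb d)" "\<And>x. x \<in> Rd d \<Longrightarrow> \<bar>a x\<bar> \<le> C" and u: "u \<in> L2 d (Rd d)"
  shows "(\<lambda>x. a x * u x) \<in> L2 d (Rd d)"
proof -
  have um: "u \<in> borel_measurable (Rd_leb d)" "integrable (Rd_leb d) (\<lambda>x. (u x)\<^sup>2)" using u by (auto simp: L2_Rd)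
  have "integrable (Rd_leb d) (\<lambda>x. (a x * u x)\<^sup>2)"
  proof (rule integrable_bounded_mult[OF um(2), where C="C\<^sup>2"])
    show "(\<lambda>x. (a x * u x)\<^sup>2) \<in> borel_measurable (Rd_leb d)" using a um by measurable
    fix x assume "x \<in> space (Rd_leb d)"
    then have "\<bar>a x\<bar>\<^sup>2 \<le> C\<^sup>2" using a(2)[of x] by (intro power_mono) auto
    then show "\<bar>(a x * u x)\<^sup>2\<bar> \<le> C\<^sup>2 * \<bar>(u x)\<^sup>2\<bar>" by (simp add: power_mult_distrib mult_right_mono)
  qed
  then show ?thesis unfolding L2_Rd using a um by simp
qed

lemma L2_sum:
  assumes "finite I" "\<And>i. i \<in> I \<Longrightarrow> u i \<in> L2 d (Rd d)"
  shows "(\<lambda>x. \<Sum>i\<in>I. u i x) \<in> L2 d (Rd d)"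
  using assms
proof (induction I rule: finite_induct)
  case empty
  then show ?case by (simp add: L2_Rd)
next
  case (insert i I)
  then show ?case using L2_lincomb_Rd[of "u i" d "\<lambda>x. \<Sum>i\<in>I. u i x" 1 1] by simp
qed

lemma mat_vec_le_op_norm: "L2_set (mat_vec d M p) {..<d} \<le> op_norm d M * L2_set p {..<d}"
proof -
  let ?S = "{x \<in> Rd d. L2_set x {..<d} \<le> 1}"
  have comp: "\<bar>y k\<bar> \<le> L2_set y {..<d}" if "k < d" for y k
    using member_le_L2_set[of "{..<d}" k "\<lambda>i. \<bar>y i\<bar>"] that by (simp add: L2_set_def)
  have bdd: "bdd_above ((\<lambda>x. L2_set (mat_vec d M x) {..<d}) ` ?S)"
  proof (rule bdd_aboveI2)
    fix x assume x: "x \<in> ?S"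
    have xj: "\<bar>x j\<bar> \<le> 1" if "j < d" for j using comp[OF that, of x] x by simp
    have "L2_set (mat_vec d M x) {..<d} \<le> (\<Sum>i<d. \<bar>mat_vec d M x i\<bar>)" by (rule L2_set_le_sum_abs)
    also have "\<dots> \<le> (\<Sum>i<d. \<Sum>j<d. \<bar>M i j\<bar>)"
    proof (rule sum_mono)
      fix i assume "i \<in> {..<d}"
      then have "\<bar>mat_vec d M x i\<bar> \<le> (\<Sum>j<d. \<bar>M i j * x j\<bar>)" by (simp add: mat_vec_def)
      also have "\<dots> \<le> (\<Sum>j<d. \<bar>M i j\<bar> * 1)"
        unfolding abs_mult using xj by (intro sum_mono mult_left_mono) auto
      finally show "\<bar>mat_vec d M x i\<bar> \<le> (\<Sum>j<d. \<bar>M i j\<bar>)" by simp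
    qed
    finally show "L2_set (mat_vec d M x) {..<d} \<le> (\<Sum>i<d. \<Sum>j<d. \<bar>M i j\<bar>)" .
  qed
  let ?n = "L2_set p {..<d}"
  have n0: "0 \<le> ?n" by (rule L2_set_nonneg)
  \<comment> \<open>The normalised vector, restricted so as to lie in \<open>Rd d\<close>. If
    \<open>?n = 0\<close>, it is 0, and so are the components of \<open>p\<close>.\<close>
  define q where "q = (\<lambda>i\<in>{..<d}. p i / ?n)"
  have p: "p j = ?n * q j" if "j < d" for j
    using comp[OF that, of p] that by (cases "?n = 0") (auto simp: q_def)
  have "L2_set q {..<d} = L2_set (\<lambda>i. (1 / ?n) * p i) {..<d}" by (simp add: q_def L2_set_def)
  also have "\<dots> = \<bar>1 / ?n\<bar> * ?n" by (rule L2_set_cmult)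
  finally have "L2_set q {..<d} \<le> 1" using n0 by (cases "?n = 0") auto
  then have q: "q \<in> ?S" by (auto simp: q_def)
  have "L2_set (mat_vec d M p) {..<d} = L2_set (\<lambda>i. ?n * mat_vec d M q i) {..<d}"
  proof -
    have "mat_vec d M p i = ?n * mat_vec d M q i" if "i < d" for i
    proof -
      have "(\<Sum>j<d. M i j * p j) = (\<Sum>j<d. ?n * (M i j * q j))"
      proof (rule sum.cong[OF refl])
        fix j assume "j \<in> {..<d}"
        then have "M i j * p j = M i j * (?n * q j)" by (intro arg_cong[where f="(*) (M i j)"] p) simp
        then show "M i j * p j = ?n * (M i j * q j)" by (simp only: mult.left_commute)
      qed
      then show ?thesis using that by (simp add: mat_vec_def sum_distrib_left)
    qed
    then show ?thesis by (simp add: L2_set_def)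
  qed
  also have "\<dots> = ?n * L2_set (mat_vec d M q) {..<d}" using n0 by (simp add: L2_set_cmult)
  also have "\<dots> \<le> ?n * op_norm d M"
    unfolding op_norm_def by (intro mult_left_mono cSUP_upper[OF q bdd] n0)
  finally show ?thesis by (simp add: mult.commute)
qed

lemma dot_mat_vec: "dot d (mat_vec d M p) q = (\<Sum>i<d. (\<Sum>j<d. M i j * p j) * q i)"
  by (simp add: dot_def mat_vec_def)

text \<open>\<open>CA\<close> serves integrability only; the rates depend on the coefficients
  through \<open>a_min\<close>, \<open>a_max\<close>, \<open>c_min\<close>,
  \<open>c_max\<close>.\<close>

locale elliptic =
  fixes d :: nat and A :: "vec \<Rightarrow> nat \<Rightarrow> nat \<Rightarrow> real" and c f us :: "vec \<Rightarrow> real"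
    and a_min a_max c_min c_max CA :: real
  assumes d: "1 \<le> d" and co: "coeff_assm d A c f a_min a_max c_min c_max"
    and ws: "weak_solution d A c f us"
    and A_smooth: "\<And>i j. i < d \<Longrightarrow> j < d \<Longrightarrow> smooth d (\<lambda>x. A x i j)"
    and A_bound: "\<And>i j x. i < d \<Longrightarrow> j < d \<Longrightarrow> x \<in> Rd d \<Longrightarrow> \<bar>A x i j\<bar> \<le> CA"
    and c_smooth: "smooth d c"
begin

definition "lam = min a_min c_min"
definition "Lam = max a_max c_max"

abbreviation "M \<equiv> Rd_leb d"
abbreviation "gs \<equiv> weak_grad d (Rd d) us"
abbreviation "AV x p i \<equiv> (\<Sum>j<d. A x i j * p j)"

lemma c_bounds: "x \<in> Rd d \<Longrightarrow> c_min \<le> c x" "x \<in> Rd d \<Longrightarrow> c x \<le> c_max" "0 < c_min" "0 < a_min"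
  using co by (auto simp: coeff_assm_def)

lemma f_L2: "f \<in> L2 d (Rd d)"
  using co by (simp add: coeff_assm_def)

lemma zero_in_Rd: "(\<lambda>_\<in>{..<d}. 0) \<in> Rd d"
  by auto

lemma lam_pos: "0 < lam"
  using c_bounds by (simp add: lam_def)

lemma AV_bound:
  assumes x: "x \<in> Rd d" shows "(\<Sum>i<d. (AV x p i)\<^sup>2) \<le> Lam\<^sup>2 * (\<Sum>i<d. (p i)\<^sup>2)"
proof -
  have "op_norm d (A x) \<le> a_max" using co x by (auto simp: coeff_assm_def)
  then have "op_norm d (A x) * L2_set p {..<d} \<le> Lam * L2_set p {..<d}"
    by (intro mult_right_mono L2_set_nonneg) (simp add: Lam_def)
  then have "L2_set (mat_vec d (A x) p) {..<d} \<le> Lam * L2_set p {..<d}"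
    using mat_vec_le_op_norm[of d "A x" p] by (rule order_trans[rotated])
  then have "(L2_set (mat_vec d (A x) p) {..<d})\<^sup>2 \<le> (Lam * L2_set p {..<d})\<^sup>2"
    by (intro power_mono L2_set_nonneg)
  then show ?thesis by (simp add: L2_set_def sum_nonneg power_mult_distrib mat_vec_def)
qed

lemma coercive_pointwise:
  assumes x: "x \<in> Rd d"
  shows "lam * (e\<^sup>2 + (\<Sum>i<d. (p i)\<^sup>2)) \<le> c x * e * e + (\<Sum>i<d. AV x p i * p i)"
proof -
  let ?q = "restrict p {..<d}"
  have "?q \<in> Rd d" by auto
  then have "a_min * (L2_set ?q {..<d})\<^sup>2 \<le> dot d ?q (mat_vec d (A x) ?q)"
    using co x by (auto simp: coeff_assm_def)
  then have 1: "a_min * (\<Sum>i<d. (p i)\<^sup>2) \<le> (\<Sum>i<d. AV x p i * p i)"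
    by (simp add: L2_set_def sum_nonneg dot_def mat_vec_def mult.commute)
  have "lam * (\<Sum>i<d. (p i)\<^sup>2) \<le> a_min * (\<Sum>i<d. (p i)\<^sup>2)"
    by (intro mult_right_mono sum_nonneg) (auto simp: lam_def)
  moreover have "lam * e\<^sup>2 \<le> c x * e\<^sup>2"
    using c_bounds(1)[OF x] by (intro mult_right_mono) (auto simp: lam_def)
  ultimately show ?thesis using 1 by (simp add: distrib_left power2_eq_square mult.assoc)
qed

text \<open>Continuity of the bilinear form in Young's version: after integration only squared norms
  occur, which replaces the Cauchy-Schwarz inequality in \<open>H1\<close>.\<close>

lemma bounded_pointwise:
  assumes x: "x \<in> Rd d"
  shows "c x * e * v + (\<Sum>i<d. AV x p i * q i) \<le>
    1/2 * (Lam\<^sup>2 * (e\<^sup>2 + (\<Sum>i<d. (p i)\<^sup>2)) + (v\<^sup>2 + (\<Sum>i<d. (q i)\<^sup>2)))"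
proof -
  have young: "a * b \<le> 1/2 * (a\<^sup>2 + b\<^sup>2)" for a b :: real
    using sum_squares_bound[of a b] by simp
  have "\<bar>c x\<bar> \<le> Lam" using c_bounds(1,2)[OF x] c_bounds(3) by (auto simp: Lam_def)
  then have "(c x)\<^sup>2 \<le> Lam\<^sup>2" by (metis abs_ge_zero power2_abs power_mono)
  then have "(c x)\<^sup>2 * e\<^sup>2 \<le> Lam\<^sup>2 * e\<^sup>2" by (intro mult_right_mono) auto
  then have 1: "c x * e * v \<le> 1/2 * (Lam\<^sup>2 * e\<^sup>2 + v\<^sup>2)"
    using young[of "c x * e" v] by (simp add: power_mult_distrib)
  have "(\<Sum>i<d. AV x p i * q i) \<le> (\<Sum>i<d. 1/2 * ((AV x p i)\<^sup>2 + (q i)\<^sup>2))" by (intro sum_mono young)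
  also have "\<dots> = 1/2 * ((\<Sum>i<d. (AV x p i)\<^sup>2) + (\<Sum>i<d. (q i)\<^sup>2))"
    by (simp only: sum.distrib[symmetric] sum_distrib_left)
  also have "\<dots> \<le> 1/2 * (Lam\<^sup>2 * (\<Sum>i<d. (p i)\<^sup>2) + (\<Sum>i<d. (q i)\<^sup>2))"
    using AV_bound[OF x, of p] by simp
  finally show ?thesis using 1 by (simp add: distrib_left)
qed

lemma us_weak_grad: "is_weak_grad d (Rd d) us gs"
  using ws unfolding weak_solution_def by (intro weak_grad_is) simp

lemma us_L2: "us \<in> L2 d (Rd d)"
  using ws H1_L2 unfolding weak_solution_def by blast

lemma gs_L2: "i < d \<Longrightarrow> gs i \<in> L2 d (Rd d)"
  by (rule is_weak_gradD(1)[OF us_weak_grad])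

lemma c_times_L2: "v \<in> L2 d (Rd d) \<Longrightarrow> (\<lambda>x. c x * v x) \<in> L2 d (Rd d)"
proof (rule L2_bounded_times[where C=c_max, OF smooth_measurable[OF c_smooth]])
  show "\<bar>c x\<bar> \<le> c_max" if "x \<in> Rd d" for x
    using c_bounds(1,2)[OF that] c_bounds(3) by simp
qed

lemma AV_L2:
  assumes "\<And>j. j < d \<Longrightarrow> p j \<in> L2 d (Rd d)" "i < d"
  shows "(\<lambda>x. AV x (\<lambda>j. p j x) i) \<in> L2 d (Rd d)"
  using assms by (intro L2_sum L2_bounded_times[where C=CA] smooth_measurable A_smooth A_bound) auto

text \<open>The integrands of the bilinear form and, below, of the \<open>H1\<close> inner product.
  Function and gradient are separate arguments, so that classical and weak gradients can be mixed
  and pointwise inequalities can be integrated.\<close>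

definition form :: "(vec \<Rightarrow> real) \<Rightarrow> (nat \<Rightarrow> vec \<Rightarrow> real) \<Rightarrow> (vec \<Rightarrow> real) \<Rightarrow> (nat \<Rightarrow> vec \<Rightarrow> real) \<Rightarrow> vec \<Rightarrow> real" where
  "form e p v q x = c x * e x * v x + (\<Sum>i<d. AV x (\<lambda>j. p j x) i * q i x)"

definition ip :: "(vec \<Rightarrow> real) \<Rightarrow> (nat \<Rightarrow> vec \<Rightarrow> real) \<Rightarrow> (vec \<Rightarrow> real) \<Rightarrow> (nat \<Rightarrow> vec \<Rightarrow> real) \<Rightarrow> vec \<Rightarrow> real" where
  "ip e p v q x = e x * v x + (\<Sum>i<d. p i x * q i x)"

abbreviation L2pair :: "(vec \<Rightarrow> real) \<Rightarrow> (nat \<Rightarrow> vec \<Rightarrow> real) \<Rightarrow> bool" where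
  "L2pair v g \<equiv> v \<in> L2 d (Rd d) \<and> (\<forall>i<d. g i \<in> L2 d (Rd d))"

lemma form_integrable: "L2pair e p \<Longrightarrow> L2pair v q \<Longrightarrow> integrable M (form e p v q)"
  unfolding form_def[abs_def]
  by (intro Bochner_Integration.integrable_add Bochner_Integration.integrable_sum L2_mult_integrable c_times_L2 AV_L2) auto

lemma ip_integrable: "L2pair e p \<Longrightarrow> L2pair v q \<Longrightarrow> integrable M (ip e p v q)"
  unfolding ip_def[abs_def]
  by (intro Bochner_Integration.integrable_add Bochner_Integration.integrable_sum L2_mult_integrable) auto

text \<open>Replaces the gradient chosen by \<open>weak_grad\<close> for the test function by any
  weak gradient of it.\<close>

lemma weak_solution_form:
  assumes v: "v \<in> L2 d (Rd d)" and g: "is_weak_grad d (Rd d) v g"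
  shows "(\<integral>x. form us gs v g x \<partial>M) = (\<integral>x. f x * v x \<partial>M)"
proof -
  let ?g = "weak_grad d (Rd d) v"
  have H: "v \<in> H1 d (Rd d)" by (rule H1_I[OF v g])
  note g' = weak_grad_is[OF H]
  have gL: "g i \<in> L2 d (Rd d)" "?g i \<in> L2 d (Rd d)" if "i < d" for i
    using is_weak_gradD(1)[OF g that] is_weak_gradD(1)[OF g' that] .
  have "(\<integral>x. dot d (mat_vec d (A x) (\<lambda>j. gs j x)) (\<lambda>i. ?g i x) \<partial>M) + (\<integral>x. c x * us x * v x \<partial>M) = (\<integral>x. f x * v x \<partial>M)"
    using ws H unfolding weak_solution_def by blast
  moreover have "(\<integral>x. dot d (mat_vec d (A x) (\<lambda>j. gs j x)) (\<lambda>i. ?g i x) \<partial>M) = (\<integral>x. (\<Sum>i<d. AV x (\<lambda>j. gs j x) i * ?g i x) \<partial>M)"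
    by (simp only: dot_mat_vec)
  moreover have "(\<integral>x. (\<Sum>i<d. AV x (\<lambda>j. gs j x) i * ?g i x) \<partial>M) = (\<integral>x. (\<Sum>i<d. AV x (\<lambda>j. gs j x) i * g i x) \<partial>M)"
  proof (rule integral_cong_AE)
    have "integrable M (\<lambda>x. \<Sum>i<d. AV x (\<lambda>j. gs j x) i * ?g i x)" "integrable M (\<lambda>x. \<Sum>i<d. AV x (\<lambda>j. gs j x) i * g i x)"
      by (intro Bochner_Integration.integrable_sum L2_mult_integrable AV_L2 gs_L2 gL; simp)+
    then show "(\<lambda>x. \<Sum>i<d. AV x (\<lambda>j. gs j x) i * ?g i x) \<in> borel_measurable M"
      "(\<lambda>x. \<Sum>i<d. AV x (\<lambda>j. gs j x) i * g i x) \<in> borel_measurable M" by auto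
    have "AE x in M. \<forall>i\<in>{..<d}. x \<in> Rd d \<longrightarrow> ?g i x = g i x"
      by (subst AE_ball_countable) (use is_weak_grad_unique[OF openin_Rd g' g] in auto)
    then show "AE x in M. (\<Sum>i<d. AV x (\<lambda>j. gs j x) i * ?g i x) = (\<Sum>i<d. AV x (\<lambda>j. gs j x) i * g i x)"
      using AE_space by eventually_elim (simp add: space_Rd_leb)
  qed
  moreover have "(\<integral>x. form us gs v g x \<partial>M) = (\<integral>x. c x * us x * v x \<partial>M) + (\<integral>x. (\<Sum>i<d. AV x (\<lambda>j. gs j x) i * g i x) \<partial>M)"
    unfolding form_def
  proof (rule Bochner_Integration.integral_add)
    show "integrable M (\<lambda>x. c x * us x * v x)" by (intro L2_mult_integrable c_times_L2 us_L2 v)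
    show "integrable M (\<lambda>x. \<Sum>i<d. AV x (\<lambda>j. gs j x) i * g i x)"
      by (intro Bochner_Integration.integrable_sum L2_mult_integrable AV_L2 gs_L2 gL) auto
  qed
  ultimately show ?thesis by simp
qed

definition err :: "(vec \<Rightarrow> real) \<Rightarrow> real" where
  "err u = (\<integral>x. (u x - us x)\<^sup>2 + (\<Sum>i<d. (partial_deriv i u x - gs i x)\<^sup>2) \<partial>M)"

text \<open>In the \<open>H1\<close> inner product \<open>w\<close> represents the bilinear form
  with the error \<open>u - us\<close> in its first argument. Testing with \<open>w\<close> bounds
  the norm of \<open>w\<close> by continuity, testing with the error bounds the inner product with
  the error from below by coercivity; expanding the square gives the factor.\<close>

lemma contraction:
  assumes u: "smooth d u" "u \<in> L2 d (Rd d)" "\<And>i. i < d \<Longrightarrow> partial_deriv i u \<in> L2 d (Rd d)"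
    and w: "smooth d w" "w \<in> L2 d (Rd d)" "\<And>i. i < d \<Longrightarrow> partial_deriv i w \<in> L2 d (Rd d)"
    and eq: "helmholtz d w (\<lambda>x. (c x * u x - f x) - (\<Sum>i<d. partial_deriv i (\<lambda>x. AV x (\<lambda>j. partial_deriv j u x) i) x))"
    and \<alpha>: "0 \<le> \<alpha>"
  shows "err (\<lambda>x. u x - \<alpha> * w x) \<le> (1 - 2 * \<alpha> * lam + \<alpha>\<^sup>2 * Lam\<^sup>2) * err u"
proof -
  define e where "e x = u x - us x" for x
  define p where "p i x = partial_deriv i u x - gs i x" for i x
  let ?G = "\<lambda>i. partial_deriv i w" and ?U = "\<lambda>i. partial_deriv i u"
  have pu: "L2pair u ?U" and pw: "L2pair w ?G" and ps: "L2pair us gs"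
    using u w us_L2 gs_L2 by auto
  have pe: "L2pair e p"
    unfolding e_def[abs_def] p_def[abs_def]
    using L2_lincomb_Rd[of _ d _ 1 "-1"] pu ps by simp
  have gu: "is_weak_grad d (Rd d) u ?U" and gw: "is_weak_grad d (Rd d) w ?G"
    using u w smooth_test_pair by (auto simp: is_weak_grad_Rd)
  have ge: "is_weak_grad d (Rd d) e p"
    using is_weak_grad_lincomb[OF openin_Rd u(2) us_L2 gu us_weak_grad, of 1 "-1"]
    by (simp add: e_def[abs_def] p_def[abs_def])
  have id: "(\<integral>x. ip w ?G v q x \<partial>M) = (\<integral>x. form e p v q x \<partial>M)"
    if v: "v \<in> L2 d (Rd d)" and q: "is_weak_grad d (Rd d) v q" for v q
  proof -
    have pv: "L2pair v q" using v is_weak_gradD(1)[OF q] by blast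
    let ?h = "\<lambda>x. c x * u x - f x" and ?F = "\<lambda>i x. AV x (\<lambda>j. partial_deriv j u x) i"
    have hL: "?h \<in> L2 d (Rd d)"
      using L2_lincomb_Rd[OF c_times_L2[OF u(2)] f_L2, of 1 "-1"] by simp
    have FL: "?F i \<in> L2 d (Rd d)" if "i < d" for i using that by (intro AV_L2 u)
    have Fs: "smooth d (?F i)" if "i < d" for i
      using that by (intro smooth_sum smooth_mult A_smooth smooth_pd u) auto
    have "(\<integral>x. ip w ?G v q x \<partial>M) = (\<integral>x. ?h x * v x + (\<Sum>i<d. ?F i x * q i x) \<partial>M)"
      unfolding ip_def by (rule helmholtz_weak[OF w(1) Fs w(2,3) FL hL eq v q])
    also have "\<dots> = (\<integral>x. form u ?U v q x - f x * v x \<partial>M)"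
      unfolding form_def by (intro Bochner_Integration.integral_cong refl) (simp add: algebra_simps)
    also have "\<dots> = (\<integral>x. form u ?U v q x \<partial>M) - (\<integral>x. f x * v x \<partial>M)"
      by (intro Bochner_Integration.integral_diff form_integrable pu pv L2_mult_integrable f_L2 v)
    also have "\<dots> = (\<integral>x. form u ?U v q x - form us gs v q x \<partial>M)"
      unfolding weak_solution_form[OF v q, symmetric]
      by (intro Bochner_Integration.integral_diff[symmetric] form_integrable pu pv ps)
    also have "\<dots> = (\<integral>x. form e p v q x \<partial>M)"
      unfolding form_def e_def p_def
      by (intro Bochner_Integration.integral_cong refl)
        (simp add: algebra_simps sum_subtractf)
    finally show ?thesis .
  qed
  have err_u: "err u = (\<integral>x. ip e p e p x \<partial>M)"
    unfolding err_def ip_def e_def p_def by (simp add: power2_eq_square)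
  \<comment> \<open>Young's inequality leaves half of the integral of \<open>ip w ?G w ?G\<close> on
    the right. By \<open>id\<close> the left-hand side is that same integral, so it is
    absorbed.\<close>
  have W: "(\<integral>x. ip w ?G w ?G x \<partial>M) \<le> Lam\<^sup>2 * err u"
  proof -
    have "(\<integral>x. form e p w ?G x \<partial>M) \<le> (\<integral>x. 1/2 * (Lam\<^sup>2 * ip e p e p x + ip w ?G w ?G x) \<partial>M)"
    proof (rule integral_mono)
      show "integrable M (form e p w ?G)" by (rule form_integrable[OF pe pw])
      show "integrable M (\<lambda>x. 1/2 * (Lam\<^sup>2 * ip e p e p x + ip w ?G w ?G x))"
        by (intro integrable_mult_right Bochner_Integration.integrable_add ip_integrable pe pw)
      fix x assume "x \<in> space M"
      then have "x \<in> Rd d" by simp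
      from bounded_pointwise[OF this, of "e x" "w x" "\<lambda>j. p j x" "\<lambda>i. ?G i x"]
      show "form e p w ?G x \<le> 1/2 * (Lam\<^sup>2 * ip e p e p x + ip w ?G w ?G x)"
        by (simp add: form_def ip_def power2_eq_square)
    qed
    also have "\<dots> = 1/2 * (Lam\<^sup>2 * err u + (\<integral>x. ip w ?G w ?G x \<partial>M))"
      unfolding err_u using ip_integrable[OF pe pe] ip_integrable[OF pw pw] by simp
    finally show ?thesis unfolding id[OF w(2) gw, symmetric] by simp
  qed
  have E: "lam * err u \<le> (\<integral>x. ip w ?G e p x \<partial>M)"
  proof -
    have "(\<integral>x. lam * ip e p e p x \<partial>M) \<le> (\<integral>x. form e p e p x \<partial>M)"
    proof (rule integral_mono)
      show "integrable M (form e p e p)" by (rule form_integrable[OF pe pe])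
      show "integrable M (\<lambda>x. lam * ip e p e p x)" by (intro integrable_mult_right ip_integrable pe)
      fix x assume "x \<in> space M"
      then have "x \<in> Rd d" by simp
      from coercive_pointwise[OF this, of "e x" "\<lambda>j. p j x"]
      show "lam * ip e p e p x \<le> form e p e p x"
        by (simp add: form_def ip_def power2_eq_square)
    qed
    also have "(\<integral>x. form e p e p x \<partial>M) = (\<integral>x. ip w ?G e p x \<partial>M)" using id[of e p] pe ge by simp
    finally show ?thesis by (simp add: err_u)
  qed
  have "err (\<lambda>x. u x - \<alpha> * w x) = (\<integral>x. ip e p e p x - 2 * \<alpha> * ip w ?G e p x + \<alpha>\<^sup>2 * ip w ?G w ?G x \<partial>M)"
    unfolding err_def
  proof (rule Bochner_Integration.integral_cong[OF refl])
    fix x assume "x \<in> space M"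
    then have x: "x \<in> Rd d" by simp
    have pdq: "partial_deriv i (\<lambda>x. u x - \<alpha> * w x) x = ?U i x - \<alpha> * ?G i x" if "i < d" for i
      using pd_diff[OF u(1) smooth_cmult[OF w(1), of \<alpha>] that x] pd_cmult[OF w(1) that x, of \<alpha>] by simp
    have "(\<Sum>i<d. (partial_deriv i (\<lambda>x. u x - \<alpha> * w x) x - gs i x)\<^sup>2) = (\<Sum>i<d. (p i x - \<alpha> * ?G i x)\<^sup>2)"
    proof (rule sum.cong[OF refl])
      fix i assume "i \<in> {..<d}"
      then have i: "i < d" by simp
      show "(partial_deriv i (\<lambda>x. u x - \<alpha> * w x) x - gs i x)\<^sup>2 = (p i x - \<alpha> * ?G i x)\<^sup>2"
        unfolding pdq[OF i] p_def by (simp add: algebra_simps)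
    qed
    also have "\<dots> = (\<Sum>i<d. p i x * p i x - 2 * \<alpha> * (?G i x * p i x) + \<alpha>\<^sup>2 * (?G i x * ?G i x))"
      by (intro sum.cong refl) (simp add: power2_eq_square algebra_simps)
    also have "\<dots> = (\<Sum>i<d. p i x * p i x) - 2 * \<alpha> * (\<Sum>i<d. ?G i x * p i x) + \<alpha>\<^sup>2 * (\<Sum>i<d. ?G i x * ?G i x)"
      by (simp only: sum.distrib sum_subtractf sum_distrib_left)
    finally show "(u x - \<alpha> * w x - us x)\<^sup>2 + (\<Sum>i<d. (partial_deriv i (\<lambda>x. u x - \<alpha> * w x) x - gs i x)\<^sup>2) =
        ip e p e p x - 2 * \<alpha> * ip w ?G e p x + \<alpha>\<^sup>2 * ip w ?G w ?G x"
      by (simp add: ip_def e_def power2_eq_square algebra_simps)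
  qed
  also have "\<dots> = err u - 2 * \<alpha> * (\<integral>x. ip w ?G e p x \<partial>M) + \<alpha>\<^sup>2 * (\<integral>x. ip w ?G w ?G x \<partial>M)"
    unfolding err_u using ip_integrable[OF pe pe] ip_integrable[OF pw pe] ip_integrable[OF pw pw] by simp
  also have "\<dots> \<le> err u - 2 * \<alpha> * (lam * err u) + \<alpha>\<^sup>2 * (Lam\<^sup>2 * err u)"
    using E W \<alpha> by (intro add_mono diff_mono mult_left_mono order_refl) auto
  finally show ?thesis by (simp add: algebra_simps)
qed

lemma H1_norm_us: "(H1_norm d (Rd d) us)\<^sup>2 = (\<integral>x. ip us gs us gs x \<partial>M)"
proof -
  have i: "integrable M (\<lambda>x. (us x)\<^sup>2)" "i < d \<Longrightarrow> integrable M (\<lambda>x. (gs i x)\<^sup>2)" for i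
    using us_L2 gs_L2[of i] by (auto simp: L2_Rd)
  have "(\<integral>x. ip us gs us gs x \<partial>M) = (\<integral>x. (us x)\<^sup>2 \<partial>M) + (\<integral>x. (\<Sum>i<d. (gs i x)\<^sup>2) \<partial>M)"
    unfolding ip_def power2_eq_square[symmetric]
    by (intro Bochner_Integration.integral_add Bochner_Integration.integrable_sum i) auto
  also have "(\<integral>x. (\<Sum>i<d. (gs i x)\<^sup>2) \<partial>M) = (\<Sum>i<d. \<integral>x. (gs i x)\<^sup>2 \<partial>M)"
    by (intro Bochner_Integration.integral_sum i) auto
  finally show ?thesis
    unfolding H1_norm_def LINT_Rd
    by (subst real_sqrt_pow2) (auto intro!: add_nonneg_nonneg sum_nonneg)
qed

text \<open>The a priori estimate: the equation tested with \<open>us\<close> itself, coercivity on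
  the left and the dual norm on the right.\<close>

lemma err_zero: "err (\<lambda>x. 0) \<le> (Hm1_norm d f / lam)\<^sup>2"
proof -
  let ?n = "H1_norm d (Rd d) us"
  have n0: "0 \<le> ?n" unfolding H1_norm_def by (intro real_sqrt_ge_zero add_nonneg_nonneg sum_nonneg)
    (auto simp: set_lebesgue_integral_def intro!: Bochner_Integration.integral_nonneg)
  have pd0: "partial_deriv i (\<lambda>x. 0) x = 0" for i x by (simp add: partial_deriv_def)
  have e: "err (\<lambda>x. 0) = ?n\<^sup>2"
    unfolding H1_norm_us err_def ip_def by (simp add: pd0 power2_eq_square)
  have "lam * ?n\<^sup>2 \<le> (\<integral>x. f x * us x \<partial>M)"
  proof -
    have ps: "L2pair us gs" using us_L2 gs_L2 by auto
    have "(\<integral>x. lam * ip us gs us gs x \<partial>M) \<le> (\<integral>x. form us gs us gs x \<partial>M)"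
    proof (rule integral_mono)
      show "integrable M (form us gs us gs)" by (rule form_integrable[OF ps ps])
      show "integrable M (\<lambda>x. lam * ip us gs us gs x)" by (intro integrable_mult_right ip_integrable ps)
      fix x assume "x \<in> space M"
      then have "x \<in> Rd d" by simp
      from coercive_pointwise[OF this, of "us x" "\<lambda>j. gs j x"]
      show "lam * ip us gs us gs x \<le> form us gs us gs x"
        by (simp add: form_def ip_def power2_eq_square)
    qed
    then show ?thesis unfolding weak_solution_form[OF us_L2 us_weak_grad] H1_norm_us by simp
  qed
  also have "(\<integral>x. f x * us x \<partial>M) \<le> Hm1_norm d f * ?n"
  proof (cases "?n = 0")
    case True
    have "integrable M (\<lambda>x. (us x)\<^sup>2)" using us_L2 by (simp add: L2_Rd)
    moreover have "(\<integral>x. (us x)\<^sup>2 \<partial>M) = 0"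
    proof -
      have "0 \<le> (\<integral>x. (us x)\<^sup>2 \<partial>M)" "0 \<le> (\<Sum>i<d. \<integral>x. (gs i x)\<^sup>2 \<partial>M)"
        by (auto intro!: Bochner_Integration.integral_nonneg sum_nonneg)
      moreover have "(\<integral>x. (us x)\<^sup>2 \<partial>M) + (\<Sum>i<d. \<integral>x. (gs i x)\<^sup>2 \<partial>M) = 0"
        using True unfolding H1_norm_def LINT_Rd by simp
      ultimately show ?thesis by linarith
    qed
    ultimately have "AE x in M. (us x)\<^sup>2 = 0" by (subst (asm) integral_nonneg_eq_0_iff_AE) auto
    then have "AE x in M. f x * us x = 0" by eventually_elim simp
    then have "(\<integral>x. f x * us x \<partial>M) = 0" by (rule integral_eq_zero_AE)
    then show ?thesis using True by simp
  next
    case False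
    then have n: "0 < ?n" using n0 by simp
    \<comment> \<open>The summand with factor 0 gives the multiple the shape of a linear
      combination, as in \<open>is_weak_grad_lincomb\<close>.\<close>
    define v where "v x = 1 / ?n * us x + 0 * us x" for x
    define q where "q i x = 1 / ?n * gs i x + 0 * gs i x" for i x
    have v: "v \<in> L2 d (Rd d)" unfolding v_def[abs_def] by (intro L2_lincomb_Rd us_L2)
    have q: "is_weak_grad d (Rd d) v q"
      unfolding v_def[abs_def] q_def[abs_def]
      by (intro is_weak_grad_lincomb openin_Rd us_L2 us_weak_grad)
    have "H1_norm d (Rd d) v = sqrt ((1 / ?n)\<^sup>2 * ?n\<^sup>2)"
    proof -
      have "?n\<^sup>2 = (\<integral>x. (us x)\<^sup>2 \<partial>M) + (\<Sum>i<d. \<integral>x. (gs i x)\<^sup>2 \<partial>M)"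
        unfolding H1_norm_def LINT_Rd by (subst real_sqrt_pow2) (auto intro!: add_nonneg_nonneg sum_nonneg)
      moreover have sc: "(\<integral>x. (s * k x + 0 * k x)\<^sup>2 \<partial>M) = s\<^sup>2 * (\<integral>x. (k x)\<^sup>2 \<partial>M)" for s and k :: "vec \<Rightarrow> real"
        by (simp only: mult_zero_left add_0_right power_mult_distrib integral_mult_right_zero)
      ultimately show ?thesis
        unfolding H1_norm_eq[OF openin_Rd v q] LINT_Rd v_def q_def sc
        by (simp only: sum_distrib_left distrib_left)
    qed
    also have "\<dots> = 1" using n by (simp add: power_divide)
    finally have nv: "H1_norm d (Rd d) v = 1" .
    let ?S = "{v \<in> H1 d (Rd d). H1_norm d (Rd d) v \<le> 1}"
    \<comment> \<open>The supremum in \<open>Hm1_norm\<close> is an upper bound only if the set is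
      bounded above; the \<open>L2\<close> norm of \<open>f\<close> gives a crude bound.\<close>
    have "bdd_above ((\<lambda>v. \<bar>\<integral>x. f x * v x \<partial>M\<bar>) ` ?S)"
    proof (rule bdd_aboveI2)
      fix v assume v: "v \<in> ?S"
      then have vL: "v \<in> L2 d (Rd d)" using H1_L2 by blast
      have "\<bar>\<integral>x. f x * v x \<partial>M\<bar> \<le> (\<integral>x. \<bar>f x * v x\<bar> \<partial>M)" by (rule integral_abs_bound)
      also have "\<dots> \<le> (\<integral>x. (f x)\<^sup>2 + (v x)\<^sup>2 \<partial>M)"
        using f_L2 vL L2_mult_integrable[OF f_L2 vL]
        by (intro integral_mono) (auto simp: L2_Rd abs_mult_le_squares)
      also have "\<dots> = (\<integral>x. (f x)\<^sup>2 \<partial>M) + (\<integral>x. (v x)\<^sup>2 \<partial>M)"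
        using f_L2 vL by (simp add: L2_Rd)
      also have "(\<integral>x. (v x)\<^sup>2 \<partial>M) \<le> 1"
      proof -
        have "0 \<le> (\<Sum>i<d. LINT x:Rd d|M. (weak_grad d (Rd d) v i x)\<^sup>2)"
          by (auto simp: set_lebesgue_integral_def intro!: Bochner_Integration.integral_nonneg sum_nonneg)
        moreover have "(\<integral>x. (v x)\<^sup>2 \<partial>M) + (\<Sum>i<d. LINT x:Rd d|M. (weak_grad d (Rd d) v i x)\<^sup>2) \<le> 1"
          using v unfolding H1_norm_def LINT_Rd by simp
        ultimately show ?thesis by linarith
      qed
      finally show "\<bar>\<integral>x. f x * v x \<partial>M\<bar> \<le> (\<integral>x. (f x)\<^sup>2 \<partial>M) + 1" by simp
    qed
    then have "\<bar>\<integral>x. f x * v x \<partial>M\<bar> \<le> Hm1_norm d f"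
      unfolding Hm1_norm_def using H1_I[OF v q] nv by (intro cSUP_upper) auto
    moreover have "(\<integral>x. f x * v x \<partial>M) = 1 / ?n * (\<integral>x. f x * us x \<partial>M)"
      unfolding v_def by (simp add: mult.left_commute)
    ultimately have "1 / ?n * (\<integral>x. f x * us x \<partial>M) \<le> Hm1_norm d f" by linarith
    then show ?thesis using n by (simp add: field_simps)
  qed
  finally have le: "lam * ?n\<^sup>2 \<le> Hm1_norm d f * ?n" .
  have "?n \<le> Hm1_norm d f / lam \<or> ?n = 0"
    using le n0 lam_pos by (cases "?n = 0") (auto simp: power2_eq_square field_simps)
  then have "?n\<^sup>2 \<le> (Hm1_norm d f / lam)\<^sup>2" using n0 by (auto intro: power_mono)
  then show ?thesis unfolding e .
qed

end

section \<open>Sampling\<close>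

lemma abs_sq_le: "\<bar>x\<bar> \<le> B \<Longrightarrow> (x::real)\<^sup>2 \<le> B * B"
  using abs_bound_mult[of x B x B] by (simp add: power2_eq_square)

text \<open>In the application \<open>I\<close> contains the function and its \<open>d\<close>
  partial derivatives, so that the whole \<open>H1\<close> error is sampled at once.
  \<open>V\<close> enters the estimate, \<open>K\<close> provides integrability.\<close>

locale sampling = P: prob_space P + \<mu>: finite_measure \<mu>
  for P :: "'t measure" and \<mu> :: "'x measure" +
  fixes I :: "'i set" and \<phi> :: "'i \<Rightarrow> 't \<Rightarrow> 'x \<Rightarrow> real" and K V :: real
  assumes I: "finite I"
    and meas: "\<And>l. l \<in> I \<Longrightarrow> (\<lambda>z. \<phi> l (snd z) (fst z)) \<in> borel_measurable (\<mu> \<Otimes>\<^sub>M P)"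
    and bound: "\<And>l \<theta> x. l \<in> I \<Longrightarrow> \<bar>\<phi> l \<theta> x\<bar> \<le> K"
    and V: "\<And>\<theta> x. (\<Sum>l\<in>I. (\<phi> l \<theta> x)\<^sup>2) \<le> V"
begin

definition G :: "'i \<Rightarrow> 'x \<Rightarrow> real" where "G l x = (\<integral>\<theta>. \<phi> l \<theta> x \<partial>P)"

lemma \<phi>_measurable: "l \<in> I \<Longrightarrow> x \<in> space \<mu> \<Longrightarrow> (\<lambda>\<theta>. \<phi> l \<theta> x) \<in> borel_measurable P"
  using measurable_compose[OF measurable_Pair1' meas, of x] by simp

lemma \<phi>_measurable': "l \<in> I \<Longrightarrow> \<theta> \<in> space P \<Longrightarrow> \<phi> l \<theta> \<in> borel_measurable \<mu>"
  using measurable_compose[OF measurable_Pair2' meas, of \<theta>] by simp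

lemma G_measurable: "l \<in> I \<Longrightarrow> G l \<in> borel_measurable \<mu>"
  unfolding G_def[abs_def] using meas[of l]
  by (intro P.borel_measurable_lebesgue_integral) (simp add: case_prod_beta')

lemma \<phi>_integrable: "l \<in> I \<Longrightarrow> x \<in> space \<mu> \<Longrightarrow> integrable P (\<lambda>\<theta>. \<phi> l \<theta> x)"
  by (rule P.integrable_const_bound[where B=K]) (use bound \<phi>_measurable in auto)

lemma \<phi>_sq_integrable: "l \<in> I \<Longrightarrow> x \<in> space \<mu> \<Longrightarrow> integrable P (\<lambda>\<theta>. (\<phi> l \<theta> x)\<^sup>2)"
proof (rule P.integrable_const_bound[where B="K * K"])
  assume l: "l \<in> I" and x: "x \<in> space \<mu>"
  show "AE \<theta> in P. norm ((\<phi> l \<theta> x)\<^sup>2) \<le> K * K"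
    by (intro AE_I2) (simp add: abs_sq_le bound[OF l])
  show "(\<lambda>\<theta>. (\<phi> l \<theta> x)\<^sup>2) \<in> borel_measurable P" using \<phi>_measurable[OF l x] by simp
qed

lemma G_bound: "l \<in> I \<Longrightarrow> x \<in> space \<mu> \<Longrightarrow> \<bar>G l x\<bar> \<le> K"
proof -
  assume l: "l \<in> I" and x: "x \<in> space \<mu>"
  have "\<bar>G l x\<bar> \<le> (\<integral>\<theta>. \<bar>\<phi> l \<theta> x\<bar> \<partial>P)" unfolding G_def by (rule integral_abs_bound)
  also have "\<dots> \<le> (\<integral>\<theta>. K \<partial>P)" using bound[OF l] \<phi>_integrable[OF l x] by (intro integral_mono) auto
  finally show ?thesis by (simp add: P.prob_space)
qed

text \<open>The term linear in \<open>\<phi> - G\<close> has mean 0; what remains is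
  \<open>s^2\<close> plus the variance.\<close>

lemma shifted_variance:
  assumes l: "l \<in> I" and x: "x \<in> space \<mu>"
  shows "(\<integral>\<theta>. (s + (\<phi> l \<theta> x - G l x))\<^sup>2 \<partial>P) = s\<^sup>2 + (\<integral>\<theta>. (\<phi> l \<theta> x)\<^sup>2 \<partial>P) - (G l x)\<^sup>2"
proof -
  have "(\<integral>\<theta>. (s + (\<phi> l \<theta> x - G l x))\<^sup>2 \<partial>P) =
      (\<integral>\<theta>. (s - G l x)\<^sup>2 + 2 * (s - G l x) * \<phi> l \<theta> x + (\<phi> l \<theta> x)\<^sup>2 \<partial>P)"
    by (intro Bochner_Integration.integral_cong refl) (simp add: power2_eq_square algebra_simps)
  also have "\<dots> = (s - G l x)\<^sup>2 + 2 * (s - G l x) * G l x + (\<integral>\<theta>. (\<phi> l \<theta> x)\<^sup>2 \<partial>P)"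
    unfolding G_def[of l x] using \<phi>_integrable[OF l x] \<phi>_sq_integrable[OF l x] by (simp add: P.prob_space)
  finally show ?thesis by (simp add: power2_eq_square algebra_simps)
qed

text \<open>Variances are nonnegative. The bound is the error estimate of the empty network, whose
  error is the function itself.\<close>

lemma G_sq_le: "x \<in> space \<mu> \<Longrightarrow> (\<Sum>l\<in>I. (G l x)\<^sup>2) \<le> V"
proof -
  assume x: "x \<in> space \<mu>"
  have "(\<Sum>l\<in>I. (G l x)\<^sup>2) \<le> (\<Sum>l\<in>I. \<integral>\<theta>. (\<phi> l \<theta> x)\<^sup>2 \<partial>P)"
  proof (rule sum_mono)
    fix l assume l: "l \<in> I"
    have "0 \<le> (\<integral>\<theta>. (0 + (\<phi> l \<theta> x - G l x))\<^sup>2 \<partial>P)" by simp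
    then show "(G l x)\<^sup>2 \<le> (\<integral>\<theta>. (\<phi> l \<theta> x)\<^sup>2 \<partial>P)" unfolding shifted_variance[OF l x] by simp
  qed
  also have "\<dots> = (\<integral>\<theta>. (\<Sum>l\<in>I. (\<phi> l \<theta> x)\<^sup>2) \<partial>P)"
    by (rule Bochner_Integration.integral_sum[symmetric]) (rule \<phi>_sq_integrable[OF _ x])
  also have "\<dots> \<le> (\<integral>\<theta>. V \<partial>P)"
    by (intro integral_mono Bochner_Integration.integrable_sum \<phi>_sq_integrable[OF _ x] V) auto
  finally show ?thesis by (simp add: P.prob_space)
qed

text \<open>The cross terms average to \<open>0\<close> over \<open>\<theta>\<close>, so some \<open>\<theta>\<close> does no worse than the mean. Choosing the samples
  one after the other avoids the product of \<open>k\<close> copies of \<open>P\<close>.\<close>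

lemma greedy_step:
  assumes S: "\<And>l. l \<in> I \<Longrightarrow> S l \<in> borel_measurable \<mu>" "\<And>l x. l \<in> I \<Longrightarrow> x \<in> space \<mu> \<Longrightarrow> \<bar>S l x\<bar> \<le> B"
  shows "\<exists>\<theta>\<in>space P. (\<integral>x. (\<Sum>l\<in>I. (S l x + (\<phi> l \<theta> x - G l x))\<^sup>2) \<partial>\<mu>) \<le>
    (\<integral>x. (\<Sum>l\<in>I. (S l x)\<^sup>2) \<partial>\<mu>) + V * measure \<mu> (space \<mu>)"
proof -
  interpret pair_sigma_finite \<mu> P ..
  interpret PP: finite_measure "\<mu> \<Otimes>\<^sub>M P"
    by (rule finite_measure_pair_measure) unfold_locales
  note [measurable] = S(1) G_measurable meas
  define f where "f x \<theta> = (\<Sum>l\<in>I. (S l x + (\<phi> l \<theta> x - G l x))\<^sup>2)" for x \<theta>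
  let ?C = "B + (K + K)"
  have t: "\<bar>S l x + (\<phi> l \<theta> x - G l x)\<bar> \<le> ?C" if "l \<in> I" "x \<in> space \<mu>" for l x \<theta>
    using S(2)[OF that] bound[OF that(1), of \<theta> x] G_bound[OF that] by linarith
  have f_int: "integrable (\<mu> \<Otimes>\<^sub>M P) (case_prod f)"
  proof (rule PP.integrable_const_bound[where B="real (card I) * (?C * ?C)"])
    show "AE z in \<mu> \<Otimes>\<^sub>M P. norm (case_prod f z) \<le> real (card I) * (?C * ?C)"
    proof (rule AE_I2)
      fix z assume "z \<in> space (\<mu> \<Otimes>\<^sub>M P)"
      then have x: "fst z \<in> space \<mu>" by (auto simp: space_pair_measure)
      have "(S l (fst z) + (\<phi> l (snd z) (fst z) - G l (fst z)))\<^sup>2 \<le> ?C * ?C" if "l \<in> I" for l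
        by (rule abs_sq_le[OF t[OF that x]])
      then have "f (fst z) (snd z) \<le> real (card I) * (?C * ?C)"
        unfolding f_def by (rule sum_bounded_above)
      moreover have "0 \<le> f (fst z) (snd z)" unfolding f_def by (intro sum_nonneg) simp
      ultimately show "norm (case_prod f z) \<le> real (card I) * (?C * ?C)" by (simp add: case_prod_beta')
    qed
    have "(\<lambda>z. \<Sum>l\<in>I. (S l (fst z) + (\<phi> l (snd z) (fst z) - G l (fst z)))\<^sup>2) \<in> borel_measurable (\<mu> \<Otimes>\<^sub>M P)"
    proof (rule borel_measurable_sum)
      fix l assume l: "l \<in> I"
      note [measurable] = S(1)[OF l] G_measurable[OF l] meas[OF l]
      show "(\<lambda>z. (S l (fst z) + (\<phi> l (snd z) (fst z) - G l (fst z)))\<^sup>2) \<in> borel_measurable (\<mu> \<Otimes>\<^sub>M P)"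
        by measurable
    qed
    then show "case_prod f \<in> borel_measurable (\<mu> \<Otimes>\<^sub>M P)" by (simp add: case_prod_beta' f_def)
  qed
  have S_int: "integrable \<mu> (\<lambda>x. \<Sum>l\<in>I. (S l x)\<^sup>2)"
  proof (intro Bochner_Integration.integrable_sum \<mu>.integrable_const_bound[where B="B * B"])
    fix l assume l: "l \<in> I"
    show "AE x in \<mu>. norm ((S l x)\<^sup>2) \<le> B * B"
      by (intro AE_I2) (simp add: abs_sq_le S(2)[OF l])
    show "(\<lambda>x. (S l x)\<^sup>2) \<in> borel_measurable \<mu>" using S(1)[OF l] by simp
  qed
  let ?Q = "\<lambda>\<theta>. \<integral>x. f x \<theta> \<partial>\<mu>" and ?b = "(\<integral>x. (\<Sum>l\<in>I. (S l x)\<^sup>2) \<partial>\<mu>) + V * measure \<mu> (space \<mu>)"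
  have "(\<integral>\<theta>. ?Q \<theta> \<partial>P) = (\<integral>x. (\<integral>\<theta>. f x \<theta> \<partial>P) \<partial>\<mu>)"
    by (rule Fubini_integral[OF f_int])
  also have "\<dots> \<le> (\<integral>x. (\<Sum>l\<in>I. (S l x)\<^sup>2) + V \<partial>\<mu>)"
  proof (rule integral_mono)
    show "integrable \<mu> (\<lambda>x. \<integral>\<theta>. f x \<theta> \<partial>P)" using integrable_fst[OF f_int] by simp
    show "integrable \<mu> (\<lambda>x. (\<Sum>l\<in>I. (S l x)\<^sup>2) + V)" using S_int by simp
    fix x assume x: "x \<in> space \<mu>"
    have int: "integrable P (\<lambda>\<theta>. (S l x + (\<phi> l \<theta> x - G l x))\<^sup>2)" if l: "l \<in> I" for l
    proof (rule P.integrable_const_bound[where B="?C * ?C"])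
      show "AE \<theta> in P. norm ((S l x + (\<phi> l \<theta> x - G l x))\<^sup>2) \<le> ?C * ?C"
        using abs_sq_le[OF t[OF l x]] by (intro AE_I2) simp
      show "(\<lambda>\<theta>. (S l x + (\<phi> l \<theta> x - G l x))\<^sup>2) \<in> borel_measurable P" using \<phi>_measurable[OF l x] by simp
    qed
    have "(\<integral>\<theta>. f x \<theta> \<partial>P) = (\<Sum>l\<in>I. (S l x)\<^sup>2 + (\<integral>\<theta>. (\<phi> l \<theta> x)\<^sup>2 \<partial>P) - (G l x)\<^sup>2)"
      unfolding f_def using int shifted_variance[OF _ x] by (simp add: Bochner_Integration.integral_sum)
    also have "\<dots> \<le> (\<Sum>l\<in>I. (S l x)\<^sup>2 + (\<integral>\<theta>. (\<phi> l \<theta> x)\<^sup>2 \<partial>P))" by (intro sum_mono) simp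
    also have "\<dots> = (\<Sum>l\<in>I. (S l x)\<^sup>2) + (\<integral>\<theta>. (\<Sum>l\<in>I. (\<phi> l \<theta> x)\<^sup>2) \<partial>P)"
      using \<phi>_sq_integrable[OF _ x] by (simp add: sum.distrib Bochner_Integration.integral_sum)
    also have "(\<integral>\<theta>. (\<Sum>l\<in>I. (\<phi> l \<theta> x)\<^sup>2) \<partial>P) \<le> (\<integral>\<theta>. V \<partial>P)"
      by (intro integral_mono Bochner_Integration.integrable_sum \<phi>_sq_integrable[OF _ x] V) auto
    finally show "(\<integral>\<theta>. f x \<theta> \<partial>P) \<le> (\<Sum>l\<in>I. (S l x)\<^sup>2) + V" by (simp add: P.prob_space)
  qed
  also have "\<dots> = ?b" using S_int by (simp add: mult.commute)
  finally have le: "(\<integral>\<theta>. ?Q \<theta> \<partial>P) \<le> ?b" .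
  have "integrable P ?Q" using integrable_snd[OF f_int] by simp
  then have "\<exists>\<theta>\<in>space P. ?Q \<theta> \<le> ?b"
    using P.expectation_greater[of ?Q ?b] le by (force intro!: AE_I2 simp: not_le)
  then show ?thesis unfolding f_def .
qed

text \<open>Sums instead of averages make the induction additive: each sample adds at most
  \<open>V\<close> times the total measure. Dividing by \<open>k^2\<close> afterwards yields the
  rate \<open>1/k\<close>.\<close>

theorem sampling_bound:
  "\<exists>\<theta>. (\<forall>j<k. \<theta> j \<in> space P) \<and>
    (\<integral>x. (\<Sum>l\<in>I. (\<Sum>j<k. \<phi> l (\<theta> j) x - G l x)\<^sup>2) \<partial>\<mu>) \<le> real k * (V * measure \<mu> (space \<mu>))"
proof (induction k)
  case 0
  then show ?case by simp
next
  case (Suc k)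
  then obtain \<theta> where \<theta>: "\<forall>j<k. \<theta> j \<in> space P"
    "(\<integral>x. (\<Sum>l\<in>I. (\<Sum>j<k. \<phi> l (\<theta> j) x - G l x)\<^sup>2) \<partial>\<mu>) \<le> real k * (V * measure \<mu> (space \<mu>))" by blast
  let ?S = "\<lambda>l x. \<Sum>j<k. \<phi> l (\<theta> j) x - G l x"
  have "\<exists>t\<in>space P. (\<integral>x. (\<Sum>l\<in>I. (?S l x + (\<phi> l t x - G l x))\<^sup>2) \<partial>\<mu>) \<le>
    (\<integral>x. (\<Sum>l\<in>I. (?S l x)\<^sup>2) \<partial>\<mu>) + V * measure \<mu> (space \<mu>)"
  proof (rule greedy_step)
    fix l assume l: "l \<in> I"
    show "?S l \<in> borel_measurable \<mu>"
      using \<theta>(1) by (intro borel_measurable_sum borel_measurable_diff \<phi>_measurable'[OF l] G_measurable[OF l]) auto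
    fix x assume x: "x \<in> space \<mu>"
    have "\<bar>?S l x\<bar> \<le> (\<Sum>j<k. \<bar>\<phi> l (\<theta> j) x - G l x\<bar>)" by (rule sum_abs)
    also have "\<dots> \<le> (\<Sum>j<k. K + K)"
    proof (rule sum_mono)
      fix j show "\<bar>\<phi> l (\<theta> j) x - G l x\<bar> \<le> K + K"
        using bound[OF l, of "\<theta> j" x] G_bound[OF l x] by linarith
    qed
    finally show "\<bar>?S l x\<bar> \<le> real k * (K + K)" by simp
  qed
  then obtain t where t: "t \<in> space P" "(\<integral>x. (\<Sum>l\<in>I. (?S l x + (\<phi> l t x - G l x))\<^sup>2) \<partial>\<mu>) \<le>
    (\<integral>x. (\<Sum>l\<in>I. (?S l x)\<^sup>2) \<partial>\<mu>) + V * measure \<mu> (space \<mu>)" by blast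
  have e: "(\<Sum>j<Suc k. \<phi> l ((\<theta>(k := t)) j) x - G l x) = ?S l x + (\<phi> l t x - G l x)" for l x
    by simp
  show ?case
  proof (intro exI[of _ "\<theta>(k := t)"] conjI)
    show "\<forall>j<Suc k. (\<theta>(k := t)) j \<in> space P" using \<theta>(1) t(1) by (simp add: less_Suc_eq)
    show "(\<integral>x. (\<Sum>l\<in>I. (\<Sum>j<Suc k. \<phi> l ((\<theta>(k := t)) j) x - G l x)\<^sup>2) \<partial>\<mu>) \<le> real (Suc k) * (V * measure \<mu> (space \<mu>))"
      unfolding e using t(2) \<theta>(2) by (simp add: algebra_simps)
  qed
qed

end

section \<open>Networks from samples\<close>

lemma ridge_function:
  assumes "bounded_smooth \<sigma>"
  shows "smooth d (\<lambda>x. a * \<sigma> (dot d w x + b))"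
    and "i < d \<Longrightarrow> x \<in> Rd d \<Longrightarrow> partial_deriv i (\<lambda>x. a * \<sigma> (dot d w x + b)) x = a * w i * deriv \<sigma> (dot d w x + b)"
proof -
  \<comment> \<open>A single neuron is an average over a one-point space, which makes the results on
    \<open>rint\<close> available.\<close>
  let ?P = "measure_pmf (return_pmf ())"
  interpret ridge ?P d "\<lambda>_. w" "\<lambda>_. b" "L2_set w {..<d}"
    by (intro ridge.intro ridge_axioms.intro) (auto intro: measure_pmf.prob_space_axioms)
  have e: "rint ?P d (\<lambda>_. w) (\<lambda>_. b) (\<lambda>_. c) s x = c * s (dot d w x + b)" for c s x
    by (simp add: rint_def)
  have a: "(\<lambda>_. a) \<in> borel_measurable ?P" "\<bar>a\<bar> \<le> \<bar>a\<bar>" by auto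
  have e': "(\<lambda>x. a * \<sigma> (dot d w x + b)) = rint ?P d (\<lambda>_. w) (\<lambda>_. b) (\<lambda>_. a) \<sigma>" by (simp add: e fun_eq_iff)
  show "smooth d (\<lambda>x. a * \<sigma> (dot d w x + b))" unfolding e' by (rule rint_smooth[OF a assms])
  show "i < d \<Longrightarrow> x \<in> Rd d \<Longrightarrow> partial_deriv i (\<lambda>x. a * \<sigma> (dot d w x + b)) x = a * w i * deriv \<sigma> (dot d w x + b)"
    unfolding e' by (subst rint_pd[OF a assms]) (simp_all add: e)
qed

lemma net_smooth:
  assumes "bounded_smooth \<sigma>"
  shows "smooth d (two_layer_net d \<sigma> k a w b)"
    and "i < d \<Longrightarrow> x \<in> Rd d \<Longrightarrow> partial_deriv i (two_layer_net d \<sigma> k a w b) x =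
      1 / real k * (\<Sum>j<k. a j * w j i * deriv \<sigma> (dot d (w j) x + b j))"
proof -
  have e: "two_layer_net d \<sigma> k a w b = (\<lambda>x. 1 / real k * (\<Sum>j<k. a j * \<sigma> (dot d (w j) x + b j)))"
    by (simp add: two_layer_net_def fun_eq_iff)
  have s: "smooth d (\<lambda>x. \<Sum>j<k. a j * \<sigma> (dot d (w j) x + b j))"
    by (intro smooth_sum ridge_function assms) auto
  show "smooth d (two_layer_net d \<sigma> k a w b)" unfolding e by (rule smooth_cmult[OF s])
  assume i: "i < d" and x: "x \<in> Rd d"
  show "partial_deriv i (two_layer_net d \<sigma> k a w b) x = 1 / real k * (\<Sum>j<k. a j * w j i * deriv \<sigma> (dot d (w j) x + b j))"
    unfolding e pd_cmult[OF s i x]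
    by (subst pd_sum[OF _ ridge_function(1)[OF assms] i x]) (simp_all add: ridge_function(2)[OF assms i x])
qed

text \<open>The squares of the derivatives are summed before they are estimated, and the squared
  components of a weight add up to at most \<open>R^2\<close>, so no factor \<open>d\<close> arises.
  For \<open>k = 0\<close> the network is 0 and the denominator is replaced by 1.\<close>

lemma net_approximation:
  assumes \<sigma>: "bounded_smooth \<sigma>" and u: "ridge_rep \<sigma> d R N u"
    and C: "\<And>y. \<bar>\<sigma> y\<bar> \<le> C0" "\<And>y. \<bar>deriv \<sigma> y\<bar> \<le> C1"
    and \<Omega>: "\<Omega> \<in> sets (Rd_leb d)" "emeasure (Rd_leb d) \<Omega> < \<infinity>"
  shows "\<exists>a w b. (\<forall>j<k. w j \<in> Rd d) \<and>
    (\<integral>x. indicator \<Omega> x * ((two_layer_net d \<sigma> k a w b x - u x)\<^sup>2 +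
       (\<Sum>i<d. (partial_deriv i (two_layer_net d \<sigma> k a w b) x - partial_deriv i u x)\<^sup>2)) \<partial>Rd_leb d)
    \<le> measure (Rd_leb d) \<Omega> * (N\<^sup>2 * (C0\<^sup>2 + R\<^sup>2 * C1\<^sup>2)) / (if k = 0 then 1 else real k)"
proof -
  let ?M = "Rd_leb d" and ?\<mu> = "restrict_space (Rd_leb d) \<Omega>"
  obtain P :: "(real \<times> vec \<times> real) measure" and w b a where
    *: "ridge P d w b R" "a \<in> borel_measurable P" "\<And>\<theta>. \<bar>a \<theta>\<bar> \<le> N" "\<And>x. x \<in> Rd d \<Longrightarrow> u x = rint P d w b a \<sigma> x"
    by (rule ridge_repE[OF u]) auto
  interpret R: ridge P d w b R by fact
  note \<sigma>' = bounded_smooth_has_deriv(2)[OF \<sigma>]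
  have \<Omega>s: "\<Omega> \<subseteq> Rd d" using sets.sets_into_space[OF \<Omega>(1)] by simp
  have sp: "space ?\<mu> = \<Omega>" using \<Omega>s by (auto simp: space_restrict_space)
  \<comment> \<open>Index \<open>d\<close> stands for the function itself, the indices below
    \<open>d\<close> for its partial derivatives.\<close>
  define \<phi> where "\<phi> l \<theta> x = (if l = d then a \<theta> * \<sigma> (dot d (w \<theta>) x + b \<theta>) else a \<theta> * w \<theta> l * deriv \<sigma> (dot d (w \<theta>) x + b \<theta>))" for l \<theta> x
  have N0: "0 \<le> N" by (rule order_trans[OF abs_ge_zero *(3)])
  have C00: "0 \<le> C0" by (rule order_trans[OF abs_ge_zero C(1)])
  have C10: "0 \<le> C1" by (rule order_trans[OF abs_ge_zero C(2)])
  define V where "V = N\<^sup>2 * (C0\<^sup>2 + R\<^sup>2 * C1\<^sup>2)"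
  have fin: "finite_measure ?\<mu>"
    using \<Omega> by (intro finite_measure_restrict_space finite_measureI) (auto simp: emeasure_restrict_space sp \<Omega>s Int_absorb1 less_top[symmetric])
  have meas_\<mu>: "measure ?\<mu> (space ?\<mu>) = measure ?M \<Omega>"
    unfolding sp using \<Omega> \<Omega>s by (subst measure_restrict_space) auto
  interpret S: sampling P ?\<mu> "{..<Suc d}" \<phi> "N * C0 + N * R * C1" V
  proof (intro sampling.intro sampling_axioms.intro R.prob_space_axioms fin)
    fix l assume l: "l \<in> {..<Suc d}"
    have dotm: "(\<lambda>z. dot d (w (snd z)) (fst z)) \<in> borel_measurable (?\<mu> \<Otimes>\<^sub>M P)"
      unfolding dot_def
    proof (intro borel_measurable_sum borel_measurable_times)
      fix i assume i: "i \<in> {..<d}"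
      show "(\<lambda>z. w (snd z) i) \<in> borel_measurable (?\<mu> \<Otimes>\<^sub>M P)"
        using i by (intro measurable_compose[OF measurable_snd] R.w_measurable) simp
      have "(\<lambda>x. x i) \<in> borel_measurable ?\<mu>" using i by (intro measurable_restrict_space1) simp
      then show "(\<lambda>z. fst z i) \<in> borel_measurable (?\<mu> \<Otimes>\<^sub>M P)" by (rule measurable_compose[OF measurable_fst])
    qed
    note [measurable] = dotm *(2) bounded_smooth_borel[OF \<sigma>] bounded_smooth_borel[OF \<sigma>']
    show "(\<lambda>z. \<phi> l (snd z) (fst z)) \<in> borel_measurable (?\<mu> \<Otimes>\<^sub>M P)"
    proof (cases "l = d")
      case False
      then have [measurable]: "(\<lambda>\<theta>. w \<theta> l) \<in> borel_measurable P" using l by (intro R.w_measurable) simp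
      show ?thesis using False unfolding \<phi>_def by simp
    qed (simp add: \<phi>_def)
    fix \<theta> x
    have p: "0 \<le> N * C0" "0 \<le> N * R * C1" using N0 C00 C10 R.R_nonneg by auto
    show "\<bar>\<phi> l \<theta> x\<bar> \<le> N * C0 + N * R * C1"
    proof (cases "l = d")
      case True
      then have "\<bar>\<phi> l \<theta> x\<bar> \<le> N * C0" by (simp add: \<phi>_def abs_bound_mult * C)
      then show ?thesis using p by simp
    next
      case False
      have "\<bar>a \<theta> * w \<theta> l * deriv \<sigma> (dot d (w \<theta>) x + b \<theta>)\<bar> \<le> N * R * C1"
        using False l by (intro abs_bound_mult * C R.w_component_bound) auto
      then show ?thesis using p False by (simp add: \<phi>_def)
    qed
  next
    fix \<theta> x
    let ?z = "dot d (w \<theta>) x + b \<theta>"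
    have sq: "(s::real)\<^sup>2 \<le> t\<^sup>2" if "\<bar>s\<bar> \<le> t" for s t
      using power_mono[OF that abs_ge_zero, of 2] by simp
    have "(\<Sum>l<Suc d. (\<phi> l \<theta> x)\<^sup>2) = (\<Sum>l<d. (a \<theta>)\<^sup>2 * (w \<theta> l)\<^sup>2 * (deriv \<sigma> ?z)\<^sup>2) + (a \<theta>)\<^sup>2 * (\<sigma> ?z)\<^sup>2"
      by (simp add: \<phi>_def power_mult_distrib)
    also have "(\<Sum>l<d. (a \<theta>)\<^sup>2 * (w \<theta> l)\<^sup>2 * (deriv \<sigma> ?z)\<^sup>2) = (a \<theta>)\<^sup>2 * ((L2_set (w \<theta>) {..<d})\<^sup>2 * (deriv \<sigma> ?z)\<^sup>2)"
      by (simp add: L2_set_def sum_nonneg sum_distrib_left sum_distrib_right mult.assoc)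
    also have "\<dots> + (a \<theta>)\<^sup>2 * (\<sigma> ?z)\<^sup>2 = (a \<theta>)\<^sup>2 * ((\<sigma> ?z)\<^sup>2 + (L2_set (w \<theta>) {..<d})\<^sup>2 * (deriv \<sigma> ?z)\<^sup>2)"
      by (simp add: algebra_simps)
    also have "\<dots> \<le> N\<^sup>2 * (C0\<^sup>2 + R\<^sup>2 * C1\<^sup>2)"
      using R.w_bound[of \<theta>]
      by (intro mult_mono add_mono sq *(3) C) (auto simp: abs_of_nonneg)
    finally show "(\<Sum>l<Suc d. (\<phi> l \<theta> x)\<^sup>2) \<le> V" by (simp add: V_def)
  qed simp
  have G: "S.G d x = u x" "i < d \<Longrightarrow> S.G i x = partial_deriv i u x" if x: "x \<in> Rd d" for x i
  proof -
    show "S.G d x = u x" unfolding S.G_def *(4)[OF x] rint_def by (simp add: \<phi>_def)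
    assume i: "i < d"
    have "partial_deriv i u x = rint P d w b (\<lambda>\<theta>. a \<theta> * w \<theta> i) (deriv \<sigma>) x"
      using partial_deriv_cong[of d u "rint P d w b a \<sigma>" i x] *(4) i x R.rint_pd[OF *(2,3) \<sigma> i x] by simp
    then show "S.G i x = partial_deriv i u x" using i unfolding S.G_def rint_def by (simp add: \<phi>_def)
  qed
  have lint: "(\<integral>x. indicator \<Omega> x * h x \<partial>?M) = (\<integral>x. h x \<partial>?\<mu>)" for h :: "vec \<Rightarrow> real"
    using \<Omega> \<Omega>s by (subst integral_restrict_space) auto
  show ?thesis
  proof (cases "k = 0")
    case True
    have "(\<integral>x. ((0 - u x)\<^sup>2 + (\<Sum>i<d. (0 - partial_deriv i u x)\<^sup>2)) \<partial>?\<mu>) = (\<integral>x. (\<Sum>l<Suc d. (S.G l x)\<^sup>2) \<partial>?\<mu>)"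
      by (rule Bochner_Integration.integral_cong[OF refl]) (use G \<Omega>s sp in \<open>auto simp: subset_eq\<close>)
    also have "\<dots> \<le> (\<integral>x. V \<partial>?\<mu>)"
    proof (rule integral_mono)
      show "integrable ?\<mu> (\<lambda>x. \<Sum>l<Suc d. (S.G l x)\<^sup>2)"
      proof (rule S.\<mu>.integrable_const_bound[where B=V])
        show "AE x in ?\<mu>. norm (\<Sum>l<Suc d. (S.G l x)\<^sup>2) \<le> V"
          using S.G_sq_le by (intro AE_I2) (simp add: abs_of_nonneg sum_nonneg del: sum.lessThan_Suc)
        show "(\<lambda>x. \<Sum>l<Suc d. (S.G l x)\<^sup>2) \<in> borel_measurable ?\<mu>"
          by (intro borel_measurable_sum borel_measurable_power S.G_measurable)
      qed
    qed (use S.G_sq_le in auto)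
    also have "\<dots> = V * measure ?M \<Omega>" using meas_\<mu> by simp
    finally have le: "(\<integral>x. ((0 - u x)\<^sup>2 + (\<Sum>i<d. (0 - partial_deriv i u x)\<^sup>2)) \<partial>?\<mu>) \<le> measure ?M \<Omega> * V"
      by (simp add: mult.commute)
    have n0: "two_layer_net d \<sigma> 0 a w b = (\<lambda>x. 0)" for a w b by (simp add: two_layer_net_def fun_eq_iff)
    have p0: "partial_deriv i (\<lambda>x. 0) x = 0" for i x by (simp add: partial_deriv_def)
    show ?thesis unfolding lint using le by (simp add: True n0 p0 V_def)
  next
    case False
    obtain \<theta> where \<theta>: "(\<integral>x. (\<Sum>l<Suc d. (\<Sum>j<k. \<phi> l (\<theta> j) x - S.G l x)\<^sup>2) \<partial>?\<mu>) \<le> real k * (V * measure ?M \<Omega>)"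
      using S.sampling_bound[of k] unfolding meas_\<mu> by blast
    let ?n = "two_layer_net d \<sigma> k (\<lambda>j. a (\<theta> j)) (\<lambda>j. restrict (w (\<theta> j)) {..<d}) (\<lambda>j. b (\<theta> j))"
    have dr: "dot d (restrict y {..<d}) x = dot d y x" for x y by (rule dot_cong) simp
    have "(\<integral>x. ((?n x - u x)\<^sup>2 + (\<Sum>i<d. (partial_deriv i ?n x - partial_deriv i u x)\<^sup>2)) \<partial>?\<mu>) =
        (\<integral>x. (1 / real k)\<^sup>2 * (\<Sum>l<Suc d. (\<Sum>j<k. \<phi> l (\<theta> j) x - S.G l x)\<^sup>2) \<partial>?\<mu>)"
    proof (rule Bochner_Integration.integral_cong[OF refl])
      fix x assume "x \<in> space ?\<mu>"
      then have x: "x \<in> Rd d" using sp \<Omega>s by auto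
      have avg: "1 / real k * (\<Sum>j<k. y j) - g = 1 / real k * (\<Sum>j<k. y j - g)" for y g
        using False by (simp add: sum_subtractf field_simps)
      have 1: "?n x - u x = 1 / real k * (\<Sum>j<k. \<phi> d (\<theta> j) x - S.G d x)"
        unfolding G(1)[OF x] avg[symmetric] by (simp add: two_layer_net_def \<phi>_def dr)
      have 2: "partial_deriv i ?n x - partial_deriv i u x = 1 / real k * (\<Sum>j<k. \<phi> i (\<theta> j) x - S.G i x)" if "i < d" for i
        unfolding G(2)[OF x that] avg[symmetric] net_smooth(2)[OF \<sigma> that x] using that by (simp add: \<phi>_def dr)
      show "(?n x - u x)\<^sup>2 + (\<Sum>i<d. (partial_deriv i ?n x - partial_deriv i u x)\<^sup>2) =
          (1 / real k)\<^sup>2 * (\<Sum>l<Suc d. (\<Sum>j<k. \<phi> l (\<theta> j) x - S.G l x)\<^sup>2)"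
      proof -
        have "(\<Sum>i<d. (partial_deriv i ?n x - partial_deriv i u x)\<^sup>2) =
            (\<Sum>i<d. (1 / real k * (\<Sum>j<k. \<phi> i (\<theta> j) x - S.G i x))\<^sup>2)"
          by (rule sum.cong[OF refl]) (simp only: 2 lessThan_iff)
        then show ?thesis
          by (simp only: 1 power_mult_distrib sum_distrib_left[symmetric] sum.lessThan_Suc distrib_left add.commute)
      qed
    qed
    also have "\<dots> = (1 / real k)\<^sup>2 * (\<integral>x. (\<Sum>l<Suc d. (\<Sum>j<k. \<phi> l (\<theta> j) x - S.G l x)\<^sup>2) \<partial>?\<mu>)"
      by (rule integral_mult_right_zero)
    also have "\<dots> \<le> (1 / real k)\<^sup>2 * (real k * (V * measure ?M \<Omega>))"
      using \<theta> by (intro mult_left_mono) auto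
    also have "\<dots> = measure ?M \<Omega> * V / real k" using False by (simp add: power2_eq_square)
    finally have le: "(\<integral>x. ((?n x - u x)\<^sup>2 + (\<Sum>i<d. (partial_deriv i ?n x - partial_deriv i u x)\<^sup>2)) \<partial>?\<mu>) \<le> measure ?M \<Omega> * V / real k" .
    show ?thesis unfolding lint
      by (intro exI[of _ "\<lambda>j. a (\<theta> j)"] exI[of _ "\<lambda>j. restrict (w (\<theta> j)) {..<d}"] exI[of _ "\<lambda>j. b (\<theta> j)"] conjI)
        (use le False in \<open>auto simp: V_def\<close>)
  qed
qed

section \<open>From the last iterate to the network, and the induction over the steps\<close>

lemma L2_cong: "(\<And>x. x \<in> Rd d \<Longrightarrow> u x = v x) \<Longrightarrow> u \<in> L2 d (Rd d) \<Longrightarrow> v \<in> L2 d (Rd d)"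
proof -
  assume e: "\<And>x. x \<in> Rd d \<Longrightarrow> u x = v x" and u: "u \<in> L2 d (Rd d)"
  have "u \<in> borel_measurable (Rd_leb d) \<longleftrightarrow> v \<in> borel_measurable (Rd_leb d)"
    by (rule measurable_cong) (simp add: e)
  moreover have "integrable (Rd_leb d) (\<lambda>x. (u x)\<^sup>2) \<longleftrightarrow> integrable (Rd_leb d) (\<lambda>x. (v x)\<^sup>2)"
    by (rule Bochner_Integration.integrable_cong) (simp_all add: e)
  ultimately show ?thesis using u by (simp add: L2_Rd)
qed

lemma bounded_Rd_finite:
  assumes "bounded_Rd d U" "U \<in> sets (Rd_leb d)" shows "emeasure (Rd_leb d) U < \<infinity>"
proof -
  obtain r where r: "\<forall>x\<in>U. L2_set x {..<d} \<le> r" using assms(1) by (auto simp: bounded_Rd_def)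
  have "U \<subseteq> cbox' d (\<lambda>_. - r) (\<lambda>_. r)"
  proof
    fix x assume x: "x \<in> U"
    have "\<bar>x i\<bar> \<le> r" if "i < d" for i
      using member_le_L2_set[of "{..<d}" i "\<lambda>i. \<bar>x i\<bar>"] r x that by (fastforce simp: L2_set_def)
    moreover have "x \<in> Rd d" using sets.sets_into_space[OF assms(2)] x by auto
    ultimately show "x \<in> cbox' d (\<lambda>_. - r) (\<lambda>_. r)" by (auto simp: PiE_iff abs_le_iff minus_le_iff)
  qed
  then have "emeasure (Rd_leb d) U \<le> emeasure (Rd_leb d) (cbox' d (\<lambda>_. - r) (\<lambda>_. r))"
    by (rule emeasure_mono) (rule sets_Rd_box)
  also have "\<dots> < \<infinity>" by (rule emeasure_Rd_box)
  finally show ?thesis .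
qed

lemma L2_sq_integrable: "f \<in> L2 d U \<Longrightarrow> integrable (Rd_leb d) (\<lambda>x. indicator U x * (f x)\<^sup>2)"
  by (simp add: L2_def set_integrable_def)

lemma net_L2:
  assumes \<sigma>: "bounded_smooth \<sigma>" and U: "openin (Rd_top d) U" "emeasure (Rd_leb d) U < \<infinity>"
  shows "two_layer_net d \<sigma> k a w b \<in> L2 d U"
    "is_weak_grad d U (two_layer_net d \<sigma> k a w b) (\<lambda>i. partial_deriv i (two_layer_net d \<sigma> k a w b))"
proof -
  let ?n = "two_layer_net d \<sigma> k a w b"
  obtain C0 where C0: "\<And>y. \<bar>\<sigma> y\<bar> \<le> C0" using bounded_smooth_has_deriv(3)[OF \<sigma>] by blast
  obtain C1 where C1: "\<And>y. \<bar>deriv \<sigma> y\<bar> \<le> C1"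
    using bounded_smooth_has_deriv(3)[OF bounded_smooth_has_deriv(2)[OF \<sigma>]] by blast
  have C10: "0 \<le> C1" by (rule order_trans[OF abs_ge_zero C1])
  note Um = openin_Rd_sets[OF U(1)]
  have "\<bar>?n x\<bar> \<le> \<bar>1 / real k\<bar> * (\<Sum>j<k. \<bar>a j\<bar> * C0)" for x
    unfolding two_layer_net_def
    by (intro abs_bound_mult order_refl order_trans[OF sum_abs sum_mono] C0)
  then show "?n \<in> L2 d U"
    by (intro L2_bounded[OF Um U(2) smooth_measurable[OF net_smooth(1)[OF \<sigma>]]])
  define B where "B i = \<bar>1 / real k\<bar> * (\<Sum>j<k. \<bar>a j * w j i\<bar> * C1)" for i
  show "is_weak_grad d U ?n (\<lambda>i. partial_deriv i ?n)"
  proof (rule is_weak_grad_smooth[OF U net_smooth(1)[OF \<sigma>], where C="\<Sum>i<d. B i"])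
    fix i x assume i: "i < d" and x: "x \<in> Rd d"
    have "\<bar>partial_deriv i ?n x\<bar> \<le> B i"
      unfolding net_smooth(2)[OF \<sigma> i x] B_def
      by (intro abs_bound_mult order_refl order_trans[OF sum_abs sum_mono] C1)
    also have "B i \<le> (\<Sum>i<d. B i)"
    proof (rule member_le_sum)
      show "0 \<le> B j" for j unfolding B_def using C10 by (intro mult_nonneg_nonneg sum_nonneg abs_ge_zero)
    qed (use i in auto)
    finally show "\<bar>partial_deriv i ?n x\<bar> \<le> (\<Sum>i<d. B i)" .
  qed
qed

context elliptic
begin

lemma err_integrable:
  assumes "u \<in> L2 d (Rd d)" "\<And>i. i < d \<Longrightarrow> partial_deriv i u \<in> L2 d (Rd d)"
  shows "integrable M (\<lambda>x. (u x - us x)\<^sup>2 + (\<Sum>i<d. (partial_deriv i u x - gs i x)\<^sup>2))"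
proof (intro Bochner_Integration.integrable_add Bochner_Integration.integrable_sum)
  show "integrable M (\<lambda>x. (u x - us x)\<^sup>2)"
    using L2_lincomb_Rd[OF assms(1) us_L2, of 1 "-1"] by (simp add: L2_Rd)
  show "integrable M (\<lambda>x. (partial_deriv i u x - gs i x)\<^sup>2)" if "i \<in> {..<d}" for i
    using L2_lincomb_Rd[OF assms(2)[of i] gs_L2[of i], of 1 "-1"] that by (simp add: L2_Rd)
qed

text \<open>The squared error is at most twice the sampling error plus twice \<open>err u\<close>,
  and each of the two is at most a quarter of \<epsilon>^2. In the condition on \<open>B\<close>,
  the 8 is the 4 from that quarter times 2 for rounding \<open>B\<close> down to an integer.\<close>

theorem approximable_of_rep:
  assumes \<sigma>: "bounded_smooth \<sigma>" and rep: "ridge_rep \<sigma> d R N u"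
    and C: "\<And>y. \<bar>\<sigma> y\<bar> \<le> C0" "\<And>y. \<bar>deriv \<sigma> y\<bar> \<le> C1"
    and u: "u \<in> L2 d (Rd d)" "\<And>i. i < d \<Longrightarrow> partial_deriv i u \<in> L2 d (Rd d)"
    and err: "err u \<le> \<epsilon>\<^sup>2 / 4" and \<epsilon>: "0 < \<epsilon>"
    and \<Omega>: "openin (Rd_top d) \<Omega>" "bounded_Rd d \<Omega>"
    and B: "8 * (measure M \<Omega> * (N\<^sup>2 * (C0\<^sup>2 + R\<^sup>2 * C1\<^sup>2))) / \<epsilon>\<^sup>2 \<le> B"
  shows "approximable d \<sigma> us \<Omega> \<epsilon> B"
proof -
  note \<Omega>m = openin_Rd_sets[OF \<Omega>(1)]
  note \<Omega>f = bounded_Rd_finite[OF \<Omega>(2) \<Omega>m]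
  let ?mV = "measure M \<Omega> * (N\<^sup>2 * (C0\<^sup>2 + R\<^sup>2 * C1\<^sup>2))"
  have mV: "0 \<le> ?mV" by simp
  have mVB: "?mV \<le> B * \<epsilon>\<^sup>2 / 8" using B \<epsilon> by (simp add: field_simps)
  have B0: "0 \<le> B" using B mV \<epsilon> by (meson divide_nonneg_nonneg mult_nonneg_nonneg order_trans zero_le_numeral zero_le_power2)
  \<comment> \<open>If \<open>B < 1\<close>, this is the zero network; otherwise
    \<open>B < k + 1 \<le> 2k\<close>.\<close>
  define k where "k = nat \<lfloor>B\<rfloor>"
  have kB: "real k \<le> B" using B0 by (simp add: k_def)
  have Bk: "B < real k + 1" using B0 by (simp add: k_def)
  obtain a w b where w: "\<forall>j<k. w j \<in> Rd d" and
    app: "(\<integral>x. indicator \<Omega> x * ((two_layer_net d \<sigma> k a w b x - u x)\<^sup>2 +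
       (\<Sum>i<d. (partial_deriv i (two_layer_net d \<sigma> k a w b) x - partial_deriv i u x)\<^sup>2)) \<partial>M)
    \<le> ?mV / (if k = 0 then 1 else real k)"
    using net_approximation[OF \<sigma> rep C \<Omega>m \<Omega>f, of k] by blast
  let ?n = "two_layer_net d \<sigma> k a w b"
  have "?mV / (if k = 0 then 1 else real k) \<le> \<epsilon>\<^sup>2 / 4"
  proof (cases "k = 0")
    case True
    then have "B * \<epsilon>\<^sup>2 \<le> 1 * \<epsilon>\<^sup>2" using Bk by (intro mult_right_mono) auto
    then have "B * \<epsilon>\<^sup>2 / 8 \<le> \<epsilon>\<^sup>2 / 4" using zero_le_power2[of \<epsilon>] by linarith
    then show ?thesis using mVB True by simp
  next
    case False
    then have "B * \<epsilon>\<^sup>2 \<le> (2 * real k) * \<epsilon>\<^sup>2" using Bk by (intro mult_right_mono) auto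
    then have "?mV \<le> real k * (\<epsilon>\<^sup>2 / 4)" using mVB by linarith
    then show ?thesis using False by (simp add: divide_le_eq mult.commute)
  qed
  with app have D1: "(\<integral>x. indicator \<Omega> x * ((?n x - u x)\<^sup>2 + (\<Sum>i<d. (partial_deriv i ?n x - partial_deriv i u x)\<^sup>2)) \<partial>M) \<le> \<epsilon>\<^sup>2 / 4"
    by (rule order_trans)
  note nL = net_L2[OF \<sigma> \<Omega>(1) \<Omega>f, of k a w b]
  have pnL: "partial_deriv i ?n \<in> L2 d \<Omega>" if "i < d" for i by (rule is_weak_gradD(1)[OF nL(2) that])
  have L: "(\<lambda>x. ?n x - us x) \<in> L2 d \<Omega>" "(\<lambda>x. ?n x - u x) \<in> L2 d \<Omega>"
    using L2_lincomb[OF \<Omega>m nL(1) L2_mono[OF \<Omega>m us_L2], of 1 "-1"] L2_lincomb[OF \<Omega>m nL(1) L2_mono[OF \<Omega>m u(1)], of 1 "-1"] by simp_all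
  have Lg: "(\<lambda>x. partial_deriv i ?n x - gs i x) \<in> L2 d \<Omega>" "(\<lambda>x. partial_deriv i ?n x - partial_deriv i u x) \<in> L2 d \<Omega>" if "i < d" for i
    using L2_lincomb[OF \<Omega>m pnL[OF that] L2_mono[OF \<Omega>m gs_L2[OF that]], of 1 "-1"]
      L2_lincomb[OF \<Omega>m pnL[OF that] L2_mono[OF \<Omega>m u(2)[OF that]], of 1 "-1"] by simp_all
  have wg: "is_weak_grad d \<Omega> (\<lambda>x. ?n x - us x) (\<lambda>i x. partial_deriv i ?n x - gs i x)"
    using is_weak_grad_lincomb[OF \<Omega>(1) nL(1) L2_mono[OF \<Omega>m us_L2] nL(2) is_weak_grad_restrict[OF \<Omega>(1) us_weak_grad], of 1 "-1"] by simp
  have i1: "integrable M (\<lambda>x. indicator \<Omega> x * ((?n x - us x)\<^sup>2 + (\<Sum>i<d. (partial_deriv i ?n x - gs i x)\<^sup>2)))"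
    unfolding distrib_left sum_distrib_left
    by (intro Bochner_Integration.integrable_add Bochner_Integration.integrable_sum L2_sq_integrable L Lg) auto
  have i2: "integrable M (\<lambda>x. indicator \<Omega> x * ((?n x - u x)\<^sup>2 + (\<Sum>i<d. (partial_deriv i ?n x - partial_deriv i u x)\<^sup>2)))"
    unfolding distrib_left sum_distrib_left
    by (intro Bochner_Integration.integrable_add Bochner_Integration.integrable_sum L2_sq_integrable L Lg) auto
  have i3: "integrable M (\<lambda>x. (u x - us x)\<^sup>2 + (\<Sum>i<d. (partial_deriv i u x - gs i x)\<^sup>2))"
    by (rule err_integrable[OF u])
  have "(LINT x:\<Omega>|M. (?n x - us x)\<^sup>2) + (\<Sum>i<d. LINT x:\<Omega>|M. (partial_deriv i ?n x - gs i x)\<^sup>2) =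
    (\<integral>x. indicator \<Omega> x * (?n x - us x)\<^sup>2 \<partial>M) + (\<integral>x. (\<Sum>i<d. indicator \<Omega> x * (partial_deriv i ?n x - gs i x)\<^sup>2) \<partial>M)"
    unfolding set_lebesgue_integral_def real_scaleR_def
    by (subst Bochner_Integration.integral_sum) (auto intro: L2_sq_integrable Lg)
  also have "\<dots> = (\<integral>x. indicator \<Omega> x * ((?n x - us x)\<^sup>2 + (\<Sum>i<d. (partial_deriv i ?n x - gs i x)\<^sup>2)) \<partial>M)"
    unfolding distrib_left sum_distrib_left
    by (intro Bochner_Integration.integral_add[symmetric] Bochner_Integration.integrable_sum L2_sq_integrable L Lg) auto
  also have "\<dots> \<le> (\<integral>x. 2 * (indicator \<Omega> x * ((?n x - u x)\<^sup>2 + (\<Sum>i<d. (partial_deriv i ?n x - partial_deriv i u x)\<^sup>2))) +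
      2 * ((u x - us x)\<^sup>2 + (\<Sum>i<d. (partial_deriv i u x - gs i x)\<^sup>2)) \<partial>M)"
  proof (rule integral_mono[OF i1])
    show "integrable M (\<lambda>x. 2 * (indicator \<Omega> x * ((?n x - u x)\<^sup>2 + (\<Sum>i<d. (partial_deriv i ?n x - partial_deriv i u x)\<^sup>2))) +
      2 * ((u x - us x)\<^sup>2 + (\<Sum>i<d. (partial_deriv i u x - gs i x)\<^sup>2)))"
      by (intro Bochner_Integration.integrable_add integrable_mult_right i2 i3)
    fix x
    have tri: "(p - r)\<^sup>2 \<le> 2 * (p - q)\<^sup>2 + 2 * (q - r)\<^sup>2" for p q r :: real
      using zero_le_power2[of "(p - q) - (q - r)"] by (simp add: power2_eq_square algebra_simps)
    have "(\<Sum>i<d. (partial_deriv i ?n x - gs i x)\<^sup>2) \<le> (\<Sum>i<d. 2 * (partial_deriv i ?n x - partial_deriv i u x)\<^sup>2 + 2 * (partial_deriv i u x - gs i x)\<^sup>2)"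
      by (intro sum_mono tri)
    then have "(?n x - us x)\<^sup>2 + (\<Sum>i<d. (partial_deriv i ?n x - gs i x)\<^sup>2) \<le>
      2 * ((?n x - u x)\<^sup>2 + (\<Sum>i<d. (partial_deriv i ?n x - partial_deriv i u x)\<^sup>2)) +
      2 * ((u x - us x)\<^sup>2 + (\<Sum>i<d. (partial_deriv i u x - gs i x)\<^sup>2))"
      using tri[of "?n x" "us x" "u x"] by (simp add: sum.distrib sum_distrib_left[symmetric])
    moreover have "0 \<le> (u x - us x)\<^sup>2 + (\<Sum>i<d. (partial_deriv i u x - gs i x)\<^sup>2)"
      by (intro add_nonneg_nonneg sum_nonneg) auto
    ultimately show "indicator \<Omega> x * ((?n x - us x)\<^sup>2 + (\<Sum>i<d. (partial_deriv i ?n x - gs i x)\<^sup>2)) \<le>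
      2 * (indicator \<Omega> x * ((?n x - u x)\<^sup>2 + (\<Sum>i<d. (partial_deriv i ?n x - partial_deriv i u x)\<^sup>2))) +
      2 * ((u x - us x)\<^sup>2 + (\<Sum>i<d. (partial_deriv i u x - gs i x)\<^sup>2))"
      by (cases "x \<in> \<Omega>") simp_all
  qed
  also have "\<dots> = 2 * (\<integral>x. indicator \<Omega> x * ((?n x - u x)\<^sup>2 + (\<Sum>i<d. (partial_deriv i ?n x - partial_deriv i u x)\<^sup>2)) \<partial>M) + 2 * err u"
    unfolding err_def
    by (rule trans[OF Bochner_Integration.integral_add[OF integrable_mult_right[OF i2] integrable_mult_right[OF i3]]])
      (rule arg_cong2[where f="(+)", OF integral_mult_right_zero integral_mult_right_zero])
  also have "\<dots> \<le> \<epsilon>\<^sup>2" using D1 err by simp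
  finally have "H1_norm d \<Omega> (\<lambda>x. ?n x - us x) \<le> \<epsilon>"
    unfolding H1_norm_eq[OF \<Omega>(1) L(1) wg] using \<epsilon> by (intro real_le_lsqrt) auto
  then show ?thesis
    unfolding approximable_def using w kB H1_I[OF L(1) wg] by blast
qed

text \<open>The equation in strong form, available because the ridge representations make the
  coefficients and the iterates smooth.\<close>

abbreviation residual :: "(vec \<Rightarrow> real) \<Rightarrow> vec \<Rightarrow> real" where
  "residual u \<equiv> (\<lambda>x. (c x * u x - f x) - (\<Sum>i<d. partial_deriv i (\<lambda>x. AV x (\<lambda>j. partial_deriv j u x) i) x))"

text \<open>The exponent \<open>e\<close> covers both cases: it is 2 in general and 0 for the
  cosine. The factor \<open>1 + \<alpha>\<close> in \<open>\<kappa>'\<close> pays for adding a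
  multiple of \<open>w\<close> to \<open>u\<close>. Step \<open>t\<close> contributes
  \<open>R^e = \<kappa>'^(t e)\<close> to the coefficients, and
  \<open>t e + e t^2 \<le> e (t + 1)^2\<close>.\<close>

theorem iteration:
  fixes \<kappa> \<alpha> :: real and e t :: nat
  assumes \<sigma>: "bounded_smooth \<sigma>" and \<kappa>: "1 \<le> \<kappa>" and \<alpha>: "0 \<le> \<alpha>"
    and f: "f \<in> borel_measurable M" "\<And>x. x \<in> Rd d \<Longrightarrow> \<bar>f x\<bar> \<le> Cf"
    and q: "q = 1 - 2 * \<alpha> * lam + \<alpha>\<^sup>2 * Lam\<^sup>2" "0 \<le> q"
    and step: "\<And>u R N. 1 \<le> R \<Longrightarrow> 1 \<le> N \<Longrightarrow> ridge_rep \<sigma> d R N u \<Longrightarrow>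
      \<exists>w. ridge_rep \<sigma> d (\<kappa> * R) (\<kappa> * (real d)\<^sup>2 * N * R ^ e) w \<and> helmholtz d w (residual u)"
    and \<kappa>': "\<kappa>' = \<kappa> * (1 + \<alpha>)"
  shows "\<exists>u. ridge_rep \<sigma> d (\<kappa>' ^ t) ((\<kappa>' * (real d)\<^sup>2) ^ t * \<kappa>' ^ (e * t\<^sup>2)) u \<and> u \<in> L2 d (Rd d) \<and>
    (\<forall>i<d. partial_deriv i u \<in> L2 d (Rd d)) \<and> err u \<le> q ^ t * err (\<lambda>x. 0)"
proof (induction t)
  case 0
  have "partial_deriv i (\<lambda>x. 0) = (\<lambda>x. 0)" for i by (simp add: partial_deriv_def fun_eq_iff)
  then show ?case
    using ridge_rep_zero[of 1 1 \<sigma> d] bounded_smooth_borel[OF \<sigma>]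
    by (intro exI[of _ "\<lambda>x. 0"]) (simp add: L2_Rd)
next
  case (Suc t)
  let ?R = "\<kappa>' ^ t" and ?N = "(\<kappa>' * (real d)\<^sup>2) ^ t * \<kappa>' ^ (e * t\<^sup>2)"
  obtain u where u: "ridge_rep \<sigma> d ?R ?N u" "u \<in> L2 d (Rd d)" "\<And>i. i < d \<Longrightarrow> partial_deriv i u \<in> L2 d (Rd d)"
    "err u \<le> q ^ t * err (\<lambda>x. 0)" using Suc by blast
  have \<kappa>\<kappa>': "\<kappa> \<le> \<kappa>'" unfolding \<kappa>' using mult_left_mono[of 1 "1 + \<alpha>" \<kappa>] \<kappa> \<alpha> by simp
  then have \<kappa>1: "1 \<le> \<kappa>'" using \<kappa> by linarith
  have d1: "1 \<le> (real d)\<^sup>2" using d by (simp add: one_le_power)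
  have kd1: "1 \<le> \<kappa>' * (real d)\<^sup>2" using mult_mono[OF \<kappa>1 d1] \<kappa>1 by simp
  have R1: "1 \<le> ?R" using \<kappa>1 by (rule one_le_power)
  have N1: "1 \<le> ?N" using mult_mono[OF one_le_power[OF kd1, of t] one_le_power[OF \<kappa>1, of "e * t\<^sup>2"]] \<kappa>1 by simp
  obtain w where w: "ridge_rep \<sigma> d (\<kappa> * ?R) (\<kappa> * (real d)\<^sup>2 * ?N * ?R ^ e) w" "helmholtz d w (residual u)"
    using step[OF R1 N1 u(1)] by blast
  let ?Nw = "\<kappa> * (real d)\<^sup>2 * ?N * ?R ^ e"
  let ?F = "\<lambda>i x. AV x (\<lambda>j. partial_deriv j u x) i" and ?h = "\<lambda>x. c x * u x - f x"
  have su: "smooth d u" and sw: "smooth d w" using ridge_rep_smooth(1)[OF \<sigma>] u(1) w(1) by blast+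
  obtain C0 where C0: "\<And>y. \<bar>\<sigma> y\<bar> \<le> C0" using bounded_smooth_has_deriv(3)[OF \<sigma>] by blast
  obtain C1 where C1: "\<And>y. \<bar>deriv \<sigma> y\<bar> \<le> C1"
    using bounded_smooth_has_deriv(3)[OF bounded_smooth_has_deriv(2)[OF \<sigma>]] by blast
  have Fs: "smooth d (?F i)" if "i < d" for i
    using that by (intro smooth_sum smooth_mult A_smooth smooth_pd su) auto
  have FL: "?F i \<in> L2 d (Rd d)" if "i < d" for i using that by (intro AV_L2 u)
  have hL: "?h \<in> L2 d (Rd d)"
    using L2_lincomb_Rd[OF c_times_L2[OF u(2)] f_L2, of 1 "-1"] by simp
  \<comment> \<open>These bounds need only be finite: they supply the boundedness that
    \<open>helmholtz_energy\<close> asks for and do not enter the rate.\<close>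
  let ?Bw = "?Nw * C0" and ?Bp = "?Nw * (\<kappa> * ?R) * C1" and ?BF = "real d * (CA * (?N * ?R * C1))"
    and ?Bh = "c_max * (?N * C0) + Cf"
  have bw: "\<bar>w x\<bar> \<le> ?Bw" if "x \<in> Rd d" for x by (rule ridge_rep_smooth(2)[OF \<sigma> w(1) C0 that])
  have bp: "\<bar>partial_deriv i w x\<bar> \<le> ?Bp" if "i < d" "x \<in> Rd d" for i x
    by (rule ridge_rep_smooth(3)[OF \<sigma> w(1) C1 that(2,1)])
  have bF: "\<bar>?F i x\<bar> \<le> ?BF" if i: "i < d" and x: "x \<in> Rd d" for i x
  proof -
    have "\<bar>?F i x\<bar> \<le> (\<Sum>j<d. \<bar>A x i j * partial_deriv j u x\<bar>)" by (rule sum_abs)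
    also have "\<dots> \<le> (\<Sum>j<d. CA * (?N * ?R * C1))"
      using i x by (intro sum_mono abs_bound_mult A_bound ridge_rep_smooth(3)[OF \<sigma> u(1) C1]) auto
    finally show ?thesis by simp
  qed
  have bh: "\<bar>?h x\<bar> \<le> ?Bh" if x: "x \<in> Rd d" for x
  proof -
    have "\<bar>c x\<bar> \<le> c_max" using c_bounds(1,2)[OF x] c_bounds(3) by simp
    then have "\<bar>c x * u x\<bar> \<le> c_max * (?N * C0)" by (intro abs_bound_mult ridge_rep_smooth(2)[OF \<sigma> u(1) C0 x])
    then show ?thesis using f(2)[OF x] by linarith
  qed
  let ?C = "max (max ?Bw ?Bp) (max ?BF ?Bh)"
  have hm: "?h \<in> borel_measurable M" using hL by (simp add: L2_Rd)
  have bw': "\<bar>w x\<bar> \<le> ?C" if "x \<in> Rd d" for x using bw[OF that] by simp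
  have bp': "\<bar>partial_deriv i w x\<bar> \<le> ?C" if "i < d" "x \<in> Rd d" for i x using bp[OF that] by simp
  have bF': "\<bar>?F i x\<bar> \<le> ?C" if "i < d" "x \<in> Rd d" for i x using bF[OF that] by simp
  have bh': "\<bar>?h x\<bar> \<le> ?C" if "x \<in> Rd d" for x using bh[OF that] by simp
  have wL1: "w \<in> L2 d (Rd d)"
    by (rule helmholtz_energy(1)[OF sw Fs hm bw' bp' bF' bh' FL hL w(2)])
  have wL2: "partial_deriv i w \<in> L2 d (Rd d)" if "i < d" for i
    by (rule helmholtz_energy(2)[OF sw Fs hm bw' bp' bF' bh' FL hL w(2) that])
  note wL = wL1 wL2
  let ?v = "\<lambda>x. u x - \<alpha> * w x"
  have "ridge_rep \<sigma> d (\<kappa>' ^ Suc t) ((\<kappa>' * (real d)\<^sup>2) ^ Suc t * \<kappa>' ^ (e * (Suc t)\<^sup>2)) (\<lambda>x. u x + (- \<alpha>) * w x)"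
  proof (rule ridge_rep_mono[OF ridge_rep_add[OF \<sigma> ridge_rep_mono[OF u(1)] ridge_rep_cmult[OF ridge_rep_mono[OF w(1)]]]])
    show "?R \<le> \<kappa>' ^ Suc t" using \<kappa>1 by (simp add: power_increasing)
    show "\<kappa> * ?R \<le> \<kappa>' ^ Suc t" using \<kappa>\<kappa>' R1 by (simp add: mult_right_mono)
    have Re: "1 \<le> ?R ^ e" using R1 by (rule one_le_power)
    have "1 \<le> (real d)\<^sup>2 * ?R ^ e" using mult_mono[OF d1 Re] by simp
    then have "?N * 1 \<le> ?N * ((real d)\<^sup>2 * ?R ^ e)" using N1 by (intro mult_left_mono) auto
    then have "?N + \<bar>- \<alpha>\<bar> * ?Nw \<le> ?N * ((real d)\<^sup>2 * ?R ^ e) + \<alpha> * \<kappa> * (?N * ((real d)\<^sup>2 * ?R ^ e))"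
      using \<alpha> by (simp add: ac_simps)
    also have "\<dots> = (1 + \<alpha> * \<kappa>) * (?N * ((real d)\<^sup>2 * ?R ^ e))" by (simp add: distrib_right)
    also have "\<dots> \<le> \<kappa>' * (?N * ((real d)\<^sup>2 * ?R ^ e))"
    proof (rule mult_right_mono)
      \<comment> \<open>The 1 is estimated by \<kappa>.\<close>
      show "1 + \<alpha> * \<kappa> \<le> \<kappa>'" using \<kappa> by (simp add: \<kappa>' algebra_simps)
      show "0 \<le> ?N * ((real d)\<^sup>2 * ?R ^ e)" 
      proof (rule mult_nonneg_nonneg)
        show "0 \<le> ?N" using N1 by linarith
        show "0 \<le> (real d)\<^sup>2 * ?R ^ e" using Re by (intro mult_nonneg_nonneg) auto
      qed
    qed
    also have "\<dots> = (\<kappa>' * (real d)\<^sup>2) ^ Suc t * (\<kappa>' ^ (e * t\<^sup>2) * \<kappa>' ^ (t * e))"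
    proof -
      have pe: "?R ^ e = \<kappa>' ^ (t * e)" by (simp add: power_mult)
      show ?thesis unfolding pe by (simp only: power_Suc ac_simps)
    qed
    also have "\<dots> \<le> (\<kappa>' * (real d)\<^sup>2) ^ Suc t * \<kappa>' ^ (e * (Suc t)\<^sup>2)"
      unfolding power_add[symmetric] using \<kappa>1 kd1
      by (intro mult_left_mono power_increasing) (auto simp: power2_eq_square algebra_simps)
    finally show "?N + \<bar>- \<alpha>\<bar> * ?Nw \<le> (\<kappa>' * (real d)\<^sup>2) ^ Suc t * \<kappa>' ^ (e * (Suc t)\<^sup>2)" .
  qed simp_all
  moreover have "?v \<in> L2 d (Rd d)" using L2_lincomb_Rd[OF u(2) wL(1), of 1 "- \<alpha>"] by simp
  moreover have "partial_deriv i ?v \<in> L2 d (Rd d)" if i: "i < d" for i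
  proof (rule L2_cong[OF _ L2_lincomb_Rd[OF u(3)[OF i] wL(2)[OF i], of 1 "- \<alpha>"]])
    fix x assume x: "x \<in> Rd d"
    show "1 * partial_deriv i u x + - \<alpha> * partial_deriv i w x = partial_deriv i ?v x"
      using pd_diff[OF su smooth_cmult[OF sw, of \<alpha>] i x] pd_cmult[OF sw i x, of \<alpha>] by simp
  qed
  moreover have "err ?v \<le> q ^ Suc t * err (\<lambda>x. 0)"
  proof -
    have "err ?v \<le> q * err u" unfolding q(1) by (rule contraction[OF su u(2,3) sw wL w(2) \<alpha>])
    also have "\<dots> \<le> q * (q ^ t * err (\<lambda>x. 0))" using u(4) q(2) by (rule mult_left_mono)
    finally show ?thesis by (simp add: mult.assoc)
  qed
  ultimately show ?case by (intro exI[of _ ?v]) simp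
qed

end

section \<open>One step of the iteration\<close>

lemma helmholtz_sum:
  assumes "finite I" "\<And>j. j \<in> I \<Longrightarrow> smooth d (v j)" "\<And>j. j \<in> I \<Longrightarrow> helmholtz d (v j) (g j)"
  shows "helmholtz d (\<lambda>x. \<Sum>j\<in>I. v j x) (\<lambda>x. \<Sum>j\<in>I. g j x)"
  using assms
proof (induction I rule: finite_induct)
  case empty
  have "partial_deriv i (\<lambda>x. 0) = (\<lambda>x. 0)" for i by (simp add: partial_deriv_def fun_eq_iff)
  then show ?case by (simp add: helmholtz_def)
next
  case (insert j I)
  have "helmholtz d (\<lambda>x. 1 * v j x + 1 * (\<Sum>j\<in>I. v j x)) (\<lambda>x. 1 * g j x + 1 * (\<Sum>j\<in>I. g j x))"
    using insert by (intro helmholtz_lincomb smooth_sum) auto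
  then show ?case using insert by simp
qed

lemma le_mult_ge_1: "0 \<le> a \<Longrightarrow> 1 \<le> b \<Longrightarrow> a \<le> a * (b::real)"
  using mult_left_mono[of 1 b a] by simp

lemma ridge_rep_double_sum:
  assumes \<sigma>: "bounded_smooth \<sigma>" and T: "\<And>i j. i < d \<Longrightarrow> j < d \<Longrightarrow> ridge_rep \<sigma> d R N (T i j)"
    and R: "0 \<le> R" and N: "0 \<le> N"
  shows "ridge_rep \<sigma> d R ((real d)\<^sup>2 * N) (\<lambda>x. \<Sum>i<d. \<Sum>j<d. T i j x)"
proof -
  have row: "ridge_rep \<sigma> d R (real (card {..<d}) * N) (\<lambda>x. \<Sum>j<d. T i j x)" if "i < d" for i
    by (rule ridge_rep_sum[OF \<sigma> finite_lessThan _ R N]) (rule T[OF that], simp)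
  have N': "0 \<le> real (card {..<d}) * N" using N by simp
  have "ridge_rep \<sigma> d R (real (card {..<d}) * (real (card {..<d}) * N)) (\<lambda>x. \<Sum>i<d. \<Sum>j<d. T i j x)"
    by (rule ridge_rep_sum[OF \<sigma> finite_lessThan _ R N']) (rule row, simp)
  then show ?thesis by (simp add: power2_eq_square mult.assoc)
qed

context elliptic
begin

lemma pd_AV:
  assumes u: "smooth d u" and x: "x \<in> Rd d" and i: "i < d"
  shows "partial_deriv i (\<lambda>x. AV x (\<lambda>j. partial_deriv j u x) i) x = (\<Sum>j<d. partial_deriv i (\<lambda>x. A x i j * partial_deriv j u x) x)"
  by (rule pd_sum[OF _ _ i x]) (use i in \<open>auto intro!: smooth_mult A_smooth smooth_pd u\<close>)

text \<open>The product rule splits each second-order term in two. The costlier one, with two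
  derivatives of \<open>u\<close>, multiplies the coefficient bound by \<open>K^5 R^2\<close>: one
  \<open>K\<close> for the coefficient, two \<open>K R K\<close> for the derivatives, one
  \<open>K\<close> for the product, and less for the other terms. The 4 collects \<open>2 B\<close>
  from the lower-order terms and \<open>2 B d^2\<close> from the double sum.\<close>

lemma resolvent_step:
  assumes \<sigma>: "bounded_smooth \<sigma>" and K: "1 \<le> K"
    and mult: "ridge_rep \<sigma> 2 K K (\<lambda>y. \<sigma> (y 0) * \<sigma> (y 1))"
    and der: "ridge_rep \<sigma> 1 K K (\<lambda>y. deriv \<sigma> (y 0))"
    and A: "\<And>i j. i < d \<Longrightarrow> j < d \<Longrightarrow> ridge_rep \<sigma> d K K (\<lambda>x. A x i j)"
    and c: "ridge_rep \<sigma> d K K c" and f: "ridge_rep \<sigma> d K K f"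
    and R: "1 \<le> R" and N: "1 \<le> N" and u: "ridge_rep \<sigma> d R N u"
  shows "\<exists>w. ridge_rep \<sigma> d (4 * K ^ 5 * R) (4 * K ^ 5 * (real d)\<^sup>2 * N * R ^ 2) w \<and> helmholtz d w (residual u)"
proof -
  have K0: "0 \<le> K" and R0: "0 \<le> R" and N0: "0 \<le> N" using K R N by auto
  have su: "smooth d u" by (rule ridge_rep_smooth(1)[OF \<sigma> u])
  let ?R = "2 * K ^ 3 * R" and ?B = "K ^ 5 * N * R ^ 2"
  have KR: "K \<le> K ^ 3 * R" "K * K \<le> K ^ 3 * R" "K * R \<le> K ^ 3 * R" "K * K * R \<le> K ^ 3 * R" "K ^ 3 \<le> K ^ 3 * R"
  proof -
    have p: "1 \<le> K ^ n" for n using K by (rule one_le_power)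
    show "K ^ 3 \<le> K ^ 3 * R" using p[of 3] R K0 by (intro le_mult_ge_1) auto
    moreover have "K \<le> K ^ 3" "K * K \<le> K ^ 3" using power_increasing[of 1 3 K] power_increasing[of 2 3 K] K by (simp_all add: power2_eq_square)
    ultimately show "K \<le> K ^ 3 * R" "K * K \<le> K ^ 3 * R" by linarith+
    show "K * R \<le> K ^ 3 * R" "K * K * R \<le> K ^ 3 * R"
      using \<open>K \<le> K ^ 3\<close> \<open>K * K \<le> K ^ 3\<close> R0 by (auto intro: mult_right_mono)
  qed
  have KN: "K \<le> ?B" "K * N * K \<le> ?B" "K ^ 5 * N * R \<le> ?B"
  proof -
    have p: "1 \<le> K ^ n" for n using K by (rule one_le_power)
    have R2: "R \<le> R ^ 2" "1 \<le> R ^ 2" using R power_increasing[of 1 2 R] one_le_power[OF R, of 2] by auto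
    show "K ^ 5 * N * R \<le> ?B" using R2 K0 N0 by (intro mult_left_mono) auto
    have "K \<le> K ^ 5" "K ^ 2 \<le> K ^ 5" using power_increasing[of 1 5 K] power_increasing[of 2 5 K] K by auto
    have "K ^ 2 * N \<le> K ^ 5 * N" using \<open>K ^ 2 \<le> K ^ 5\<close> N0 by (rule mult_right_mono)
    also have "\<dots> \<le> ?B" using R2 K0 N0 by (intro le_mult_ge_1) auto
    finally show "K * N * K \<le> ?B" by (simp add: power2_eq_square ac_simps)
    have "K \<le> K ^ 5 * N" using \<open>K \<le> K ^ 5\<close> le_mult_ge_1[of "K ^ 5" N] N K0 by (meson order_trans zero_le_power)
    also have "\<dots> \<le> ?B" using R2 K0 N0 by (intro le_mult_ge_1) auto
    finally show "K \<le> ?B" .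
  qed
  let ?T = "\<lambda>i j x. partial_deriv i (\<lambda>x. A x i j) x * partial_deriv j u x + A x i j * partial_deriv i (partial_deriv j u) x"
  have T: "ridge_rep \<sigma> d ?R (2 * ?B) (?T i j)" if i: "i < d" and j: "j < d" for i j
  proof -
    note du = ridge_rep_deriv[OF \<sigma> der u j]
    have 1: "ridge_rep \<sigma> d ?R ?B (\<lambda>x. partial_deriv i (\<lambda>x. A x i j) x * partial_deriv j u x)"
    proof (rule ridge_rep_mono[OF ridge_rep_mult[OF \<sigma> mult ridge_rep_deriv[OF \<sigma> der A[OF i j] i] du]])
      have "K * (K * K + K * R) = K ^ 3 + K * K * R" by (simp add: algebra_simps power3_eq_cube)
      then show "K * (K * K + K * R) \<le> ?R" using KR by linarith
      have "K * K * K * (N * R * K) * K = K ^ 5 * N * R" by (simp add: power_def eval_nat_numeral)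
      then show "K * K * K * (N * R * K) * K \<le> ?B" using KN by linarith
    qed
    have 2: "ridge_rep \<sigma> d ?R ?B (\<lambda>x. A x i j * partial_deriv i (partial_deriv j u) x)"
    proof (rule ridge_rep_mono[OF ridge_rep_mult[OF \<sigma> mult A[OF i j] ridge_rep_deriv[OF \<sigma> der du i]]])
      have "K * (K + K * (K * R)) = K * K + K ^ 3 * R" by (simp add: algebra_simps power3_eq_cube)
      then show "K * (K + K * (K * R)) \<le> ?R" using KR by linarith
      show "K * (N * R * K * (K * R) * K) * K \<le> ?B" by (simp add: power_def eval_nat_numeral ac_simps)
    qed
    show ?thesis using ridge_rep_add[OF \<sigma> 1 2] unfolding mult_2 .
  qed
  have cu: "ridge_rep \<sigma> d ?R ?B (\<lambda>x. c x * u x)"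
  proof (rule ridge_rep_mono[OF ridge_rep_mult[OF \<sigma> mult c u] _ KN(2)])
    have "K * (K + R) = K * K + K * R" by (simp add: algebra_simps)
    then show "K * (K + R) \<le> ?R" using KR by linarith
  qed
  have f': "ridge_rep \<sigma> d ?R ?B f"
    by (rule ridge_rep_mono[OF f _ KN(1)]) (use KR K0 in linarith)
  have pos: "0 \<le> ?R" "0 \<le> 2 * ?B" using K0 R0 N0 by auto
  have "ridge_rep \<sigma> d ?R (?B + \<bar>- 1\<bar> * ?B + \<bar>- 1\<bar> * ((real d)\<^sup>2 * (2 * ?B))) (\<lambda>x. c x * u x + (- 1) * f x + (- 1) * (\<Sum>i<d. \<Sum>j<d. ?T i j x))"
    by (intro ridge_rep_add[OF \<sigma>] ridge_rep_cmult cu f' ridge_rep_double_sum[OF \<sigma> T] pos)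
  then have "ridge_rep \<sigma> d ?R (?B + \<bar>- 1\<bar> * ?B + \<bar>- 1\<bar> * ((real d)\<^sup>2 * (2 * ?B))) (residual u)"
  proof (rule ridge_rep_cong)
    fix x assume x: "x \<in> Rd d"
    have "partial_deriv i (\<lambda>x. AV x (\<lambda>j. partial_deriv j u x) i) x = (\<Sum>j<d. ?T i j x)" if i: "i < d" for i
      unfolding pd_AV[OF su x i]
      by (rule sum.cong[OF refl]) (rule pd_mult[OF A_smooth[OF i] smooth_pd[OF su] i x], simp_all)
    then show "c x * u x + (- 1) * f x + (- 1) * (\<Sum>i<d. \<Sum>j<d. ?T i j x) = residual u x" by simp
  qed
  then obtain w where w: "ridge_rep \<sigma> d ?R (?B + \<bar>- 1\<bar> * ?B + \<bar>- 1\<bar> * ((real d)\<^sup>2 * (2 * ?B))) w" "helmholtz d w (residual u)"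
    using ridge_rep_resolvent[OF \<sigma>] by blast
  have "ridge_rep \<sigma> d (4 * K ^ 5 * R) (4 * K ^ 5 * (real d)\<^sup>2 * N * R ^ 2) w"
  proof (rule ridge_rep_mono[OF w(1)])
    have "K ^ 3 * R \<le> K ^ 5 * R" using K R0 by (intro mult_right_mono power_increasing) auto
    moreover have "0 \<le> K ^ 5 * R" using K0 R0 by simp
    ultimately show "?R \<le> 4 * K ^ 5 * R" by linarith
    have "?B \<le> ?B * (real d)\<^sup>2" using mult_nonneg_nonneg[OF mult_nonneg_nonneg[OF zero_le_power[OF K0] N0] zero_le_power[OF R0]] d by (intro le_mult_ge_1) (auto simp: one_le_power)
    then have "?B + \<bar>- 1\<bar> * ?B + \<bar>- 1\<bar> * ((real d)\<^sup>2 * (2 * ?B)) \<le> 4 * (?B * (real d)\<^sup>2)" by (simp add: algebra_simps)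
    then show "?B + \<bar>- 1\<bar> * ?B + \<bar>- 1\<bar> * ((real d)\<^sup>2 * (2 * ?B)) \<le> 4 * K ^ 5 * (real d)\<^sup>2 * N * R ^ 2" by (simp add: ac_simps)
  qed
  with w(2) show ?thesis by blast
qed

text \<open>The second-order terms stay in divergence form and are inverted one by one by the
  special resolvent. The terms \<open>c u\<close> and \<open>f\<close> carry no derivatives, so
  \<open>ridge_rep_resolvent\<close> treats them without a factor \<open>R\<close>; linearity puts
  the solutions together.\<close>

lemma resolvent_step_cos:
  assumes K: "1 \<le> K" and A: "\<And>i j. i < d \<Longrightarrow> j < d \<Longrightarrow> ridge_rep cos d K K (\<lambda>x. A x i j)"
    and c: "ridge_rep cos d K K c" and f: "ridge_rep cos d K K f"
    and R: "1 \<le> R" and N: "1 \<le> N" and u: "ridge_rep cos d R N u"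
  shows "\<exists>w. ridge_rep cos d (8 * K\<^sup>2 * R) (8 * K\<^sup>2 * (real d)\<^sup>2 * N * R ^ 0) w \<and> helmholtz d w (residual u)"
proof -
  note \<sigma> = bounded_smooth_cos
  have K0: "0 \<le> K" and R0: "0 \<le> R" and N0: "0 \<le> N" using K R N by auto
  have su: "smooth d u" by (rule ridge_rep_smooth(1)[OF \<sigma> u])
  let ?R = "4 * (K * R)" and ?B = "2 * (K\<^sup>2 * N)"
  have KR: "K \<le> K * R" "R \<le> K * R" using le_mult_ge_1[OF K0 R] le_mult_ge_1[OF R0 K] by (simp_all add: mult.commute)
  have K2: "K \<le> K\<^sup>2" using power_increasing[of 1 2 K] K by simp
  have KN: "K * N \<le> K\<^sup>2 * N" "K \<le> K\<^sup>2 * N"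
  proof -
    show "K * N \<le> K\<^sup>2 * N" using K2 N0 by (rule mult_right_mono)
    then show "K \<le> K\<^sup>2 * N" using le_mult_ge_1[OF K0 N] by linarith
  qed
  have pos: "0 \<le> ?R" "0 \<le> ?B" using K0 R0 N0 by auto
  have "\<exists>v. ridge_rep cos d ?R ?B v \<and> helmholtz d v (partial_deriv i (\<lambda>x. A x i j * partial_deriv j u x))" if i: "i < d" and j: "j < d" for i j
  proof -
    obtain v where v: "ridge_rep cos d (R + K) (N * K * (1 + K)) v" "helmholtz d v (partial_deriv i (\<lambda>x. A x i j * partial_deriv j u x))"
      using ridge_rep_cos_resolvent[OF A[OF i j] u i j] by blast
    have "N * K * (1 + K) = K * N + K\<^sup>2 * N" by (simp add: algebra_simps power2_eq_square)
    then have "N * K * (1 + K) \<le> ?B" using KN by linarith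
    moreover have "R + K \<le> ?R" using KR pos by linarith
    ultimately have "ridge_rep cos d ?R ?B v" by (intro ridge_rep_mono[OF v(1)])
    with v(2) show ?thesis by blast
  qed
  then obtain v where v: "\<And>i j. i < d \<Longrightarrow> j < d \<Longrightarrow> ridge_rep cos d ?R ?B (v i j)"
    "\<And>i j. i < d \<Longrightarrow> j < d \<Longrightarrow> helmholtz d (v i j) (partial_deriv i (\<lambda>x. A x i j * partial_deriv j u x))" by metis
  have sv: "smooth d (v i j)" if "i < d" "j < d" for i j by (rule ridge_rep_smooth(1)[OF \<sigma> v(1)[OF that]])
  have cu: "ridge_rep cos d ?R ?B (\<lambda>x. c x * u x)"
  proof (rule ridge_rep_mono[OF ridge_rep_mult[OF \<sigma> ridge_rep_cos_cos c u]])
    have "2 * (K + R) \<le> 2 * (K * R + K * R)" using add_mono[OF KR] by simp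
    then show "2 * (K + R) \<le> ?R" by simp
    show "K * N * 1 \<le> ?B" using KN pos by linarith
  qed
  obtain wc where wc: "ridge_rep cos d ?R ?B wc" "helmholtz d wc (\<lambda>x. c x * u x)"
    using ridge_rep_resolvent[OF \<sigma> cu] by blast
  have f': "ridge_rep cos d ?R ?B f"
  proof (rule ridge_rep_mono[OF f])
    show "K \<le> ?R" using KR pos by linarith
    show "K \<le> ?B" using KN pos by linarith
  qed
  obtain wf where wf: "ridge_rep cos d ?R ?B wf" "helmholtz d wf f"
    using ridge_rep_resolvent[OF \<sigma> f'] by blast
  let ?w = "\<lambda>x. 1 * (1 * wc x + (- 1) * wf x) + (- 1) * (\<Sum>i<d. \<Sum>j<d. v i j x)"
  note sc = ridge_rep_smooth(1)[OF \<sigma> wc(1)] and sf = ridge_rep_smooth(1)[OF \<sigma> wf(1)]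
  have "ridge_rep cos d ?R (\<bar>1\<bar> * (\<bar>1\<bar> * ?B + \<bar>- 1\<bar> * ?B) + \<bar>- 1\<bar> * ((real d)\<^sup>2 * ?B)) ?w"
    by (intro ridge_rep_add[OF \<sigma>] ridge_rep_cmult wc wf ridge_rep_double_sum[OF \<sigma> v(1)] pos)
  then have "ridge_rep cos d (8 * K\<^sup>2 * R) (8 * K\<^sup>2 * (real d)\<^sup>2 * N * R ^ 0) ?w"
  proof (rule ridge_rep_mono)
    have "K * R \<le> K\<^sup>2 * R" using K2 R0 by (rule mult_right_mono)
    then show "?R \<le> 8 * K\<^sup>2 * R" using mult_nonneg_nonneg[OF K0 R0] unfolding mult.assoc by linarith
    have "?B \<le> ?B * (real d)\<^sup>2" using pos d by (intro le_mult_ge_1) (auto simp: one_le_power)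
    then have "\<bar>1\<bar> * (\<bar>1\<bar> * ?B + \<bar>- 1\<bar> * ?B) + \<bar>- 1\<bar> * ((real d)\<^sup>2 * ?B) \<le> 4 * (?B * (real d)\<^sup>2)"
      using pos by (simp add: algebra_simps)
    then show "\<bar>1\<bar> * (\<bar>1\<bar> * ?B + \<bar>- 1\<bar> * ?B) + \<bar>- 1\<bar> * ((real d)\<^sup>2 * ?B) \<le> 8 * K\<^sup>2 * (real d)\<^sup>2 * N * R ^ 0" by (simp add: ac_simps)
  qed
  moreover have "helmholtz d ?w (\<lambda>x. 1 * (1 * (c x * u x) + (- 1) * f x) + (- 1) * (\<Sum>i<d. \<Sum>j<d. partial_deriv i (\<lambda>x. A x i j * partial_deriv j u x) x))"
    by (intro helmholtz_lincomb helmholtz_sum smooth_add smooth_cmult smooth_sum sc sf sv wc wf v) auto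
  then have "helmholtz d ?w (residual u)"
    by (rule helmholtz_cong) (simp add: pd_AV[OF su])
  ultimately show ?thesis by blast
qed

end

section \<open>From Barron norms to ridge averages\<close>

text \<open>Reweighting \<open>\<rho>\<close> by \<open>|a|\<close> turns the integrable coefficient into one of constant modulus.\<close>

lemma ridge_rep_of_barron:
  assumes \<sigma>: "\<sigma> \<in> borel_measurable borel" and R: "0 \<le> R" and N: "barron1_norm \<sigma> R n (Rd n) g < ennreal N"
  shows "ridge_rep \<sigma> n R N g"
proof -
  note [measurable] = \<sigma>
  let ?S = "(borel :: real measure) \<Otimes>\<^sub>M ((\<Pi>\<^sub>M i\<in>{..<n}. (borel::real measure)) \<Otimes>\<^sub>M (borel :: real measure))"
  obtain \<rho> where \<rho>: "barron_rep \<sigma> R n (Rd n) g \<rho>" and lt: "(\<integral>\<^sup>+ (a, w, b). ennreal \<bar>a\<bar> \<partial>\<rho>) < ennreal N"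
    using N unfolding barron1_norm_def by (auto simp: INF_less_iff)
  interpret prob_space \<rho> using \<rho> by (simp add: barron_rep_def)
  have sets: "sets \<rho> = sets ?S" using \<rho> by (simp add: barron_rep_def)
  have mc: "measurable \<rho> M = measurable ?S M" for M :: "real measure" by (rule measurable_cong_sets[OF sets refl])
  have am [measurable]: "fst \<in> borel_measurable \<rho>" unfolding mc by measurable
  have bm [measurable]: "(\<lambda>p. snd (snd p)) \<in> borel_measurable \<rho>" unfolding mc by measurable
  have wm [measurable]: "(\<lambda>p. fst (snd p) i) \<in> borel_measurable \<rho>" if "i < n" for i
  proof -
    have "i \<in> {..<n}" using that by simp
    then show ?thesis unfolding mc
      using measurable_compose[of "\<lambda>p. fst (snd p)" ?S "\<Pi>\<^sub>M i\<in>{..<n}. borel", OF _ measurable_component_singleton[OF \<open>i \<in> {..<n}\<close>]] by simp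
  qed
  have Lm [measurable]: "(\<lambda>p. L2_set (fst (snd p)) {..<n}) \<in> borel_measurable \<rho>"
  proof -
    have "(\<lambda>p. \<Sum>i<n. (fst (snd p) i)\<^sup>2) \<in> borel_measurable \<rho>"
      by (intro borel_measurable_sum borel_measurable_power wm) auto
    then show ?thesis unfolding L2_set_def by measurable
  qed
  have dm: "(\<lambda>p. dot n (fst (snd p)) x) \<in> borel_measurable \<rho>" for x
    unfolding dot_def by (intro borel_measurable_sum borel_measurable_times wm) auto
  have N0: "0 < N" using lt by (metis ennreal_neg not_less_zero not_le)
  have wR: "AE p in \<rho>. L2_set (fst (snd p)) {..<n} \<le> R"
    using \<rho> by (simp add: barron_rep_def case_prod_beta)
  have gx: "g x = (\<integral>p. fst p * \<sigma> (dot n (fst (snd p)) x + snd (snd p)) \<partial>\<rho>)" if "x \<in> Rd n" for x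
    using \<rho> that by (simp add: barron_rep_def case_prod_beta')
  have lt': "(\<integral>\<^sup>+p. ennreal \<bar>fst p\<bar> \<partial>\<rho>) < ennreal N" using lt by (simp add: case_prod_beta')
  have ai: "integrable \<rho> (\<lambda>p. \<bar>fst p\<bar>)"
    by (intro integrableI_nonneg less_trans[OF lt']) auto
  define m where "m = (\<integral>p. \<bar>fst p\<bar> \<partial>\<rho>)"
  have m0: "0 \<le> m" by (simp add: m_def)
  have nn: "(\<integral>\<^sup>+p. ennreal \<bar>fst p\<bar> \<partial>\<rho>) = ennreal m"
    unfolding m_def by (rule nn_integral_eq_integral[OF ai]) auto
  then have mN: "m \<le> N" using lt' N0 by (simp add: ennreal_less_iff m0)
  \<comment> \<open>The norm bound holds almost everywhere; weights on the exceptional null set are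
    replaced by 0.\<close>
  define W where "W p = (if L2_set (fst (snd p)) {..<n} \<le> R then fst (snd p) else (\<lambda>_. 0))" for p :: "real \<times> vec \<times> real"
  have Wm: "(\<lambda>p. W p i) \<in> borel_measurable \<rho>" if "i < n" for i
  proof -
    have "(\<lambda>p. W p i) = (\<lambda>p. if L2_set (fst (snd p)) {..<n} \<le> R then fst (snd p) i else 0)" by (auto simp: W_def)
    moreover have "(\<lambda>p. if L2_set (fst (snd p)) {..<n} \<le> R then fst (snd p) i else 0) \<in> borel_measurable \<rho>"
      using wm[OF that] by measurable
    ultimately show ?thesis by simp
  qed
  have WR: "L2_set (W p) {..<n} \<le> R" for p using R by (auto simp: W_def L2_set_def)
  show ?thesis
  proof (cases "m = 0")
    case True
    \<comment> \<open>The density of the other case divides by \<open>m\<close>. Here the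
      coefficient, and with it \<open>g\<close>, is 0.\<close>
    have "AE p in \<rho>. \<bar>fst p\<bar> = 0"
      using ai True unfolding m_def by (subst (asm) integral_nonneg_eq_0_iff_AE) auto
    then have "g x = 0" if "x \<in> Rd n" for x
      unfolding gx[OF that] by (intro integral_eq_zero_AE) (auto elim: eventually_mono)
    then show ?thesis
      by (intro ridge_rep_cong[OF ridge_rep_zero[OF R less_imp_le[OF N0] \<sigma>]]) simp
  next
    case False
    then have m: "0 < m" using m0 by simp
    let ?P = "density \<rho> (\<lambda>p. ennreal (\<bar>fst p\<bar> / m))"
    have pP: "prob_space ?P"
    proof
      have "emeasure ?P (space ?P) = (\<integral>\<^sup>+p. ennreal (\<bar>fst p\<bar> / m) \<partial>\<rho>)"
        by (simp add: emeasure_density cong: nn_integral_cong)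
      also have "\<dots> = (\<integral>\<^sup>+p. ennreal \<bar>fst p\<bar> * ennreal (1 / m) \<partial>\<rho>)"
        using m by (intro nn_integral_cong) (simp add: ennreal_mult[symmetric])
      also have "\<dots> = ennreal m * ennreal (1 / m)" by (simp add: nn_integral_multc nn)
      also have "\<dots> = 1" using m by (simp add: ennreal_mult[symmetric])
      finally show "emeasure ?P (space ?P) = 1" .
    qed
    \<comment> \<open>Against the density \<open>|a| / m\<close> the coefficient
      \<open>m * sgn a\<close> restores \<open>a\<close>, and its modulus is at most
      \<open>m\<close>.\<close>
    define a where "a p = m * sgn (fst p)" for p :: "real \<times> vec \<times> real"
    have am' [measurable]: "a \<in> borel_measurable \<rho>" unfolding a_def[abs_def] by measurable
    have r: "ridge ?P n W (\<lambda>p. snd (snd p)) R"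
      using Wm by (intro ridge.intro ridge_axioms.intro pP WR) auto
    show ?thesis
    proof (rule ridge_repI[OF r _ _ \<sigma>])
      show "a \<in> borel_measurable ?P" by simp
      show "\<bar>a p\<bar> \<le> N" for p using mN m N0 by (auto simp: a_def abs_mult sgn_if)
      fix x assume x: "x \<in> Rd n"
      have dW [measurable]: "(\<lambda>p. dot n (W p) x) \<in> borel_measurable \<rho>"
        unfolding dot_def by (intro borel_measurable_sum borel_measurable_times Wm) auto
      note [measurable] = dm[of x]
      have "rint ?P n W (\<lambda>p. snd (snd p)) a \<sigma> x = (\<integral>p. (\<bar>fst p\<bar> / m) * (a p * \<sigma> (dot n (W p) x + snd (snd p))) \<partial>\<rho>)"
        unfolding rint_def using m by (subst integral_real_density) auto
      also have "\<dots> = g x"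
        unfolding gx[OF x]
      proof (rule integral_cong_AE)
        show "AE p in \<rho>. (\<bar>fst p\<bar> / m) * (a p * \<sigma> (dot n (W p) x + snd (snd p))) = fst p * \<sigma> (dot n (fst (snd p)) x + snd (snd p))"
          using wR
        proof eventually_elim
          case (elim p)
          have "(\<bar>fst p\<bar> / m) * a p = fst p" using m by (simp add: a_def abs_mult_sgn)
          then show ?case using elim by (simp add: W_def mult.assoc[symmetric] del: times_divide_eq_left)
        qed
      qed measurable
      finally show "g x = rint ?P n W (\<lambda>p. snd (snd p)) a \<sigma> x" ..
    qed
  qed
qed

text \<open>The infimum in the Barron norm need not be attained, hence the room from
  \<open>l\<close> to \<open>l + 1\<close>.\<close>

lemma ridge_rep_of_barron_norm:
  assumes \<sigma>: "\<sigma> \<in> borel_measurable borel" and R: "0 < R" "R \<le> K" and l: "barron1_norm \<sigma> R n (Rd n) g \<le> ennreal l" "l + 1 \<le> K" "0 \<le> l"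
  shows "ridge_rep \<sigma> n K K g"
proof -
  have "barron1_norm \<sigma> R n (Rd n) g < ennreal (l + 1)"
    by (rule le_less_trans[OF l(1)]) (use l(3) in \<open>simp add: ennreal_less_iff\<close>)
  from ridge_rep_mono[OF ridge_rep_of_barron[OF \<sigma> less_imp_le[OF R(1)] this] R(2) l(2)] show ?thesis .
qed

lemma has_barron1_normD:
  assumes "has_barron1_norm \<sigma> R n g l" shows "barron1_norm \<sigma> R n (Rd n) g \<le> ennreal l" "0 \<le> l"
  using assms by (auto simp: has_barron1_norm_def)

text \<open>The one-dimensional Barron representation of \<open>\<sigma>'\<close> gives
  \<open>\<sigma>\<^bsup>(n+1)\<^esup>(y) = \<integral> a w\<^sup>n \<sigma>\<^bsup>(n)\<^esup>(w y + b)\<close>, which turns a bound on one derivative into a bound on the next.\<close>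

lemma bounded_smooth_of_ridge_rep_deriv:
  assumes D: "\<And>n y. ((deriv ^^ n) \<sigma> has_real_derivative (deriv ^^ Suc n) \<sigma> y) (at y)"
    and C: "\<And>y. \<bar>\<sigma> y\<bar> \<le> C" and rep: "ridge_rep \<sigma> 1 R N (\<lambda>y. deriv \<sigma> (y 0))"
  shows "bounded_smooth \<sigma>"
proof -
  obtain P :: "(real \<times> vec \<times> real) measure" and w b a where
    *: "ridge P 1 w b R" "a \<in> borel_measurable P" "\<And>\<theta>. \<bar>a \<theta>\<bar> \<le> N" "\<And>y. y \<in> Rd 1 \<Longrightarrow> deriv \<sigma> (y 0) = rint P 1 w b a \<sigma> y"
    by (rule ridge_repE[OF rep]) auto
  interpret ridge P 1 w b R by fact
  let ?s = "\<lambda>n. (deriv ^^ n) \<sigma>" and ?v = "\<lambda>\<theta>. w \<theta> 0"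
  have cont: "continuous_on UNIV (?s n)" for n
    by (intro continuous_at_imp_continuous_on ballI DERIV_isCont) (rule D)
  have sm [measurable]: "?s n \<in> borel_measurable borel" for n
    by (rule borel_measurable_continuous_onI[OF cont])
  have vm [measurable]: "?v \<in> borel_measurable P" by (rule w_measurable) simp
  note [measurable] = *(2)
  have vR: "\<bar>?v \<theta>\<bar> \<le> R" for \<theta> using w_bound[of \<theta>] by (simp add: L2_set_def)
  let ?J = "\<lambda>n y. \<integral>\<theta>. a \<theta> * ?v \<theta> ^ n * ?s n (?v \<theta> * y + b \<theta>) \<partial>P"
  have bnd: "\<bar>a \<theta> * ?v \<theta> ^ n * z\<bar> \<le> N * R ^ n * B" if "\<bar>z\<bar> \<le> B" for \<theta> n z B
    unfolding abs_mult power_abs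
    by (intro mult_mono' power_mono *(3) vR that mult_nonneg_nonneg abs_ge_zero zero_le_power)
  have "(\<exists>B. \<forall>y. \<bar>?s n y\<bar> \<le> B) \<and> (\<forall>y. ?s (Suc n) y = ?J n y)" for n
  proof (induction n)
    case 0
    have "deriv \<sigma> y = ?J 0 y" for y
    proof -
      have "(\<lambda>i\<in>{..<1}. y) \<in> Rd 1" by simp
      from *(4)[OF this] show ?thesis by (simp add: rint_def dot_def)
    qed
    then show ?case using C by auto
  next
    case (Suc n)
    then obtain B where B: "\<And>y. \<bar>?s n y\<bar> \<le> B" and J: "\<And>y. ?s (Suc n) y = ?J n y" by blast
    define B' where "B' = N * R ^ n * B"
    have B': "\<bar>?s (Suc n) y\<bar> \<le> B'" for y
      unfolding J B'_def
      by (rule order_trans[OF integral_abs_bound integral_le_const])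
        (auto intro!: bnd B AE_I2 integrable_const_bound[where B="N * R ^ n * B"])
    \<comment> \<open>The formula for the next derivative comes from differentiating
      \<open>?J n\<close> under the integral. The bound \<open>B'\<close> just obtained makes the
      difference quotients of \<open>?s n\<close> bounded uniformly in \<theta>, so dominated
      convergence applies along the sequence \<open>?h\<close>.\<close>
    have "?s (Suc (Suc n)) y = ?J (Suc n) y" for y
    proof -
      let ?h = "\<lambda>k::nat. inverse (real (Suc k))"
      have h: "filterlim ?h (at 0) sequentially"
        by (rule filterlim_atI[OF LIMSEQ_inverse_real_of_nat]) simp
      have lim: "(\<lambda>k. (?s m (x + v * ?h k) - ?s m x) / ?h k) \<longlonglongrightarrow> v * ?s (Suc m) x" for m x v
      proof -
        have "((\<lambda>t. ?s m (x + v * t)) has_real_derivative ?s (Suc m) (x + v * 0) * v) (at 0)"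
          by (rule DERIV_chain'[OF _ D]) (auto intro!: derivative_eq_intros)
        then have "((\<lambda>t. (?s m (x + v * t) - ?s m x) / t) \<longlongrightarrow> v * ?s (Suc m) x) (at 0)"
          by (simp add: has_field_derivative_iff mult.commute del: funpow.simps)
        from filterlim_compose[OF this h] show ?thesis .
      qed
      have int: "integrable P (\<lambda>\<theta>. a \<theta> * ?v \<theta> ^ n * ?s n (?v \<theta> * y + b \<theta>))" for y
        by (rule integrable_const_bound[where B="N * R ^ n * B"]) (auto intro!: bnd B AE_I2)
      let ?q = "\<lambda>k \<theta>. a \<theta> * ?v \<theta> ^ n * ((?s n ((?v \<theta> * y + b \<theta>) + ?v \<theta> * ?h k) - ?s n (?v \<theta> * y + b \<theta>)) / ?h k)"
      have "(\<lambda>k. integral\<^sup>L P (?q k)) \<longlonglongrightarrow> ?J (Suc n) y"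
      proof (rule integral_dominated_convergence[where w="\<lambda>_. N * R ^ n * (R * B')"])
        show "AE \<theta> in P. (\<lambda>k. ?q k \<theta>) \<longlonglongrightarrow> a \<theta> * ?v \<theta> ^ Suc n * ?s (Suc n) (?v \<theta> * y + b \<theta>)"
        proof (rule AE_I2)
          fix \<theta>
          have "(\<lambda>k. ?q k \<theta>) \<longlonglongrightarrow> a \<theta> * ?v \<theta> ^ n * (?v \<theta> * ?s (Suc n) (?v \<theta> * y + b \<theta>))"
            by (intro tendsto_mult tendsto_const lim)
          then show "(\<lambda>k. ?q k \<theta>) \<longlonglongrightarrow> a \<theta> * ?v \<theta> ^ Suc n * ?s (Suc n) (?v \<theta> * y + b \<theta>)"
            by (simp add: mult_ac del: funpow.simps)
        qed
        fix k
        show "AE \<theta> in P. norm (?q k \<theta>) \<le> N * R ^ n * (R * B')"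
        proof (rule AE_I2)
          fix \<theta>
          have "\<bar>?s n ((?v \<theta> * y + b \<theta>) + ?v \<theta> * ?h k) - ?s n (?v \<theta> * y + b \<theta>)\<bar> \<le> B' * \<bar>?v \<theta> * ?h k\<bar>"
            by (rule order_trans[OF lipschitz_of_deriv_bound[OF D B']]) simp
          also have "\<dots> \<le> B' * (R * ?h k)"
            using vR[of \<theta>] order_trans[OF abs_ge_zero B'] by (intro mult_left_mono) (simp_all add: abs_mult divide_right_mono inverse_eq_divide)
          finally have le: "\<bar>?s n ((?v \<theta> * y + b \<theta>) + ?v \<theta> * ?h k) - ?s n (?v \<theta> * y + b \<theta>)\<bar> \<le> (R * B') * ?h k"
            by (simp only: mult_ac)
          have hk: "0 < ?h k" by simp
          have "\<bar>(?s n ((?v \<theta> * y + b \<theta>) + ?v \<theta> * ?h k) - ?s n (?v \<theta> * y + b \<theta>)) / ?h k\<bar> \<le> R * B'"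
            unfolding abs_divide abs_of_pos[OF hk] pos_divide_le_eq[OF hk] by (rule le)
          from bnd[OF this] show "norm (?q k \<theta>) \<le> N * R ^ n * (R * B')" unfolding real_norm_def .
        qed
      qed (rule integrable_const | intro borel_measurable_times borel_measurable_power borel_measurable_divide borel_measurable_diff
          borel_measurable_add borel_measurable_const measurable_compose[OF _ sm] vm b_measurable *(2))+
      moreover have "integral\<^sup>L P (?q k) = (?s (Suc n) (y + 1 * ?h k) - ?s (Suc n) y) / ?h k" for k
      proof -
        have "?q k = (\<lambda>\<theta>. (a \<theta> * ?v \<theta> ^ n * ?s n (?v \<theta> * (y + ?h k) + b \<theta>) - a \<theta> * ?v \<theta> ^ n * ?s n (?v \<theta> * y + b \<theta>)) / ?h k)"
          by (simp add: algebra_simps diff_divide_distrib del: funpow.simps of_nat_Suc)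
        then show ?thesis unfolding J
          by (simp only: Bochner_Integration.integral_divide_zero Bochner_Integration.integral_diff[OF int int] mult_1_left)
      qed
      ultimately have "(\<lambda>k. (?s (Suc n) (y + 1 * ?h k) - ?s (Suc n) y) / ?h k) \<longlonglongrightarrow> ?J (Suc n) y" by (simp only:)
      from LIMSEQ_unique[OF lim this] show ?thesis by simp
    qed
    with B' show ?case by blast
  qed
  then have B: "\<exists>B. \<forall>y. \<bar>?s n y\<bar> \<le> B" for n by blast
  have "bounded (range (?s n))" for n
    using B[of n] by (auto simp: bounded_iff)
  moreover have "\<sigma> \<in> range ?s" by (rule range_eqI[of _ _ 0]) simp
  ultimately show ?thesis
    unfolding bounded_smooth_def using D by (intro exI[of _ "range ?s"]) blast
qed

lemma act_assm_has_deriv: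
  assumes "act_assm \<sigma> C0 C1 C2"
  shows "((deriv ^^ n) \<sigma> has_real_derivative (deriv ^^ Suc n) \<sigma> y) (at y)" "\<bar>\<sigma> y\<bar> \<le> C0" "\<bar>deriv \<sigma> y\<bar> \<le> C1"
proof -
  have "(deriv ^^ n) \<sigma> differentiable (at y)"
    using assms by (simp add: act_assm_def differentiable_on_def)
  then show "((deriv ^^ n) \<sigma> has_real_derivative (deriv ^^ Suc n) \<sigma> y) (at y)"
    by (simp add: DERIV_deriv_iff_real_differentiable)
  show "\<bar>\<sigma> y\<bar> \<le> C0" "\<bar>deriv \<sigma> y\<bar> \<le> C1"
    using assms by (auto simp: act_assm_def intro: cSUP_upper)
qed

section \<open>Complexity bounds\<close>

text \<open>With \<open>L = |ln \<epsilon>|\<close> the logarithm of the right-hand side is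
  \<open>\<beta> L (ln d + L)\<close>. The part with \<open>ln d\<close> is covered by
  \<open>4 \<tau>\<close>. The other terms are linear or quadratic in \<open>L\<close>, and
  \<open>ln 2 \<le> L\<close> makes the linear ones quadratic; this accounts for the summands of
  \<beta>.\<close>

lemma general_rate:
  fixes \<epsilon> \<tau> \<kappa> :: real and d T :: nat
  assumes \<epsilon>: "0 < \<epsilon>" "\<epsilon> < 1/2" and d: "1 \<le> d" and \<kappa>: "1 \<le> \<kappa>" and \<tau>: "0 \<le> \<tau>" and T: "real T \<le> \<tau> * \<bar>ln \<epsilon>\<bar>"
    and \<beta>: "\<beta> = 4 * \<tau> + ln \<kappa> * (4 * \<tau> / ln 2 + 4 * \<tau>\<^sup>2) + 2 / ln 2"
  shows "real d ^ (4 * T) * \<kappa> ^ (4 * T + 4 * T\<^sup>2) / \<epsilon>\<^sup>2 \<le> (real d / \<epsilon>) powr (\<beta> * \<bar>ln \<epsilon>\<bar>)"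
proof -
  define L where "L = \<bar>ln \<epsilon>\<bar>"
  have le: "ln \<epsilon> = - L" using \<epsilon> by (simp add: L_def)
  have "ln \<epsilon> \<le> ln (1/2)" using \<epsilon> by (subst ln_le_cancel_iff) auto
  then have L: "ln 2 \<le> L" by (simp add: le ln_div)
  have L0: "0 < L" using L ln_gt_zero[of "2::real"] by linarith
  have LL: "L \<le> L\<^sup>2 / ln 2" using mult_right_mono[OF L, of L] L0 by (simp add: field_simps power2_eq_square)
  have D: "0 \<le> ln (real d)" and K: "0 \<le> ln \<kappa>" using d \<kappa> by auto
  have T': "real T \<le> \<tau> * L" using T by (simp add: L_def)
  have "ln (real d ^ (4 * T) * \<kappa> ^ (4 * T + 4 * T\<^sup>2) / \<epsilon>\<^sup>2) = 4 * real T * ln (real d) + (4 * real T + 4 * (real T)\<^sup>2) * ln \<kappa> + 2 * L"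
    using d \<kappa> \<epsilon> by (simp add: ln_div ln_mult ln_realpow le)
  also have "\<dots> \<le> 4 * (\<tau> * L) * ln (real d) + (4 * (\<tau> * (L\<^sup>2 / ln 2)) + 4 * (\<tau> * L)\<^sup>2) * ln \<kappa> + 2 * (L\<^sup>2 / ln 2)"
  proof (intro add_mono mult_right_mono mult_left_mono power_mono)
    show "real T \<le> \<tau> * (L\<^sup>2 / ln 2)" by (rule order_trans[OF T' mult_left_mono[OF LL \<tau>]])
  qed (use D K T' LL in auto)
  also have "\<dots> = 4 * \<tau> * L * ln (real d) + (\<beta> - 4 * \<tau>) * L\<^sup>2"
    by (simp add: \<beta> field_simps power2_eq_square)
  also have "\<dots> \<le> \<beta> * L * ln (real d) + \<beta> * L\<^sup>2"
  proof -
    have \<beta>': "4 * \<tau> \<le> \<beta>" unfolding \<beta> using K \<tau> by (simp add: add_nonneg_nonneg)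
    show ?thesis using \<tau> L0 D \<beta>' by (intro add_mono mult_right_mono) auto
  qed
  also have "\<dots> = ln ((real d / \<epsilon>) powr (\<beta> * L))"
    using d \<epsilon> by (simp add: ln_powr ln_div le algebra_simps power2_eq_square)
  finally show ?thesis unfolding L_def using d \<kappa> \<epsilon> by (subst (asm) ln_le_cancel_iff) auto
qed

text \<open>All terms are now linear in \<open>L\<close>, so a base that is independent of
  \<epsilon> suffices. Its logarithm must be bounded below to absorb the powers of \<kappa> and
  1/\<epsilon>, hence \<open>max 2 d\<close>: for \<open>d = 1\<close> powers of \<open>d\<close> do
  not grow.\<close>

lemma cos_rate:
  fixes \<epsilon> \<tau> \<kappa> :: real and d T :: nat
  assumes \<epsilon>: "0 < \<epsilon>" "\<epsilon> < 1/2" and d: "1 \<le> d" and \<kappa>: "1 \<le> \<kappa>" and \<tau>: "0 \<le> \<tau>" and T: "real T \<le> \<tau> * \<bar>ln \<epsilon>\<bar>"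
    and \<beta>: "\<beta> = 4 * \<tau> + 4 * \<tau> * ln \<kappa> / ln 2 + 2 / ln 2"
  shows "real d ^ (4 * T) * \<kappa> ^ (4 * T) / \<epsilon>\<^sup>2 \<le> real (max 2 d) powr (\<beta> * \<bar>ln \<epsilon>\<bar>)"
proof -
  define L where "L = \<bar>ln \<epsilon>\<bar>"
  have le: "ln \<epsilon> = - L" using \<epsilon> by (simp add: L_def)
  have L0: "0 \<le> L" by (simp add: L_def)
  define D where "D = ln (real (max 2 d))"
  have D: "ln 2 \<le> D" "ln (real d) \<le> D" using d by (auto simp: D_def)
  have D1: "1 \<le> D / ln 2" using D(1) by simp
  have K: "0 \<le> ln \<kappa>" using \<kappa> by auto
  have T': "real T \<le> \<tau> * L" using T by (simp add: L_def)
  have "ln (real d ^ (4 * T) * \<kappa> ^ (4 * T) / \<epsilon>\<^sup>2) = real T * (4 * ln (real d) + 4 * ln \<kappa> * 1) + 2 * L * 1"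
    using d \<kappa> \<epsilon> by (simp add: ln_div ln_mult ln_realpow le algebra_simps)
  also have "\<dots> \<le> (\<tau> * L) * (4 * D + 4 * ln \<kappa> * (D / ln 2)) + 2 * L * (D / ln 2)"
    using K L0 D D1 d \<tau> by (intro add_mono mult_mono T' mult_left_mono add_nonneg_nonneg mult_nonneg_nonneg) auto
  also have "\<dots> = ln (real (max 2 d) powr (\<beta> * L))"
    by (simp add: ln_powr D_def[symmetric] \<beta> field_simps)
  finally show ?thesis unfolding L_def using d \<kappa> \<epsilon> by (subst (asm) ln_le_cancel_iff) auto
qed

context elliptic
begin

lemma lam_le_Lam: "lam \<le> Lam"
  using c_bounds(1,2)[OF zero_in_Rd] by (simp add: lam_def Lam_def)

text \<open>The number of steps is fixed inside the proof, so the condition on \<open>B\<close>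
  ranges over all \<open>T\<close> up to the bound \<open>\<tau> |ln \<epsilon>|\<close>.\<close>

theorem approximable_of_step:
  fixes \<kappa> C0 C1 \<epsilon> :: real and e :: nat
  assumes \<sigma>: "bounded_smooth \<sigma>" and \<kappa>: "1 \<le> \<kappa>"
    and C: "\<And>y. \<bar>\<sigma> y\<bar> \<le> C0" "\<And>y. \<bar>deriv \<sigma> y\<bar> \<le> C1"
    and f: "f \<in> borel_measurable M" "\<And>x. x \<in> Rd d \<Longrightarrow> \<bar>f x\<bar> \<le> Cf"
    and step: "\<And>u R N. 1 \<le> R \<Longrightarrow> 1 \<le> N \<Longrightarrow> ridge_rep \<sigma> d R N u \<Longrightarrow>
      \<exists>w. ridge_rep \<sigma> d (\<kappa> * R) (\<kappa> * (real d)\<^sup>2 * N * R ^ e) w \<and> helmholtz d w (residual u)"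
    and \<theta>: "\<theta> = lam\<^sup>2 / Lam\<^sup>2" and \<kappa>': "\<kappa>' = \<kappa> * (1 + lam / Lam\<^sup>2)"
    and \<tau>: "\<tau> = (ln (1 + 4 * (Hm1_norm d f / lam)\<^sup>2) / ln 2 + 2) / \<theta> + 1 / ln 2"
    and \<epsilon>: "0 < \<epsilon>" "\<epsilon> < 1/2" and \<Omega>: "openin (Rd_top d) \<Omega>" "bounded_Rd d \<Omega>"
    and B: "\<And>T. real T \<le> \<tau> * \<bar>ln \<epsilon>\<bar> \<Longrightarrow>
      8 * (C0\<^sup>2 + C1\<^sup>2) * measure M \<Omega> * (real d ^ (4 * T) * \<kappa>' ^ (4 * T + 2 * e * T\<^sup>2) / \<epsilon>\<^sup>2) \<le> B"
  shows "approximable d \<sigma> us \<Omega> \<epsilon> B"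
proof -
  have Lam0: "0 < Lam" using lam_pos lam_le_Lam by linarith
  \<comment> \<open>The minimiser of \<open>1 - 2 \<alpha> lam + \<alpha>^2 Lam^2\<close>; the
    minimum is \<open>1 - \<theta>\<close>.\<close>
  define \<alpha> where "\<alpha> = lam / Lam\<^sup>2"
  have \<alpha>0: "0 \<le> \<alpha>" using lam_pos by (simp add: \<alpha>_def)
  have \<theta>0: "0 < \<theta>" using lam_pos Lam0 by (simp add: \<theta>)
  have "\<theta> \<le> 1" using lam_pos lam_le_Lam Lam0 by (simp add: \<theta> power_mono)
  then have q0: "0 \<le> 1 - \<theta>" by simp
  have q: "1 - \<theta> = 1 - 2 * \<alpha> * lam + \<alpha>\<^sup>2 * Lam\<^sup>2"
    using Lam0 by (simp add: \<theta> \<alpha>_def field_simps power2_eq_square)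
  define G where "G = (Hm1_norm d f / lam)\<^sup>2"
  have G0: "0 \<le> G" by (simp add: G_def)
  define L where "L = \<bar>ln \<epsilon>\<bar>"
  have le: "ln \<epsilon> = - L" using \<epsilon> by (simp add: L_def)
  have "ln \<epsilon> \<le> ln (1/2)" using \<epsilon> by (subst ln_le_cancel_iff) auto
  then have L: "1 \<le> L / ln 2" by (simp add: le ln_div)
  \<comment> \<open>Then \<open>exp (- X) = \<epsilon>^2 / (1 + 4 G)\<close>, which brings the
    initial error, at most \<open>G\<close>, below a quarter of \<epsilon>^2. The 1 keeps the
    logarithm nonnegative for small \<open>G\<close>.\<close>
  define X where "X = ln (1 + 4 * G) + 2 * L"
  define T where "T = nat \<lceil>X / \<theta>\<rceil>"
  have X0: "0 \<le> X" using G0 by (simp add: X_def L_def)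
  have T1: "X / \<theta> \<le> real T" and T2: "real T \<le> X / \<theta> + 1"
    using X0 \<theta>0 unfolding T_def by (auto simp: of_nat_ceiling)
  \<comment> \<open>Constants become multiples of \<open>L\<close> by
    \<open>1 \<le> L / ln 2\<close>, which holds because \<epsilon> is below 1/2. The result is the
    definition of \<tau>; its summand \<open>1 / ln 2\<close> pays for rounding \<open>T\<close>
    up.\<close>
  have "X / \<theta> + 1 \<le> (ln (1 + 4 * G) * (L / ln 2) + 2 * L) / \<theta> + L / ln 2"
    unfolding X_def using L G0 \<theta>0 le_mult_ge_1[OF _ L, of "ln (1 + 4 * G)"] by (intro add_mono divide_right_mono) auto
  also have "\<dots> = \<tau> * L" by (simp add: \<tau>[folded G_def] field_simps)
  finally have T\<tau>: "real T \<le> \<tau> * \<bar>ln \<epsilon>\<bar>" using T2 by (simp add: L_def)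
  have err_le: "(1 - \<theta>) ^ T * G \<le> \<epsilon>\<^sup>2 / 4"
  proof -
    have "(1 - \<theta>) ^ T \<le> exp (- \<theta>) ^ T" using q0 exp_ge_add_one_self[of "- \<theta>"] by (intro power_mono) auto
    also have "\<dots> = exp (- (\<theta> * real T))" by (simp add: exp_of_nat_mult[symmetric] mult.commute)
    also have "\<dots> \<le> exp (- X)" using T1 \<theta>0 by (simp add: field_simps)
    also have "\<dots> = \<epsilon>\<^sup>2 / (1 + 4 * G)"
    proof -
      have "exp (- X) = exp (ln \<epsilon>) ^ 2 / exp (ln (1 + 4 * G))"
        by (simp add: X_def le exp_of_nat_mult[symmetric] exp_diff[symmetric])
      then show ?thesis using \<epsilon> G0 by simp
    qed
    finally have "(1 - \<theta>) ^ T * G \<le> \<epsilon>\<^sup>2 / (1 + 4 * G) * G" using G0 by (rule mult_right_mono)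
    also have "\<dots> \<le> \<epsilon>\<^sup>2 / 4" using G0 by (simp add: field_simps)
    finally show ?thesis .
  qed
  obtain u where u: "ridge_rep \<sigma> d (\<kappa>' ^ T) ((\<kappa>' * (real d)\<^sup>2) ^ T * \<kappa>' ^ (e * T\<^sup>2)) u" "u \<in> L2 d (Rd d)"
    "\<And>i. i < d \<Longrightarrow> partial_deriv i u \<in> L2 d (Rd d)" "err u \<le> (1 - \<theta>) ^ T * err (\<lambda>x. 0)"
    using iteration[OF \<sigma> \<kappa> \<alpha>0 f q q0 step \<kappa>'[folded \<alpha>_def], of T] by blast
  have \<kappa>'1: "1 \<le> \<kappa>'" unfolding \<kappa>'[folded \<alpha>_def] using \<kappa> \<alpha>0 mult_mono[of 1 \<kappa> 1 "1 + \<alpha>"] by simp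
  show ?thesis
  proof (rule approximable_of_rep[OF \<sigma> u(1) C u(2,3) _ \<epsilon>(1) \<Omega>])
    have "(1 - \<theta>) ^ T * err (\<lambda>x. 0) \<le> (1 - \<theta>) ^ T * G"
      unfolding G_def by (intro mult_left_mono err_zero zero_le_power q0)
    then show "err u \<le> \<epsilon>\<^sup>2 / 4" using u(4) err_le by linarith
    let ?N = "(\<kappa>' * (real d)\<^sup>2) ^ T * \<kappa>' ^ (e * T\<^sup>2)" and ?R = "\<kappa>' ^ T"
    have R1: "1 \<le> ?R\<^sup>2" using \<kappa>'1 by (simp add: one_le_power)
    have "C0\<^sup>2 + ?R\<^sup>2 * C1\<^sup>2 \<le> ?R\<^sup>2 * (C0\<^sup>2 + C1\<^sup>2)"
      using mult_right_mono[OF R1, of "C0\<^sup>2"] by (simp add: algebra_simps)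
    then have "?N\<^sup>2 * (C0\<^sup>2 + ?R\<^sup>2 * C1\<^sup>2) \<le> ?N\<^sup>2 * (?R\<^sup>2 * (C0\<^sup>2 + C1\<^sup>2))" by (rule mult_left_mono) simp
    also have "\<dots> = (C0\<^sup>2 + C1\<^sup>2) * (real d ^ (4 * T) * \<kappa>' ^ (4 * T + 2 * e * T\<^sup>2))"
    proof -
      have "?N\<^sup>2 * ?R\<^sup>2 = real d ^ (4 * T) * \<kappa>' ^ (4 * T + 2 * e * T\<^sup>2)"
      proof -
        have e: "4 * T + 2 * e * T\<^sup>2 = T * 2 + e * T\<^sup>2 * 2 + T * 2" "4 * T = 2 * T * 2" by simp_all
        show ?thesis unfolding e(1) unfolding e(2)
          by (simp only: power_add power_mult_distrib power_mult[symmetric] mult_ac)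
      qed
      then show ?thesis by (simp add: mult_ac)
    qed
    finally have "8 * (measure M \<Omega> * (?N\<^sup>2 * (C0\<^sup>2 + ?R\<^sup>2 * C1\<^sup>2))) / \<epsilon>\<^sup>2 \<le>
      8 * (measure M \<Omega> * ((C0\<^sup>2 + C1\<^sup>2) * (real d ^ (4 * T) * \<kappa>' ^ (4 * T + 2 * e * T\<^sup>2)))) / \<epsilon>\<^sup>2"
      by (intro divide_right_mono mult_left_mono) auto
    also have "\<dots> = 8 * (C0\<^sup>2 + C1\<^sup>2) * measure M \<Omega> * (real d ^ (4 * T) * \<kappa>' ^ (4 * T + 2 * e * T\<^sup>2) / \<epsilon>\<^sup>2)"
      by (simp only: times_divide_eq_right mult_ac)
    also have "\<dots> \<le> B" by (rule B[OF T\<tau>])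
    finally show "8 * (measure M \<Omega> * (?N\<^sup>2 * (C0\<^sup>2 + ?R\<^sup>2 * C1\<^sup>2))) / \<epsilon>\<^sup>2 \<le> B" .
  qed
qed

end

section \<open>Assembly of the constants\<close>

lemma barron_coeff_assm_reps:
  assumes b: "barron_coeff_assm d \<sigma> A c f R_A R_c R_f l_A l_c l_f" and \<sigma>: "\<sigma> \<in> borel_measurable borel"
    and K: "1 + \<bar>R_A\<bar> + \<bar>R_c\<bar> + \<bar>R_f\<bar> + \<bar>l_A\<bar> + \<bar>l_c\<bar> + \<bar>l_f\<bar> \<le> K"
  shows "i < d \<Longrightarrow> j < d \<Longrightarrow> ridge_rep \<sigma> d K K (\<lambda>x. A x i j)" "ridge_rep \<sigma> d K K c" "ridge_rep \<sigma> d K K f"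
proof -
  have R: "0 < R_A" "0 < R_c" "0 < R_f" and c: "has_barron1_norm \<sigma> R_c d c l_c" and f: "has_barron1_norm \<sigma> R_f d f l_f"
    using b by (simp_all add: barron_coeff_assm_def)
  show "ridge_rep \<sigma> d K K c"
    by (rule ridge_rep_of_barron_norm[OF \<sigma> R(2) _ has_barron1_normD(1)[OF c] _ has_barron1_normD(2)[OF c]]) (use K in linarith)+
  show "ridge_rep \<sigma> d K K f"
    by (rule ridge_rep_of_barron_norm[OF \<sigma> R(3) _ has_barron1_normD(1)[OF f] _ has_barron1_normD(2)[OF f]]) (use K in linarith)+
  assume ij: "i < d" "j < d"
  let ?n = "\<lambda>(i, j). barron1_norm \<sigma> R_A d (Rd d) (\<lambda>x. A x i j)"
  have N: "(MAX p\<in>{..<d} \<times> {..<d}. ?n p) < \<top>" "l_A = enn2real (MAX p\<in>{..<d} \<times> {..<d}. ?n p)"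
    using b by (simp_all add: barron_coeff_assm_def Let_def)
  have "?n (i, j) \<le> (MAX p\<in>{..<d} \<times> {..<d}. ?n p)"
    by (rule Max_ge) (use ij in auto)
  then have n: "barron1_norm \<sigma> R_A d (Rd d) (\<lambda>x. A x i j) \<le> ennreal l_A" using N by simp
  have l: "0 \<le> l_A" using N(2) by simp
  show "ridge_rep \<sigma> d K K (\<lambda>x. A x i j)"
    by (rule ridge_rep_of_barron_norm[OF \<sigma> R(1) _ n _ l]) (use K in linarith)+
qed

lemma elliptic_of_reps:
  assumes \<sigma>: "bounded_smooth \<sigma>" and C0: "\<And>y. \<bar>\<sigma> y\<bar> \<le> C0" and d: "1 \<le> d"
    and co: "coeff_assm d A c f a_min a_max c_min c_max" and u: "weak_solution d A c f u"
    and A: "\<And>i j. i < d \<Longrightarrow> j < d \<Longrightarrow> ridge_rep \<sigma> d K K (\<lambda>x. A x i j)" and c: "ridge_rep \<sigma> d K K c"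
  shows "elliptic d A c f u a_min a_max c_min c_max (K * C0)"
proof
  show "smooth d (\<lambda>x. A x i j)" if "i < d" "j < d" for i j
    by (rule ridge_rep_smooth(1)[OF \<sigma> A[OF that]])
  show "\<bar>A x i j\<bar> \<le> K * C0" if "i < d" "j < d" "x \<in> Rd d" for i j x
    by (rule ridge_rep_smooth(2)[OF \<sigma> A[OF that(1,2)] C0 that(3)])
  show "smooth d c" by (rule ridge_rep_smooth(1)[OF \<sigma> c])
qed (fact d co u)+

lemma tau_nonneg:
  fixes F l :: real assumes "0 \<le> \<theta>"
  shows "0 \<le> (ln (1 + 4 * (F / l)\<^sup>2) / ln 2 + 2) / \<theta> + 1 / ln 2"
  using assms by (intro add_nonneg_nonneg divide_nonneg_nonneg) auto

lemma growth_ge_1: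
  fixes k x :: real assumes "1 \<le> k" "0 \<le> x" shows "1 \<le> k * (1 + x)"
  using mult_mono[of 1 k 1 "1 + x"] assms by simp

text \<open>In the second part \<gamma>' and \<beta>' are quantified before the constants of (Mult)
  and (Deriv). There \<open>ridge_rep_cos_cos\<close> supplies the products and
  \<open>ridge_rep_cos_resolvent\<close> the derivatives. The base \<open>max 2 d\<close> keeps the
  bound growing as \<epsilon> tends to 0 also for \<open>d = 1\<close>.\<close>

theorem theorem2p10:
  fixes F a_min a_max c_min c_max C0 C1 C2 R_A R_c R_f l_A l_c l_f :: real
  shows
    "(\<forall>R_m l_m R_d1 R_d2 l_d1 l_d2 :: real. \<exists>\<gamma> \<beta> :: real. \<forall>(d::nat) \<sigma> A c f u.
        1 \<le> d \<and> coeff_assm d A c f a_min a_max c_min c_max \<and> Hm1_norm d f = F \<and>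
        act_assm \<sigma> C0 C1 C2 \<and> barron_coeff_assm d \<sigma> A c f R_A R_c R_f l_A l_c l_f \<and>
        mult_assm \<sigma> R_m l_m \<and> deriv_assm \<sigma> R_d1 R_d2 l_d1 l_d2 \<and>
        weak_solution d A c f u \<longrightarrow>
        (\<forall>\<epsilon> \<Omega>. 0 < \<epsilon> \<and> \<epsilon> < 1/2 \<and> openin (Rd_top d) \<Omega> \<and> bounded_Rd d \<Omega> \<longrightarrow>
           approximable d \<sigma> u \<Omega> \<epsilon>
             (\<gamma> * measure (Rd_leb d) \<Omega> * (real d / \<epsilon>) powr (\<beta> * \<bar>ln \<epsilon>\<bar>)))) \<and>
     (\<exists>\<gamma>' \<beta>' :: real. \<forall>(R_m::real) l_m R_d1 R_d2 l_d1 l_d2 (d::nat) \<sigma> A c f u.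
        1 \<le> d \<and> coeff_assm d A c f a_min a_max c_min c_max \<and> Hm1_norm d f = F \<and>
        act_assm \<sigma> C0 C1 C2 \<and> barron_coeff_assm d \<sigma> A c f R_A R_c R_f l_A l_c l_f \<and>
        mult_assm \<sigma> R_m l_m \<and> deriv_assm \<sigma> R_d1 R_d2 l_d1 l_d2 \<and>
        weak_solution d A c f u \<and> \<sigma> = cos \<longrightarrow>
        (\<forall>\<epsilon> \<Omega>. 0 < \<epsilon> \<and> \<epsilon> < 1/2 \<and> openin (Rd_top d) \<Omega> \<and> bounded_Rd d \<Omega> \<longrightarrow>
           approximable d \<sigma> u \<Omega> \<epsilon>
             (\<gamma>' * measure (Rd_leb d) \<Omega> * real (max 2 d) powr (\<beta>' * \<bar>ln \<epsilon>\<bar>))))"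
proof
  \<comment> \<open>Everything up to the choice of \<gamma> and \<beta> is built from the given
    constants alone, before dimension and coefficients are fixed; inside the locale these two become
    \<open>lam\<close> and \<open>Lam\<close>.\<close>
  define lm LM where "lm = min a_min c_min" and "LM = max a_max c_max"
  define \<tau> where "\<tau> = (ln (1 + 4 * (F / lm)\<^sup>2) / ln 2 + 2) / (lm\<^sup>2 / LM\<^sup>2) + 1 / ln 2"
  define k where "k = 1 + \<bar>R_A\<bar> + \<bar>R_c\<bar> + \<bar>R_f\<bar> + \<bar>l_A\<bar> + \<bar>l_c\<bar> + \<bar>l_f\<bar>"
  have \<tau>0: "0 \<le> \<tau>" unfolding \<tau>_def by (rule tau_nonneg) simp
  have k: "1 \<le> k" by (simp add: k_def)
  show "\<forall>R_m l_m R_d1 R_d2 l_d1 l_d2 :: real. \<exists>\<gamma> \<beta> :: real. \<forall>(d::nat) \<sigma> A c f u.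
        1 \<le> d \<and> coeff_assm d A c f a_min a_max c_min c_max \<and> Hm1_norm d f = F \<and>
        act_assm \<sigma> C0 C1 C2 \<and> barron_coeff_assm d \<sigma> A c f R_A R_c R_f l_A l_c l_f \<and>
        mult_assm \<sigma> R_m l_m \<and> deriv_assm \<sigma> R_d1 R_d2 l_d1 l_d2 \<and>
        weak_solution d A c f u \<longrightarrow>
        (\<forall>\<epsilon> \<Omega>. 0 < \<epsilon> \<and> \<epsilon> < 1/2 \<and> openin (Rd_top d) \<Omega> \<and> bounded_Rd d \<Omega> \<longrightarrow>
           approximable d \<sigma> u \<Omega> \<epsilon>
             (\<gamma> * measure (Rd_leb d) \<Omega> * (real d / \<epsilon>) powr (\<beta> * \<bar>ln \<epsilon>\<bar>)))"
  proof (intro allI)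
    fix R_m l_m R_d1 R_d2 l_d1 l_d2 :: real
    \<comment> \<open>A single number above all radii and above all norms increased by 1 (the 1 is
      contained in \<open>k\<close>), so that every representation has both bounds equal to
      \<open>K\<close>.\<close>
    define K where "K = k + \<bar>R_m\<bar> + \<bar>l_m\<bar> + \<bar>R_d1\<bar> + \<bar>l_d1\<bar>"
    define \<kappa> where "\<kappa> = 4 * K ^ 5 * (1 + lm / LM\<^sup>2)"
    define \<beta> where "\<beta> = 4 * \<tau> + ln \<kappa> * (4 * \<tau> / ln 2 + 4 * \<tau>\<^sup>2) + 2 / ln 2"
    have K: "1 \<le> K" "k \<le> K" using k by (simp_all add: K_def)
    have K5: "1 \<le> 4 * K ^ 5" using one_le_power[OF K(1), of 5] by linarith
    \<comment> \<open>The witness for \<gamma> is \<open>8 (C0^2 + C1^2)\<close>, the factor in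
      front of the measure in \<open>approximable_of_step\<close>; the growth in \<open>d\<close>
      and 1/\<epsilon> goes into \<beta>.\<close>
    show "\<exists>\<gamma> \<beta> :: real. \<forall>(d::nat) \<sigma> A c f u.
        1 \<le> d \<and> coeff_assm d A c f a_min a_max c_min c_max \<and> Hm1_norm d f = F \<and>
        act_assm \<sigma> C0 C1 C2 \<and> barron_coeff_assm d \<sigma> A c f R_A R_c R_f l_A l_c l_f \<and>
        mult_assm \<sigma> R_m l_m \<and> deriv_assm \<sigma> R_d1 R_d2 l_d1 l_d2 \<and>
        weak_solution d A c f u \<longrightarrow>
        (\<forall>\<epsilon> \<Omega>. 0 < \<epsilon> \<and> \<epsilon> < 1/2 \<and> openin (Rd_top d) \<Omega> \<and> bounded_Rd d \<Omega> \<longrightarrow>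
           approximable d \<sigma> u \<Omega> \<epsilon>
             (\<gamma> * measure (Rd_leb d) \<Omega> * (real d / \<epsilon>) powr (\<beta> * \<bar>ln \<epsilon>\<bar>)))"
    proof (rule exI[of _ "8 * (C0\<^sup>2 + C1\<^sup>2)"], rule exI[of _ \<beta>], intro allI impI; (elim conjE)?)
      fix d :: nat and \<sigma> :: "real \<Rightarrow> real" and A :: "vec \<Rightarrow> nat \<Rightarrow> nat \<Rightarrow> real" and c f u :: "vec \<Rightarrow> real"
        and \<epsilon> :: real and \<Omega> :: "vec set"
      assume d: "1 \<le> d" and co: "coeff_assm d A c f a_min a_max c_min c_max" and F: "Hm1_norm d f = F"
        and act: "act_assm \<sigma> C0 C1 C2" and bar: "barron_coeff_assm d \<sigma> A c f R_A R_c R_f l_A l_c l_f"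
        and mult: "mult_assm \<sigma> R_m l_m" and der: "deriv_assm \<sigma> R_d1 R_d2 l_d1 l_d2"
        and u: "weak_solution d A c f u"
        and \<epsilon>: "0 < \<epsilon>" "\<epsilon> < 1/2" and \<Omega>: "openin (Rd_top d) \<Omega>" "bounded_Rd d \<Omega>"
      note D = act_assm_has_deriv(1)[OF act] and C = act_assm_has_deriv(2,3)[OF act]
      have \<sigma>m: "\<sigma> \<in> borel_measurable borel"
        by (intro borel_measurable_continuous_onI continuous_at_imp_continuous_on ballI DERIV_isCont)
          (rule D[of 0, simplified])
      have mult': "0 < R_m" "has_barron1_norm \<sigma> R_m 2 (\<lambda>y. \<sigma> (y 0) * \<sigma> (y 1)) l_m"
        using mult by (simp_all add: mult_assm_def)
      have der': "0 < R_d1" "has_barron1_norm \<sigma> R_d1 1 (\<lambda>y. deriv \<sigma> (y 0)) l_d1"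
        using der by (simp_all add: deriv_assm_def)
      have rm: "ridge_rep \<sigma> 2 K K (\<lambda>y. \<sigma> (y 0) * \<sigma> (y 1))"
        by (rule ridge_rep_of_barron_norm[OF \<sigma>m mult'(1) _ has_barron1_normD(1)[OF mult'(2)] _ has_barron1_normD(2)[OF mult'(2)]])
          (use k in \<open>unfold K_def, linarith+\<close>)
      have rd: "ridge_rep \<sigma> 1 K K (\<lambda>y. deriv \<sigma> (y 0))"
        by (rule ridge_rep_of_barron_norm[OF \<sigma>m der'(1) _ has_barron1_normD(1)[OF der'(2)] _ has_barron1_normD(2)[OF der'(2)]])
          (use k in \<open>unfold K_def, linarith+\<close>)
      \<comment> \<open>From here on all derivatives of \<sigma> are bounded, by the bound
        \<open>C0\<close> and the representation of \<sigma>'.\<close>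
      note \<sigma> = bounded_smooth_of_ridge_rep_deriv[OF D C(1) rd]
      note reps = barron_coeff_assm_reps[OF bar \<sigma>m K(2)[unfolded k_def]]
      interpret elliptic d A c f u a_min a_max c_min c_max "K * C0"
        by (rule elliptic_of_reps[OF \<sigma> C(1) d co u reps(1,2)])
      have lm: "lam = lm" "Lam = LM" by (simp_all add: lam_def Lam_def lm_def LM_def)
      have \<kappa>1: "1 \<le> \<kappa>" unfolding \<kappa>_def using lam_pos by (intro growth_ge_1 K5) (simp add: lm)
      show "approximable d \<sigma> u \<Omega> \<epsilon> (8 * (C0\<^sup>2 + C1\<^sup>2) * measure (Rd_leb d) \<Omega> * (real d / \<epsilon>) powr (\<beta> * \<bar>ln \<epsilon>\<bar>))"
      proof (rule approximable_of_step[OF \<sigma> K5 C, where e=2 and \<kappa>'=\<kappa> and \<tau>=\<tau> and \<theta>="lm\<^sup>2 / LM\<^sup>2"])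
        show "f \<in> borel_measurable M" by (rule smooth_measurable[OF ridge_rep_smooth(1)[OF \<sigma> reps(3)]])
        show "\<bar>f x\<bar> \<le> K * C0" if "x \<in> Rd d" for x by (rule ridge_rep_smooth(2)[OF \<sigma> reps(3) C(1) that])
        show "\<exists>w. ridge_rep \<sigma> d (4 * K ^ 5 * R) (4 * K ^ 5 * (real d)\<^sup>2 * N * R ^ 2) w \<and> helmholtz d w (residual v)"
          if "1 \<le> R" "1 \<le> N" "ridge_rep \<sigma> d R N v" for v R N
          by (rule resolvent_step[OF \<sigma> K(1) rm rd reps that])
        show "8 * (C0\<^sup>2 + C1\<^sup>2) * measure M \<Omega> * (real d ^ (4 * T) * \<kappa> ^ (4 * T + 2 * 2 * T\<^sup>2) / \<epsilon>\<^sup>2) \<le>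
            8 * (C0\<^sup>2 + C1\<^sup>2) * measure M \<Omega> * (real d / \<epsilon>) powr (\<beta> * \<bar>ln \<epsilon>\<bar>)"
          if "real T \<le> \<tau> * \<bar>ln \<epsilon>\<bar>" for T
          using general_rate[OF \<epsilon> d \<kappa>1 \<tau>0 that \<beta>_def] by (intro mult_left_mono) simp_all
      qed (use \<epsilon> \<Omega> in \<open>simp_all add: lm \<kappa>_def \<tau>_def F\<close>)
    qed
  qed
  \<comment> \<open>For the cosine \<open>k\<close> takes the place of \<open>K\<close>: it contains
    only the constants of (Barron-Coeff).\<close>
  define \<kappa> where "\<kappa> = 8 * k\<^sup>2 * (1 + lm / LM\<^sup>2)"
  define \<beta> where "\<beta> = 4 * \<tau> + 4 * \<tau> * ln \<kappa> / ln 2 + 2 / ln 2"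
  have k2: "1 \<le> 8 * k\<^sup>2" using one_le_power[OF k, of 2] by linarith
  show "\<exists>\<gamma>' \<beta>' :: real. \<forall>(R_m::real) l_m R_d1 R_d2 l_d1 l_d2 (d::nat) \<sigma> A c f u.
        1 \<le> d \<and> coeff_assm d A c f a_min a_max c_min c_max \<and> Hm1_norm d f = F \<and>
        act_assm \<sigma> C0 C1 C2 \<and> barron_coeff_assm d \<sigma> A c f R_A R_c R_f l_A l_c l_f \<and>
        mult_assm \<sigma> R_m l_m \<and> deriv_assm \<sigma> R_d1 R_d2 l_d1 l_d2 \<and>
        weak_solution d A c f u \<and> \<sigma> = cos \<longrightarrow>
        (\<forall>\<epsilon> \<Omega>. 0 < \<epsilon> \<and> \<epsilon> < 1/2 \<and> openin (Rd_top d) \<Omega> \<and> bounded_Rd d \<Omega> \<longrightarrow>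
           approximable d \<sigma> u \<Omega> \<epsilon>
             (\<gamma>' * measure (Rd_leb d) \<Omega> * real (max 2 d) powr (\<beta>' * \<bar>ln \<epsilon>\<bar>)))"
  proof (rule exI[of _ "8 * (C0\<^sup>2 + C1\<^sup>2)"], rule exI[of _ \<beta>], intro allI impI; (elim conjE)?)
    fix d :: nat and \<sigma> :: "real \<Rightarrow> real" and A :: "vec \<Rightarrow> nat \<Rightarrow> nat \<Rightarrow> real" and c f u :: "vec \<Rightarrow> real"
      and \<epsilon> :: real and \<Omega> :: "vec set"
    assume d: "1 \<le> d" and co: "coeff_assm d A c f a_min a_max c_min c_max" and F: "Hm1_norm d f = F"
      and act: "act_assm \<sigma> C0 C1 C2" and bar: "barron_coeff_assm d \<sigma> A c f R_A R_c R_f l_A l_c l_f"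
      and u: "weak_solution d A c f u" and cos: "\<sigma> = cos"
      and \<epsilon>: "0 < \<epsilon>" "\<epsilon> < 1/2" and \<Omega>: "openin (Rd_top d) \<Omega>" "bounded_Rd d \<Omega>"
    note C = act_assm_has_deriv(2,3)[OF act, unfolded cos]
    note \<sigma> = bounded_smooth_cos
    note reps = barron_coeff_assm_reps[OF bar[unfolded cos] bounded_smooth_borel[OF \<sigma>] order_refl, folded k_def]
    interpret elliptic d A c f u a_min a_max c_min c_max "k * C0"
      by (rule elliptic_of_reps[OF \<sigma> C(1) d co u reps(1,2)])
    have lm: "lam = lm" "Lam = LM" by (simp_all add: lam_def Lam_def lm_def LM_def)
    have \<kappa>1: "1 \<le> \<kappa>" unfolding \<kappa>_def using lam_pos by (intro growth_ge_1 k2) (simp add: lm)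
    show "approximable d \<sigma> u \<Omega> \<epsilon> (8 * (C0\<^sup>2 + C1\<^sup>2) * measure (Rd_leb d) \<Omega> * real (max 2 d) powr (\<beta> * \<bar>ln \<epsilon>\<bar>))"
      unfolding cos
    proof (rule approximable_of_step[OF \<sigma> k2 C, where e=0 and \<kappa>'=\<kappa> and \<tau>=\<tau> and \<theta>="lm\<^sup>2 / LM\<^sup>2"])
      show "f \<in> borel_measurable M" by (rule smooth_measurable[OF ridge_rep_smooth(1)[OF \<sigma> reps(3)]])
      show "\<bar>f x\<bar> \<le> k * C0" if "x \<in> Rd d" for x by (rule ridge_rep_smooth(2)[OF \<sigma> reps(3) C(1) that])
      show "\<exists>w. ridge_rep cos d (8 * k\<^sup>2 * R) (8 * k\<^sup>2 * (real d)\<^sup>2 * N * R ^ 0) w \<and> helmholtz d w (residual v)"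
        if "1 \<le> R" "1 \<le> N" "ridge_rep cos d R N v" for v R N
        by (rule resolvent_step_cos[OF k reps that])
      show "8 * (C0\<^sup>2 + C1\<^sup>2) * measure M \<Omega> * (real d ^ (4 * T) * \<kappa> ^ (4 * T + 2 * 0 * T\<^sup>2) / \<epsilon>\<^sup>2) \<le>
          8 * (C0\<^sup>2 + C1\<^sup>2) * measure M \<Omega> * real (max 2 d) powr (\<beta> * \<bar>ln \<epsilon>\<bar>)"
        if "real T \<le> \<tau> * \<bar>ln \<epsilon>\<bar>" for T
        using cos_rate[OF \<epsilon> d \<kappa>1 \<tau>0 that \<beta>_def] by (intro mult_left_mono) simp_all
    qed (use \<epsilon> \<Omega> in \<open>simp_all add: lm \<kappa>_def \<tau>_def F\<close>)
  qed
qed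

end
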